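(* Let $\{\epsilon_k:k\in\mathbb Z\}$ be independent with $E\epsilon_k=0$, $\sigma_k^2=E\epsilon_k^2$, $\gamma_k=E\epsilon_k^4$ and $\sup_kE|\epsilon_k|^{4+\delta}<\infty$ for some $\delta>0$. For $n\ge1$ let $\mathbf Y_{ni}=(Y_{ni}^{(1)},\dots,Y_{ni}^{(d_n)})'$ with $Y_{ni}^{(\nu)}=\sum_{j\ge0}c_{nj}^{(\nu)}\epsilon_{i-j}$, where $\sup_n\max_{\nu\le d_n}|c_{nj}^{(\nu)}|^2\le K(j\vee1)^{-3/2-\theta}$ for all $j\ge 0$, some $K<\infty$, $0<\theta<1/2$. Let $K_0\in\mathbb N$ be fixed and let $\mathbf v_{nj},\mathbf w_{nj}\in\mathbb R^{d_n}$, $1\le j\le K_0$, have uniformly bounded $\ell_1$-norms: $\sup_n\max_j\max(\|\mathbf v_{nj}\|_{\ell_1},\|\mathbf w_{nj}\|_{\ell_1})<\infty$. With $\hat{\boldsymbol\Sigma}_{nk}=\sum_{i\le k}\mathbf Y_{ni}\mathbf Y_{ni}'$, $\boldsymbol\Sigma_{nk}=E\hat{\boldsymbol\Sigma}_{nk}$, put $\mathcal D_n(t;\mathbf v,\mathbf w)=n^{-1/2}\mathbf v'(\hat{\boldsymbol\Sigma}_{n,\lfloor nt\rfloor}-\boldsymbol\Sigma_{n,\lfloor nt\rfloor})\mathbf w$. Then (on a suitable probability space carrying equivalent versions of the processes) there exists a $K_0$-dimensional Brownian motion $\{\mathbf B^{(n)}(t):t\in[0,1]\}$ with coordinates $B_n(t;\mathbf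 v_{ni},\mathbf w_{ni})$, $i=1,\dots,K_0$, characterized by $E(B_n(1;\mathbf v_{ni},\mathbf w_{ni})B_n(1;\mathbf v_{nj},\mathbf w_{nj}))=\beta_n(\mathbf v_{ni},\mathbf w_{ni},\mathbf v_{nj},\mathbf w_{nj})$ for $i\ne j$ and $E(B_n^2(1;\mathbf v_{ni},\mathbf w_{ni}))=\alpha_n^2(\mathbf v_{ni},\mathbf w_{ni})$, such that $$\Big\|\big(\mathcal D_n(t;\mathbf v_{ni},\mathbf w_{ni})\big)_{i=1}^{K_0}-\big(B_n(\lfloor nt\rfloor/n;\mathbf v_{ni},\mathbf w_{ni})\big)_{i=1}^{K_0}\Big\|=o(1)$$ almost surely as $n\to\infty$, for any vector norm $\|\cdot\|$ on $\mathbb R^{K_0}$.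
   Context: For weighting vectors $\mathbf v,\mathbf w\in\mathbb R^{d_n}$ let $f_{0,j}^{(n)}(\mathbf v,\mathbf w)=\sum_{\nu,\mu}v_\nu w_\mu c_{nj}^{(\nu)}c_{nj}^{(\mu)}$, $f_{l,j}^{(n)}(\mathbf v,\mathbf w)=\sum_{\nu,\mu}v_\nu w_\mu[c_{nj}^{(\nu)}c_{n,j+l}^{(\mu)}+c_{nj}^{(\mu)}c_{n,j+l}^{(\nu)}]$ for $l\ge1$, $\tilde f_{l,i}^{(n)}=\sum_{j\ge i}f_{l,j}^{(n)}$. The numbers $\alpha_n^2(\mathbf v,\mathbf w)\ge0$ are such that for all $n',m'\ge0$: $(\tilde f_{0,0}^{(n)})^2\sum_{j=1}^{n'}(\gamma_{m'+j}-\sigma_{m'+j}^4)+\sum_{j=1}^{n'}\sum_{l=1}^{j-1}(\tilde f_{j-l,0}^{(n)})^2\sigma_{m'+j}^2\sigma_{m'+l}^2-n'\alpha_n^2\le C(n')^{1-\theta}$; the numbers $\beta_n(\mathbf v,\mathbf w,\tilde{\mathbf v},\tilde{\mathbf w})$ are such that for all $n',m'$: $\tilde f_{0,0}^{(n)}(\mathbf v,\mathbf w)\tilde f_{0,0}^{(n)}(\tilde{\mathbf v},\tilde{\mathbf w})\sum_{j=1}^{n'}(\gamma_{m'+j}-\sigma^4_{m'+j})+\sum_{j=1}^{n'}\sum_{l=1}^{j-1}\tilde f_{j-l,0}^{(n)}(\mathbf v,\mathbf w)\tilde f_{j-l,0}^{(n)}(\tilde{\mathbf v},\tilde{\mathbf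 w})\sigma^2_{m'+j}\sigma^2_{m'+l}-n'\beta_n\le C(n')^{1-\theta}$ (existence of both is proved in the paper). In the stationary case $\gamma_k=\gamma$, $\sigma_k^2=\sigma^2$: $\alpha_n^2=(\gamma-\sigma^4)(\tilde f_{0,0}^{(n)})^2+\sigma^4\sum_{l\ge1}(\tilde f_{l,0}^{(n)})^2$ and $\beta_n=(\gamma-\sigma^4)\tilde f_{0,0}^{(n)}(\mathbf v,\mathbf w)\tilde f_{0,0}^{(n)}(\tilde{\mathbf v},\tilde{\mathbf w})+\sigma^4\sum_{l\ge1}\tilde f_{l,0}^{(n)}(\mathbf v,\mathbf w)\tilde f_{l,0}^{(n)}(\tilde{\mathbf v},\tilde{\mathbf w})$. A $K_0$-dimensional Brownian motion with covariance $\mathbf V$ is a centered Gaussian process with independent increments and $E(\mathbf B(s)\mathbf B(t)')=\min(s,t)\mathbf V$.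
   Formalization: The growth conditions defining α_n² and β_n are taken with absolute values (two-sided, with C independent of n); with the stated one-sided bounds any larger number would qualify, and for nonstationary innovations the claim would fail. *)

theory Defs
  imports "HOL-Probability.Probability"
begin

text \<open>Conventions. Innovations: eps :: int => 'a => real (eps k x).
 Coefficients: c n j nu (nu in {1..d n}, j >= 0). Weighting vectors: nat => real,
 only coordinates in {1..d n} matter.\<close>

definition sigma2 :: "'a measure \<Rightarrow> (int \<Rightarrow> 'a \<Rightarrow> real) \<Rightarrow> int \<Rightarrow> real" where
  "sigma2 M eps k = integral\<^sup>L M (\<lambda>x. (eps k x)^2)"

definition gamma4 :: "'a measure \<Rightarrow> (int \<Rightarrow> 'a \<Rightarrow> real) \<Rightarrow> int \<Rightarrow> real" where
  "gamma4 M eps k = integral\<^sup>L M (\<lambda>x. (eps k x)^4)"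

definition fcoef :: "(nat \<Rightarrow> nat \<Rightarrow> nat \<Rightarrow> real) \<Rightarrow> (nat \<Rightarrow> nat) \<Rightarrow> nat \<Rightarrow> nat \<Rightarrow> nat
     \<Rightarrow> (nat \<Rightarrow> real) \<Rightarrow> (nat \<Rightarrow> real) \<Rightarrow> real" where
  "fcoef c d n l j v w =
    (if l = 0 then (\<Sum>\<nu>\<in>{1..d n}. \<Sum>\<mu>\<in>{1..d n}. v \<nu> * w \<mu> * c n j \<nu> * c n j \<mu>)
     else (\<Sum>\<nu>\<in>{1..d n}. \<Sum>\<mu>\<in>{1..d n}.
             v \<nu> * w \<mu> * (c n j \<nu> * c n (j + l) \<mu> + c n j \<mu> * c n (j + l) \<nu>)))"

definition ftilde :: "(nat \<Rightarrow> nat \<Rightarrow> nat \<Rightarrow> real) \<Rightarrow> (nat \<Rightarrow> nat) \<Rightarrow> nat \<Rightarrow> nat \<Rightarrow> nat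
     \<Rightarrow> (nat \<Rightarrow> real) \<Rightarrow> (nat \<Rightarrow> real) \<Rightarrow> real" where
  "ftilde c d n l i v w = (\<Sum>k. fcoef c d n l (i + k) v w)"

text \<open>The finite-n' quantity whose growth defines alpha_n^2 (with v'=v, w'=w) and beta_n.\<close>
definition covsum :: "'a measure \<Rightarrow> (int \<Rightarrow> 'a \<Rightarrow> real) \<Rightarrow> (nat \<Rightarrow> nat \<Rightarrow> nat \<Rightarrow> real)
     \<Rightarrow> (nat \<Rightarrow> nat) \<Rightarrow> nat \<Rightarrow> (nat \<Rightarrow> real) \<Rightarrow> (nat \<Rightarrow> real) \<Rightarrow> (nat \<Rightarrow> real) \<Rightarrow> (nat \<Rightarrow> real)
     \<Rightarrow> nat \<Rightarrow> nat \<Rightarrow> real" where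
  "covsum M eps c d n v w v' w' n' m' =
     ftilde c d n 0 0 v w * ftilde c d n 0 0 v' w' *
       (\<Sum>j\<in>{1..n'}. gamma4 M eps (int (m' + j)) - (sigma2 M eps (int (m' + j)))^2)
   + (\<Sum>j\<in>{1..n'}. \<Sum>l\<in>{1..<j}. ftilde c d n (j - l) 0 v w * ftilde c d n (j - l) 0 v' w'
        * sigma2 M eps (int (m' + j)) * sigma2 M eps (int (m' + l)))"

definition Yn :: "(int \<Rightarrow> 'a \<Rightarrow> real) \<Rightarrow> (nat \<Rightarrow> nat \<Rightarrow> nat \<Rightarrow> real) \<Rightarrow> nat \<Rightarrow> int \<Rightarrow> nat \<Rightarrow> 'a \<Rightarrow> real" where
  "Yn eps c n i \<nu> x = (\<Sum>j. c n j \<nu> * eps (i - int j) x)"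

definition SigmaHat :: "(int \<Rightarrow> 'a \<Rightarrow> real) \<Rightarrow> (nat \<Rightarrow> nat \<Rightarrow> nat \<Rightarrow> real) \<Rightarrow> nat \<Rightarrow> nat \<Rightarrow> nat \<Rightarrow> nat \<Rightarrow> 'a \<Rightarrow> real" where
  "SigmaHat eps c n k \<nu> \<mu> x = (\<Sum>i\<in>{1..k}. Yn eps c n (int i) \<nu> x * Yn eps c n (int i) \<mu> x)"

definition Dn :: "'a measure \<Rightarrow> (int \<Rightarrow> 'a \<Rightarrow> real) \<Rightarrow> (nat \<Rightarrow> nat \<Rightarrow> nat \<Rightarrow> real) \<Rightarrow> (nat \<Rightarrow> nat)
     \<Rightarrow> nat \<Rightarrow> real \<Rightarrow> (nat \<Rightarrow> real) \<Rightarrow> (nat \<Rightarrow> real) \<Rightarrow> 'a \<Rightarrow> real" where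
  "Dn M eps c d n t v w x =
     (1 / sqrt (real n)) * (\<Sum>\<nu>\<in>{1..d n}. \<Sum>\<mu>\<in>{1..d n}. v \<nu> * w \<mu> *
        (SigmaHat eps c n (nat \<lfloor>real n * t\<rfloor>) \<nu> \<mu> x
         - integral\<^sup>L M (SigmaHat eps c n (nat \<lfloor>real n * t\<rfloor>) \<nu> \<mu>)))"

definition real_gaussian :: "'a measure \<Rightarrow> ('a \<Rightarrow> real) \<Rightarrow> real \<Rightarrow> real \<Rightarrow> bool" where
  "real_gaussian M X mu s2 \<longleftrightarrow>
     X \<in> borel_measurable M \<and>
     ((s2 = 0 \<and> (AE x in M. X x = mu)) \<or>
      (s2 > 0 \<and> distributed M lborel X (normal_density mu (sqrt s2))))"

definition is_BM :: "'a measure \<Rightarrow> nat set \<Rightarrow> (nat \<Rightarrow> nat \<Rightarrow> real) \<Rightarrow> (nat \<Rightarrow> real \<Rightarrow> 'a \<Rightarrow> real) \<Rightarrow> bool" where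
  "is_BM M I V B \<longleftrightarrow>
     (\<forall>i\<in>I. \<forall>t\<in>{0..1}. B i t \<in> borel_measurable M) \<and>
     (\<forall>F a. finite F \<longrightarrow> F \<subseteq> I \<times> {0..1} \<longrightarrow>
        (\<exists>s2. real_gaussian M (\<lambda>x. \<Sum>(i,t)\<in>F. a (i,t) * B i t x) 0 s2)) \<and>
     (\<forall>(ts :: nat \<Rightarrow> real) m. mono ts \<longrightarrow> (\<forall>k\<le>m. ts k \<in> {0..1}) \<longrightarrow>
        prob_space.indep_vars M (\<lambda>_. PiM I (\<lambda>_. borel))
          (\<lambda>k x. \<lambda>i\<in>I. B i (ts (Suc k)) x - B i (ts k) x) {..<m}) \<and>
     (\<forall>i\<in>I. \<forall>j\<in>I. \<forall>s\<in>{0..1}. \<forall>t\<in>{0..1}.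
        integrable M (\<lambda>x. B i s x * B j t x) \<and>
        integral\<^sup>L M (\<lambda>x. B i s x * B j t x) = min s t * V i j)"

definition is_norm_on :: "nat set \<Rightarrow> ((nat \<Rightarrow> real) \<Rightarrow> real) \<Rightarrow> bool" where
  "is_norm_on I N \<longleftrightarrow>
     (\<forall>x y (r::real). (\<forall>i. i \<notin> I \<longrightarrow> x i = 0) \<longrightarrow> (\<forall>i. i \<notin> I \<longrightarrow> y i = 0) \<longrightarrow>
        N x \<ge> 0 \<and> (N x = 0 \<longleftrightarrow> (\<forall>i. x i = 0)) \<and>
        N (\<lambda>i. r * x i) = \<bar>r\<bar> * N x \<and>
        N (\<lambda>i. x i + y i) \<le> N x + N y)"

end

theory Submission
  imports Defs "HOL-Library.Discrete_Functions"
begin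

text \<open>For 2^p <= n < 2^(p+1) the time axis is cut into blocks of length q = 2^((1 - k) p), and these into
 sub-blocks of a much smaller length u. The part of the quadratic form of the innovations that lives inside
 the sub-blocks gives independent block sums T_b whose covariances are exactly the finite sums that define
 alpha and beta. The rest is o(sqrt n) almost surely: the bound
 E exp (sum e_j Z_j - 1/2 sum (e_j^2 + s_j^2) Z_j^2) <= 1 for Z_j depending on the past gives Gaussian tails
 relative to a random variance, and an envelope of that variance depends on p and on the block only, so
 that moments of order slightly above four suffice for Borel--Cantelli over p.

 The laws of T_b / sqrt q and of the Gaussian increment are coupled after smoothing both with a small
 Gaussian kernel, the smoothed densities being compared through characteristic functions. The product of
 these coupling densities over the blocks is a density on innovations times Brownian motion which keeps both
 marginals; the Brownian motions for the different n are drawn independently given the innovations. With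
 summable exceptional probability all but a bounded number of blocks are close, and a bounded number of
 blocks is negligible.\<close>

section \<open>Self-normalized tail bounds\<close>

text \<open>Filters and weights for neighbouring \<open>n\<close> are unrelated, so nothing carries
  over from one \<open>n\<close> to the next, and moments slightly above four give for each
  \<open>n\<close> only a small negative power of \<open>n\<close>, which cannot be summed. Hence a
  division of labour: events of probability 2^(- eta p) with tiny eta may depend on \<open>p\<close>
  and on one of about 2^(p / ka) blocks, while whatever is tied to a single \<open>n\<close> and
  \<open>k\<close> needs a total of order n^-2, supplied by Gaussian tails with x^2 of order p. The
  coupling obeys the same rule. One block fails with probability of order t = 2^(- kp p), too large
  to be summed over \<open>n\<close>; but failures of different blocks are independent and there are
  at most 4 * 2^(kp p / 2) blocks, so r0 failures have probability of order 2^(- kp p r0 / 2), which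
  is O(n^-2) once kp * r0 >= 4. This is why fewer than r0 bad blocks are tolerated and why single
  blocks get their own estimate. No joint law is prescribed for the Brownian motions of different
  \<open>n\<close>, so each level is coupled separately.\<close>

abbreviation NN where "NN == nn_integral"

lemma (in prob_space) indep_var_nn_integral:
 assumes ind: "indep_var S X T Y" and G[measurable]: "G : borel_measurable (S \<Otimes>\<^sub>M T)"
 shows "NN M (%x. G (X x, Y x)) = NN M (%x. NN M (%y. G (X x, Y y)))"
proof -
 have [measurable]: "random_variable S X" "random_variable T Y" using indep_var_rv1[OF ind] indep_var_rv2[OF ind] by auto
 interpret Y: prob_space "distr M T Y" by (rule prob_space_distr) simp
 have eq: "distr M S X \<Otimes>\<^sub>M distr M T Y = distr M (S \<Otimes>\<^sub>M T) (%x. (X x, Y x))"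
  using ind unfolding indep_var_distribution_eq by simp
 have "NN M (%x. G (X x, Y x)) = NN ((distr M S X \<Otimes>\<^sub>M distr M T Y)) G" unfolding eq by (subst nn_integral_distr) auto
 also have "... = NN (distr M S X) (%x. NN (distr M T Y) (%y. G (x, y)))" by (subst Y.nn_integral_fst[symmetric]) auto
 also have "... = NN M (%x. NN M (%y. G (X x, Y y)))"
  by (subst nn_integral_distr, simp, simp, intro nn_integral_cong, subst nn_integral_distr) auto
 finally show ?thesis .
qed

text \<open>The logarithm \<open>h\<close> of the ratio of the two sides has derivative y (1 + y/2 +
  y^2/2) / (1 + y + y^2/2), whose sign is that of y; so \<open>h\<close> is minimal at 0, where it
  vanishes.\<close>

lemma exp_quadratic_le:
 fixes x :: real
 shows "exp (x - x^2/2) <= 1 + x + x^2/2"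
proof -
 have pos: "0 < 1 + y + y^2/2" for y :: real
 proof -
  have "1 + y + y^2/2 = ((y+1)^2 + 1)/2" by (simp add: power2_eq_square field_simps)
  also have "0 < ..." by (intro divide_pos_pos add_nonneg_pos) auto
  finally show ?thesis .
 qed
 let ?X = "%y. 1 + y + y^2/2"
 define h where "h = (%y::real. ln (?X y) - y + y^2/2)"
 have d: "(h has_real_derivative (y * (1 + y/2 + y^2/2) / (?X y))) (at y)" for y
 proof -
  have "(h has_real_derivative ((1 + y) / (?X y) - 1 + y)) (at y)" unfolding h_def using pos[of y] by (auto intro!: derivative_eq_intros)
  also have "(1 + y) / (?X y) - 1 + y = y * (1 + y/2 + y^2/2) / (?X y)"
  proof -
   have "(1 + y) / (?X y) - 1 + y = ((1 + y) + (y - 1) * ?X y) / (?X y)" using pos[of y] by (simp add: field_simps)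
   also have "(1 + y) + (y - 1) * ?X y = y * (1 + y/2 + y^2/2)" by (simp add: field_simps power2_eq_square)
   finally show ?thesis .
  qed
  finally show ?thesis .
 qed
 have pos2: "0 < 1 + y/2 + y^2/2" for y :: real
 proof -
  have "1 + y/2 + y^2/2 = ((y+1/2)^2 + 7/4)/2" by (simp add: power2_eq_square field_simps)
  also have "0 < ..." by (intro divide_pos_pos add_nonneg_pos) auto
  finally show ?thesis .
 qed
 have "h 0 <= h x"
 proof (cases "0 <= x")
  case True
  show ?thesis by (rule DERIV_nonneg_imp_nondecreasing[OF True])
     (meson d pos pos2 less_imp_le divide_nonneg_pos mult_nonneg_nonneg)
 next
  case False
  show ?thesis
  proof (rule DERIV_nonpos_imp_nonincreasing[of x 0])
   show "x <= 0" using False by simp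
   fix y assume "x <= y" "y <= 0"
   then show "EX z. DERIV h y :> z & z <= 0" using d[of y] pos[of y] pos2[of y] by (intro exI[of _ "y * (1 + y/2 + y^2/2) / (?X y)"])
      (auto intro!: divide_nonpos_pos mult_nonpos_nonneg)
  qed
 qed
 then have "x - x^2/2 <= ln (1 + x + x^2/2)" by (simp add: h_def)
 then have "exp (x - x^2/2) <= exp (ln (1 + x + x^2/2))" by simp
 then show ?thesis using pos[of x] by simp
qed

text \<open>Instantiated by the innovations from a starting time onwards, by their centred squares,
  by the innovations read backwards in time, and by the sub-block sums.\<close>

locale indep_centered = prob_space M for M :: "'a measure" +
 fixes e :: "nat => 'a => real" and s2 :: "nat => real"
 assumes indep: "indep_vars (%_. borel) e UNIV"
  and sq_int: "!!j. integrable M (%x. (e j x)^2)" and mean0: "!!j. expectation (e j) = 0" and s2: "!!j. expectation (%x. (e j x)^2) = s2 j"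
begin

lemma e_meas[measurable]: "e j : borel_measurable M" using indep unfolding indep_vars_def by auto

lemma e_int: "integrable M (e j)" using sq_int[of j] square_integrable_imp_integrable[of "e j"] by auto

lemma s2_nonneg: "0 <= s2 j" unfolding s2[symmetric] by simp

lemma indep_past: "indep_var (PiM {..<n} (%_. borel)) (%x. \<lambda>i\<in>{..<n}. e i x)
  (PiM {n} (%_. borel)) (%x. \<lambda>i\<in>{n}. e i x)" by (rule indep_var_restrict[OF indep]) auto

lemma nn_integral_past:
 assumes G[measurable]: "G : borel_measurable (PiM {..<n} (%_. borel) \<Otimes>\<^sub>M borel)"
 shows "NN M (%x. G (\<lambda>i\<in>{..<n}. e i x, e n x)) = NN M (%x. NN M (%y. G (\<lambda>i\<in>{..<n}. e i x, e n y)))"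
 using indep_var_nn_integral[OF indep_past, of "%(r, r'). G (r, r' n)" n] by simp

text \<open>The one-step bound is \<^term>\<open>exp (x - x^2/2) <= 1 + x + x^2/2\<close>, integrated against
 the conditional law of the innovation given its past.\<close>

lemma exp_self_normalized:
 assumes z[measurable]: "!!j. z j : borel_measurable (PiM {..<j} (%_. borel))"
 defines "Z == %j x. z j (\<lambda>i\<in>{..<j}. e i x)"
 shows "NN M (%x. ennreal (exp (\<Sum>j<N. e j x * Z j x - ((e j x)^2 + s2 j) * (Z j x)^2/2))) <= 1"
proof (induction N)
 case 0
 then show ?case by (simp add: emeasure_space_1)
next
 case (Suc N)
 define S where "S = (%r::nat=>real. (\<Sum>j<N. r j * z j (restrict r {..<j}) - ((r j)^2 + s2 j) * (z j (restrict r {..<j}))^2/2))"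
 define G where "G = (%(r, y). ennreal (exp (S r)) * ennreal (exp (y * z N r - (y^2 + s2 N) * (z N r)^2/2)))"
 have zr: "(%r. z j (restrict r {..<j})) : borel_measurable (PiM {..<N} (%_. borel))" if "j < N" for j
  by (rule measurable_compose[OF measurable_restrict_subset z]) (use that in auto)
 have [measurable]: "S : borel_measurable (PiM {..<N} (%_. borel))" unfolding S_def
  by (intro borel_measurable_sum borel_measurable_diff borel_measurable_times borel_measurable_divide
    borel_measurable_power borel_measurable_add borel_measurable_const zr) (auto intro: measurable_component_singleton)
 have G[measurable]: "G : borel_measurable (PiM {..<N} (%_. borel) \<Otimes>\<^sub>M borel)" unfolding G_def by measurable
 have S_eq: "S (\<lambda>i\<in>{..<N}. e i x) = (\<Sum>j<N. e j x * Z j x - ((e j x)^2 + s2 j) * (Z j x)^2/2)" for x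
 proof -
  have "restrict (\<lambda>i\<in>{..<N}. e i x) {..<j} = (\<lambda>i\<in>{..<j}. e i x)" if "j < N" for j
   using that by (auto simp: fun_eq_iff)
  then show ?thesis unfolding S_def Z_def by (intro sum.cong refl) simp
 qed
 have inner: "NN M (%y. ennreal (exp (e N y * c - ((e N y)^2 + s2 N) * c^2/2))) <= 1" for c
 proof -
  have "(NN M (%y. ennreal (exp (e N y * c - ((e N y)^2 + s2 N) * c^2/2))))
   <= NN M (%y. ennreal (exp (- (s2 N * c^2/2)) * (1 + e N y * c + (e N y)^2 * c^2/2)))"
  proof (intro nn_integral_mono ennreal_leI)
   fix y
   have "exp (e N y * c - ((e N y)^2 + s2 N) * c^2/2) = exp (- (s2 N * c^2/2)) * exp (e N y * c - (e N y * c)^2/2)"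
    by (simp add: exp_add[symmetric] algebra_simps power_mult_distrib add_divide_distrib)
   also have "... <= exp (- (s2 N * c^2/2)) * (1 + e N y * c + (e N y)^2 * c^2/2)"
    using exp_quadratic_le[of "e N y * c"] by (simp add: power_mult_distrib)
   finally show "exp (e N y * c - ((e N y)^2 + s2 N) * c^2/2) <= ..." .
  qed
  also have "... = ennreal (expectation (%y. exp (- (s2 N * c^2/2)) * (1 + e N y * c + (e N y)^2 * c^2/2)))"
  proof (rule nn_integral_eq_integral)
   show "integrable M (%y. exp (- (s2 N * c^2/2)) * (1 + e N y * c + (e N y)^2 * c^2/2))" using sq_int[of N] e_int[of N] by auto
   show "AE y in M. 0 <= exp (- (s2 N * c^2/2)) * (1 + e N y * c + (e N y)^2 * c^2/2)"
   proof (intro AE_I2 mult_nonneg_nonneg)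
    fix y
    have "0 <= exp (e N y * c - (e N y * c)^2/2)" by simp
    also have "... <= 1 + e N y * c + (e N y)^2 * c^2/2" using exp_quadratic_le[of "e N y * c"] by (simp add: power_mult_distrib)
    finally show "0 <= ..." .
   qed simp
  qed
  \<comment> \<open>The compensator at work: the second moment contributes 1 + s2 c^2/2, and the
    deterministic part of the exponent cancels it.\<close>
  also have "expectation (%y. exp (- (s2 N * c^2/2)) * (1 + e N y * c + (e N y)^2 * c^2/2))
    = exp (- (s2 N * c^2/2)) * (1 + s2 N * c^2/2)" using sq_int[of N] e_int[of N] by (simp add: mean0 s2 prob_space)
  also have "... <= exp (- (s2 N * c^2/2)) * exp (s2 N * c^2/2)" by (intro mult_left_mono exp_ge_add_one_self) auto
  also have "... = 1" by (simp add: exp_add[symmetric])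
  finally show ?thesis by (simp add: ennreal_leI)
 qed
 have "(NN M (%x. ennreal (exp (\<Sum>j<Suc N. e j x * Z j x - ((e j x)^2 + s2 j) * (Z j x)^2/2))))
   = NN M (%x. G (\<lambda>i\<in>{..<N}. e i x, e N x))"
  unfolding G_def by (intro nn_integral_cong) (simp add: S_eq exp_add ennreal_mult Z_def)
 also have "... = NN M (%x. NN M (%y. G (\<lambda>i\<in>{..<N}. e i x, e N y)))" by (rule nn_integral_past[OF G])
 also have "... = NN M (%x. ennreal (exp (S (\<lambda>i\<in>{..<N}. e i x))) *
   (NN M (%y. ennreal (exp (e N y * Z N x - ((e N y)^2 + s2 N) * (Z N x)^2/2)))))"
  unfolding G_def by (intro nn_integral_cong) (simp add: nn_integral_cmult Z_def)
 also have "... <= NN M (%x. ennreal (exp (S (\<lambda>i\<in>{..<N}. e i x))) * 1)" by (intro nn_integral_mono mult_left_mono inner) auto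
 also have "... <= 1" using Suc.IH by (simp add: S_eq)
 finally show ?case .
qed

lemma Z_meas:
 assumes z[measurable]: "!!j. z j : borel_measurable (PiM {..<j} (%_. borel))"
 shows "(%x. z j (\<lambda>i\<in>{..<j}. e i x)) : borel_measurable M"
 by (rule measurable_compose[OF _ z]) (auto intro!: measurable_restrict)

text \<open>Chernoff bound restricted to the event that the random variance stays below the
  deterministic level y; the exponential bound controls the sum and its variance only
  jointly.\<close>

lemma self_normalized_tail_one_sided:
 assumes z[measurable]: "!!j. z j : borel_measurable (PiM {..<j} (%_. borel))"
 defines "Z == %j x. z j (\<lambda>i\<in>{..<j}. e i x)"
 assumes y: "y > 0" and x: "x >= 0"
 shows "prob {w:space M. (\<Sum>j<N. e j w * Z j w) > x * sqrt (2*y) &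
      (\<Sum>j<N. ((e j w)^2 + s2 j) * (Z j w)^2) <= y} <= exp (-(x^2))" (is "prob ?A <= _")
proof -
 have [measurable]: "Z j : borel_measurable M" for j unfolding Z_def by (rule Z_meas[OF z])
 \<comment> \<open>This slope maximises l x sqrt(2 y) - l^2 y / 2; the maximum is x^2.\<close>
 define l where "l = x * sqrt (2 / y)"
 have l: "l >= 0" unfolding l_def using x y by auto
 let ?X = "%w l. \<Sum>j<N. e j w * (l * Z j w) - ((e j w)^2 + s2 j) * (l * Z j w)^2/2"
 define f where "f = (%w. exp (?X w l))"
 have [measurable]: "f : borel_measurable M" unfolding f_def by measurable
 have int: "NN M (%w. ennreal (f w)) <= 1" using exp_self_normalized[of "%j r. l * z j r" N] unfolding f_def Z_def by simp
 let ?Y = "%x. ennreal (exp (-(x^2)))"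
 have sub: "indicator ?A w <= ?Y x * ennreal (f w)" for w
 proof (cases "w : ?A")
  case True
  then have a: "(\<Sum>j<N. e j w * Z j w) > x * sqrt (2*y)" and b: "(\<Sum>j<N. ((e j w)^2 + s2 j) * (Z j w)^2) <= y" by auto
  have "?X w l =
    l * (\<Sum>j<N. e j w * Z j w) - l^2/2 * (\<Sum>j<N. ((e j w)^2 + s2 j) * (Z j w)^2)"
   by (simp add: sum_distrib_left sum_subtractf[symmetric] power_mult_distrib algebra_simps add_divide_distrib)
  also have "... >= l * (x * sqrt (2*y)) - l^2/2 * y" using a b l by (intro diff_mono mult_left_mono) auto
  also have "l * (x * sqrt (2*y)) - l^2/2 * y = x^2"
  proof -
   have "sqrt (2/y) * sqrt (2*y) = 2" using y by (simp add: real_sqrt_mult[symmetric])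
   then have "l * (x * sqrt (2*y)) = 2 * x^2" unfolding l_def by (simp add: power2_eq_square mult_ac)
   moreover have "l^2/2 * y = x^2" unfolding l_def using y by (simp add: power_mult_distrib)
   ultimately show ?thesis by simp
  qed
  finally have "exp (x^2) <= f w" unfolding f_def by simp
  then have "1 <= exp (-(x^2)) * f w" by (simp add: exp_minus field_simps)
  then show ?thesis using True by (simp add: ennreal_mult[symmetric] f_def del: mem_Collect_eq)
 qed auto
 have "emeasure M ?A = NN M (%w. indicator ?A w)" by simp
 also have "... <= NN M (%w. ?Y x * ennreal (f w))" by (intro nn_integral_mono sub)
 also have "... = ?Y x * (NN M (%w. ennreal (f w)))" by (simp add: nn_integral_cmult)
 also have "... <= ?Y x * 1" by (intro mult_left_mono int) auto
 finally show ?thesis by (simp add: emeasure_eq_measure)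
qed

lemma self_normalized_tail:
 assumes z[measurable]: "!!j. z j : borel_measurable (PiM {..<j} (%_. borel))"
 defines "Z == %j x. z j (\<lambda>i\<in>{..<j}. e i x)"
 assumes y: "y > 0" and x: "x >= 0"
 shows "prob {w:space M. abs (\<Sum>j<N. e j w * Z j w) > x * sqrt (2*y) &
      (\<Sum>j<N. ((e j w)^2 + s2 j) * (Z j w)^2) <= y} <= 2 * exp (-(x^2))" (is "prob ?A <= _")
proof -
 have [measurable]: "Z j : borel_measurable M" for j unfolding Z_def by (rule Z_meas[OF z])
 let ?P = "{w:space M. (\<Sum>j<N. e j w * Z j w) > x * sqrt (2*y) &
      (\<Sum>j<N. ((e j w)^2 + s2 j) * (Z j w)^2) <= y}"
 let ?Q = "{w:space M. (\<Sum>j<N. e j w * (- Z j w)) > x * sqrt (2*y) &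
      (\<Sum>j<N. ((e j w)^2 + s2 j) * (- Z j w)^2) <= y}"
 have "?A <= ?P \<union> ?Q" by (auto simp: sum_negf)
 then have "prob ?A <= prob (?P \<union> ?Q)" by (intro finite_measure_mono) auto
 also have "... <= prob ?P + prob ?Q" by (intro measure_Un_le) auto
 also have "... <= exp (-(x^2)) + exp (-(x^2))" using self_normalized_tail_one_sided[of z y x N, OF z y x]
   self_normalized_tail_one_sided[of "%j r. - z j r" y x N, OF _ y x] unfolding Z_def by (intro add_mono) auto
 finally show ?thesis by simp
qed

lemma linear_tail:
 assumes y: "y > 0" and x: "x >= 0"
 shows "prob {w:space M. abs (\<Sum>j<N. k j * e j w) > x * sqrt (2*y) &
      (\<Sum>j<N. (k j)^2 * ((e j w)^2 + s2 j)) <= y} <= 2 * exp (-(x^2))"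
 using self_normalized_tail[of "%j _. k j" y x N, OF _ y x] by (simp add: mult_ac)

text \<open>\<open>linear_tail\<close> works at a deterministic level of \<open>V\<close>. Peeling
  over the dyadic levels 2^r w with r <= R makes the level random at the price of a factor R + 1;
  the floor w keeps the number of levels finite.\<close>

lemma linear_tail_random_level:
 fixes N R :: nat and k :: "nat => real"
 assumes w: "w > 0" and x: "x >= 0"
 defines "V == %y. \<Sum>j<N. (k j)^2 * ((e j y)^2 + s2 j)"
 shows "prob {y:space M. (\<Sum>j<N. k j * e j y)^2 > 4 * x^2 * (w + V y) & V y <= 2^R * w}
   <= real (Suc R) * (2 * exp (-(x^2)))" (is "prob ?A <= _")
proof -
 let ?Z = "%y. \<Sum>j<N. k j * e j y"
 let ?B = "%r. {y:space M. abs (?Z y) > x * sqrt (2*(2^r*w)) & V y <= 2^r*w}"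
 have [measurable]: "V : borel_measurable M" unfolding V_def by measurable
 have V0: "V y >= 0" for y unfolding V_def using s2_nonneg by (intro sum_nonneg mult_nonneg_nonneg add_nonneg_nonneg) auto
 let ?X = "UN r:{..R}. ?B r"
 have "?A <= ?X"
 proof
  fix y assume y: "y : ?A"
  define r where "r = (LEAST r. V y <= 2^r * w)"
  have r1: "V y <= 2^r * w" unfolding r_def by (rule LeastI[of _ R]) (use y in auto)
  have r2: "r <= R" unfolding r_def by (rule Least_le) (use y in auto)
  have r3: "2^r * w <= 2 * (w + V y)"
  proof (cases r)
   case 0 then show ?thesis using V0[of y] w by simp
  next
   case (Suc r')
   then have "~ (V y <= 2^r' * w)" using not_less_Least[of r' "%r. V y <= 2^r * w"] unfolding r_def by simp
   then show ?thesis using Suc w by simp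
  qed
  have "x^2 * (2*(2^r*w)) <= x^2 * (4 * (w + V y))" using r3 by (intro mult_left_mono) auto
  also have "... < (?Z y)^2" using y by (simp add: algebra_simps)
  finally have "(x * sqrt (2*(2^r*w)))^2 < abs (?Z y)^2" using w by (simp add: power_mult_distrib)
  then have "x * sqrt (2*(2^r*w)) < abs (?Z y)" by (rule power2_less_imp_less) simp
  with r1 r2 y show "y : ?X" by auto
 qed
 then have "prob ?A <= prob ?X" by (intro finite_measure_mono) auto
 also have "... <= (SUM r:{..R}. prob (?B r))" by (intro measure_UNION_le) auto
 also have "... <= (SUM r:{..R}. 2 * exp (-(x^2)))" unfolding V_def by (intro sum_mono linear_tail) (use w x in auto)
 finally show ?thesis by simp
qed

text \<open>Self-normalization is applied twice. First each inner linear form is bounded by its own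
  random variance; on that event the random variance of the outer sum is at most 4 x^2 H, where H is
  built from the majorant \<open>kp\<close> alone. Then the outer sum is treated at the
  deterministic level 4 x^2 h. Since H also dominates every inner variance, h <= 2^R w caps the
  number of peeling levels.\<close>

lemma quadratic_tail:
 fixes N R :: nat and K kp :: "nat => nat => real"
 assumes w: "w > 0" and x: "x >= 0" and c0: "c0 >= 1" "!!j. s2 j <= c0"
  and kp: "!!s t. t < s ==> s < N ==> (K s t)^2 <= kp s t" and h: "h > 0" "h <= 2^R * w"
 defines "g == %j y. (e j y)^2 + c0"
 defines "H == %y. \<Sum>s<N. g s y * (w + (\<Sum>t<s. kp s t * g t y))"
 shows "prob {y:space M. abs (\<Sum>s<N. e s y * (\<Sum>t<s. K s t * e t y)) > 4 * x^2 * sqrt h & H y <= h}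
   <= (real N * real (Suc R) + 1) * (2 * exp (-(x^2)))" (is "prob ?A <= _")
proof -
 define Z where "Z = (%s y. \<Sum>t<s. K s t * e t y)"
 define V where "V = (%s y. \<Sum>t<s. (K s t)^2 * ((e t y)^2 + s2 t))"
 let ?B = "%s. {y:space M. (Z s y)^2 > 4 * x^2 * (w + V s y) & V s y <= 2^R * w}"
 let ?Y = "%y Z. \<Sum>s<N. ((e s y)^2 + s2 s) * (Z s y)^2"
 let ?C = "{y:space M. abs (\<Sum>s<N. e s y * Z s y) > x * sqrt (2*(4*x^2*h)) &
   (?Y y Z) <= 4*x^2*h}"
 let ?Z = "borel_measurable M"
 have [measurable]: "Z s : ?Z" "V s : ?Z" "g s : ?Z" for s unfolding Z_def V_def g_def by measurable
 have [measurable]: "H : ?Z" unfolding H_def by measurable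
 have g: "g j y >= 1" "(e j y)^2 + s2 j <= g j y" for j y using c0 unfolding g_def by (auto intro: order_trans[OF c0(1)])
 have g0: "g j y >= 0" for j y using g(1)[of j y] by simp
 have kp0: "kp s t >= 0" if "t < s" "s < N" for s t using kp[OF that] by (meson order_trans zero_le_power2)
 have V0: "V s y >= 0" for s y unfolding V_def using s2_nonneg by (intro sum_nonneg mult_nonneg_nonneg add_nonneg_nonneg) auto
 have VK: "V s y <= (\<Sum>t<s. kp s t * g t y)" if "s < N" for s y unfolding V_def using that g s2_nonneg
  by (intro sum_mono mult_mono kp) (auto intro!: kp0 add_nonneg_nonneg)
 have term0: "g s y * (w + (\<Sum>t<s. kp s t * g t y)) >= 0" if "s < N" for s y
  using w that g0 by (intro mult_nonneg_nonneg add_nonneg_nonneg sum_nonneg) (auto intro!: kp0)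
 have VH: "w + V s y <= H y" if "s < N" for s y
 proof -
  have "w + V s y <= 1 * (w + (\<Sum>t<s. kp s t * g t y))" using VK[OF that] by simp
  also have "... <= g s y * (w + (\<Sum>t<s. kp s t * g t y))"
   using g w that g0 by (intro mult_right_mono add_nonneg_nonneg sum_nonneg mult_nonneg_nonneg) (auto intro!: kp0)
  also have "... <= H y" unfolding H_def using that by (intro member_le_sum term0) auto
  finally show ?thesis .
 qed
 let ?X = "UN s:{..<N}. ?B s"
 have sub: "?A <= ?C \<union> ?X"
 proof
  fix y assume y: "y : ?A"
  show "y : ?C \<union> ?X"
  proof (cases "y : ?X")
   case False
   have Z: "(Z s y)^2 <= 4 * x^2 * (w + V s y)" if "s < N" for s
   proof -
    have "V s y <= 2^R * w" using VH[OF that, of y] y h w by auto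
    then show ?thesis using False that y by (auto simp: not_less[symmetric])
   qed
   have "?Y y Z <= (\<Sum>s<N. g s y * (4 * x^2 * (w + (\<Sum>t<s. kp s t * g t y))))"
   proof (intro sum_mono mult_mono)
    fix s assume s: "s : {..<N}"
    have "(Z s y)^2 <= 4 * x^2 * (w + V s y)" using Z s by auto
    also have "... <= 4 * x^2 * (w + (\<Sum>t<s. kp s t * g t y))" using VK[of s y] s by (intro mult_left_mono) auto
    finally show "(Z s y)^2 <= 4 * x^2 * (w + (\<Sum>t<s. kp s t * g t y))" .
   qed (use g g0 in auto)
   also have "... = 4 * x^2 * H y" unfolding H_def by (simp add: sum_distrib_left mult_ac)
   also have "... <= 4 * x^2 * h" using y by (intro mult_left_mono) auto
   finally have 1: "?Y y Z <= 4 * x^2 * h" .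
   have "sqrt (2*(4*x^2*h)) = sqrt 8 * (x * sqrt h)" using x by (simp add: real_sqrt_mult)
   also have "... <= 4 * (x * sqrt h)" using x h by (intro mult_right_mono real_le_lsqrt) (auto intro: real_le_lsqrt)
   finally have "x * sqrt (2*(4*x^2*h)) <= x * (4 * (x * sqrt h))" using x by (intro mult_left_mono) auto
   also have "... = 4 * x^2 * sqrt h" by (simp add: power2_eq_square)
   also have "... < abs (\<Sum>s<N. e s y * Z s y)" using y unfolding Z_def by auto
   finally show ?thesis using y 1 by auto
  qed auto
 qed
 have C: "prob ?C <= 2 * exp (-(x^2))"
 \<comment> \<open>The level 4 x^2 h has to be positive; for x = 0 the claimed bound is 2.\<close>
 proof (cases "x = 0")
  case True
  then have "exp (-(x^2)) = 1" by simp
  then show ?thesis using prob_le_1[of ?C] by linarith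
 next
  case False
  have Zr: "Z j = (%x. (%r. \<Sum>t<j. K j t * r t) (\<lambda>i\<in>{..<j}. e i x))" for j unfolding Z_def by (auto simp: fun_eq_iff)
  show ?thesis using self_normalized_tail[of "%j r. \<Sum>t<j. K j t * r t" "4*x^2*h" x N] False x h unfolding Zr by simp
 qed
 have "prob ?A <= prob (?C \<union> ?X)" using sub by (intro finite_measure_mono) auto
 also have "... <= prob ?C + prob ?X" by (intro measure_Un_le) auto
 also have "prob ?X <= (\<Sum>s<N. prob (?B s))" by (intro measure_UNION_le) auto
 also have "... <= (\<Sum>s<N. real (Suc R) * (2 * exp (-(x^2))))" unfolding Z_def V_def by (intro sum_mono linear_tail_random_level w x)
 finally show ?thesis using C by (simp add: algebra_simps)
qed

end

section \<open>Coupling by Gaussian smoothing\<close>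

lemma nn_integral_iterated_add:
 assumes Q: "sigma_finite_measure Q"
  and [measurable]: "case_prod f : borel_measurable (P \<Otimes>\<^sub>M Q)" "case_prod g : borel_measurable (P \<Otimes>\<^sub>M Q)"
 shows "NN P (%x. NN Q (%y. f x y + g x y)) = NN P (%x. NN Q (f x)) + NN P (%x. NN Q (g x))"
proof -
 interpret sigma_finite_measure Q by fact
 have "NN P (%x. NN Q (%y. f x y + g x y)) = NN P (%x. NN Q (f x) + NN Q (g x))" by (intro nn_integral_cong nn_integral_add) auto
 then show ?thesis by (simp add: nn_integral_add)
qed

text \<open>Gluing through a common smoothed point y. The kernels smooth P and Q to densities p and
  q; the common part of these is shared by both sides, and the mass D left over on either side is
  coupled independently. If x and g are far apart, then y is far from one of them or the pair stems
  from the leftover mass: these are the three terms of the bound.\<close>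

lemma coupling_density:
 fixes P :: "'x measure" and Q :: "'y measure" and Y :: "'z measure"
  and k1 :: "'x => 'z => ennreal" and k2 :: "'y => 'z => ennreal"
 assumes P: "prob_space P" and Q: "prob_space Q" and Y: "sigma_finite_measure Y"
  and k1[measurable]: "case_prod k1 : borel_measurable (P \<Otimes>\<^sub>M Y)"
  and k2[measurable]: "case_prod k2 : borel_measurable (Q \<Otimes>\<^sub>M Y)" and k1_1: "!!x. x : space P ==> NN Y (%y. k1 x y) = 1"
  and k2_1: "!!x. x : space Q ==> NN Y (%y. k2 x y) = 1"
 defines "p == %y. NN P (%x. k1 x y)" and "q == %y. NN Q (%x. k2 x y)"
 assumes p: "!!y. y : space Y ==> p y > 0 & p y < \<top>" and q: "!!y. y : space Y ==> q y > 0 & q y < \<top>"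
 obtains h where "case_prod h : borel_measurable (P \<Otimes>\<^sub>M Q)"
  "!!x. x : space P ==> NN Q (%g. h x g) = 1"
  "!!g. g : space Q ==> NN P (%x. h x g) = 1"
  "!!A A1 A2. A : sets (P \<Otimes>\<^sub>M Q) ==> A1 : sets (P \<Otimes>\<^sub>M Y) ==> A2 : sets (Q \<Otimes>\<^sub>M Y) ==>
    (!!x g y. (x, g) : A ==> y : space Y ==> (x, y) : A1 | (g, y) : A2) ==>
    (NN P (%x. NN Q (%g. h x g * indicator A (x, g)))) <=
     (NN P (%x. NN Y (%y. k1 x y * indicator A1 (x, y)))) +
     (NN Q (%g. NN Y (%y. k2 g y * indicator A2 (g, y)))) + (NN Y (%y. p y - q y))"
proof -
 interpret P: prob_space P by fact
 interpret Q: prob_space Q by fact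
 interpret Y: sigma_finite_measure Y by fact
 interpret PY: pair_sigma_finite P Y ..
 interpret QY: pair_sigma_finite Q Y ..
 interpret PQ: pair_sigma_finite P Q ..
 have pm[measurable]: "p : borel_measurable Y" unfolding p_def by measurable
 have qm[measurable]: "q : borel_measurable Y" unfolding q_def by measurable
 have pa: "NN P (%x. k1 x y) = p y" and qa: "NN Q (%x. k2 x y) = q y" for y by (simp_all add: p_def q_def)
 define m where "m = (%y. min (p y) (q y))"
 have [measurable]: "m : borel_measurable Y" unfolding m_def by measurable
 have p_int: "NN Y p = 1" unfolding p_def by (subst PY.Fubini') (auto simp: k1_1 P.emeasure_space_1 cong: nn_integral_cong)
 have q_int: "NN Y q = 1" unfolding q_def by (subst QY.Fubini') (auto simp: k2_1 Q.emeasure_space_1 cong: nn_integral_cong)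
 \<comment> \<open>Subtraction of extended nonnegative reals is truncated, so this is the total
   variation distance; it is 1 minus the mass of the common part, seen from p as well as from
   q.\<close>
 define D where "D = NN Y (%y. p y - q y)"
 have m_le: "NN Y m <= 1" unfolding p_int[symmetric] by (intro nn_integral_mono) (auto simp: m_def)
 have D1: "D = 1 - NN Y m"
 proof -
  have "D = NN Y (%y. p y - m y)" unfolding D_def m_def
  proof (intro nn_integral_cong)
   fix y assume "y : space Y"
   then have "p y < \<top>" using p by auto
   then show "p y - q y = p y - min (p y) (q y)" by (cases "p y <= q y") (auto simp: min_def diff_eq_0_iff_ennreal)
  qed
  also have "... = (NN Y p) - NN Y m" by (rule nn_integral_diff) (use m_le in \<open>auto simp: m_def top_unique less_top[symmetric]\<close>)
  finally show ?thesis by (simp add: p_int)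
 qed
 have D2: "D = NN Y (%y. q y - m y)"
 proof -
  have "NN Y (%y. q y - m y) = (NN Y q) - NN Y m"
   by (rule nn_integral_diff) (use m_le in \<open>auto simp: m_def top_unique less_top[symmetric]\<close>)
  then show ?thesis by (simp add: q_int D1)
 qed
 have D_le: "D <= 1" unfolding D1 by (simp add: diff_le_self_ennreal)
 have mp: "m y / p y <= 1" "m y / q y <= 1" "m y / p y * p y = m y" "m y / q y * q y = m y"
   "m y / (p y * q y) * q y = m y / p y" "m y / (p y * q y) * p y = m y / q y" if "y : space Y" for y
 proof -
  note p' = p[OF that] and q' = q[OF that]
  have ip: "p y * inverse (p y) = 1" using p' ennreal_divide_self[of "p y"] by (auto simp: divide_ennreal_def)
  have iq: "q y * inverse (q y) = 1" using q' ennreal_divide_self[of "q y"] by (auto simp: divide_ennreal_def)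
  have ipq: "inverse (p y * q y) = inverse (p y) * inverse (q y)" using p' q' by (intro ennreal_inverse_mult) auto
  show "m y / p y <= 1" unfolding divide_ennreal_def by (subst ip[symmetric]) (auto simp: m_def intro!: mult_right_mono)
  show "m y / q y <= 1" unfolding divide_ennreal_def by (subst iq[symmetric]) (auto simp: m_def intro!: mult_right_mono)
  show "m y / p y * p y = m y" "m y / q y * q y = m y" unfolding divide_ennreal_def mult.assoc using ip iq by (simp_all add: mult.commute)
  have "m y / (p y * q y) * q y = m y * inverse (p y) * (q y * inverse (q y))" unfolding divide_ennreal_def ipq by (simp add: mult_ac)
  then show "m y / (p y * q y) * q y = m y / p y" unfolding iq divide_ennreal_def by simp
  have "m y / (p y * q y) * p y = m y * inverse (q y) * (p y * inverse (p y))" unfolding divide_ennreal_def ipq by (simp add: mult_ac)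
  then show "m y / (p y * q y) * p y = m y / q y" unfolding ip divide_ennreal_def by simp
 qed
 \<comment> \<open>Mass at x that is lost when \<open>k1 x\<close> is thinned to the common part;
   the independent leftover has to refill it.\<close>
 define a where "a = (%x. 1 - (NN Y (%y. k1 x y * (m y / p y))))"
 define b where "b = (%g. 1 - (NN Y (%y. k2 g y * (m y / q y))))"
 have [measurable]: "a : borel_measurable P" "b : borel_measurable Q" unfolding a_def b_def by measurable
 have a_le: "NN Y (%y. k1 x y * (m y / p y)) <= 1" if "x : space P" for x
  unfolding k1_1[OF that, symmetric] using mp by (intro nn_integral_mono) (metis mult.right_neutral mult_left_mono zero_le)
 have b_le: "NN Y (%y. k2 x y * (m y / q y)) <= 1" if "x : space Q" for x
  unfolding k2_1[OF that, symmetric] using mp by (intro nn_integral_mono) (metis mult.right_neutral mult_left_mono zero_le)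
 have a_int: "NN P a = D"
 proof -
  have *: "NN P (%x. NN Y (%y. k1 x y * (m y / p y))) = NN Y m" by (subst PY.Fubini'[symmetric])
     (auto simp: nn_integral_multc pa mult.commute[of "p _"] mp intro!: nn_integral_cong)
  have "NN P a = (NN P (%x. 1)) - (NN P (%x. NN Y (%y. k1 x y * (m y / p y))))"
   unfolding a_def by (rule nn_integral_diff) (use m_le a_le in \<open>auto simp: * top_unique less_top[symmetric]\<close>)
  then show ?thesis by (simp add: * D1 P.emeasure_space_1)
 qed
 have b_int: "NN Q b = D"
 proof -
  have *: "NN Q (%x. NN Y (%y. k2 x y * (m y / q y))) = NN Y m" by (subst QY.Fubini'[symmetric])
     (auto simp: nn_integral_multc qa mult.commute[of "q _"] mp intro!: nn_integral_cong)
  have "NN Q b = (NN Q (%x. 1)) - (NN Q (%x. NN Y (%y. k2 x y * (m y / q y))))"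
   unfolding b_def by (rule nn_integral_diff) (use m_le b_le in \<open>auto simp: * top_unique less_top[symmetric]\<close>)
  then show ?thesis by (simp add: * D1 Q.emeasure_space_1)
 qed
 \<comment> \<open>For D = 0 the quotient a x * D / D equals 0, so the marginal identity then rests
   on a being 0 itself.\<close>
 have D0: "a x = 0" if "D = 0" "x : space P" for x
 proof -
  have "AE y in Y. p y - q y = 0" using that(1) unfolding D_def by (subst (asm) nn_integral_0_iff_AE) auto
  then have "AE y in Y. m y / p y = 1" using AE_space
  proof eventually_elim
   case (elim y)
   then show ?case using p[of y] q[of y] by (auto simp: m_def min_def diff_eq_0_iff_ennreal)
  qed
  then have "NN Y (%y. k1 x y * (m y / p y)) = NN Y (%y. k1 x y)" by (intro nn_integral_cong_AE) auto
  then show ?thesis using k1_1[OF that(2)] by (simp add: a_def)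
 qed
 have D0': "b x = 0" if "D = 0" "x : space Q" for x
 proof -
  have "AE y in Y. q y - m y = 0" using that(1) unfolding D2 by (subst (asm) nn_integral_0_iff_AE) auto
  then have "AE y in Y. m y / q y = 1" using AE_space
  proof eventually_elim
   case (elim y)
   then show ?case using p[of y] q[of y] by (auto simp: m_def min_def diff_eq_0_iff_ennreal split: if_splits)
  qed
  then have "NN Y (%y. k2 x y * (m y / q y)) = NN Y (%y. k2 x y)" by (intro nn_integral_cong_AE) auto
  then show ?thesis using k2_1[OF that(2)] by (simp add: b_def)
 qed
 let ?X = "%m y. m y / (p y * q y)"
 \<comment> \<open>Given x, draw y from k1 x, keep it with probability m y / p y, then draw g by
   Bayes' rule, with density k2 g y / q y relative to Q.\<close>
 define h1 where "h1 = (%x g. NN Y (%y. k1 x y * k2 g y * ?X m y))"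
 define h where "h = (%x g. h1 x g + a x * b g / D)"
 let ?W = "P \<Otimes>\<^sub>M Q"
 have h1_meas[measurable]: "case_prod h1 : borel_measurable ?W" unfolding h1_def by measurable
 have DD: "D / D = 1" if "D ~= 0" using that order.strict_trans1[OF D_le, of top] by (intro ennreal_divide_self) auto
 have aDD: "a x * D / D = a x" if "x : space P" for x using DD D0[OF _ that] by (cases "D = 0") (auto simp: ennreal_times_divide[symmetric])
 have bDD: "D * b x / D = b x" if "x : space Q" for x
  using DD D0'[OF _ that] by (cases "D = 0") (auto simp: ennreal_times_divide[symmetric] mult.commute[of D])
 have DDD: "D * D / D <= D" using DD by (cases "D = 0") (auto simp: ennreal_times_divide[symmetric])
 note add2 = nn_integral_iterated_add[OF Q.sigma_finite_measure_axioms, where P=P]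
 have add_minus: "x + (1 - x) = (1::ennreal)" if "x <= 1" for x using that by (simp add: add_diff_inverse_ennreal)
 let ?Y = "%h1 A. NN P (%x. NN Q (%g. h1 x g * indicator A (x, g)))"
 let ?Z = "%Y A1. NN P (%x. NN Y (%y. k1 x y * indicator A1 (x, y)))"
 let ?U = "%Y A2. NN Q (%g. NN Y (%y. k2 g y * indicator A2 (g, y)))"
 show ?thesis
 proof (rule that)
  show [measurable]: "case_prod h : borel_measurable ?W" unfolding h_def by measurable
  fix x assume x[measurable]: "x : space P"
  have "NN Q (%g. h1 x g) = NN Y (%y. k1 x y * (m y / p y))" unfolding h1_def by (subst QY.Fubini'[symmetric])
     (auto simp: nn_integral_multc nn_integral_cmult qa mp mult_ac intro!: nn_integral_cong, simp add: mp(5)[symmetric] mult_ac)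
  moreover have "NN Q (%g. a x * b g / D) = a x" by (simp add: nn_integral_divide nn_integral_cmult b_int aDD x)
  ultimately show "NN Q (%g. h x g) = 1" unfolding h_def using a_le[OF x] by (simp add: nn_integral_add) (simp add: a_def add_minus)
 next
  fix x assume x[measurable]: "x : space Q"
  have "NN P (%g. h1 g x) = NN Y (%y. k2 x y * (m y / q y))" unfolding h1_def by (subst PY.Fubini'[symmetric])
     (auto simp: nn_integral_multc nn_integral_cmult pa mp mult_ac intro!: nn_integral_cong, simp add: mp(6)[symmetric] mult_ac)
  moreover have "NN P (%g. a g * b x / D) = b x" by (simp add: nn_integral_divide nn_integral_multc a_int bDD x)
  ultimately show "NN P (%g. h g x) = 1" unfolding h_def using b_le[OF x] by (simp add: nn_integral_add) (simp add: b_def add_minus)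
 next
  fix A A1 A2 assume A[measurable]: "A : sets ?W" "A1 : sets (P \<Otimes>\<^sub>M Y)" "A2 : sets (Q \<Otimes>\<^sub>M Y)"
   and sub: "!!x g y. (x, g) : A ==> y : space Y ==> (x, y) : A1 | (g, y) : A2"
  have i1: "?Y h1 A <=
    (NN P (%x. NN Q (%g. (NN Y (%y. k1 x y * k2 g y * ?X m y * indicator A1 (x, y))) +
      (NN Y (%y. k1 x y * k2 g y * ?X m y * indicator A2 (g, y))))))"
  proof (intro nn_integral_mono)
   fix x g assume [measurable]: "x : space P" "g : space Q"
   have "h1 x g * indicator A (x, g) = NN Y (%y. k1 x y * k2 g y * ?X m y * indicator A (x, g))"
    unfolding h1_def by (simp add: nn_integral_multc)
   also have "... <= NN Y (%y. k1 x y * k2 g y * ?X m y * indicator A1 (x, y) +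
     k1 x y * k2 g y * ?X m y * indicator A2 (g, y))" using sub[of x g] by (intro nn_integral_mono) (auto simp: indicator_def)
   also have "... = (NN Y (%y. k1 x y * k2 g y * ?X m y * indicator A1 (x, y))) +
      (NN Y (%y. k1 x y * k2 g y * ?X m y * indicator A2 (g, y)))" by (rule nn_integral_add) auto
   finally show "h1 x g * indicator A (x, g) <= ..." .
  qed
  also have "... = (NN P (%x. NN Q (%g. NN Y (%y. k1 x y * k2 g y * ?X m y * indicator A1 (x, y)))))
    + (NN P (%x. NN Q (%g. NN Y (%y. k1 x y * k2 g y * ?X m y * indicator A2 (g, y)))))" by (rule add2) measurable
  also have "(NN P (%x. NN Q (%g. NN Y (%y. k1 x y * k2 g y * ?X m y * indicator A1 (x, y)))))
    <= ?Z Y A1"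
  proof (intro nn_integral_mono)
   fix x assume [measurable]: "x : space P"
   have "(NN Q (%g. NN Y (%y. k1 x y * k2 g y * ?X m y * indicator A1 (x, y))))
     = NN Y (%y. NN Q (%g. k2 g y * (k1 x y * ?X m y * indicator A1 (x, y))))" by (subst QY.Fubini'[symmetric]) (auto simp: mult_ac)
   also have "... = NN Y (%y. (m y / p y) * (k1 x y * indicator A1 (x, y)))"
    by (intro nn_integral_cong) (simp add: nn_integral_multc qa, simp add: mp(5)[symmetric] mult_ac)
   also have "... <= NN Y (%y. 1 * (k1 x y * indicator A1 (x, y)))" by (intro nn_integral_mono mult_right_mono mp) auto
   finally show "(NN Q (%g. NN Y (%y. k1 x y * k2 g y * ?X m y * indicator A1 (x, y))))
     <= NN Y (%y. k1 x y * indicator A1 (x, y))" by simp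
  qed
  also have "(NN P (%x. NN Q (%g. NN Y (%y. k1 x y * k2 g y * ?X m y * indicator A2 (g, y)))))
    = NN Q (%g. NN P (%x. NN Y (%y. k1 x y * k2 g y * ?X m y * indicator A2 (g, y))))" by (subst PQ.Fubini') auto
  also have "... <= ?U Y A2"
  proof (intro nn_integral_mono)
   fix x assume [measurable]: "x : space Q"
   have "(NN P (%g. NN Y (%y. k1 g y * k2 x y * ?X m y * indicator A2 (x, y))))
     = NN Y (%y. NN P (%g. k1 g y * (k2 x y * ?X m y * indicator A2 (x, y))))" by (subst PY.Fubini'[symmetric]) (auto simp: mult_ac)
   also have "... = NN Y (%y. (m y / q y) * (k2 x y * indicator A2 (x, y)))"
    by (intro nn_integral_cong) (simp add: nn_integral_multc pa, simp add: mp(6)[symmetric] mult_ac)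
   also have "... <= NN Y (%y. 1 * (k2 x y * indicator A2 (x, y)))" by (intro nn_integral_mono mult_right_mono mp) auto
   finally show "(NN P (%g. NN Y (%y. k1 g y * k2 x y * ?X m y * indicator A2 (x, y))))
     <= NN Y (%y. k2 x y * indicator A2 (x, y))" by simp
  qed
  finally have i1: "?Y h1 A <=
     (?Z Y A1) + ?U Y A2" by (simp add: add_mono)
  have "NN P (%x. NN Q (%g. a x * b g / D * indicator A (x, g))) <= NN P (%x. NN Q (%g. a x * b g / D))"
   by (intro nn_integral_mono) (auto simp: indicator_def)
  also have "... = D * D / D" by (simp add: nn_integral_divide nn_integral_cmult nn_integral_multc a_int b_int)
  also have "... <= D" by (rule DDD)
  finally have i2: "NN P (%x. NN Q (%g. a x * b g / D * indicator A (x, g))) <= D" .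
  have "?Y h A =
   (?Y h1 A) + (NN P (%x. NN Q (%g. a x * b g / D * indicator A (x, g))))" unfolding h_def distrib_right by (rule add2) measurable
  also have "... <= ?Z Y A1 +
     (?U Y A2) + D" by (intro add_mono i1 i2)
  finally show "?Y h A <=
     (?Z Y A1) +
     (?U Y A2) + (NN Y (%y. p y - q y))" unfolding D_def .
 qed
qed

section \<open>Gaussian kernels and the distance of smoothed densities\<close>

definition gauss_kernel :: "'i set => real => ('i => real) => ('i => real) => real" where
 "gauss_kernel I rho x y = (PROD i:I. normal_density (x i) rho (y i))"

definition mchar :: "('i => real) measure => 'i set => ('i => real) => complex" where
 "mchar P I u = (CLINT x|P. iexp (SUM i:I. u i * x i))"

lemma gauss_kernel_nonneg[simp]: "0 <= gauss_kernel I rho x y" unfolding gauss_kernel_def by (intro prod_nonneg) auto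

lemma gauss_kernel_pos: "0 < rho ==> 0 < gauss_kernel I rho x y"
 unfolding gauss_kernel_def by (intro prod_pos) (auto intro: normal_density_pos)

lemma gauss_kernel_le: "0 < rho ==> gauss_kernel I rho x y <= (1 / (sqrt (2*pi) * rho)) ^ card I"
proof -
 assume rho: "0 < rho"
 let ?X = "%i. exp (- (y i - x i)\<^sup>2 / (2 * rho\<^sup>2))"
 have "gauss_kernel I rho x y <= (PROD i:I. 1 / (sqrt (2*pi) * rho))" unfolding gauss_kernel_def
 proof (intro prod_mono conjI)
  fix i
  have "?X i <= 1" by simp
  then have "1 / sqrt (2 * pi * rho^2) * ?X i <= 1 / sqrt (2 * pi * rho^2) * 1" using rho by (intro mult_left_mono) auto
  then show "normal_density (x i) rho (y i) <= 1 / (sqrt (2*pi) * rho)" unfolding normal_density_def using rho by (simp add: real_sqrt_mult)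
 qed simp
 then show ?thesis by simp
qed

lemma normal_density_joint_measurable[measurable]:
 "(%(x, y). normal_density x rho y) : borel_measurable (borel \<Otimes>\<^sub>M borel)" unfolding normal_density_def by measurable

lemma gauss_kernel_measurable[measurable]:
 assumes "finite I"
 shows "(%(x, y). gauss_kernel I rho x y) : borel_measurable (PiM I (%_. borel) \<Otimes>\<^sub>M PiM I (%_. borel))"
proof -
 have "(%z. normal_density (fst z i) rho (snd z i)) : borel_measurable (PiM I (%_. borel) \<Otimes>\<^sub>M PiM I (%_. borel))" if "i : I" for i
  using measurable_compose[OF measurable_Pair[OF measurable_compose[OF measurable_fst measurable_component_singleton[OF that]]
   measurable_compose[OF measurable_snd measurable_component_singleton[OF that]]] normal_density_joint_measurable] by (simp add: split_beta)
 then show ?thesis unfolding gauss_kernel_def split_beta by (intro borel_measurable_prod)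
qed

interpretation lb: product_sigma_finite "%_::'i. lborel :: real measure" by standard

lemma gauss_kernel_nn_integral:
 assumes "finite I" "0 < rho"
 shows "NN (PiM I (%_. lborel)) (%y. ennreal (gauss_kernel I rho x y)) = 1"
proof -
 have "NN (PiM I (%_. lborel)) (%y. ennreal (gauss_kernel I rho x y)) =
   (NN (PiM I (%_. lborel)) (%y. (PROD i:I. ennreal (normal_density (x i) rho (y i)))))" unfolding gauss_kernel_def by (simp add: prod_ennreal)
 also have "... = (PROD i:I. NN lborel (%y. ennreal (normal_density (x i) rho y)))" by (rule lb.product_nn_integral_prod) (use assms in auto)
 also have "... = 1" using assms(2) by (intro prod.neutral ballI) (simp add: nn_integral_eq_integral)
 finally show ?thesis .
qed

lemma gauss_kernel_second_moment:
 fixes I :: "'i set"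
 assumes I: "finite I" "0 < rho" and i: "i : I"
 shows "NN (PiM I (%_. lborel)) (%y. ennreal ((y i - x i)^2 * gauss_kernel I rho x y)) = ennreal (rho^2)"
proof -
 let ?f = "%j y. ennreal (normal_density (x j) rho y * (if j = i then (y - x j)^2 else 1))"
 let ?X = "ennreal (rho^2)"
 let ?Y = "%y. ennreal ((y i - x i)^2 * gauss_kernel I rho x y)"
 have "NN (PiM I (%_. lborel)) (%y. ?Y y) =
   (NN (PiM I (%_. lborel)) (%y. (PROD j:I. ?f j (y j))))"
 proof (intro nn_integral_cong)
  fix y :: "'i => real"
  have "(PROD j:I. normal_density (x j) rho (y j) * (if j = i then (y j - x j)^2 else 1)) = (y i - x i)^2 * gauss_kernel I rho x y"
   unfolding prod.distrib gauss_kernel_def using I i by (simp add: prod.delta' mult.commute)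
  then show "?Y y = (PROD j:I. ?f j (y j))" by (subst prod_ennreal) auto
 qed
 also have "... = (PROD j:I. NN lborel (%y. ?f j y))" by (rule lb.product_nn_integral_prod) (use assms in auto)
 also have "... = (PROD j:I. if j = i then ?X else 1)"
 proof (intro prod.cong refl)
  fix j
  have "NN lborel (%y. ennreal (normal_density (x i) rho y * (y - x i)^2)) = ?X"
  proof -
   have "fact (2 * 1) / ((2 / rho^2)^1 * fact 1) = rho^2" by simp
   then have "has_bochner_integral lborel (%y. normal_density (x i) rho y * (y - x i)^2) (rho^2)"
    using normal_moment_even[OF I(2), of "x i" 1] by (simp only: mult_1_right)
   then show ?thesis by (subst nn_integral_eq_integral) (auto simp: has_bochner_integral_iff)
  qed
  then show "NN lborel (%y. ?f j y) = (if j = i then ?X else 1)" using I(2) by (simp add: nn_integral_eq_integral)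
 qed
 also have "... = ?X" using I i by (simp add: prod.delta')
 finally show ?thesis .
qed

text \<open>Up to its peak value a Gaussian density is a Gaussian characteristic function. As an
  expectation over standard normal eta it yields Fourier inversion of smoothed densities by Fubini,
  the Gaussian weight taking the place of integrability of the characteristic functions.\<close>

lemma gauss_kernel_fourier:
 fixes I :: "'i set"
 assumes I: "finite I" "0 < rho"
 shows "complex_of_real (gauss_kernel I rho x y) = (1 / (sqrt (2*pi) * rho)) ^ card I *
  (CLINT eta|PiM I (%_. std_normal_distribution). iexp (SUM i:I. eta i * (y i - x i) / rho))"
proof -
 interpret N: real_distribution std_normal_distribution by (rule real_dist_normal_dist)
 interpret sn: product_prob_space "%_::'i. std_normal_distribution" UNIV by (intro product_prob_spaceI N.prob_space_axioms)
 let ?Y = "%i. (y i - x i) / rho"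
 let ?Z = "%i. complex_of_real (normal_density (x i) rho (y i))"
 have 1: "?Z i =
   (1 / (sqrt (2*pi) * rho)) * (CLINT eta|std_normal_distribution. iexp (eta * ?Y i))" for i
 proof -
  have "(CLINT eta|std_normal_distribution. iexp (eta * ?Y i)) =
    char std_normal_distribution (?Y i)" unfolding char_def by (simp add: mult.commute)
  also have "... = exp (- ((y i - x i)^2 / (2*rho^2)))" unfolding char_std_normal_distribution by (simp add: power_divide)
  finally show ?thesis using I(2) unfolding normal_density_def by (simp add: real_sqrt_mult)
 qed
 let ?X = "PiM I (%_. std_normal_distribution)"
 have "(CLINT eta|?X. iexp (SUM i:I. eta i * (y i - x i) / rho))
   = (CLINT eta|?X. (PROD i:I. iexp (eta i * ?Y i)))"
  using I(1) by (intro Bochner_Integration.integral_cong refl) (simp add: exp_sum[symmetric] sum_distrib_left)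
 also have "... = (PROD i:I. CLINT eta|std_normal_distribution. iexp (eta * ?Y i))"
  by (rule sn.product_integral_prod[OF I(1)]) (auto intro!: finite_measure.integrable_const_bound[OF prob_space.finite_measure[OF prob_space_normal_density], where B=1])
 finally have "(1 / (sqrt (2*pi) * rho)) ^ card I *
  (CLINT eta|?X. iexp (SUM i:I. eta i * (y i - x i) / rho)) =
  (PROD i:I. ?Z i)" unfolding 1 prod.distrib by simp
 then show ?thesis unfolding gauss_kernel_def by simp
qed

context
 fixes I :: "'i set" and rho :: real
 assumes I[simp]: "finite I" and rho: "0 < rho"
begin

abbreviation "XI == PiM I (%_. borel :: real measure)"
abbreviation "NI == PiM I (%_. std_normal_distribution)"

lemma smoothed_density_fourier:
 assumes P: "prob_space P" and sP[measurable_cong]: "sets P = sets XI"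
 shows "complex_of_real (LINT x|P. gauss_kernel I rho x y) = (1 / (sqrt (2*pi) * rho)) ^ card I *
  (CLINT eta|NI. iexp (SUM i:I. eta i * y i / rho) * mchar P I (%i. - eta i / rho))"
proof -
 interpret P: prob_space P by fact
 interpret NI: prob_space NI by (rule prob_space_PiM) (rule real_distribution.axioms(1)[OF real_dist_normal_dist])
 interpret PN: pair_prob_space P NI ..
 have [measurable_cong]: "sets NI = sets XI" by (intro sets_PiM_cong) auto
 have [measurable]: "i : I ==> (%x. x i) : borel_measurable P" for i
  using measurable_component_singleton[of i I "%_. borel"] sP by (simp cong: measurable_cong_sets)
 let ?X = "%eta x. iexp (SUM i:I. eta i * (y i - x i) / rho)"
 have m: "(%(x, eta). ?X eta x) : borel_measurable (P \<Otimes>\<^sub>M NI)" by measurable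
 let ?Y = "%eta. iexp (SUM i:I. eta i * y i / rho)"
 have "complex_of_real (LINT x|P. gauss_kernel I rho x y) = (LINT x|P. complex_of_real (gauss_kernel I rho x y))" by simp
 also have "... = (LINT x|P. (1 / (sqrt (2*pi) * rho)) ^ card I *
  (CLINT eta|NI. ?X eta x))" by (simp add: gauss_kernel_fourier[OF I rho])
 also have "... = (1 / (sqrt (2*pi) * rho)) ^ card I * (LINT x|P. (CLINT eta|NI. ?X eta x))" by simp
 also have "(LINT x|P. (CLINT eta|NI. ?X eta x)) =
   (CLINT eta|NI. (LINT x|P. ?X eta x))" by (rule PN.Fubini_integral[symmetric], rule PN.P.integrable_const_bound[where B=1, OF _ m]) auto
 also have "... = (CLINT eta|NI. ?Y eta * mchar P I (%i. - eta i / rho))"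
 proof (intro Bochner_Integration.integral_cong refl)
  fix eta :: "'i => real"
  have "?X eta x = ?Y eta * iexp (SUM i:I. - eta i / rho * x i)" for x
   by (simp add: exp_add[symmetric] sum.distrib[symmetric] sum_distrib_left algebra_simps diff_divide_distrib sum_subtractf sum_negf)
  then show "(CLINT x|P. ?X eta x) = ?Y eta * mchar P I (%i. - eta i / rho)" unfolding mchar_def by simp
 qed
 finally show ?thesis .
qed

lemma mchar_measurable:
 assumes P: "prob_space P" and sP[measurable_cong]: "sets P = sets XI"
 shows "(%eta. mchar P I (%i. - eta i / rho)) : borel_measurable NI"
proof -
 interpret P: prob_space P by fact
 have [measurable_cong]: "sets NI = sets XI" by (intro sets_PiM_cong) auto
 have [measurable]: "i : I ==> (%x. x i) : borel_measurable P" for i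
  using measurable_component_singleton[of i I "%_. borel"] sP by (simp cong: measurable_cong_sets)
 show ?thesis unfolding mchar_def by measurable
qed

lemma mchar_norm_le: "prob_space P ==> norm (mchar P I u) <= 1"
proof -
 assume "prob_space P"
 then interpret P: prob_space P .
 have "norm (mchar P I u) <= (LINT x|P. norm (iexp (SUM i:I. u i * x i)))" unfolding mchar_def by (rule integral_norm_bound)
 then show ?thesis by (simp add: P.prob_space)
qed

text \<open>The bound on the characteristic functions is integrated at u = - eta / rho against the
  standard normal law of eta; third absolute moments are at most 2, whence 2 card I / rho^3.\<close>

lemma smoothed_density_diff:
 assumes P: "prob_space P" and sP: "sets P = sets XI"
  and Q: "prob_space Q" and sQ: "sets Q = sets XI" and cf: "!!u. norm (mchar P I u - mchar Q I u) <= Del * (1 + (SUM i:I. abs (u i)^3))"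
 shows "abs ((LINT x|P. gauss_kernel I rho x y) - (LINT x|Q. gauss_kernel I rho x y))
   <= (1 / (sqrt (2*pi) * rho)) ^ card I * (Del * (1 + 2 * card I / rho^3))"
proof -
 interpret NI: prob_space NI by (rule prob_space_PiM) (rule real_distribution.axioms(1)[OF real_dist_normal_dist])
 have [measurable]: "i : I ==> (%x. x i) : borel_measurable NI" for i by (simp cong: measurable_cong_sets)
 note [measurable] = mchar_measurable[OF P sP] mchar_measurable[OF Q sQ]
 have Del: "0 <= Del" using cf[of "%_. 0"] by (simp add: order_trans[OF norm_ge_zero])
 let ?S = "%eta. iexp (SUM i:I. eta i * y i / rho)"
 have iN: "integrable NI (%eta. ?S eta * mchar P' I (%i. - eta i / rho))"
  if "prob_space P'" "sets P' = sets XI" for P' using mchar_measurable[OF that] mchar_norm_le[OF that(1)]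
  by (intro NI.integrable_const_bound[where B=1]) (auto simp: norm_mult)
 have m3: "integrable NI (%eta. abs (eta i)^3)" "(LINT eta|NI. abs (eta i)^3) <= 2" if "i : I" for i
 proof -
  have 1: "integrable std_normal_distribution (%x. abs x^3)"
   using integrable_abs[OF integrable_std_normal_distribution_moment[of 3]] by (simp add: power_abs)
  have 2: "(LINT x|std_normal_distribution. abs x^3) <= 2"
  proof -
   have "(LINT x|std_normal_distribution. abs x^(2*1+1)) = sqrt (2/pi) * 2" by (subst std_normal_distribution_odd_moments_abs) simp
   moreover have "sqrt (2/pi) <= 1" using pi_ge_two by simp
   ultimately show ?thesis by (simp add: numeral_3_eq_3)
  qed
  have d: "distr NI std_normal_distribution (%eta. eta i) = std_normal_distribution"
   by (rule distr_PiM_component) (use that real_distribution.axioms(1)[OF real_dist_normal_dist] in auto)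
  show "integrable NI (%eta. abs (eta i)^3)" using 1 that by (subst (asm) d[symmetric]) (simp add: integrable_distr_eq)
  show "(LINT eta|NI. abs (eta i)^3) <= 2" using 2 that by (subst (asm) d[symmetric]) (simp add: integral_distr)
 qed
 let ?Z = "%eta. mchar P I (%i. - eta i / rho) - mchar Q I (%i. - eta i / rho)"
 let ?X = "%eta. norm (?S eta * ?Z eta)"
 let ?Y = "%NI. norm (CLINT eta|NI. ?S eta * ?Z eta)"
 let ?U = "%eta. 1 + (SUM i:I. abs (eta i)^3 / rho^3)"
 have "?Y NI
   <= (LINT eta|NI. ?X eta)" by (rule integral_norm_bound)
 also have "... <= (LINT eta|NI. Del * ?U eta)"
 proof (rule integral_mono)
  show "integrable NI (%eta. ?X eta)"
  proof (rule NI.integrable_const_bound[where B=2])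
   have "?X eta <= 1 * (1 + 1)" for eta unfolding norm_mult
    by (intro mult_mono order_trans[OF norm_triangle_ineq4] add_mono mchar_norm_le P Q) auto
   then show "AE eta in NI. norm (?X eta) <= 2" by (intro AE_I2) (simp only: real_norm_def abs_norm_cancel, simp)
  qed measurable
  show "integrable NI (%eta. Del * ?U eta)"
   using m3(1) by (intro integrable_mult_right Bochner_Integration.integrable_add integrable_const Bochner_Integration.integrable_sum integrable_divide) auto
  fix eta
  have "?X eta
    = norm (?Z eta)" by (simp only: norm_mult norm_exp_i_times mult_1_left)
  also have "... <= Del * (1 + (SUM i:I. abs (- eta i / rho)^3))" by (rule cf)
  also have "... = Del * ?U eta" using rho by (simp add: power_divide)
  finally show "?X eta
    <= Del * ?U eta" .
 qed
 also have "... = Del * (1 + (SUM i:I. (LINT eta|NI. abs (eta i)^3) / rho^3))" using m3(1) by (simp add: NI.prob_space)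
 also have "... <= Del * (1 + (SUM i:I. 2 / rho^3))"
  using m3(2) rho by (intro mult_left_mono add_left_mono sum_mono divide_right_mono Del) auto
 finally have N: "?Y NI
   <= Del * (1 + 2 * card I / rho^3)" by (simp add: mult.commute)
 let ?W = "%x. gauss_kernel I rho x y"
 have "abs ((LINT x|P. ?W x) - (LINT x|Q. ?W x)) =
   norm (complex_of_real (LINT x|P. ?W x) - complex_of_real (LINT x|Q. ?W x))" by (metis norm_of_real of_real_diff)
 also have "... = (1 / (sqrt (2*pi) * rho)) ^ card I *
   ?Y NI" unfolding smoothed_density_fourier[OF P sP] smoothed_density_fourier[OF Q sQ] right_diff_distrib
  using rho by (subst Bochner_Integration.integral_diff[OF iN[OF P sP] iN[OF Q sQ]])
   (simp add: right_diff_distrib[symmetric] norm_mult norm_power norm_divide)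
 finally show ?thesis using rho N by (simp add: mult_left_mono)
qed

text \<open>The terms of the bound: Chebyshev for either smoothing to move a coordinate by more than
  r/2; the sup-distance of the smoothed densities times the volume of the cube of side 2 R; the mass
  of the smoothed P outside that cube. The positive part of p - q is at most p, so only the tail of
  P enters.\<close>

lemma gaussian_smoothing_coupling:
 assumes P: "prob_space P" and sP[measurable_cong]: "sets P = sets XI"
  and Q: "prob_space Q" and sQ[measurable_cong]: "sets Q = sets XI"
  and cf: "!!u. norm (mchar P I u - mchar Q I u) <= Del * (1 + (SUM i:I. abs (u i)^3))"
  and C2: "NN P (%x. ennreal (SUM i:I. (x i)^2)) <= ennreal C2" "0 <= C2" and R: "0 < R" and r: "0 < r"
 obtains h where "case_prod h : borel_measurable (XI \<Otimes>\<^sub>M XI)"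
  "!!x. x : space XI ==> NN Q (%g. h x g) = 1"
  "!!g. g : space XI ==> NN P (%x. h x g) = 1"
  "(NN P (%x. NN Q (%g. h x g * indicator {(x, g). EX i:I. abs (x i - g i) > r} (x, g))))
   <= ennreal (8 * card I * rho^2 / r^2 + (2 * R) ^ card I * ((1 / (sqrt (2*pi) * rho)) ^ card I * (Del * (1 + 2 * card I / rho^3)))
     + 2 * (C2 + card I * rho^2) / R^2)"
proof -
 interpret P: prob_space P by fact
 interpret Q: prob_space Q by fact
 let ?Y = "PiM I (%_. lborel :: real measure)"
 interpret Y: sigma_finite_measure ?Y by (rule lb.sigma_finite) simp
 interpret PY: pair_sigma_finite P ?Y ..
 have [measurable_cong]: "sets ?Y = sets XI" by (intro sets_PiM_cong) auto
 have spP: "space P = space XI" "space Q = space XI" "space ?Y = space XI"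
  using sets_eq_imp_space_eq[OF sP] sets_eq_imp_space_eq[OF sQ] by (auto simp: space_PiM)
 let ?X = "P \<Otimes>\<^sub>M ?Y"
 let ?Z = "Q \<Otimes>\<^sub>M ?Y"
 let ?P = "%x y. gauss_kernel I rho x y"
 have [measurable]: "(%(x, y). ?P x y) : borel_measurable ?X"
   "(%(x, y). ?P x y) : borel_measurable ?Z" using gauss_kernel_measurable[OF I] by (simp_all cong: measurable_cong_sets)
 let ?c = "(1 / (sqrt (2*pi) * rho)) ^ card I"
 define k where "k = (%x y. ennreal (?P x y))"
 have kM: "case_prod k : borel_measurable ?X" "case_prod k : borel_measurable ?Z" unfolding k_def by measurable
 note [measurable] = kM
 let ?K = "borel_measurable ?Y"
 have coordP[measurable]: "i : I ==> (%x. x i) : borel_measurable P" "i : I ==> (%x. x i) : borel_measurable Q"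
   "i : I ==> (%x. x i) : ?K" for i using measurable_component_singleton[of i I "%_. borel"] by (simp_all cong: measurable_cong_sets)
 have int: "integrable P' (%x. ?P x y)" "NN P' (%x. k x y) = ennreal (LINT x|P'. gauss_kernel I rho x y)"
  "0 < (NN P' (%x. k x y))" "(NN P' (%x. k x y)) < \<top>"
  if P': "prob_space P'" "sets P' = sets XI" and y: "y : space XI" for P' y
 proof -
  interpret P': prob_space P' by fact
  have [measurable]: "(%x. ?P x y) : borel_measurable P'"
   using measurable_compose[OF measurable_Pair2'[OF y] gauss_kernel_measurable[OF I, of rho]] P'(2) by (simp cong: measurable_cong_sets)
  show 1: "integrable P' (%x. ?P x y)" by (rule P'.integrable_const_bound[where B="?c"]) (auto intro: gauss_kernel_le rho)
  show 2: "NN P' (%x. k x y) = ennreal (LINT x|P'. gauss_kernel I rho x y)" unfolding k_def by (rule nn_integral_eq_integral[OF 1]) simp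
  show "(NN P' (%x. k x y)) < \<top>" unfolding 2 by simp
  have "(NN P' (%x. k x y)) ~= 0"
  proof
   assume "NN P' (%x. k x y) = 0"
   then have "AE x in P'. gauss_kernel I rho x y <= 0" unfolding k_def by (subst (asm) nn_integral_0_iff_AE) auto
   then have "AE x in P'. False" by eventually_elim (use gauss_kernel_pos[OF rho, of I] in \<open>simp add: not_le[symmetric]\<close>)
   then show False by simp
  qed
  then show "0 < (NN P' (%x. k x y))" by (simp add: zero_less_iff_neq_zero)
 qed
 have k1: "NN ?Y (%y. k x y) = 1" for x unfolding k_def by (rule gauss_kernel_nn_integral[OF I rho])
 let ?N = "ennreal (rho^2)"
 have k2: "NN ?Y (%y. ennreal ((y i - x i)^2) * k x y) = ?N" if "i : I" for x i
  unfolding k_def using gauss_kernel_second_moment[OF I rho that, of x] by (simp add: ennreal_mult)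
 let ?U = "P \<Otimes>\<^sub>M Q"
 let ?Q = "%k. NN ?Y (%y. (NN P (%x. k x y)) - (NN Q (%x. k x y)))"
 obtain h where h: "case_prod h : borel_measurable ?U"
  "!!x. x : space P ==> NN Q (%g. h x g) = 1"
  "!!g. g : space Q ==> NN P (%x. h x g) = 1"
  "!!A A1 A2. A : sets ?U ==> A1 : sets ?X ==> A2 : sets ?Z ==>
    (!!x g y. (x, g) : A ==> y : space ?Y ==> (x, y) : A1 | (g, y) : A2) ==>
    (NN P (%x. NN Q (%g. h x g * indicator A (x, g)))) <=
     (NN P (%x. NN ?Y (%y. k x y * indicator A1 (x, y)))) +
     (NN Q (%g. NN ?Y (%y. k g y * indicator A2 (g, y)))) + ?Q k"
  by (rule coupling_density[OF P Q Y.sigma_finite_measure_axioms kM, unfolded spP]) (use int[OF P sP] int[OF Q sQ] k1 spP in auto)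
 define S where "S = {(x::'i=>real, g::'i=>real). EX i:I. abs (x i - g i) > r}"
 define S' where "S' = {(x::'i=>real, y::'i=>real). EX i:I. abs (y i - x i) > r/2}"
 have SS: "S \<inter> space ?U : sets ?U" "S' \<inter> space ?X : sets ?X"
   "S' \<inter> space ?Z : sets ?Z"
 proof -
  have 1: "S \<inter> space ?U = (UN i:I. {z : space ?U. abs (fst z i - snd z i) > r})" unfolding S_def by auto
  have 2: "S' \<inter> space (P' \<Otimes>\<^sub>M ?Y) = (UN i:I. {z : space (P' \<Otimes>\<^sub>M ?Y). abs (snd z i - fst z i) > r/2})" for P'
   unfolding S'_def by auto
  show "S \<inter> space ?U : sets ?U" "S' \<inter> space ?X : sets ?X"
   "S' \<inter> space ?Z : sets ?Z" unfolding 1 2 by (intro sets.finite_UN I; measurable)+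
 qed
 let ?W = "ennreal (4 * card I * rho^2 / r^2)"
 let ?E = "ennreal (4/r^2)"
 have tail: "NN ?Y (%y. k x y * indicator S' (x, y)) <= ?W"
  if [measurable]: "x : space XI" for x
 proof -
  have "NN ?Y (%y. k x y * indicator S' (x, y)) <= NN ?Y (%y. (SUM i:I. ?E * (ennreal ((y i - x i)^2) * k x y)))"
  proof (intro nn_integral_mono)
   fix y
   show "k x y * indicator S' (x, y) <= (SUM i:I. ?E * (ennreal ((y i - x i)^2) * k x y))"
   proof (cases "(x, y) : S'")
    case True
    then obtain i where i: "i : I" "abs (y i - x i) > r/2" unfolding S'_def by auto
    have "(r/2)^2 <= abs (y i - x i)^2" using i r by (intro power_mono) auto
    then have "1 <= 4/r^2 * (y i - x i)^2" using r by (simp add: power_divide field_simps)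
    then have "1 <= ?E * ennreal ((y i - x i)^2)" by (simp add: ennreal_mult[symmetric])
    then have "1 * k x y <= ?E * ennreal ((y i - x i)^2) * k x y" by (rule mult_right_mono) simp
    also have "... <= (SUM i:I. ?E * (ennreal ((y i - x i)^2) * k x y))" unfolding mult.assoc using i by (intro member_le_sum) auto
    finally show ?thesis by (simp add: indicator_def True)
   qed auto
  qed
  also have "... = (SUM i:I. ?E * ?N)"
  proof (subst nn_integral_sum)
   have [measurable]: "(%y. k x y) : ?K" by (rule measurable_Pair_compose_split[OF kM(1)]) (use that spP in auto)
   fix i assume "i : I" 
   then show "(%y. ?E * (ennreal ((y i - x i)^2) * k x y)) : ?K" by measurable
  next
   have [measurable]: "(%y. k x y) : ?K" by (rule measurable_Pair_compose_split[OF kM(1)]) (use that spP in auto)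
   show "(SUM i:I. NN ?Y (%y. ?E * (ennreal ((y i - x i)^2) * k x y))) = (SUM i:I. ?E * ?N)"
    by (intro sum.cong refl) (simp add: nn_integral_cmult k2)
  qed
  also have "... = ?W" using r by (simp add: ennreal_mult[symmetric] ennreal_of_nat_eq_real_of_nat)
  finally show ?thesis .
 qed
 define box where "box = {y : space ?Y. ALL i:I. abs (y i) <= R}"
 have box_eq: "box = PiE I (%_. {-R..R})" unfolding box_def space_PiM by (auto simp: PiE_iff abs_le_iff extensional_def) (metis minus_le_iff)
 have box_vol: "emeasure ?Y box = ennreal ((2*R) ^ card I)" unfolding box_eq using R by (subst lb.emeasure_PiM) (auto simp: ennreal_power)
 have [measurable]: "box : sets ?Y" unfolding box_def by measurable
 let ?D = "?c * (Del * (1 + 2 * card I / rho^3))"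
 have D0: "0 <= ?D" using smoothed_density_diff[OF P sP Q sQ cf, of "%_. 0"] by (rule order_trans[OF abs_ge_zero])
 let ?S = "%box y. indicator (space ?Y - box) y"
 let ?T = "C2 + card I * rho^2"
 let ?R = "%x. ennreal (SUM i:I. (x i)^2)"
 let ?F = "ennreal (2/R^2)"
 let ?H = "ennreal (card I * rho^2)"
 let ?L = "%x y. (SUM i:I. (x i)^2) + (SUM i:I. (y i - x i)^2)"
 let ?M = "%k box. NN P (%x. NN ?Y (%y. k x y * ?S box y))"
 let ?A = "ennreal (2 * ?T / R^2)"
 have outside: "?M k box <= ?A"
 proof -
  have "NN ?Y (%y. k x y * ?S box y) <= ?F * (?R x + ?H)"
   if [measurable]: "x : space XI" for x
  proof -
   have [measurable]: "(%y. k x y) : ?K" by (rule measurable_Pair_compose_split[OF kM(1)]) (use that spP in auto)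
   have "NN ?Y (%y. k x y * ?S box y) <=
     (NN ?Y (%y. ?F * (?R x * k x y + (SUM i:I. ennreal ((y i - x i)^2) * k x y))))"
   proof (intro nn_integral_mono)
    fix y
    show "k x y * ?S box y <= ?F * (?R x * k x y + (SUM i:I. ennreal ((y i - x i)^2) * k x y))"
    proof (cases "y : space ?Y - box")
     case True
     then obtain i where i: "i : I" "abs (y i) > R" unfolding box_def by auto
     have "R^2 <= abs (y i)^2" using i R by (intro power_mono) auto
     also have "... <= 2 * ((x i)^2 + (y i - x i)^2)"
      using sum_squares_ge_zero[of "x i - (y i - x i)" 0] by (simp add: power2_eq_square algebra_simps)
     also have "... <= 2 * ?L x y" using i by (intro mult_left_mono add_mono member_le_sum) auto
     finally have "1 <= 2/R^2 * ?L x y" using R by (simp add: field_simps)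
     then have "1 <= ennreal (2/R^2 * ?L x y)" by simp
     also have "... = ?F * (?R x + (SUM i:I. ennreal ((y i - x i)^2)))"
      by (subst ennreal_mult') (auto simp: ennreal_plus[symmetric] sum_nonneg simp del: ennreal_plus)
     finally have "1 * k x y <= ?F * (?R x + (SUM i:I. ennreal ((y i - x i)^2))) * k x y" by (rule mult_right_mono) simp
     then show ?thesis using True by (simp add: indicator_def distrib_left distrib_right sum_distrib_right mult.assoc del: sum_ennreal)
    qed auto
   qed
   also have "... = ?F * (?R x + (SUM i:I. ?N))" by (simp add: nn_integral_cmult nn_integral_add nn_integral_sum k1 k2)
   finally show ?thesis by (simp add: ennreal_mult ennreal_of_nat_eq_real_of_nat)
  qed
  then have "?M k box <=
    (NN P (%x. ?F * (?R x + ?H)))" by (intro nn_integral_mono) (simp add: spP)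
  also have "... = ?F * ((NN P (%x. ?R x)) + ?H)"
   by (subst nn_integral_cmult, measurable, subst nn_integral_add) (auto simp: P.emeasure_space_1)
  also have "... <= ?F * (ennreal C2 + ?H)" by (intro mult_left_mono add_right_mono C2) auto
  also have "... = ?A" using C2(2) by (simp add: ennreal_plus[symmetric] ennreal_mult[symmetric] del: ennreal_plus)
  finally show ?thesis .
 qed
 let ?G = "ennreal ((2 * R) ^ card I * ?D + 2 * ?T / R^2)"
 have TV: "(?Q k)
   <= ?G"
 proof -
  have "?Q k <=
   (NN ?Y (%y. ennreal ?D * indicator box y + (NN P (%x. k x y * ?S box y))))"
  proof (intro nn_integral_mono)
   fix y assume y[measurable]: "y : space ?Y"
   show "(NN P (%x. k x y)) - (NN Q (%x. k x y)) <= ennreal ?D * indicator box y + (NN P (%x. k x y * ?S box y))"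
   proof (cases "y : box")
    case True
    have "(NN P (%x. k x y)) - (NN Q (%x. k x y)) = ennreal ((LINT x|P. ?P x y) - (LINT x|Q. ?P x y))"
     using int(2)[OF P sP, of y] int(2)[OF Q sQ, of y] y by (simp add: spP ennreal_minus)
    also have "... <= ennreal ?D" using smoothed_density_diff[OF P sP Q sQ cf, of y] by (intro ennreal_leI) linarith
    finally show ?thesis using True by simp
   next
    case False
    then show ?thesis using y by (simp add: diff_le_self_ennreal)
   qed
  qed
  also have "... = ennreal ?D * emeasure ?Y box + (NN ?Y (%y. NN P (%x. k x y * ?S box y)))"
   by (subst nn_integral_add) (auto simp: nn_integral_cmult)
  also have "NN ?Y (%y. NN P (%x. k x y * ?S box y)) = ?M k box" by (rule PY.Fubini') measurable
  also have "ennreal ?D * emeasure ?Y box + ... <= ennreal ?D * ennreal ((2*R) ^ card I) + ?A"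
   unfolding box_vol by (intro add_left_mono outside)
  also have "... = ?G" using D0 R C2(2) by (simp add: ennreal_mult[symmetric] ennreal_plus[symmetric] mult.commute del: ennreal_plus)
  finally show ?thesis .
 qed
 let ?J = "ennreal (8 * card I * rho^2 / r^2 + (2 * R) ^ card I * ?D + 2 * ?T / R^2)"
 show ?thesis
 proof (rule that[of h])
  show "case_prod h : borel_measurable (XI \<Otimes>\<^sub>M XI)" using h(1) by (simp cong: measurable_cong_sets)
  have "NN P (%x. NN Q (%g. h x g * indicator S (x, g))) = NN P (%x. NN Q (%g. h x g * indicator (S \<inter> space ?U) (x, g)))"
   by (intro nn_integral_cong) (auto simp: indicator_def space_pair_measure)
  also have "... <= (NN P (%x. NN ?Y (%y. k x y * indicator (S' \<inter> space ?X) (x, y)))) +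
     (NN Q (%g. NN ?Y (%y. k g y * indicator (S' \<inter> space ?Z) (g, y)))) + ?Q k"
  proof (rule h(4)[OF SS])
   fix x g y assume a: "(x, g) : S \<inter> space ?U" "y : space ?Y"
   then obtain i where i: "i : I" "abs (x i - g i) > r" unfolding S_def by auto
   then have "abs (y i - x i) > r/2 | abs (y i - g i) > r/2" by linarith
   then show "(x, y) : S' \<inter> space ?X | (g, y) : S' \<inter> space ?Z" using i a unfolding S'_def by (auto simp: space_pair_measure)
  qed
  also have "... <= (NN P (%x. ?W)) + (NN Q (%x. ?W))
    + ?G"
  proof (intro add_mono TV nn_integral_mono)
   fix x assume x: "x : space P"
   have "NN ?Y (%y. k x y * indicator (S' \<inter> space ?X) (x, y)) = NN ?Y (%y. k x y * indicator S' (x, y))"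
    using x by (intro nn_integral_cong) (auto simp: indicator_def space_pair_measure)
   also have "... <= ?W" using tail x spP by simp
   finally show "NN ?Y (%y. k x y * indicator (S' \<inter> space ?X) (x, y)) <= ..." .
  next
   fix x assume x: "x : space Q"
   have "NN ?Y (%y. k x y * indicator (S' \<inter> space ?Z) (x, y)) = NN ?Y (%y. k x y * indicator S' (x, y))"
    using x by (intro nn_integral_cong) (auto simp: indicator_def space_pair_measure)
   also have "... <= ?W" using tail x spP by simp
   finally show "NN ?Y (%y. k x y * indicator (S' \<inter> space ?Z) (x, y)) <= ..." .
  qed
  also have "... = ?J" using D0 R C2(2) by (simp add: P.emeasure_space_1 Q.emeasure_space_1 ennreal_plus[symmetric] del: ennreal_plus)
  finally show "(NN P (%x. NN Q (%g. h x g * indicator {(x, g). EX i:I. abs (x i - g i) > r} (x, g))))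
   <= ?J" unfolding S_def .
 qed (use h spP in auto)
qed

end

lemma (in prob_space) iexp_integrable[intro]:
 "X : borel_measurable M ==> integrable M (%x. iexp (X x))" by (rule integrable_const_bound[where B=1]) auto

text \<open>Equality of characteristic functions gives couplings under which the two vectors are arbitrarily close,
 and closed rectangles are decreasing limits of their neighbourhoods.\<close>

lemma char_eq_imp_closed_rectangle_le:
 fixes I :: "'i set" and A :: "'i => real set"
 assumes I: "finite I" and P: "prob_space P" and sP[measurable_cong]: "sets P = sets (PiM I (%_. borel))"
  and Q: "prob_space Q" and sQ[measurable_cong]: "sets Q = sets (PiM I (%_. borel))"
  and cf: "!!u. mchar P I u = mchar Q I u" and C: "NN P (%x. ennreal (SUM i:I. (x i)^2)) <= ennreal C" "0 <= C" and A: "!!i. closed (A i)"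
 shows "measure P {x:space P. ALL i:I. x i : A i} <= measure Q {x:space Q. ALL i:I. x i : A i}" (is "measure P ?A <= _")
\<comment> \<open>\<open>infdist\<close> to the empty set is 0, so neighbourhoods of an empty side
  would not shrink to it.\<close>
proof (cases "EX i:I. A i = {}")
 case True
 then have "?A = {}" by auto
 then show ?thesis by (simp only: measure_empty measure_nonneg)
next
 case False
 interpret P: prob_space P by fact
 interpret Q: prob_space Q by fact
 interpret PQ: pair_sigma_finite P Q ..
 have sp: "space P = space (PiM I (%_. borel))" "space Q = space (PiM I (%_. borel))"
  by (rule sets_eq_imp_space_eq[OF sP], rule sets_eq_imp_space_eq[OF sQ])
 have [measurable]: "A i : sets borel" for i using A by auto
 have [measurable]: "(%y. infdist y (A i)) : borel_measurable borel" for i by (intro borel_measurable_continuous_onI continuous_intros)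
 have Am[measurable]: "?A : sets P" using I by measurable
 define B where "B = (%r. {x:space Q. ALL i:I. infdist (x i) (A i) <= r})"
 have Bm[measurable]: "B r : sets Q" for r unfolding B_def using I by measurable
 have le: "measure P ?A <= measure Q (B r) + e" if r: "0 < r" and e: "0 < e" for r e
 proof -
  \<comment> \<open>Error of the smoothing coupling with Del = 0, rho = y and R = 1/y; for fixed r
    it tends to 0 with y.\<close>
  let ?b = "%y::real. 8 * real (card I) * y^2 / r^2 + 2 * (C + real (card I) * y^2) * y^2"
  have "(%n. ?b (inverse (real (Suc n)))) \<longlonglongrightarrow> ?b 0" by (intro tendsto_intros LIMSEQ_inverse_real_of_nat) (use r in simp)
  then have "\<forall>\<^sub>F n in sequentially. ?b (inverse (real (Suc n))) < e" by (rule order_tendstoD) (use e in simp)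
  then obtain n where n: "?b (inverse (real (Suc n))) < e" by (auto simp: eventually_sequentially)
  define y where "y = inverse (real (Suc n))"
  have y: "0 < y" "0 < inverse y" "?b y < e" using n unfolding y_def by simp_all
  let ?S = "{(x, g). EX i:I. abs (x i - g i) > r}"
  have cf': "norm (mchar P I u - mchar Q I u) <= 0 * (1 + (SUM i:I. abs (u i)^3))" for u using cf by simp
  obtain h where h: "case_prod h : borel_measurable (PiM I (%_. borel) \<Otimes>\<^sub>M PiM I (%_. borel))"
    "!!x. x : space (PiM I (%_. borel)) ==> NN Q (h x) = 1" "!!g. g : space (PiM I (%_. borel)) ==> NN P (%x. h x g) = 1"
   and S: "NN P (%x. NN Q (%g. h x g * indicator ?S (x, g))) <= ennreal (8 * card I * y^2 / r^2 + (2 * inverse y) ^ card I * ((1 / (sqrt (2*pi) * y)) ^ card I * (0 * (1 + 2 * card I / y^3))) + 2 * (C + card I * y^2) / (inverse y)^2)"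
   by (rule gaussian_smoothing_coupling[OF I y(1) P sP Q sQ cf' C y(2) r]) blast
  note S
  also have "ennreal (8 * card I * y^2 / r^2 + (2 * inverse y) ^ card I * ((1 / (sqrt (2*pi) * y)) ^ card I * (0 * (1 + 2 * card I / y^3))) + 2 * (C + card I * y^2) / (inverse y)^2) <= ennreal e"
   using y(3) by (intro ennreal_leI) (simp add: power_inverse divide_inverse)
  finally have hS: "NN P (%x. NN Q (%g. h x g * indicator ?S (x, g))) <= ennreal e" .
  have [measurable]: "case_prod h : borel_measurable (P \<Otimes>\<^sub>M Q)" using h(1) by (simp cong: measurable_cong_sets)
  have h1: "x : space P ==> NN Q (h x) = 1" "x : space Q ==> NN P (%y. h y x) = 1" for x using h(2,3) unfolding sp by auto
  have Sm: "(%z. indicator ?S z :: ennreal) : borel_measurable (P \<Otimes>\<^sub>M Q)"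
  proof -
   have "(%z. indicator ?S z :: ennreal) = (%z. if EX i:I. abs (fst z i - snd z i) > r then 1 else 0)" by (auto simp: indicator_def fun_eq_iff)
   then show ?thesis using I by (simp only:) measurable
  qed
  have "emeasure P ?A = NN P (%x. NN Q (%g. h x g * indicator ?A x))"
   by (subst nn_integral_indicator[OF Am, symmetric], intro nn_integral_cong, subst nn_integral_multc) (auto simp: h1)
  also have "... <= NN P (%x. NN Q (%g. h x g * indicator (B r) g + h x g * indicator ?S (x, g)))"
  proof (intro nn_integral_mono)
   fix x g assume g: "g : space Q"
   have "g : B r" if x: "x : ?A" "(x, g) ~: ?S" unfolding B_def
   proof (intro CollectI conjI ballI g)
    fix i assume i: "i : I"
    have "infdist (g i) (A i) <= dist (g i) (x i)" by (rule infdist_le) (use x(1) i in blast)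
    also have "... <= r" using x(2) i by (auto simp: dist_real_def abs_minus_commute not_less)
    finally show "infdist (g i) (A i) <= r" .
   qed
   then show "h x g * indicator ?A x <= h x g * indicator (B r) g + h x g * indicator ?S (x, g)"
    by (cases "x : ?A"; cases "(x, g) : ?S") (simp_all add: indicator_def del: mem_Collect_eq)
  qed
  also have "... = NN P (%x. NN Q (%g. h x g * indicator (B r) g)) + NN P (%x. NN Q (%g. h x g * indicator ?S (x, g)))"
   by (rule nn_integral_iterated_add[OF Q.sigma_finite_measure_axioms]) (use Sm in measurable)
  also have "NN P (%x. NN Q (%g. h x g * indicator (B r) g)) = NN Q (%g. NN P (%x. h x g) * indicator (B r) g)"
   by (subst PQ.Fubini'[symmetric]) (auto intro!: nn_integral_cong nn_integral_multc)
  also have "... = NN Q (indicator (B r))" by (intro nn_integral_cong) (simp add: h1)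
  also have "... = emeasure Q (B r)" by (rule nn_integral_indicator[OF Bm])
  also have "emeasure Q (B r) + NN P (%x. NN Q (%g. h x g * indicator ?S (x, g))) <= emeasure Q (B r) + ennreal e"
   by (rule add_left_mono[OF hS])
  finally have "ennreal (measure P ?A) <= ennreal (measure Q (B r)) + ennreal e" by (simp only: P.emeasure_eq_measure Q.emeasure_eq_measure)
  also have "... = ennreal (measure Q (B r) + e)" by (rule ennreal_plus[symmetric]) (use e in auto)
  finally show ?thesis using e by (subst (asm) ennreal_le_iff) auto
 qed
 have "measure P ?A <= measure Q (B (inverse (real (Suc n))))" for n by (rule field_le_epsilon, rule le) simp_all
 moreover have "(%n. measure Q (B (inverse (real (Suc n))))) \<longlonglongrightarrow> measure Q (\<Inter>n. B (inverse (real (Suc n))))"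
 proof (rule Q.finite_Lim_measure_decseq)
  show "decseq (%n. B (inverse (real (Suc n))))"
  proof (rule decseq_SucI)
   fix n
   have "inverse (real (Suc (Suc n))) <= inverse (real (Suc n))" by (intro le_imp_inverse_le) auto
   then show "B (inverse (real (Suc (Suc n)))) <= B (inverse (real (Suc n)))" unfolding B_def by (auto intro: order_trans)
  qed
 qed auto
 ultimately have "measure P ?A <= measure Q (\<Inter>n. B (inverse (real (Suc n))))" by (intro LIMSEQ_le_const) auto
 also have "(\<Inter>n. B (inverse (real (Suc n)))) = {x:space Q. ALL i:I. x i : A i}"
 proof -
  have "(y : A i) = (ALL n. infdist y (A i) <= inverse (real (Suc n)))" if i: "i : I" for y i
  proof
   assume "ALL n. infdist y (A i) <= inverse (real (Suc n))"
   then have "infdist y (A i) <= 0" by (intro LIMSEQ_le_const[OF LIMSEQ_inverse_real_of_nat]) auto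
   then show "y : A i" using in_closed_iff_infdist_zero[OF A, of i y] False i infdist_nonneg[of y "A i"] by auto
  qed simp
  then show ?thesis unfolding B_def by auto
 qed
 finally show ?thesis .
qed

lemma distr_sum_squares_le:
 fixes N :: "'a measure" and Z :: "'i => 'a => real"
 assumes m: "(%x. \<lambda>j\<in>J. Z j x) : measurable N (PiM J (%_. borel))" and int: "!!j. j : J ==> integrable N (%x. (Z j x)^2)"
 shows "NN (distr N (PiM J (%_. borel)) (%x. \<lambda>j\<in>J. Z j x)) (%y. ennreal (SUM j:J. (y j)^2)) <= ennreal (LINT x|N. (SUM j:J. (Z j x)^2))"
proof -
 have r: "(SUM j:J. ((\<lambda>j\<in>J. Z j) j)^2) = (SUM j:J. (Z j)^2)" for Z :: "'i => real" by (intro sum.cong) auto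
 have sq: "(%y. ennreal (SUM j:J. (y j)^2)) : borel_measurable (PiM J (%_. borel :: real measure))" by measurable
 have "NN (distr N (PiM J (%_. borel)) (%x. \<lambda>j\<in>J. Z j x)) (%y. ennreal (SUM j:J. (y j)^2)) = NN N (%x. ennreal (SUM j:J. (Z j x)^2))"
  by (subst nn_integral_distr[OF m]) (use sq in \<open>simp_all only: r measurable_distr_eq1\<close>)
 also have "... = ennreal (LINT x|N. (SUM j:J. (Z j x)^2))"
  by (rule nn_integral_eq_integral) (use int in \<open>auto intro!: sum_nonneg\<close>)
 finally show ?thesis by simp
qed

text \<open>Uniqueness of the law of a random vector with second moments, in the form in which
  independence is tested below: closed rectangles are stable under intersection and generate the
  product sigma-algebra.\<close>

lemma joint_char_eq_imp_closed_rectangle_eq: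
 fixes M :: "'a measure" and M' :: "'b measure" and X :: "'i => 'a => real" and X' :: "'i => 'b => real"
 assumes M: "prob_space M" and M': "prob_space M'" and J: "finite J"
  and X: "!!j. j : J ==> X j : borel_measurable M" "!!j. j : J ==> integrable M (%x. (X j x)^2)"
  and X': "!!j. j : J ==> X' j : borel_measurable M'" "!!j. j : J ==> integrable M' (%x. (X' j x)^2)"
  and eq: "!!u. (CLINT x|M. iexp (SUM j:J. u j * X j x)) = (CLINT x|M'. iexp (SUM j:J. u j * X' j x))" and A: "!!j. closed (A j)"
 shows "measure M {x:space M. ALL j:J. X j x : A j} = measure M' {x:space M'. ALL j:J. X' j x : A j}"
proof -
 let ?B = "PiM J (%_. borel :: real measure)"
 have mX: "(%x. \<lambda>j\<in>J. X j x) : measurable M ?B" and mX': "(%x. \<lambda>j\<in>J. X' j x) : measurable M' ?B"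
  using X X' by (auto intro!: measurable_restrict)
 define P where "P = distr M ?B (%x. \<lambda>j\<in>J. X j x)"
 define Q where "Q = distr M' ?B (%x. \<lambda>j\<in>J. X' j x)"
 have PQ: "prob_space P" "prob_space Q" "sets P = sets ?B" "sets Q = sets ?B"
  unfolding P_def Q_def by (auto intro!: prob_space.prob_space_distr M M' mX mX')
 have iexp_meas: "(%y. iexp (SUM j:J. u j * y j)) : borel_measurable ?B" for u by measurable
 have cf: "mchar P J u = mchar Q J u" for u
  unfolding mchar_def P_def Q_def integral_distr[OF mX iexp_meas] integral_distr[OF mX' iexp_meas] using eq[of u] by (simp cong: sum.cong)
 have Pe: "measure M {x:space M. ALL j:J. X j x : A j} = measure P {x:space P. ALL j:J. x j : A j}"
  and Qe: "measure M' {x:space M'. ALL j:J. X' j x : A j} = measure Q {x:space Q. ALL j:J. x j : A j}"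
 proof -
  have [measurable]: "A j : sets borel" for j using A by auto
  have s: "{x:space ?B. ALL j:J. x j : A j} : sets ?B" using J by measurable
  show "measure M {x:space M. ALL j:J. X j x : A j} = measure P {x:space P. ALL j:J. x j : A j}"
   unfolding P_def space_distr measure_distr[OF mX s] by (rule arg_cong[of _ _ "measure M"]) (use measurable_space[OF mX] in auto)
  show "measure M' {x:space M'. ALL j:J. X' j x : A j} = measure Q {x:space Q. ALL j:J. x j : A j}"
   unfolding Q_def space_distr measure_distr[OF mX' s] by (rule arg_cong[of _ _ "measure M'"]) (use measurable_space[OF mX'] in auto)
 qed
 show ?thesis unfolding Pe Qe
  by (intro antisym char_eq_imp_closed_rectangle_le[OF J PQ(1,3,2,4) cf distr_sum_squares_le[OF mX X(2), folded P_def] _ A] char_eq_imp_closed_rectangle_le[OF J PQ(2,4,1,3) cf[symmetric] distr_sum_squares_le[OF mX' X'(2), folded Q_def] _ A] Bochner_Integration.integral_nonneg sum_nonneg) auto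
qed

section \<open>Gaussian processes\<close>

definition tent :: "real => real" where "tent t = min t (1 - t)"

lemma tent_bounds: "0 <= t ==> t <= 1 ==> 0 <= tent t & tent t <= 1" unfolding tent_def by auto

text \<open>Covariance of the Brownian bridge, and its self-similar decomposition over the two halves of the
 unit interval; iterating it gives the covariance of the Levy--Ciesielski series.\<close>

definition bridge_cov :: "real => real => real" where "bridge_cov s t = min s t - s * t"

lemma bridge_cov_halves:
 assumes s: "0 <= s" "s < 1" and t: "0 <= t" "t < 1"
 shows "bridge_cov s t = tent s * tent t +
   (if (floor (2 * s)) = (floor (2 * t)) then bridge_cov (frac (2 * s)) (frac (2 * t)) / 2 else 0)"
proof -
 have fl: "(floor (2 * x)) = (if x < 1/2 then 0 else 1)" if "0 <= x" "x < 1" for x :: real using that by (auto simp: floor_eq_iff)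
 have fr: "frac (2 * x) = (if x < 1/2 then 2 * x else 2 * x - 1)" if "0 <= x" "x < 1" for x :: real unfolding frac_def fl[OF that] by auto
 show ?thesis unfolding fl[OF s] fl[OF t] fr[OF s] fr[OF t] bridge_cov_def tent_def
  by (cases "s < 1/2"; cases "t < 1/2"; cases "s <= t") (auto simp: min_def field_simps)
qed

text \<open>What is left of the bridge covariance after k halvings: independent bridges on the
  dyadic intervals of length 2^-k, rescaled by self-similarity.\<close>

definition bridge_level :: "nat => real => real => real" where
 "bridge_level k s t = (if (floor (2^k * s)) = (floor (2^k * t)) then bridge_cov (frac (2^k * s)) (frac (2^k * t)) / 2^k else 0)"

lemma floor_double: "(floor (2 * (z::real))) = 2 * (floor z) + (floor (2 * frac z))" "frac (2 * z) = frac (2 * frac z)"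
proof -
 have "2 * z = of_int (2 * (floor z)) + 2 * frac z" by (simp add: frac_def)
 then show 1: "(floor (2 * z)) = 2 * (floor z) + (floor (2 * frac z))" by (metis floor_add_int add.commute)
 show "frac (2 * z) = frac (2 * frac z)" unfolding frac_def[of "2 * z"] frac_def[of "2 * frac z"] 1 by (simp add: frac_def)
qed

lemma floor_2frac: "(floor (2 * frac (z::real))) : {0, 1}" using frac_lt_1[of z] frac_ge_0[of z] by (auto simp: floor_eq_iff)

lemma bridge_level_step:
 "bridge_level k s t = (if (floor (2^k * s)) = (floor (2^k * t)) then tent (frac (2^k * s)) * tent (frac (2^k * t)) / 2^k else 0)
   + bridge_level (Suc k) s t"
proof -
 let ?x = "2^k * s" and ?y = "2^k * t"
 have e: "((floor (2^Suc k * s)) = (floor (2^Suc k * t))) = ((floor (?x)) = (floor (?y)) & (floor (2 * frac ?x)) = (floor (2 * frac ?y)))"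
 proof -
  have "2^Suc k * s = 2 * ?x" "2^Suc k * t = 2 * ?y" by simp_all
  then have a: "(floor (2^Suc k * s)) = 2 * (floor (?x)) + (floor (2 * frac ?x))" "(floor (2^Suc k * t)) = 2 * (floor (?y)) + (floor (2 * frac ?y))"
   using floor_double(1) by metis+
  show ?thesis unfolding a using floor_2frac[of ?x] floor_2frac[of ?y] by (simp only: insert_iff empty_iff) presburger
 qed
 have f: "frac (2^Suc k * s) = frac (2 * frac ?x)" "frac (2^Suc k * t) = frac (2 * frac ?y)"
  using floor_double(2)[of ?x] floor_double(2)[of ?y] by (simp_all add: mult.assoc)
 show ?thesis using bridge_cov_halves[of "frac ?x" "frac ?y"] frac_lt_1[of ?x] frac_lt_1[of ?y]
  unfolding bridge_level_def e f by (auto simp: frac_ge_0 add_divide_distrib)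
qed

text \<open>All Schauder functions of level k in one: at t only that of the dyadic interval
  containing t can be nonzero, and \<open>frac\<close> moves this interval to [0, 1).\<close>

definition schauder :: "nat => real => real" where
 "schauder k t = tent (frac (2^k * t)) / sqrt (2^k)"

lemma schauder_bounds: "0 <= schauder k t" "schauder k t <= 1 / sqrt (2^k)"
 using tent_bounds[of "frac (2^k * t)"] frac_lt_1[of "2^k * t"] frac_ge_0[of "2^k * t"]
 unfolding schauder_def by (auto simp: divide_right_mono)

text \<open>Covariance of the Levy--Ciesielski series cut after m levels. The term s * t comes from
  the linear part; two times share the coefficient of level k only if they lie in the same dyadic
  interval.\<close>

definition wcov :: "nat => real => real => real" where
 "wcov m s t = s * t + (\<Sum>k<m. if (floor (2^k * s)) = (floor (2^k * t)) then schauder k s * schauder k t else 0)"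

lemma wcov_eq:
 assumes "s : {0..1}" "t : {0..1}"
 shows "wcov m s t = min s t - bridge_level m s t"
proof (induction m)
 case 0
 have "bridge_level 0 s t = bridge_cov s t"
 proof (cases "s < 1 & t < 1")
  case True
  then have "(floor s) = 0" "(floor t) = 0" "frac s = s" "frac t = t" using assms by (auto simp: frac_eq floor_eq_iff)
  then show ?thesis by (simp add: bridge_level_def)
 next
  \<comment> \<open>At 1 the floor jumps to 1 and \<open>frac\<close> to 0; the bridge covariance
    vanishes there, so the formula survives the endpoint.\<close>
  case False
  then have "s = 1 | t = 1" using assms by auto
  then have 0: "bridge_cov s t = 0" using assms by (auto simp: bridge_cov_def min_def)
  show ?thesis
  proof (cases "(floor s) = (floor t)")
   case True
   then have "s = 1 & t = 1" using \<open>s = 1 \<or> t = 1\<close> assms by (auto simp: floor_eq_iff)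
   then show ?thesis using 0 by (simp add: bridge_level_def bridge_cov_def)
  qed (simp add: bridge_level_def 0)
 qed
 then show ?case by (simp add: wcov_def bridge_cov_def)
next
 case (Suc m)
 have "wcov (Suc m) s t = wcov m s t + (if (floor (2^m * s)) = (floor (2^m * t)) then schauder m s * schauder m t else 0)"
  unfolding wcov_def by simp
 then show ?case using Suc bridge_level_step[of m s t] by (simp add: schauder_def)
qed

lemma wcov_tendsto:
 assumes "s : {0..1}" "t : {0..1}"
 shows "(%m. wcov m s t) \<longlonglongrightarrow> min s t"
proof -
 have "abs (bridge_cov (frac x) (frac y)) <= 2" for x y
 proof -
  have "abs (min (frac x) (frac y)) <= 1" "abs (frac x * frac y) <= 1" using frac_lt_1[of x] frac_lt_1[of y] frac_ge_0[of x] frac_ge_0[of y]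
   by (auto simp: abs_mult intro!: mult_le_one)
  then show ?thesis unfolding bridge_cov_def by linarith
 qed
 then have le: "abs (bridge_level m s t) <= 2 * (1/2)^m" for m unfolding bridge_level_def by (auto simp: power_divide divide_right_mono)
 have "(%m. 2 * (1/2)^m :: real) \<longlonglongrightarrow> 2 * 0" by (intro tendsto_mult tendsto_const LIMSEQ_power_zero) simp
 then have "(%m. bridge_level m s t) \<longlonglongrightarrow> 0"
  using le by (rule_tac Lim_null_comparison[OF always_eventually, of _ "%m. 2 * (1/2)^m"]) simp_all
 from tendsto_diff[OF tendsto_const[of "min s t"] this]
 show ?thesis unfolding wcov_eq[OF assms] by simp
qed

text \<open>Index (l, k, j): component l, level k of the Schauder expansion (level 0 is the linear part), dyadic interval j.\<close>

type_synonym widx = "nat \<times> nat \<times> nat"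

abbreviation Xi :: "(widx => real) measure" where
 "Xi == PiM UNIV (%_. std_normal_distribution)"

interpretation Xi: product_prob_space "%_::widx. std_normal_distribution" UNIV
 by (intro product_prob_spaceI) (auto intro: real_distribution.axioms(1)[OF real_dist_normal_dist])

lemma sets_Xi[measurable_cong]: "sets Xi = sets (PiM UNIV (%_. borel))" by (intro sets_PiM_cong) auto

lemma Xi_char_finite:
 assumes S: "finite S"
 shows "(CLINT xi|Xi. iexp (SUM s:S. c s * xi s)) = exp (- (SUM s:S. (c s)^2) / 2)"
proof -
 let ?NS = "PiM S (%_. std_normal_distribution)"
 have [measurable_cong]: "sets ?NS = sets (PiM S (%_. borel))" by (intro sets_PiM_cong) auto
 let ?X = "distr Xi ?NS (%xi. restrict xi S)"
 let ?Y = "%xi. iexp (SUM s:S. c s * xi s)"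
 have "(CLINT xi|Xi. ?Y xi) = (CLINT xi|Xi. iexp (SUM s:S. c s * restrict xi S s))" by (intro Bochner_Integration.integral_cong refl) simp
 also have "... = (CLINT xi|?X. ?Y xi)"
  by (rule integral_distr[symmetric]) (rule measurable_restrict_subset, simp, simp only: of_real_sum of_real_mult, measurable)
 also have "?X = ?NS" by (rule Xi.distr_PiM_restrict_finite) (use S in auto)
 also have "(CLINT xi|?NS. ?Y xi) = (CLINT xi|?NS. (PROD s:S. iexp (c s * xi s)))"
  using S by (intro Bochner_Integration.integral_cong refl) (simp add: exp_sum[symmetric] sum_distrib_left)
 also have "... = (PROD s:S. CLINT x|std_normal_distribution. iexp (c s * x))" by (rule Xi.product_integral_prod[OF S])
    (auto intro!: finite_measure.integrable_const_bound[OF prob_space.finite_measure[OF prob_space_normal_density], where B=1])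
 also have "... = (PROD s:S. complex_of_real (exp (- ((c s)^2) / 2)))" using char_std_normal_distribution by (simp add: char_def fun_eq_iff)
 also have "... = exp (- (SUM s:S. (c s)^2) / 2)" using S by (simp flip: of_real_prod add: exp_sum[symmetric] sum_negf sum_divide_distrib)
 finally show ?thesis .
qed

definition wiener_partial :: "nat => nat => real => (widx => real) => real" where
 "wiener_partial m l t xi = t * xi (l, 0, 0) + (\<Sum>k<m. schauder k t * xi (l, Suc k, nat (floor (2^k * t))))"

definition wiener :: "nat => real => (widx => real) => real" where
 "wiener l t xi = t * xi (l, 0, 0) + (\<Sum>k. schauder k t * xi (l, Suc k, nat (floor (2^k * t))))"

text \<open>Coefficient of \<open>xi (l, k, j)\<close> in the series at time t. Spreading it over
  all j permits one finite index set for several times at once.\<close>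

definition wcoef :: "real => nat => nat => real" where
 "wcoef t k j = (case k of 0 => if j = 0 then t else 0 | Suc k' => if j = nat (floor (2^k' * t)) then schauder k' t else 0)"

lemma wiener_measurable[measurable]: "wiener l t : borel_measurable Xi" "wiener_partial m l t : borel_measurable Xi"
 unfolding wiener_def wiener_partial_def by measurable

lemma nat_floor_le: "(t::real) : {0..1} ==> k < m ==> nat (floor (2^k * t)) <= (2::nat)^m"
proof -
 assume t: "(t::real) : {0..1}" and k: "k < m"
 have "2^k * t <= 2^m * (1::real)" using t k by (intro mult_mono power_increasing) auto
 then have "(floor (2^k * t)) <= 2^m" by (simp add: floor_le_iff)
 then show ?thesis by (simp add: nat_le_iff)
qed

lemma wiener_partial_eq:
 assumes t: "t : {0..1}"
 shows "wiener_partial m l t xi = (SUM k<=m. SUM j<=2^m. wcoef t k j * xi (l, k, j))"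
proof -
 let ?X = "\<Sum>k<m. SUM j<=2^m. wcoef t (Suc k) j * xi (l, Suc k, j)"
 let ?Y = "SUM j<=2^m. wcoef t 0 j * xi (l, 0, j)"
 have "(SUM k<=m. SUM j<=2^m. wcoef t k j * xi (l, k, j)) =
   ?Y + ?X" by (simp add: lessThan_Suc_atMost[symmetric] sum.lessThan_Suc_shift del: sum.lessThan_Suc)
 also have "?Y = t * xi (l, 0, 0)" unfolding wcoef_def by (simp add: if_distrib[of "%x. x * _"] sum.delta cong: if_cong)
 also have "?X = (\<Sum>k<m. schauder k t * xi (l, Suc k, nat (floor (2^k * t))))" unfolding wcoef_def using nat_floor_le[OF t, of _ m]
  by (intro sum.cong refl) (simp add: if_distrib[of "%x. x * _"] sum.delta' cong: if_cong)
 finally show ?thesis unfolding wiener_partial_def ..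
qed

lemma wcoef_cov:
 assumes s: "s : {0..1}" and t: "t : {0..1}"
 shows "(SUM k<=m. SUM j<=2^m. wcoef s k j * wcoef t k j) = wcov m s t"
proof -
 have "(SUM k<=m. SUM j<=2^m. wcoef s k j * wcoef t k j) =
   (SUM j<=2^m. wcoef s 0 j * wcoef t 0 j) + (\<Sum>k<m. SUM j<=2^m. wcoef s (Suc k) j * wcoef t (Suc k) j)"
  by (simp add: lessThan_Suc_atMost[symmetric] sum.lessThan_Suc_shift del: sum.lessThan_Suc)
 also have "(SUM j<=2^m. wcoef s 0 j * wcoef t 0 j) = s * t"
  unfolding wcoef_def by (simp add: if_distrib[of "%x. x * _"] sum.delta cong: if_cong)
 also have "(\<Sum>k<m. SUM j<=2^m. wcoef s (Suc k) j * wcoef t (Suc k) j) =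
   (\<Sum>k<m. if (floor (2^k * s)) = (floor (2^k * t)) then schauder k s * schauder k t else 0)"
 proof (intro sum.cong refl)
  fix k assume k: "k : {..<m}"
  have "(SUM j<=2^m. wcoef s (Suc k) j * wcoef t (Suc k) j) =
    (SUM j<=2^m. if j = nat (floor (2^k * s)) then (if nat (floor (2^k * s)) = nat (floor (2^k * t)) then schauder k s * schauder k t else 0) else 0)"
   unfolding wcoef_def by (intro sum.cong refl) auto
  also have "... = (if nat (floor (2^k * s)) = nat (floor (2^k * t)) then schauder k s * schauder k t else 0)"
   using nat_floor_le[OF s, of k m] k by (simp add: sum.delta')
  also have "(nat (floor (2^k * s)) = nat (floor (2^k * t))) = ((floor (2^k * s)) = (floor (2^k * t)))"
   using s t by (intro eq_nat_nat_iff) auto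
  finally show "(SUM j<=2^m. wcoef s (Suc k) j * wcoef t (Suc k) j) =
   (if (floor (2^k * s)) = (floor (2^k * t)) then schauder k s * schauder k t else 0)" .
 qed
 finally show ?thesis unfolding wcov_def .
qed

lemma Xi_abs_moment: "NN Xi (%xi. ennreal (abs (xi s))) <= 1"
proof -
 have "NN Xi (%xi. ennreal (abs (xi s))) = NN (distr Xi std_normal_distribution (%xi. xi s)) (%x. ennreal (abs x))"
  by (subst nn_integral_distr) auto
 also have "... = NN std_normal_distribution (%x. ennreal (abs x))" by (subst Xi.PiM_component) auto
 also have "... = ennreal (LINT x|std_normal_distribution. abs x)"
  using integrable_std_normal_distribution_moment[of 1] by (intro nn_integral_eq_integral) auto
 also have "(LINT x|std_normal_distribution. abs x) = sqrt (2/pi)" using std_normal_distribution_odd_moments_abs[of 0] by simp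
 also have "ennreal (sqrt (2/pi)) <= 1" using pi_ge_two by (simp add: ennreal_le_1)
 finally show ?thesis .
qed

text \<open>At a fixed time each level contributes a single normal variable, so the expected
  absolute sum is at most the sum of 2^(-k/2).\<close>

lemma wiener_partial_tendsto:
 "AE xi in Xi. (%m. wiener_partial m l t xi) \<longlonglongrightarrow> wiener l t xi"
proof -
 let ?g = "%k xi. schauder k t * xi (l, Suc k, nat (floor (2^k * t)))"
 have sm: "summable (%k. 1 / sqrt (2^k) :: real)"
 proof -
  have "summable (%k. (1 / sqrt 2)^k :: real)" by (intro summable_geometric) simp
  then show ?thesis by (simp add: real_sqrt_power power_divide)
 qed
 have "NN Xi (%xi. (\<Sum>k. ennreal (abs (?g k xi)))) = (\<Sum>k. NN Xi (%xi. ennreal (abs (?g k xi))))"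
  by (rule nn_integral_suminf) measurable
 also have "... <= (\<Sum>k. ennreal (1 / sqrt (2^k)))"
 proof (intro suminf_le summableI)
  fix k
  have "NN Xi (%xi. ennreal (abs (?g k xi))) = ennreal (schauder k t) * (NN Xi (%xi. ennreal (abs (xi (l, Suc k, nat (floor (2^k * t)))))))"
   using schauder_bounds(1)[of k t] by (simp add: abs_mult ennreal_mult nn_integral_cmult)
  also have "... <= ennreal (1 / sqrt (2^k)) * 1" by (intro mult_mono ennreal_leI schauder_bounds Xi_abs_moment) auto
  finally show "NN Xi (%xi. ennreal (abs (?g k xi))) <= ennreal (1 / sqrt (2^k))" by simp
 qed
 also have "... < \<top>" using sm by (subst suminf_ennreal2) auto
 finally have "(NN Xi (%xi. (\<Sum>k. ennreal (abs (?g k xi))))) ~= \<infinity>" by auto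
 then have "AE xi in Xi. (\<Sum>k. ennreal (abs (?g k xi))) ~= \<infinity>" by (intro nn_integral_PInf_AE) auto
 then show ?thesis
 proof eventually_elim
  case (elim xi)
  then have "summable (%k. abs (?g k xi))" by (intro summable_suminf_not_top) (simp_all only: abs_ge_zero infinity_ennreal_def, simp)
  then have "summable (%k. ?g k xi)" by (rule summable_rabs_cancel)
  then have "(%m. \<Sum>k<m. ?g k xi) \<longlonglongrightarrow> (\<Sum>k. ?g k xi)" by (rule summable_LIMSEQ)
  then show ?case unfolding wiener_partial_def wiener_def by (intro tendsto_intros)
 qed
qed

text \<open>Independent Wiener processes mixed by a factor A of the covariance: if V = A A', this is
  the Brownian motion with covariance V.\<close>

definition gbm :: "nat set => (nat => nat => real) => nat => real => (widx => real) => real" where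
 "gbm I A i t xi = (SUM l:I. A i l * wiener l t xi)"

lemma gbm_measurable[measurable]: "gbm I A i t : borel_measurable Xi" unfolding gbm_def by measurable

text \<open>The cut series is a finite linear form in independent normal coordinates, and its
  squared coefficients add up to a quadratic form in \<open>wcov\<close>. The cut is then removed by
  dominated convergence and \<open>wcov_tendsto\<close>.\<close>

lemma gbm_char:
 fixes I :: "nat set" and A V :: "nat => nat => real" and ii :: "'j => nat"
 assumes I: "finite I" and V: "!!i j. i : I ==> j : I ==> V i j = (SUM l:I. A i l * A j l)"
  and J: "finite J" and ii: "!!j. j : J ==> ii j : I" and tt: "!!j. j : J ==> tt j : {0..1}"
 shows "(CLINT xi|Xi. iexp (SUM j:J. a j * gbm I A (ii j) (tt j) xi)) =
   exp (- (SUM j:J. SUM j':J. a j * a j' * (V (ii j) (ii j') * min (tt j) (tt j'))) / 2)"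
proof -
 define P where "P = (%m xi. SUM j:J. a j * (SUM l:I. A (ii j) l * wiener_partial m l (tt j) xi))"
 have [measurable]: "P m : borel_measurable Xi" for m unfolding P_def by measurable
 define S where "S = (%m::nat. I \<times> {..m} \<times> {..(2::nat)^m})"
 have S: "finite (S m)" for m unfolding S_def using I by auto
 define c where "c = (%(l, k, n). SUM j:J. a j * A (ii j) l * wcoef (tt j) k n)"
 let ?X = "%j s. wcoef (tt j) (fst (snd s)) (snd (snd s))"
 let ?Z = "%j s. A (ii j) (fst s)"
 have P_eq: "P m xi = (SUM s:S m. c s * xi s)" for m xi
 proof -
  have "P m xi = (SUM j:J. SUM l:I. SUM k<=m. SUM n<=2^m. a j * A (ii j) l * wcoef (tt j) k n * xi (l, k, n))"
   unfolding P_def using tt by (intro sum.cong refl) (simp add: wiener_partial_eq sum_distrib_left mult_ac)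
  also have "... = (SUM j:J. SUM s:S m. a j * ?Z j s * ?X j s * xi s)" unfolding S_def by (simp add: sum.cartesian_product split_beta)
  also have "... = (SUM s:S m. c s * xi s)" by (subst sum.swap) (simp add: c_def split_beta sum_distrib_right)
  finally show ?thesis .
 qed
 define q where "q = (%m. SUM j:J. SUM j':J. a j * a j' * (V (ii j) (ii j') * wcov m (tt j) (tt j')))"
 have c_sq: "(SUM s:S m. (c s)^2) = q m" for m
 proof -
  have "(SUM s:S m. (c s)^2) = (SUM s:S m. SUM j:J. SUM j':J. a j * a j' * (?Z j s * ?Z j' s *
    (?X j s * ?X j' s)))" unfolding c_def power2_eq_square by (simp add: split_beta sum_product mult_ac)
  also have "... = (SUM j:J. SUM j':J. SUM s:S m. a j * a j' * (?Z j s * ?Z j' s *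
    (?X j s * ?X j' s)))" by (subst sum.swap, intro sum.cong refl, subst sum.swap, rule refl)
  also have "... = q m" unfolding q_def
  proof (intro sum.cong refl)
   fix j j' assume jj: "j : J" "j' : J"
   have "(SUM s:S m. a j * a j' * (?Z j s * ?Z j' s *
    (?X j s * ?X j' s))) =
    (SUM l:I. SUM k<=m. SUM n<=2^m. a j * a j' * (A (ii j) l * A (ii j') l * (wcoef (tt j) k n * wcoef (tt j') k n)))"
    unfolding S_def by (simp add: sum.cartesian_product split_beta)
   also have "... = (SUM l:I. a j * a j' * (A (ii j) l * A (ii j') l * (SUM k<=m. SUM n<=2^m. wcoef (tt j) k n * wcoef (tt j') k n)))"
    by (simp only: sum_distrib_left)
   also have "... = a j * a j' * ((SUM l:I. A (ii j) l * A (ii j') l) * wcov m (tt j) (tt j'))"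
    using jj tt by (simp add: wcoef_cov) (simp add: sum_distrib_left sum_distrib_right mult_ac)
   also have "... = a j * a j' * (V (ii j) (ii j') * wcov m (tt j) (tt j'))" using jj ii by (simp add: V)
   finally show "(SUM s:S m. a j * a j' * (?Z j s * ?Z j' s *
    (?X j s * ?X j' s))) =
    a j * a j' * (V (ii j) (ii j') * wcov m (tt j) (tt j'))" .
  qed
  finally show ?thesis .
 qed
 have Pc: "(CLINT xi|Xi. iexp (P m xi)) = exp (- q m / 2)" for m using Xi_char_finite[OF S, of c m] unfolding P_eq c_sq .
 have lim1: "(%m. CLINT xi|Xi. iexp (P m xi)) \<longlonglongrightarrow> (CLINT xi|Xi. iexp (SUM j:J. a j * gbm I A (ii j) (tt j) xi))"
 proof (rule integral_dominated_convergence[where w="%_. 1"])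
  have "AE xi in Xi. ALL l:I. ALL j:J. (%m. wiener_partial m l (tt j) xi) \<longlonglongrightarrow> wiener l (tt j) xi"
   using I J by (intro AE_finite_allI wiener_partial_tendsto) auto
  then show "AE xi in Xi. (%m. iexp (P m xi)) \<longlonglongrightarrow> iexp (SUM j:J. a j * gbm I A (ii j) (tt j) xi)"
  proof eventually_elim
   case (elim xi)
   then show ?case unfolding P_def gbm_def by (intro tendsto_intros) auto
  qed
 qed auto
 let ?Y = "SUM j:J. SUM j':J. a j * a j' * (V (ii j) (ii j') * min (tt j) (tt j'))"
 have "q \<longlonglongrightarrow> ?Y" unfolding q_def using tt by (intro tendsto_intros wcov_tendsto) auto
 then have "(%m. complex_of_real (exp (- q m / 2))) \<longlonglongrightarrow> exp (- ?Y / 2)" by (intro tendsto_intros) auto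
 with lim1 show ?thesis unfolding Pc by (rule LIMSEQ_unique)
qed

lemma psd_factorization:
 fixes V :: "'i => 'i => real"
 assumes "finite I" and "!!i j. i : I ==> j : I ==> V i j = V j i"
  and "!!x. 0 <= (SUM i:I. SUM j:I. x i * x j * V i j)"
 shows "EX A. ALL i:I. ALL j:I. V i j = (SUM l:I. A i l * A j l)"
 using assms
proof (induction I arbitrary: V rule: finite_induct)
 case (insert a I)
 have sym: "V i j = V j i" if "i : insert a I" "j : insert a I" for i j using insert.prems(1) that by auto
 let ?X = "%I x. SUM i:I. SUM j:I. x i * x j * V i j"
 have expand: "(SUM i:insert a I. SUM j:insert a I. x i * x j * V i j) =
   (x a)^2 * V a a + 2 * x a * (SUM i:I. x i * V i a) + ?X I x" for x
 proof -
  have "(SUM j:I. x a * x j * V a j) = x a * (SUM i:I. x i * V i a)" using sym by (simp add: sum_distrib_left mult_ac)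
  moreover have "(SUM i:I. x i * x a * V i a) = x a * (SUM i:I. x i * V i a)" by (simp add: sum_distrib_left mult_ac)
  ultimately show ?thesis using insert.hyps by (simp add: sum.distrib power2_eq_square algebra_simps)
 qed
 have psd: "0 <= (x a)^2 * V a a + 2 * x a * (SUM i:I. x i * V i a) + ?X I x" for x using insert.prems(2)[of x] unfolding expand .
 have Vaa: "0 <= V a a"
 proof -
  let ?x = "%i. if i = a then 1 else 0 :: real"
  have "(SUM i:I. ?x i * V i a) = 0" "(SUM i:I. SUM j:I. ?x i * ?x j * V i j) = 0" using insert.hyps by (auto intro!: sum.neutral)
  then show ?thesis using psd[of ?x] by simp
 qed
 define W where "W = (%i j. if V a a = 0 then V i j else V i j - V i a * V j a / V a a)"
 have "EX A. ALL i:I. ALL j:I. W i j = (SUM l:I. A i l * A j l)"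
 proof (rule insert.IH)
  show "W i j = W j i" if "i : I" "j : I" for i j using sym that unfolding W_def by (auto simp: mult.commute)
  fix x :: "'i => real"
  define S where "S = (SUM i:I. x i * V i a)"
  \<comment> \<open>The value at a that minimises the form in this coordinate; completing the square
    leaves the Schur complement.\<close>
  let ?y = "%i. if i = a then (if V a a = 0 then 0 else - S / V a a) else x i"
  have e: "(SUM i:I. ?y i * V i a) = S" "(SUM i:I. SUM j:I. ?y i * ?y j * V i j) = ?X I x"
   unfolding S_def using insert.hyps by (intro sum.cong refl; auto)+
  have "(SUM i:I. SUM j:I. x i * x j * (V i a * V j a)) = S * S" unfolding S_def by (simp add: sum_product mult_ac)
  then have "(SUM i:I. SUM j:I. x i * x j * (V i a * V j a / V a a)) = S^2 / V a a"
   by (simp add: sum_divide_distrib[symmetric] power2_eq_square)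
  then have "(SUM i:I. SUM j:I. x i * x j * W i j) = (if V a a = 0 then (?X I x) else (?X I x) - S^2 / V a a)"
   unfolding W_def by (simp add: right_diff_distrib sum_subtractf)
  also have "... = (?y a)^2 * V a a + 2 * ?y a * (SUM i:I. ?y i * V i a) + (SUM i:I. SUM j:I. ?y i * ?y j * V i j)"
   unfolding e by (auto simp: power2_eq_square field_simps)
  also have "0 <= ..." by (rule psd)
  finally show "0 <= (SUM i:I. SUM j:I. x i * x j * W i j)" .
 qed
 then obtain A where A: "!!i j. i : I ==> j : I ==> W i j = (SUM l:I. A i l * A j l)" by blast
 have V0: "V i a = 0" if "V a a = 0" "i : I" for i
 proof (rule ccontr)
  assume n: "V i a ~= 0"
  \<comment> \<open>With a zero pivot and V i a nonzero, this choice gives the form the value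
    -1.\<close>
  define r where "r = - (V i i + 1) / (2 * V i a)"
  let ?x = "%j. if j = a then r else if j = i then 1 else 0"
  have "(SUM j:I. ?x j * V j a) = (SUM j:I. if j = i then V i a else 0)"
   "(SUM j:I. SUM k:I. ?x j * ?x k * V j k) = (SUM j:I. SUM k:I. if k = i then (if j = i then V i i else 0) else 0)"
   using insert.hyps by (intro sum.cong refl; auto)+
  then have "(SUM j:I. ?x j * V j a) = V i a" "(SUM j:I. SUM k:I. ?x j * ?x k * V j k) = V i i" using that insert.hyps by simp_all
  then have "0 <= V i a * (2 * r) + V i i" using psd[of ?x] that(1) by (simp add: mult_ac)
  also have "... = -1" unfolding r_def using n by (simp add: field_simps)
  finally show False by simp
 qed
 define A' where "A' = (%i l. if l = a then (if V a a = 0 then 0 else V i a / sqrt (V a a)) else if i = a then 0 else A i l)"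
 have "V i j = (SUM l:insert a I. A' i l * A' j l)" if ij: "i : insert a I" "j : insert a I" for i j
 proof -
  have s: "(SUM l:insert a I. A' i l * A' j l) = A' i a * A' j a + (if i = a | j = a then 0 else (SUM l:I. A i l * A j l))"
  proof -
   have "(SUM l:I. A' i l * A' j l) = (SUM l:I. if i = a | j = a then 0 else A i l * A j l)"
    unfolding A'_def using insert.hyps by (intro sum.cong refl) auto
   then show ?thesis using insert.hyps by auto
  qed
  have p: "A' i a * A' j a = (if V a a = 0 then 0 else V i a * V j a / V a a)" unfolding A'_def using Vaa by (auto simp: real_sqrt_mult_self)
  show ?thesis unfolding s p using ij V0 sym[of a j] by (auto simp: A[symmetric] W_def)
 qed
 then show ?case by blast
qed simp

lemma normal_char:
 assumes "q > 0"
 shows "char (density lborel (normal_density 0 (sqrt q))) t = exp (- (t^2 * q) / 2)"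
proof -
 have "distributed std_normal_distribution lborel (%x. x) std_normal_density" unfolding distributed_def by (simp add: distr_id2)
 from prob_space.normal_density_affine[OF prob_space_normal_density this, of "sqrt q" 0] assms
 have d: "distributed std_normal_distribution lborel (%x. sqrt q * x) (normal_density 0 (sqrt q))" by simp
 then have "density lborel (normal_density 0 (sqrt q)) = distr std_normal_distribution lborel (%x. sqrt q * x)"
  by (simp add: distributed_distr_eq_density)
 then have "char (density lborel (normal_density 0 (sqrt q))) t = char std_normal_distribution (t * sqrt q)"
  unfolding char_def by (simp add: integral_distr mult.assoc)
 then show ?thesis using assms unfolding char_std_normal_distribution by (simp add: power_mult_distrib)
qed

lemma (in prob_space) gaussian_of_char:
 assumes X[measurable]: "X : borel_measurable M" and q: "q >= 0"
  and ch: "!!r. (CLINT x|M. iexp (r * X x)) = exp (- (r^2 * q) / 2)"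
 shows "real_gaussian M X 0 q"
proof -
 have rd: "real_distribution (distr M borel X)" by (auto simp: real_distribution_def real_distribution_axioms_def intro!: prob_space_distr)
 have ch': "char (distr M borel X) r = exp (- (r^2 * q) / 2)" for r unfolding char_def by (subst integral_distr, simp, simp, rule ch)
 let ?X = "density lborel (normal_density 0 (sqrt q))"
 show ?thesis
 proof (cases "q = 0")
  case True
  have "real_distribution (return borel (0::real))"
   by (auto simp: real_distribution_def real_distribution_axioms_def intro!: prob_space_return)
  moreover have "char (distr M borel X) = char (return borel 0)" using ch' True by (auto simp: fun_eq_iff char_def integral_return)
  ultimately have eq: "distr M borel X = return borel 0" by (intro Levy_uniqueness rd)
  have "AE x in distr M borel X. x = 0" unfolding eq by (simp add: AE_return)
  then have "AE x in M. X x = 0" by (subst (asm) AE_distr_iff) auto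
  then show ?thesis unfolding real_gaussian_def using True by simp
 next
  case False
  with q have q: "q > 0" by simp
  have "real_distribution (?X)"
   using prob_space_normal_density[of "sqrt q" 0] q by (auto simp: real_distribution_def real_distribution_axioms_def)
  moreover have "char (distr M borel X) = char (?X)" using ch' normal_char[OF q] by (auto simp: fun_eq_iff)
  ultimately have eq: "distr M borel X = ?X" by (intro Levy_uniqueness rd)
  have "distr M lborel X = distr M borel X" by (intro distr_cong) auto
  then have "distributed M lborel X (normal_density 0 (sqrt q))" unfolding distributed_def using eq by simp
  then show ?thesis unfolding real_gaussian_def using q by simp
 qed
qed

lemma (in prob_space) real_gaussian_moment:
 assumes g: "real_gaussian M X 0 q" and k: "k > 0"
 shows "integrable M (%x. X x ^ (2 * k))" "expectation (%x. X x ^ (2 * k)) = fact (2 * k) / (2 ^ k * fact k) * q ^ k"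
proof -
 let ?X = "expectation (%x. X x ^ (2 * k))"
 let ?Y = "%M. integrable M (%x. X x ^ (2 * k))"
 let ?Z = "fact (2 * k)"
 have [measurable]: "X : borel_measurable M" using g unfolding real_gaussian_def by auto
 consider "q = 0" "AE x in M. X x = 0" | "q > 0" "distributed M lborel X (normal_density 0 (sqrt q))"
  using g unfolding real_gaussian_def by auto
 then have "?Y M & ?X = ?Z / (2 ^ k * fact k) * q ^ k"
 proof cases
  case 1
  then have z: "AE x in M. X x ^ (2 * k) = 0" using k by (auto elim!: eventually_mono)
  have "?Y M = integrable M (%x. 0::real)" using z by (intro integrable_cong_AE) auto
  moreover have "?X = 0" by (rule integral_eq_zero_AE[OF z])
  ultimately show ?thesis using 1 k by simp
 next
  case 2
  have h: "has_bochner_integral lborel (%x. normal_density 0 (sqrt q) x * x ^ (2 * k)) (?Z / ((2 / q)^k * fact k))"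
   using normal_moment_even[of "sqrt q" 0 k] 2 by simp
  have "?Y M" using distributed_integrable[OF 2(2), of "%x. x ^ (2 * k)"] h by (auto simp: has_bochner_integral_iff)
  moreover have "?X = ?Z / ((2 / q)^k * fact k)"
   using distributed_integral[OF 2(2), of "%x. x ^ (2 * k)"] h by (auto simp: has_bochner_integral_iff)
  ultimately show ?thesis using 2(1) by (simp add: power_divide)
 qed
 then show "?Y M" "?X = ?Z / (2 ^ k * fact k) * q ^ k" by auto
qed

text \<open>Preimages of closed rectangles are stable under intersection and generate the
  sigma-algebras of the vectors, so the product rule extends from them.\<close>

lemma (in prob_space) indep_vars_of_rectangles:
 fixes D :: "'k => 'i => 'a => real"
 assumes I: "finite I" and K: "finite K"
  and D[measurable]: "!!k i. k : K ==> i : I ==> D k i : borel_measurable M"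
  and eq: "!!A. (!!k i. closed (A k i)) ==> prob {x:space M. ALL k:K. ALL i:I. D k i x : A k i} =
    (PROD k:K. prob {x:space M. ALL i:I. D k i x : A k i})"
 shows "indep_vars (%_. PiM I (%_. borel)) (%k x. \<lambda>i\<in>I. D k i x) K"
proof -
 define E where "E = (%k. {{x:space M. ALL i:I. D k i x : A i} | A. ALL i. closed (A i)})"
 have cl: "{x:space M. D k i x : B} : events" if "k : K" "i : I" "closed B" for k i B
  using measurable_sets[OF D[OF that(1,2)] borel_closed[OF that(3)]] by (simp add: vimage_def Int_def conj_commute)
 have Esub: "E k <= events" if "k : K" for k unfolding E_def using that by (auto intro!: sets.sets_Collect_finite_All[OF cl I])
 have Est: "Int_stable (E k)" for k
 proof (rule Int_stableI)
  fix a b assume "a : E k" "b : E k"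
  then obtain A B where A: "a = {x:space M. ALL i:I. D k i x : A i}" "!!i. closed (A i)"
   and B: "b = {x:space M. ALL i:I. D k i x : B i}" "!!i. closed (B i)" unfolding E_def by auto
  have "a \<inter> b = {x:space M. ALL i:I. D k i x : A i \<inter> B i}" unfolding A B by auto
  then show "a \<inter> b : E k" unfolding E_def using A B by (auto intro!: exI[of _ "%i. A i \<inter> B i"])
 qed
 have ind: "indep_sets E K"
 proof (rule indep_setsI[OF Esub])
  fix B J assume J: "J ~= {}" "J <= K" "finite J" and B: "ALL j:J. B j : E j"
  then have "ALL j:J. EX A. B j = {x:space M. ALL i:I. D j i x : A i} & (ALL i. closed (A i))" unfolding E_def by auto
  from bchoice[OF this] obtain A
   where A0: "ALL j:J. B j = {x:space M. ALL i:I. D j i x : A j i} & (ALL i. closed (A j i))" by blast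
  then have A: "!!j. j : J ==> B j = {x:space M. ALL i:I. D j i x : A j i}" "!!j i. j : J ==> closed (A j i)" by auto
  \<comment> \<open>Indices outside J receive the trivial rectangle, whose probability 1 drops out
    of the product.\<close>
  define A' where "A' = (%j i. if j : J then A j i else UNIV)"
  have A': "closed (A' j i)" for j i unfolding A'_def using A by auto
  have "(INT j:J. B j) = {x:space M. ALL k:K. ALL i:I. D k i x : A' k i}" using J A(1) unfolding A'_def by (auto split: if_splits)
  then have "prob (INT j:J. B j) = (PROD k:K. prob {x:space M. ALL i:I. D k i x : A' k i})" using eq[of A', OF A'] by simp
  also have "... = (PROD k:J. prob {x:space M. ALL i:I. D k i x : A' k i})"
   using J K by (intro prod.mono_neutral_right) (auto simp: A'_def prob_space)
  also have "... = (PROD j:J. prob (B j))" by (intro prod.cong refl) (simp add: A(1) A'_def)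
  finally show "prob (INT j:J. B j) = (PROD j:J. prob (B j))" .
 qed auto
 let ?Y = "PiM I (%_. borel)"
 have rv: "(%x. \<lambda>i\<in>I. D k i x) : measurable M ?Y" if "k : K" for k using that by (intro measurable_restrict) auto
 let ?Z = "%E k. sigma_sets (space M) (E k)"
 have ind': "indep_sets (%k. ?Z E k) K" by (rule indep_sets_sigma[OF ind Est])
 let ?X = "%E k. sigma (space M) (E k)"
 show ?thesis unfolding indep_vars_def
 proof (rule conjI[OF ballI[OF rv] indep_sets_mono_sets[OF ind']])
  fix k assume k: "k : K"
  have "E k <= Pow (space M)" unfolding E_def by auto
  then have sE: "sets (?X E k) = ?Z E k" by (rule sets_measure_of)
  have meas: "(%x. \<lambda>i\<in>I. D k i x) : measurable (?X E k) ?Y"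
  proof (intro measurable_restrict)
   fix i assume i: "i : I"
   show "D k i : borel_measurable (?X E k)" unfolding borel_eq_closed
   proof (rule measurable_measure_of)
    fix A :: "real set" assume A: "A : Collect closed"
    have "D k i -` A \<inter> space (?X E k) = {x:space M. ALL j:I. D k j x : (if j = i then A else UNIV)}"
     using i by (auto simp: space_measure_of_conv split: if_splits)
    also have "... : E k" unfolding E_def using A by (auto intro!: exI[of _ "%j. if j = i then A else UNIV"])
    finally show "D k i -` A \<inter> space (?X E k) : sets (?X E k)" unfolding sE by (auto simp: space_measure_of_conv)
   qed auto
  qed
  show "sigma_sets (space M) {(%x. \<lambda>i\<in>I. D k i x) -` A \<inter> space M |A. A : sets ?Y} <= ?Z E k"
  proof (rule sigma_sets_mono)
   show "{(%x. \<lambda>i\<in>I. D k i x) -` A \<inter> space M |A. A : sets ?Y} <= ?Z E k"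
    using measurable_sets[OF meas] unfolding sE by (auto simp: space_measure_of_conv)
  qed
 qed
qed

text \<open>The vectors are compared with independent copies on a power of M: if the characteristic
  function factorizes, both joint laws agree on closed rectangles, and for the copies these
  probabilities are products.\<close>

lemma (in prob_space) indep_vars_of_char:
 fixes D :: "'k => 'i => 'a => real"
 assumes I: "finite I" and K: "finite K"
  and D[measurable]: "!!k i. k : K ==> i : I ==> D k i : borel_measurable M"
  and sq: "!!k i. k : K ==> i : I ==> integrable M (%x. (D k i x)^2)"
  and eq: "!!u. (CLINT x|M. iexp (SUM k:K. SUM i:I. u k i * D k i x)) = (PROD k:K. CLINT x|M. iexp (SUM i:I. u k i * D k i x))"
 shows "indep_vars (%_. PiM I (%_. borel)) (%k x. \<lambda>i\<in>I. D k i x) K"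
proof (rule indep_vars_of_rectangles[OF I K D])
 fix A :: "'k => 'i => real set" assume A: "!!k i. closed (A k i)"
 then have [measurable]: "A k i : sets borel" for k i by auto
 interpret PM: product_prob_space "%_::'k. M" K by (intro product_prob_spaceI prob_space_axioms)
 let ?PM = "PiM K (%_. M)"
 have PM: "prob_space ?PM" by (intro prob_space_PiM prob_space_axioms)
 let ?X' = "%p \<omega>. D (fst p) (snd p) (\<omega> (fst p))"
 let ?Y = "%p x. D (fst p) (snd p) x"
 let ?Z = "%A. PROD k:K. prob {x:space M. ALL i:I. D k i x : A k i}"
 have "measure M {x:space M. ALL p:K\<times>I. ?Y p x : A (fst p) (snd p)} =
  measure ?PM {\<omega>:space ?PM. ALL p:K\<times>I. ?X' p \<omega> : A (fst p) (snd p)}"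
 proof (rule joint_char_eq_imp_closed_rectangle_eq[OF prob_space_axioms PM])
  show "finite (K \<times> I)" using I K by auto
  show "D (fst p) (snd p) : borel_measurable M" if "p : K \<times> I" for p using that by auto
  show "?X' p : borel_measurable ?PM" if "p : K \<times> I" for p
  proof -
   have "(%\<omega>. \<omega> (fst p)) : measurable ?PM M" using that by (intro measurable_component_singleton) auto
   then show ?thesis by (rule measurable_compose[OF _ D]) (use that in auto)
  qed
  show "integrable M (%x. (?Y p x)^2)" if "p : K \<times> I" for p using that by (auto intro: sq)
  show "integrable ?PM (%\<omega>. (?X' p \<omega>)^2)" if p: "p : K \<times> I" for p
  proof -
   have k: "fst p : K" using p by auto
   have "integrable (distr ?PM M (%\<omega>. \<omega> (fst p))) (%x. (?Y p x)^2)"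
    using distr_PiM_component[of K "%_. M", OF prob_space_axioms k] sq p by auto
   then show ?thesis by (rule integrable_distr[OF measurable_component_singleton[OF k]])
  qed
  show "closed (A (fst p) (snd p))" for p using A by simp
  fix u :: "'k \<times> 'i => real"
  have "(CLINT x|M. iexp (SUM p:K\<times>I. u p * ?Y p x)) = (CLINT x|M. iexp (SUM k:K. SUM i:I. u (k, i) * D k i x))"
   by (simp add: sum.cartesian_product split_beta)
  also have "... = (PROD k:K. CLINT x|M. iexp (SUM i:I. u (k, i) * D k i x))" by (rule eq)
  also have "... = (CLINT \<omega>|?PM. (PROD k:K. iexp (SUM i:I. u (k, i) * D k i (\<omega> k))))"
  proof (rule PM.product_integral_prod[OF K, symmetric])
   fix k assume [simp]: "k : K"
   have "(%x. SUM i:I. u (k, i) * D k i x) : borel_measurable M" by (intro borel_measurable_sum) auto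
   then show "integrable M (%x. iexp (SUM i:I. u (k, i) * D k i x))" by (rule iexp_integrable)
  qed
  also have "... = (CLINT \<omega>|?PM. iexp (SUM p:K\<times>I. u p * ?X' p \<omega>))"
   using K by (intro Bochner_Integration.integral_cong refl)
    (simp add: exp_sum[symmetric] sum.cartesian_product[symmetric] sum_distrib_left split_beta sum.cartesian_product')
  finally show "(CLINT x|M. iexp (SUM p:K\<times>I. u p * ?Y p x)) = (CLINT \<omega>|?PM. iexp (SUM p:K\<times>I. u p * ?X' p \<omega>))" .
 qed
 also have "{\<omega>:space ?PM. ALL p:K\<times>I. ?X' p \<omega> : A (fst p) (snd p)} = PiE K (%k. {x:space M. ALL i:I. D k i x : A k i})"
  by (auto simp: space_PiM PiE_iff extensional_def)
 also have "measure ?PM ... = ?Z A" unfolding measure_def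
  using I A by (subst PM.emeasure_PiM[OF K]) (auto intro!: sets.sets_Collect_finite_All simp: emeasure_eq_measure prod_ennreal prod_nonneg)
 finally show "prob {x:space M. ALL k:K. ALL i:I. D k i x : A k i} = ?Z A"
  by (simp add: Ball_def_raw split_paired_all) (smt (verit) Collect_cong)
qed

lemma prob_space_Xi: "prob_space Xi" by (intro prob_space_PiM real_distribution.axioms(1)[OF real_dist_normal_dist])

lemma sum_triple_bool:
 "(SUM j:K\<times>I\<times>(UNIV::bool set). f j) = (SUM k:K. SUM i:I. f (k, i, True) + f (k, i, False))"
 unfolding sum.cartesian_product' by (simp add: UNIV_bool add.commute)

context
 fixes I :: "nat set" and A V :: "nat => nat => real"
 assumes I: "finite I" and V: "!!i j. i : I ==> j : I ==> V i j = (SUM l:I. A i l * A j l)"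
begin

lemma gbm_gaussian:
 fixes ii :: "'j => nat"
 assumes J: "finite J" and ii: "!!j. j : J ==> ii j : I" and tt: "!!j. j : J ==> tt j : {0..1}"
 shows "real_gaussian Xi (%xi. SUM j:J. a j * gbm I A (ii j) (tt j) xi) 0
   (SUM j:J. SUM j':J. a j * a j' * (V (ii j) (ii j') * min (tt j) (tt j')))" (is "real_gaussian _ ?X 0 ?q")
proof (rule Xi.P.gaussian_of_char)
 let ?Y = "%r. SUM j:J. SUM j':J. (r * a j) * (r * a j') * (V (ii j) (ii j') * min (tt j) (tt j'))"
 have ch: "(CLINT xi|Xi. iexp (r * ?X xi)) = exp (- (r^2 * ?q) / 2)" for r
 proof -
  have "(CLINT xi|Xi. iexp (r * ?X xi)) = (CLINT xi|Xi. iexp (SUM j:J. (r * a j) * gbm I A (ii j) (tt j) xi))"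
   by (simp only: sum_distrib_left mult.assoc)
  also have "... = exp (- (?Y r) / 2)" by (rule gbm_char[OF I V J ii tt])
  also have "?Y r = r^2 * ?q" by (simp only: sum_distrib_left) (intro sum.cong refl, simp add: power2_eq_square mult_ac)
  finally show ?thesis .
 qed
 show "(CLINT xi|Xi. iexp (r * ?X xi)) = exp (- (r^2 * ?q) / 2)" for r by (rule ch)
 \<comment> \<open>A characteristic function has modulus at most 1, so the quadratic form in the
   exponent cannot be negative.\<close>
 have "norm (CLINT xi|Xi. iexp (1 * ?X xi)) <= (LINT xi|Xi. norm (iexp (1 * ?X xi)))" by (rule integral_norm_bound)
 also have "... = 1" by (simp add: prob_space.prob_space[OF prob_space_Xi] del: of_real_sum)
 finally show "?q >= 0" unfolding ch by simp
qed measurable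

text \<open>Under the covariance min s t increments over disjoint intervals are uncorrelated, so the
  double sum over times collapses to its diagonal.\<close>

lemma gbm_increment_var:
 assumes ts: "mono (ts :: nat => real)"
 shows "(\<Sum>k<m. SUM i:I. \<Sum>k'<m. SUM i':I. u k i * u k' i' * (V i i' *
   (min (ts (Suc k)) (ts (Suc k')) - min (ts (Suc k)) (ts k') - min (ts k) (ts (Suc k')) + min (ts k) (ts k'))))
  = (\<Sum>k<m. (ts (Suc k) - ts k) * (SUM i:I. SUM i':I. u k i * u k i' * V i i'))"
proof -
 have d: "min (ts (Suc k)) (ts (Suc k')) - min (ts (Suc k)) (ts k') - min (ts k) (ts (Suc k')) + min (ts k) (ts k')
   = (if k' = k then ts (Suc k) - ts k else 0)" for k k'
 proof -
  consider "k = k'" | "Suc k <= k'" | "Suc k' <= k" by linarith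
  then show ?thesis
  proof cases
   case 1
   then show ?thesis using monoD[OF ts, of k "Suc k"] by (simp add: min_def)
  next
   case 2
   then show ?thesis using monoD[OF ts, of k "Suc k"] monoD[OF ts, of "Suc k" k'] monoD[OF ts, of k' "Suc k'"] by (simp add: min_def)
  next
   case 3
   then show ?thesis using monoD[OF ts, of k' "Suc k'"] monoD[OF ts, of "Suc k'" k] monoD[OF ts, of k "Suc k"] by (simp add: min_def)
  qed
 qed
 have "(\<Sum>k<m. SUM i:I. \<Sum>k'<m. SUM i':I. u k i * u k' i' * (V i i' * (if k' = k then ts (Suc k) - ts k else 0))) =
  (\<Sum>k<m. SUM i:I. \<Sum>k'<m. if k' = k then (SUM i':I. u k i * u k i' * (V i i' * (ts (Suc k) - ts k))) else 0)"
  by (intro sum.cong refl) auto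
 also have "... = (\<Sum>k<m. (ts (Suc k) - ts k) * (SUM i:I. SUM i':I. u k i * u k i' * V i i'))"
  by (intro sum.cong refl) (simp add: sum.delta' sum_distrib_left mult_ac)
 finally show ?thesis unfolding d .
qed

lemma gbm_increment_char:
 assumes ts: "mono (ts :: nat => real)" "!!k. k <= m ==> ts k : {0..1}"
 shows "(CLINT xi|Xi. iexp (\<Sum>k<m. SUM i:I. u k i * (gbm I A i (ts (Suc k)) xi - gbm I A i (ts k) xi))) =
   exp (- (\<Sum>k<m. (ts (Suc k) - ts k) * (SUM i:I. SUM i':I. u k i * u k i' * V i i')) / 2)"
proof -
 let ?J = "{..<m} \<times> I \<times> (UNIV :: bool set)"
 let ?a = "%(k, i, b). if b then u k i else - u k i"
 let ?ii = "%(k, i, b). i" and ?tt = "%(k, i, b). if b then ts (Suc k) else ts k"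
 have 1: "(\<Sum>k<m. SUM i:I. u k i * (gbm I A i (ts (Suc k)) xi - gbm I A i (ts k) xi)) =
   (SUM j:?J. ?a j * gbm I A (?ii j) (?tt j) xi)" for xi unfolding sum_triple_bool by (simp add: algebra_simps)
 let ?X = "SUM j:?J. SUM j':?J. ?a j * ?a j' * (V (?ii j) (?ii j') * min (?tt j) (?tt j'))"
 have "(CLINT xi|Xi. iexp (SUM j:?J. ?a j * gbm I A (?ii j) (?tt j) xi)) =
   exp (- ?X / 2)" by (rule gbm_char[OF I V]) (use I ts in auto)
 also have "?X =
  (\<Sum>k<m. SUM i:I. \<Sum>k'<m. SUM i':I. u k i * u k' i' * (V i i' *
   (min (ts (Suc k)) (ts (Suc k')) - min (ts (Suc k)) (ts k') - min (ts k) (ts (Suc k')) + min (ts k) (ts k'))))"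
  unfolding sum_triple_bool sum.distrib[symmetric] by (intro sum.cong refl) (simp add: algebra_simps)
 also have "... = (\<Sum>k<m. (ts (Suc k) - ts k) * (SUM i:I. SUM i':I. u k i * u k i' * V i i'))" by (rule gbm_increment_var[OF ts(1)])
 finally show ?thesis unfolding 1 .
qed

text \<open>Polarization: the sum and the difference of the two variables are Gaussian, and their
  second moments determine the mixed one.\<close>

lemma gbm_covariance:
 assumes ij: "i : I" "j : I" and st: "s : {0..1}" "t : {0..1}"
 shows "integrable Xi (%xi. gbm I A i s xi * gbm I A j t xi)"
  "integral\<^sup>L Xi (%xi. gbm I A i s xi * gbm I A j t xi) = min s t * V i j"
proof -
 let ?X = "gbm I A i s" and ?Y = "gbm I A j t"
 have sym: "V i j = V j i" using ij by (simp add: V mult.commute)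
 have g: "real_gaussian Xi (%xi. ?X xi + c * ?Y xi) 0 (V i i * s + 2 * c * V i j * min s t + c^2 * V j j * t)" for c
 proof -
  let ?a = "%b. if b then 1 else c" and ?ii = "%b. if b then i else j" and ?tt = "%b. if b then s else t"
  have "real_gaussian Xi (%xi. SUM b:(UNIV::bool set). ?a b * gbm I A (?ii b) (?tt b) xi) 0
   (SUM b:(UNIV::bool set). SUM b':(UNIV::bool set). ?a b * ?a b' * (V (?ii b) (?ii b') * min (?tt b) (?tt b')))"
   by (rule gbm_gaussian) (use ij st in auto)
  then show ?thesis using sym by (simp add: UNIV_bool algebra_simps power2_eq_square min.commute)
 qed
 note mp = prob_space.real_gaussian_moment[OF prob_space_Xi g[of 1] zero_less_one]
  and mm = prob_space.real_gaussian_moment[OF prob_space_Xi g[of "-1"] zero_less_one]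
 have eq: "?X xi * ?Y xi = ((?X xi + 1 * ?Y xi)^(2*1) - (?X xi + (-1) * ?Y xi)^(2*1)) / 4" for xi
  by (simp add: power2_eq_square algebra_simps)
 show "integrable Xi (%xi. ?X xi * ?Y xi)" unfolding eq using mp(1) mm(1) by auto
 show "integral\<^sup>L Xi (%xi. ?X xi * ?Y xi) = min s t * V i j"
  unfolding eq by (simp only: integral_divide_zero Bochner_Integration.integral_diff[OF mp(1) mm(1)] mp(2) mm(2)) (simp add: field_simps)
qed

lemma gbm_is_BM: "is_BM Xi I V (gbm I A)" unfolding is_BM_def
proof (intro conjI ballI allI impI)
 show "gbm I A i t : borel_measurable Xi" for i t by measurable
next
 fix F :: "(nat \<times> real) set" and a :: "nat \<times> real => real"
 assume F: "finite F" "F <= I \<times> {0..1}"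
 show "EX s2. real_gaussian Xi (%xi. SUM (i,t):F. a (i,t) * gbm I A i t xi) 0 s2"
  using gbm_gaussian[OF F(1), of fst snd a] F(2) by (fastforce simp: split_beta)
next
 fix ts :: "nat => real" and m assume ts: "mono ts" "ALL k<=m. ts k : {0..1}"
 show "Xi.indep_vars (%_. PiM I (%_. borel)) (%k xi. \<lambda>i\<in>I. gbm I A i (ts (Suc k)) xi - gbm I A i (ts k) xi) {..<m}"
 proof (rule Xi.P.indep_vars_of_char[OF I])
  fix u :: "nat => nat => real"
  let ?D = "%k i xi. gbm I A i (ts (Suc k)) xi - gbm I A i (ts k) xi"
  have one: "(CLINT xi|Xi. iexp (SUM i:I. u k i * ?D k i xi)) = exp (- ((ts (Suc k) - ts k) * (SUM i:I. SUM i':I. u k i * u k i' * V i i')) / 2)"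
   if k: "k < m" for k
  proof -
   have s: "(\<Sum>k'<m. if k' = k then g k' else 0) = (g k :: real)" for g using k by (simp add: sum.delta)
   have "(\<Sum>k'<m. SUM i:I. (if k' = k then u k i else 0) * ?D k' i xi) = (SUM i:I. u k i * ?D k i xi)" for xi
    by (subst s[symmetric]) (intro sum.cong refl, auto)
   moreover have "(\<Sum>k'<m. (ts (Suc k') - ts k') * (SUM i:I. SUM i':I. (if k' = k then u k i else 0) * (if k' = k then u k i' else 0) * V i i'))
     = (ts (Suc k) - ts k) * (SUM i:I. SUM i':I. u k i * u k i' * V i i')" by (subst s[symmetric]) (intro sum.cong refl, auto)
   ultimately show ?thesis using gbm_increment_char[of ts m "%k' i. if k' = k then u k i else 0"] ts by simp
  qed
  have "(CLINT xi|Xi. iexp (\<Sum>k<m. SUM i:I. u k i * ?D k i xi)) = exp (- (\<Sum>k<m. (ts (Suc k) - ts k) * (SUM i:I. SUM i':I. u k i * u k i' * V i i')) / 2)"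
   by (rule gbm_increment_char) (use ts in auto)
  also have "... = (\<Prod>k<m. complex_of_real (exp (- ((ts (Suc k) - ts k) * (SUM i:I. SUM i':I. u k i * u k i' * V i i')) / 2)))"
   by (simp flip: of_real_prod exp_sum add: sum_negf sum_divide_distrib)
  also have "... = (\<Prod>k<m. CLINT xi|Xi. iexp (SUM i:I. u k i * ?D k i xi))" by (intro prod.cong refl) (simp only: one lessThan_iff)
  finally show "(CLINT xi|Xi. iexp (\<Sum>k<m. SUM i:I. u k i * ?D k i xi)) = (\<Prod>k<m. CLINT xi|Xi. iexp (SUM i:I. u k i * ?D k i xi))" .
 next
  fix k i assume "k : {..<m}" and i: "i : I"
  then have k: "ts (Suc k) : {0..1}" "ts k : {0..1}" using ts(2) by simp_all
  have "(x - y)^2 = x * x - 2 * (x * y) + y * y" for x y :: real by (simp add: power2_eq_square algebra_simps)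
  then show "integrable Xi (%xi. (gbm I A i (ts (Suc k)) xi - gbm I A i (ts k) xi)^2)"
   using gbm_covariance(1)[OF i i k(1,1)] gbm_covariance(1)[OF i i k] gbm_covariance(1)[OF i i k(2,2)] by simp
 qed auto
next
 fix i j :: nat and s t :: real assume "i : I" "j : I" "s : {0..1}" "t : {0..1}"
 note c = gbm_covariance[OF this]
 show "integrable Xi (%xi. gbm I A i s xi * gbm I A j t xi)" "integral\<^sup>L Xi (%xi. gbm I A i s xi * gbm I A j t xi) = min s t * V i j" by (rule c)+
qed

end

section \<open>Quadratic forms in the innovations\<close>

lemma ennreal_mult_add:
 assumes "0 <= a" "0 <= b" "0 <= c"
 shows "ennreal c * (ennreal a + ennreal b) = ennreal (c * (a + b))"
 using assms by (simp only: ennreal_plus ennreal_mult add_nonneg_nonneg)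

lemma powr_weighted_mean_le:
 fixes X w :: "'i => real"
 assumes A: "finite A" and X: "!!i. i : A ==> X i > 0" and w: "!!i. i : A ==> w i >= 0" and p: "p >= 1"
 shows "(SUM i:A. w i * X i) powr p <= (SUM i:A. w i) powr (p - 1) * (SUM i:A. w i * X i powr p)"
proof (cases "(SUM i:A. w i) = 0")
 case True
 then have "w i = 0" if "i : A" for i using sum_nonneg_0[OF A] w that by blast
 then show ?thesis using p by simp
next
 case False
 define W where "W = (SUM i:A. w i)"
 have W: "W > 0" using False w unfolding W_def by (simp add: sum_nonneg order_less_le)
 have "A ~= {}" using False by auto
 have "(SUM i:A. (w i / W) *\<^sub>R X i) powr p <= (SUM i:A. (w i / W) * X i powr p)"
  using convex_on_sum[OF A \<open>A ~= {}\<close> powr_convex[OF p], of "%i. w i / W" X] W w X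
  by (simp add: W_def sum_divide_distrib[symmetric] divide_nonneg_nonneg sum_nonneg)
 then have "((SUM i:A. w i * X i) / W) powr p <= (SUM i:A. w i * X i powr p) / W" by (simp add: sum_divide_distrib)
 moreover have "(SUM i:A. w i * X i) >= 0" using w X by (intro sum_nonneg mult_nonneg_nonneg) (auto intro: less_imp_le)
 ultimately have "(SUM i:A. w i * X i) powr p <= W powr p * ((SUM i:A. w i * X i powr p) / W)" using W by (simp add: powr_divide field_simps)
 also have "... = W powr (p - 1) * (SUM i:A. w i * X i powr p)" using W by (simp add: powr_diff)
 finally show ?thesis unfolding W_def .
qed

text \<open>Jensen for the weights, then Markov for the p-th moment. The summands may be dependent,
  which admits the products \<open>g s x * g t x\<close> over overlapping pairs.\<close>

lemma (in prob_space) weighted_sum_tail: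
 assumes A: "finite A" and X[measurable]: "!!i. i : A ==> X i : borel_measurable M"
  and X0: "!!i x. i : A ==> X i x > 0" and w: "!!i. i : A ==> w i >= 0" and p: "p >= 1"
  and C: "!!i. i : A ==> NN M (%x. ennreal (X i x powr p)) <= ennreal C" "C >= 0" and W: "(SUM i:A. w i) <= W" and h: "h > 0"
 shows "prob {x:space M. (SUM i:A. w i * X i x) > h} <= C * (W / h) powr p"
proof -
 let ?S = "%x. SUM i:A. w i * X i x"
 let ?W = "SUM i:A. w i"
 have W0: "?W >= 0" using w by (rule sum_nonneg)
 let ?X = "%x. ennreal (?S x powr p)"
 let ?Z = "ennreal (?W powr (p - 1))"
 let ?T = "%x. SUM i:A. ennreal (w i) * ennreal (X i x powr p)"
 have "NN M (%x. ?X x) <= NN M (%x. ?Z * ?T x)"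
 proof (intro nn_integral_mono)
  fix x
  have "?S x powr p <= ?W powr (p - 1) * (SUM i:A. w i * X i x powr p)" by (rule powr_weighted_mean_le) (use assms in auto)
  then show "?X x <= ?Z * ?T x" using w by (simp add: ennreal_mult[symmetric] sum_nonneg ennreal_leI)
 qed
 also have "... = ?Z * (SUM i:A. ennreal (w i) * (NN M (%x. ennreal (X i x powr p))))"
  by (subst nn_integral_cmult, measurable, subst nn_integral_sum, measurable) (intro arg_cong2[where f="(*)"] sum.cong refl nn_integral_cmult, measurable)
 also have "... <= ?Z * (SUM i:A. ennreal (w i) * ennreal C)" by (intro mult_left_mono sum_mono C) auto
 also have "... = ennreal (?W powr (p - 1) * (?W * C))" using w C(2) by (simp add: ennreal_mult[symmetric] sum_nonneg sum_distrib_right)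
 also have "?W powr (p - 1) * (?W * C) = C * ?W powr p" using W0 by (cases "?W = 0") (auto simp: powr_diff)
 finally have m: "NN M (%x. ?X x) <= ennreal (C * ?W powr p)" .
 let ?Y = "ennreal (1 / h powr p)"
 let ?U = "NN M (%x. ?X x * indicator (space M) x)"
 have "emeasure M {x:space M. ?S x > h} <= emeasure M {x:space M. 1 <= ?Y * ?X x}"
 proof (intro emeasure_mono subsetI)
  fix x assume "x : {x:space M. ?S x > h}"
  then have x: "x : space M" "h < ?S x" by auto
  then have "h powr p <= ?S x powr p" using h p by (intro powr_mono2) auto
  then have "1 <= 1 / h powr p * ?S x powr p" using h by (simp add: field_simps)
  then show "x : {x:space M. 1 <= ?Y * ?X x}" using x by (simp add: ennreal_mult[symmetric])
 qed measurable
 also have "... <= ?Y * (?U)" by (rule nn_integral_Markov_inequality) auto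
 also have "?U = NN M (%x. ?X x)" by (intro nn_integral_cong) auto
 also have "?Y * ... <= ?Y * ennreal (C * ?W powr p)" by (intro mult_left_mono m) auto
 also have "... = ennreal (C * (?W / h) powr p)" using C(2) h W0 by (simp add: ennreal_mult[symmetric] powr_divide)
 finally have "prob {x:space M. ?S x > h} <= C * (?W / h) powr p" using C(2) by (simp add: emeasure_eq_measure)
 also have "... <= C * (W / h) powr p" using C(2) W W0 h p by (intro mult_left_mono powr_mono2 divide_right_mono divide_nonneg_pos) auto
 finally show ?thesis .
qed

text \<open>With moments of order 4 pm, just above four, the envelopes of the random variances, made
  of fourth powers and products of squares, are controlled at the order pm > 1; this margin is what
  makes Borel--Cantelli over p work.\<close>

locale innov = prob_space M for M :: "'a measure" +
 fixes eps :: "int => 'a => real" and pm B :: real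
 assumes eps_indep: "indep_vars (%_. borel) eps UNIV"
  and eps_mean: "!!k. expectation (eps k) = 0" and pm: "1 < pm" "pm <= 3/2" and B1: "B >= 1"
  and eps_mom: "!!k. NN M (%x. ennreal (abs (eps k x) powr (4 * pm))) <= ennreal B"
begin

definition "sig2 k = expectation (%x. (eps k x)^2)"
definition "gam4 k = expectation (%x. (eps k x)^4)"
text \<open>Common bound for second and fourth moments, from x^4 <= 1 + |x|^(4 pm).\<close>

definition "c0 = 1 + B"

lemma eps_meas[measurable]: "eps k : borel_measurable M" using eps_indep unfolding indep_vars_def by auto

lemma c0: "c0 >= 1" "c0 >= 0" "c0 >= 2" unfolding c0_def using B1 by auto

lemma eps4: "integrable M (%x. (eps k x)^4)" "gam4 k <= c0" "0 <= gam4 k"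
proof -
 have le: "x^4 <= 1 + abs x powr (4 * pm)" for x :: real
 proof (cases "abs x <= 1")
  case True
  have "abs x^4 <= 1" using True by (intro power_le_one) auto
  then have "x^4 <= 1" by simp
  then show ?thesis by (meson add_increasing2 powr_ge_zero)
 next
  case False
  then have "abs x powr 4 <= abs x powr (4 * pm)" using pm by (intro powr_mono) auto
  then show ?thesis using False by simp
 qed
 let ?X = "NN M (%x. ennreal ((eps k x)^4))"
 have n: "?X <= ennreal c0"
 proof -
  have "?X <= NN M (%x. 1 + ennreal (abs (eps k x) powr (4 * pm)))"
   using le[of "eps k _"] by (intro nn_integral_mono) (simp add: ennreal_leI flip: ennreal_plus ennreal_1)
  also have "... = 1 + (NN M (%x. ennreal (abs (eps k x) powr (4 * pm))))" by (subst nn_integral_add) (auto simp: emeasure_space_1)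
  also have "... <= 1 + ennreal B" by (intro add_left_mono eps_mom)
  also have "... = ennreal c0" unfolding c0_def using B1 by (simp flip: ennreal_plus ennreal_1)
  finally show ?thesis .
 qed
 show i: "integrable M (%x. (eps k x)^4)"
 proof (rule integrableI_nonneg)
  show "(?X) < \<infinity>" using n by (simp add: order_le_less_trans)
 qed auto
 show "0 <= gam4 k" unfolding gam4_def by simp
 have "ennreal (gam4 k) <= ennreal c0" using n i unfolding gam4_def by (subst nn_integral_eq_integral[symmetric]) auto
 then show "gam4 k <= c0" using c0 by simp
qed

lemma eps2: "integrable M (%x. (eps k x)^2)" "sig2 k <= c0" "0 <= sig2 k" "(sig2 k)^2 <= gam4 k"
proof -
 show i: "integrable M (%x. (eps k x)^2)"
  using eps4(1)[of k] by (intro square_integrable_imp_integrable[of "%x. (eps k x)^2"]) (auto simp: power_mult[symmetric])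
 show "0 <= sig2 k" unfolding sig2_def by simp
 have "(%x. ((eps k x)^2)^2) = (%x. (eps k x)^4)" by (simp flip: power_mult)
 then have "variance (%x. (eps k x)^2) = gam4 k - (sig2 k)^2"
  using variance_eq[of "%x. (eps k x)^2"] i eps4(1)[of k] by (simp add: gam4_def sig2_def)
 moreover have "variance (%x. (eps k x)^2) >= 0" by simp
 ultimately show 1: "(sig2 k)^2 <= gam4 k" by simp
 have "(sig2 k)^2 <= c0^2"
 proof -
  have "(sig2 k)^2 <= c0" using 1 eps4(2)[of k] by simp
  also have "... <= c0^2" using c0 by (simp add: self_le_power)
  finally show ?thesis .
 qed
 then show "sig2 k <= c0" by (rule power2_le_imp_le) (use c0 in auto)
qed

lemma eps1: "integrable M (eps k)" using eps2(1)[of k] square_integrable_imp_integrable[of "eps k"] by auto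

lemma indep_shift:
 assumes f[measurable]: "!!j. f j : borel_measurable borel"
 shows "indep_vars (%_. borel) (%j x. f j (eps (lo + int j) x)) (UNIV :: nat set)"
proof -
 have "indep_vars (%j. PiM {lo + int j} (%_. borel)) (%j x. \<lambda>i\<in>{lo + int j}. eps i x) (UNIV :: nat set)"
  by (rule indep_vars_restrict[OF eps_indep]) (auto simp: disjoint_family_on_def)
 from indep_vars_compose2[OF this, of "%j r. f j (r (lo + int j))" "%_. borel"]
 show ?thesis by simp
qed

text \<open>Numbering a window of integer times from its left end turns the past of an innovation
  into a finite initial segment of nat, as the self-normalized bounds want it.\<close>

lemma shifted: "indep_centered M (%j. eps (lo + int j)) (%j. sig2 (lo + int j))"
proof
 show "indep_vars (%_. borel) (%j. eps (lo + int j)) UNIV" using indep_shift[of "%_ x. x" lo] by simp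
qed (auto simp: eps2 eps_mean sig2_def)

lemma sq_diff_le: "0 <= a ==> 0 <= b ==> (a - b)^2 <= a^2 + (b::real)^2" by (simp add: power2_diff)

definition "dvar k = gam4 k - (sig2 k)^2"

lemma shifted_sq: "indep_centered M (%j x. (eps (lo + int j) x)^2 - sig2 (lo + int j)) (%j. dvar (lo + int j))"
proof
 show "indep_vars (%_. borel) (%j x. (eps (lo + int j) x)^2 - sig2 (lo + int j)) (UNIV :: nat set)"
  by (rule indep_shift[of "%j y. y^2 - sig2 (lo + int j)"]) measurable
 fix j
 let ?k = "lo + int j"
 have e: "((eps ?k x)^2 - sig2 ?k)^2 = (eps ?k x)^4 - 2 * sig2 ?k * (eps ?k x)^2 + (sig2 ?k)^2" for x
  by (simp add: power2_diff power_mult[symmetric] algebra_simps)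
 show "integrable M (%x. ((eps ?k x)^2 - sig2 ?k)^2)" unfolding e using eps4(1)[of ?k] eps2(1)[of ?k] by auto
 show "expectation (%x. ((eps ?k x)^2 - sig2 ?k)^2) = dvar ?k" unfolding e dvar_def
  using eps4(1)[of ?k] eps2(1)[of ?k] by (simp add: prob_space gam4_def[symmetric] sig2_def[symmetric]) (simp add: power2_eq_square)
 show "expectation (%x. (eps ?k x)^2 - sig2 ?k) = 0" using eps2(1)[of ?k] by (simp add: prob_space sig2_def)
qed

lemma dvar: "0 <= dvar k" "dvar k <= c0" using eps2(4)[of k] eps4(2)[of k] zero_le_power2[of "sig2 k"] unfolding dvar_def by linarith+

text \<open>\<open>g\<close> majorizes the weight e^2 + s2 of the self-normalized bounds for the
  innovations; \<open>G\<close> does the same for their centred squares.\<close>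

definition "g s x = (eps s x)^2 + c0"
definition "G s x = (eps s x)^4 + 2 * c0^2"

lemma g_meas[measurable]: "g s : borel_measurable M" "G s : borel_measurable M" unfolding g_def G_def by measurable

lemma g_pos: "g s x >= 1" "g s x > 0" "G s x > 0"
proof -
 show "g s x >= 1" unfolding g_def using c0 by (simp add: add_increasing)
 then show "g s x > 0" by simp
 have "c0^2 > 0" using c0 by simp
 then show "G s x > 0" unfolding G_def by (simp add: add_nonneg_pos)
qed

text \<open>One constant for the pm-th moments of g, of G and of products of g at two different
  times.\<close>

definition "Cm = (8 * (B + c0^3) + 16 * (B + c0^6))^2"

lemma powr_add_le: "0 <= a ==> 0 <= b ==> 0 <= r ==> (a + b) powr r <= 2 powr r * (a powr r + (b::real) powr r)"
proof -
 assume a: "0 <= a" "0 <= b" "0 <= r"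
 have "(a + b) powr r <= (2 * max a b) powr r" using a by (intro powr_mono2) auto
 also have "... = 2 powr r * (max a b) powr r" using a by (simp add: powr_mult)
 also have "(max a b) powr r <= a powr r + b powr r" by (auto simp: max_def)
 finally show ?thesis by (simp add: mult_left_mono)
qed

lemma g_mom_aux: "NN M (%x. ennreal (g s x powr (2 * pm))) <= ennreal (8 * (B + c0^3))"
proof -
 have "g s x powr (2 * pm) <= 8 * (abs (eps s x) powr (4 * pm) + c0^3)" for x
 proof -
  have "g s x powr (2 * pm) <= 2 powr (2 * pm) * (((eps s x)^2) powr (2 * pm) + c0 powr (2 * pm))"
   unfolding g_def using pm c0 by (intro powr_add_le) auto
  also have "... <= 2 powr 3 * (((eps s x)^2) powr (2 * pm) + c0 powr 3)"
   using pm c0 by (intro mult_mono add_left_mono powr_mono add_nonneg_nonneg) auto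
  also have "((eps s x)^2) powr (2 * pm) = abs (eps s x) powr (4 * pm)"
  proof (cases "eps s x = 0")
   case False
   then have "((eps s x)^2) powr (2 * pm) = (abs (eps s x) powr 2) powr (2 * pm)" by simp
   then show ?thesis by (simp only: powr_powr) simp
  qed simp
  finally show ?thesis using c0 by simp
 qed
 then have "NN M (%x. ennreal (g s x powr (2 * pm))) <= NN M (%x. ennreal 8 * (ennreal (abs (eps s x) powr (4 * pm)) + ennreal (c0^3)))"
  using c0 by (intro nn_integral_mono) (subst ennreal_mult_add, simp, simp, simp, rule ennreal_leI, blast)
 also have "... = ennreal 8 * ((NN M (%x. ennreal (abs (eps s x) powr (4 * pm)))) + ennreal (c0^3))"
  by (subst nn_integral_cmult, measurable, subst nn_integral_add) (auto simp: emeasure_space_1)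
 also have "... <= ennreal 8 * (ennreal B + ennreal (c0^3))" by (intro mult_left_mono add_right_mono eps_mom) auto
 also have "... = ennreal (8 * (B + c0^3))" using c0 B1 by (intro ennreal_mult_add) auto
 finally show ?thesis .
qed

lemma Cm_ge: "8 * (B + c0^3) <= Cm" "16 * (B + c0^6) <= Cm" "(8 * (B + c0^3))^2 <= Cm" "0 <= Cm" "1 <= 8 * (B + c0^3)"
proof -
 have p: "1 <= c0^3" "1 <= c0^6" using c0 by (auto intro: one_le_power)
 then have "8 * (B + c0^3) >= 1" "16 * (B + c0^6) >= 1" using B1 by auto
 moreover have "y <= (y + z)^2" "z <= (y + z)^2" "y^2 <= (y + z)^2" if "y >= 1" "z >= 1" for y z :: real
  using that self_le_power[of "y+z" 2] by (auto intro!: power_mono)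
 ultimately show "8 * (B + c0^3) <= Cm" "16 * (B + c0^6) <= Cm" "(8 * (B + c0^3))^2 <= Cm" "1 <= 8 * (B + c0^3)" unfolding Cm_def by blast+
 show "0 <= Cm" unfolding Cm_def by simp
qed

lemma g_mom: "NN M (%x. ennreal (g s x powr pm)) <= ennreal (8 * (B + c0^3))"
proof -
 have "NN M (%x. ennreal (g s x powr pm)) <= NN M (%x. ennreal (g s x powr (2 * pm)))"
  using pm g_pos(1) by (intro nn_integral_mono ennreal_leI powr_mono) auto
 then show ?thesis using g_mom_aux by (rule order_trans)
qed

lemma indep_pair:
 assumes "s ~= t"
 shows "indep_var (PiM {s} (%_. borel)) (%x. \<lambda>i\<in>{s}. eps i x) (PiM {t} (%_. borel)) (%x. \<lambda>i\<in>{t}. eps i x)"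
 by (rule indep_var_restrict[OF eps_indep]) (use assms in auto)

lemma gg_mom:
 assumes "s ~= t"
 shows "NN M (%x. ennreal ((g s x * g t x) powr pm)) <= ennreal Cm"
proof -
 let ?X = "%x. ennreal (g s x powr pm)"
 let ?Y = "%x. ennreal (g t x powr pm)"
 have "NN M (%x. ennreal ((g s x * g t x) powr pm)) = NN M (%x. ?X x * ?Y x)"
  using g_pos(2) by (intro nn_integral_cong) (simp add: powr_mult less_imp_le flip: ennreal_mult)
 also have "... = NN M (%x. NN M (%y. ?X x * ?Y y))"
  using indep_var_nn_integral[OF indep_pair[OF assms], of "%(r, r'). ennreal ((r s ^2 + c0) powr pm) * ennreal ((r' t ^2 + c0) powr pm)"]
  unfolding g_def by simp
 also have "... = (NN M (%x. ?X x)) * (NN M (%x. ?Y x))" by (simp add: nn_integral_cmult nn_integral_multc)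
 also have "... <= ennreal (8 * (B + c0^3)) * ennreal (8 * (B + c0^3))" by (intro mult_mono g_mom) auto
 also have "... <= ennreal Cm" using Cm_ge by (simp add: power2_eq_square flip: ennreal_mult)
 finally show ?thesis .
qed

lemma G_mom: "NN M (%x. ennreal (G s x powr pm)) <= ennreal Cm"
proof -
 let ?X = "%x. abs (eps s x)"
 have "G s x powr pm <= 16 * (?X x powr (4 * pm) + c0^6)" for x
 proof -
  have "G s x powr pm <= 2 powr pm * (((eps s x)^4) powr pm + (2 * c0^2) powr pm)" unfolding G_def using pm c0 by (intro powr_add_le) auto
  also have "... <= 2 powr 2 * (((eps s x)^4) powr pm + (2 * c0^2) powr 2)"
  proof -
   have "1 <= c0^2" using c0 by (simp add: one_le_power)
   then have "1 <= 2 * c0^2" by simp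
   then show ?thesis using pm by (intro mult_mono add_left_mono powr_mono add_nonneg_nonneg) auto
  qed
  also have "((eps s x)^4) powr pm = ?X x powr (4 * pm)"
  proof (cases "eps s x = 0")
   case False
   then have "((eps s x)^4) powr pm = (?X x powr 4) powr pm" by simp
   then show ?thesis by (simp only: powr_powr)
  qed simp
  also have "(2 * c0^2) powr 2 = 4 * c0^4" using c0 by (simp add: power_mult_distrib power_mult[symmetric])
  also have "2 powr 2 * (?X x powr (4 * pm) + 4 * c0^4) <= 16 * (?X x powr (4 * pm) + c0^6)"
   using c0 power_increasing[of 4 6 c0] powr_ge_zero[of "?X x" "4 * pm"] by (simp, linarith)
  finally show ?thesis .
 qed
 then have "NN M (%x. ennreal (G s x powr pm)) <= NN M (%x. ennreal 16 * (ennreal (?X x powr (4 * pm)) + ennreal (c0^6)))"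
  using c0 by (intro nn_integral_mono) (subst ennreal_mult_add, simp, simp, simp, rule ennreal_leI, blast)
 also have "... = ennreal 16 * ((NN M (%x. ennreal (?X x powr (4 * pm)))) + ennreal (c0^6))"
  by (subst nn_integral_cmult, measurable, subst nn_integral_add) (auto simp: emeasure_space_1)
 also have "... <= ennreal 16 * (ennreal B + ennreal (c0^6))" by (intro mult_left_mono add_right_mono eps_mom) auto
 also have "... = ennreal (16 * (B + c0^6))" using c0 B1 by (intro ennreal_mult_add) auto
 also have "... <= ennreal Cm" using Cm_ge by (simp add: ennreal_leI)
 finally show ?thesis .
qed

text \<open>Centred quadratic form in which the strict lower triangle carries the weight of both
  orders of a pair; so the off-diagonal part is a sum of innovations times functions of their
  past.\<close>

definition Qf :: "(int => int => real) => int => int => 'a => real" where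
 "Qf K lo hi x = (SUM s:{lo..hi}. K s s * ((eps s x)^2 - sig2 s) + eps s x * (SUM t:{lo..<s}. K s t * eps t x))"

lemma Qf_meas[measurable]: "Qf K lo hi : borel_measurable M" unfolding Qf_def by measurable

text \<open>Envelopes of the conditional variances of the off-diagonal and the diagonal part of \<^term>\<open>Qf K\<close>:
 they involve only a majorant of the kernel, not the kernel itself.\<close>

definition HO :: "(int => int => real) => real => int => int => 'a => real" where
 "HO kp w lo hi x = (SUM s:{lo..hi}. g s x * (w + (SUM t:{lo..<s}. (kp s t)^2 * g t x)))"

definition HD :: "(int => int => real) => int => int => 'a => real" where
 "HD kp lo hi x = (SUM s:{lo..hi}. (kp s s)^2 * G s x)"

lemma H_meas[measurable]: "HO kp w lo hi : borel_measurable M" "HD kp lo hi : borel_measurable M" unfolding HO_def HD_def by measurable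

lemma sum_int_nat: "(SUM s:{lo..hi}. f s) = (\<Sum>j<nat (hi - lo + 1). f (lo + int j))"
 by (rule sum.reindex_bij_witness[of _ "%j. lo + int j" "%s. nat (s - lo)"]) auto

lemma sum_int_nat': "(SUM t:{lo..<lo + int j}. f t) = (\<Sum>i<j. f (lo + int i))"
 by (rule sum.reindex_bij_witness[of _ "%j. lo + int j" "%s. nat (s - lo)"]) auto

text \<open>The off-diagonal part falls under \<open>quadratic_tail\<close> and gives 4 x^2 sqrt h.
  The diagonal is a linear form in the centred squares; \<open>linear_tail\<close> gives x sqrt (2
  h), at most 2 x sqrt h.\<close>

lemma Qf_tail:
 fixes R :: nat
 assumes w: "w > 0" and x: "x >= 0" and h: "h > 0" "h <= 2^R * w"
  and kp: "!!s t. lo <= t ==> t <= s ==> s <= hi ==> abs (K s t) <= kp s t"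
 shows "prob {y:space M. abs (Qf K lo hi y) > (4 * x^2 + 2 * x) * sqrt h & HO kp w lo hi y <= h & HD kp lo hi y <= h}
   <= (real (nat (hi - lo + 1)) * real (Suc R) + 2) * (2 * exp (-(x^2)))" (is "prob ?A <= _")
proof -
 let ?N = "nat (hi - lo + 1)"
 let ?e = "%j. eps (lo + int j)"
 let ?X = "%j. sig2 (lo + int j)"
 interpret S: indep_centered M ?e "%j. ?X j" by (rule shifted)
 let ?Y = "%j. dvar (lo + int j)"
 interpret D: indep_centered M "%j x. (?e j x)^2 - ?X j" "%j. ?Y j" by (rule shifted_sq)
 define QO where "QO = (%y. \<Sum>s<?N. ?e s y * (\<Sum>t<s. K (lo + int s) (lo + int t) * ?e t y))"
 define QD where "QD = (%y. \<Sum>s<?N. K (lo + int s) (lo + int s) * ((?e s y)^2 - ?X s))"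
 have [measurable]: "QO : borel_measurable M" "QD : borel_measurable M" unfolding QO_def QD_def by measurable
 have Q: "Qf K lo hi y = QD y + QO y" for y unfolding Qf_def QD_def QO_def sum_int_nat sum_int_nat' sum.distrib ..
 have Ksq: "(K s t)^2 <= (kp s t)^2" if "lo <= t" "t <= s" "s <= hi" for s t using kp[OF that] by (metis abs_ge_zero power2_abs power_mono)
 let ?A1 = "{y:space M. abs (QO y) > 4 * x^2 * sqrt h & HO kp w lo hi y <= h}"
 let ?Z = "sqrt (2 * h)"
 let ?A2 = "{y:space M. abs (QD y) > x * ?Z & HD kp lo hi y <= h}"
 have "prob ?A1 <= (real ?N * real (Suc R) + 1) * (2 * exp (-(x^2)))"
  using S.quadratic_tail[of w x c0 ?N "%s t. K (lo + int s) (lo + int t)" "%s t. (kp (lo + int s) (lo + int t))^2" h R, OF w x c0(1) eps2(2) _ h]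
  unfolding QO_def HO_def sum_int_nat sum_int_nat' g_def by (simp add: Ksq)
 moreover have "prob ?A2 <= 2 * exp (-(x^2))"
 proof -
  let ?V = "%y. \<Sum>s<?N. (K (lo + int s) (lo + int s))^2 * (((?e s y)^2 - ?X s)^2 + ?Y s)"
  have VH: "?V y <= HD kp lo hi y" for y unfolding HD_def sum_int_nat
  proof (intro sum_mono mult_mono Ksq)
   fix s
   have a: "((?e s y)^2 - ?X s)^2 <= ((?e s y)^2)^2 + (?X s)^2" by (rule sq_diff_le) (auto simp: eps2)
   have b: "(?X s)^2 <= c0^2" using eps2(2,3)[of "lo + int s"] by (intro power_mono) auto
   have c: "?Y s <= c0^2" using dvar(2)[of "lo + int s"] self_le_power[of c0 2] c0 by simp
   have d: "((?e s y)^2)^2 = (?e s y)^4" by (simp flip: power_mult)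
   show "((?e s y)^2 - ?X s)^2 + ?Y s <= G (lo + int s) y" using a b c unfolding G_def d by linarith
  qed (auto simp: dvar)
  have "prob ?A2 <= prob {y:space M. abs (QD y) > x * ?Z & ?V y <= h}" using VH by (intro finite_measure_mono) (auto intro: order_trans)
  also have "... <= 2 * exp (-(x^2))" unfolding QD_def by (rule D.linear_tail[OF h(1) x])
  finally show ?thesis .
 qed
 moreover have "prob ?A <= prob (?A1 \<union> ?A2)"
 proof (intro finite_measure_mono subsetI)
  fix y assume y: "y : ?A"
  have "x * ?Z <= 2 * x * sqrt h"
  proof -
   have "sqrt 2 <= 2" by (rule real_le_lsqrt) auto
   then have "x * sqrt h * sqrt 2 <= x * sqrt h * 2" using x h by (intro mult_left_mono) auto
   then show ?thesis by (simp add: real_sqrt_mult mult_ac)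
  qed
  then have "~ (abs (QO y) <= 4 * x^2 * sqrt h & abs (QD y) <= x * ?Z)" using y unfolding Q by (auto simp: distrib_right)
  then show "y : ?A1 \<union> ?A2" using y by auto
 qed measurable
 moreover have "prob (?A1 \<union> ?A2) <= prob ?A1 + prob ?A2" by (intro measure_Un_le) measurable
 ultimately show ?thesis by (simp add: algebra_simps)
qed

text \<open>The envelopes are weighted sums of g, of products of g at different times, and of G. All
  have pm-th moments at most \<open>Cm\<close>, and each of the three sums is allowed h/2.\<close>

lemma H_tail:
 assumes w: "w >= 0" and h: "h > 0"
  and W: "real (nat (hi - lo + 1)) * w <= W" "(SUM s:{lo..hi}. SUM t:{lo..s}. (kp s t)^2) <= W"
 shows "prob {y:space M. HO kp w lo hi y > h | HD kp lo hi y > h} <= 3 * Cm * (2 * W / h) powr pm"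
proof -
 define P1 where "P1 = (%y. SUM s:{lo..hi}. w * g s y)"
 define P2 where "P2 = (%y. SUM p:Sigma {lo..hi} (%s. {lo..<s}). (kp (fst p) (snd p))^2 * (g (fst p) y * g (snd p) y))"
 have [measurable]: "P1 : borel_measurable M" "P2 : borel_measurable M" unfolding P1_def P2_def by measurable
 have HOe: "HO kp w lo hi y = P1 y + P2 y" for y
 proof -
  have "P2 y = (SUM s:{lo..hi}. SUM t:{lo..<s}. (kp s t)^2 * (g s y * g t y))" unfolding P2_def by (subst sum.Sigma) (auto simp: split_beta)
  then show ?thesis unfolding HO_def P1_def by (simp add: sum.distrib[symmetric] sum_distrib_left algebra_simps)
 qed
 have h2: "h / 2 > 0" using h by simp
 have split: "(SUM t:{lo..s}. (kp s t)^2) = (kp s s)^2 + (SUM t:{lo..<s}. (kp s t)^2)" if "lo <= s" for s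
 proof -
  have "{lo..s} = insert s {lo..<s}" using that by auto
  then show ?thesis by simp
 qed
 let ?X = "SUM s:{lo..hi}. SUM t:{lo..<s}. (kp s t)^2"
 have Wsplit: "(SUM s:{lo..hi}. (kp s s)^2) + ?X <= W" using W(2) split by (simp add: sum.distrib[symmetric])
 have n1: "(SUM s:{lo..hi}. (kp s s)^2) >= 0" "?X >= 0" by (auto intro!: sum_nonneg)
 have b1: "prob {y:space M. P1 y > h/2} <= Cm * (W / (h/2)) powr pm" unfolding P1_def
  by (rule weighted_sum_tail[OF _ _ _ _ _ _ _ _ h2]) (use w pm W g_pos Cm_ge in \<open>auto intro: order_trans[OF g_mom ennreal_leI]\<close>)
 let ?Y = "SUM p:Sigma {lo..hi} (%s. {lo..<s}). (kp (fst p) (snd p))^2"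
 have b2: "prob {y:space M. P2 y > h/2} <= Cm * (W / (h/2)) powr pm" unfolding P2_def
 proof (rule weighted_sum_tail[OF _ _ _ _ _ _ _ _ h2])
  fix p assume "p : Sigma {lo..hi} (%s. {lo..<s})"
  then have "fst p ~= snd p" by auto
  then show "NN M (%x. ennreal ((g (fst p) x * g (snd p) x) powr pm)) <= ennreal Cm" by (rule gg_mom)
 next
  have "?Y = ?X" by (subst sum.Sigma) (auto simp: split_beta)
  then show "?Y <= W" using Wsplit n1 by linarith
 qed (use pm g_pos Cm_ge in auto)
 have b3: "prob {y:space M. HD kp lo hi y > h/2} <= Cm * (W / (h/2)) powr pm" unfolding HD_def
  by (rule weighted_sum_tail[OF _ _ _ _ _ _ _ _ h2]) (use pm g_pos Cm_ge Wsplit n1 G_mom in auto)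
 have "prob {y:space M. HO kp w lo hi y > h | HD kp lo hi y > h} <=
   prob ({y:space M. P1 y > h/2} \<union> {y:space M. P2 y > h/2} \<union> {y:space M. HD kp lo hi y > h/2})"
  using h by (intro finite_measure_mono) (auto simp: HOe)
 also have "... <= prob {y:space M. P1 y > h/2} + prob {y:space M. P2 y > h/2} + prob {y:space M. HD kp lo hi y > h/2}"
  by (intro order_trans[OF measure_Un_le] add_mono order_refl measure_Un_le) measurable
 finally show ?thesis using b1 b2 b3 by (simp add: field_simps)
qed

end

section \<open>Power-law sums and the dyadic scale\<close>

definition zsum :: "real => real" where
 "zsum \<gamma> = (\<Sum>j. real (max j 1) powr (-1 - \<gamma>))"

lemma zsum_summable: "\<gamma> > 0 ==> summable (%j. real (max j 1) powr (-1 - \<gamma>))"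
proof -
 assume "\<gamma> > 0"
 then have "summable (%j. real j powr (-1 - \<gamma>))" by (subst summable_real_powr_iff) auto
 then show ?thesis by (rule summable_cong[THEN iffD1, rotated]) (auto simp: eventually_sequentially max_def intro!: exI[of _ 1])
qed

lemma zsum_ge: "\<gamma> > 0 ==> finite A ==> (SUM j:A. real (max j 1) powr (-1 - \<gamma>)) <= zsum \<gamma>"
 unfolding zsum_def by (intro sum_le_suminf zsum_summable) auto

lemma zsum_ge_1: "\<gamma> > 0 ==> zsum \<gamma> >= 1" using zsum_ge[of \<gamma> "{0}"] by simp

text \<open>Decay of kernels in the lag. The exponent lies just beyond -1/2, so
  \<open>lam th\<close> is square summable, and it keeps a reserve of th/4 against the actual decay
  \<open>lam (2 * th)\<close> of the kernels.\<close>

definition lam :: "real => int => real" where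
 "lam th l = real_of_int (max l 1) powr (-1/2 - th/4)"

lemma lam_pos: "lam th l > 0" unfolding lam_def by simp

lemma lam_sq_sum:
 assumes "th > 0"
 shows "(SUM t:{lo..s}. (lam th (s - t))^2) <= zsum (th/2)"
proof -
 have sq: "(lam th l)^2 = real_of_int (max l 1) powr (-1 - th/2)" for l
 proof -
  have "(lam th l)^2 = lam th l powr 2" using lam_pos[of th l] by simp
  then show ?thesis unfolding lam_def by (simp add: powr_powr)
 qed
 have "(SUM t:{lo..s}. (lam th (s - t))^2) = (SUM j:nat ` {0..s-lo}. real (max j 1) powr (-1 - th/2))" unfolding sq
  by (rule sum.reindex_bij_witness[of _ "%j. s - int j" "%t. nat (s - t)"]) (auto simp: max_def image_iff intro!: bexI[of _ "s - _"])
 also have "... <= zsum (th/2)" using assms by (intro zsum_ge) auto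
 finally show ?thesis .
qed

text \<open>The innovations that matter for n < 2^(p+1), after truncation of the filters at lag 2^(12 (p+1)).\<close>

definition lo :: "nat => int" where "lo p = - (2 ^ (12 * (p + 1)))"
definition hi :: "nat => int" where "hi p = 2 ^ (p + 1)"

lemma floor_log_at_top: "filterlim floor_log at_top sequentially" unfolding filterlim_at_top eventually_sequentially
proof (intro allI)
 fix P
 show "EX N. ALL n>=N. P <= floor_log n" using floor_log_le_iff[of "2^P"] by (intro exI[of _ "2^P"]) auto
qed

lemma exp_le_two_powr: "exp (- real m) <= (1/2)^m"
proof -
 have "exp (- real m) = (exp (-1))^m" by (simp add: exp_of_nat_mult[symmetric])
 also have "... <= (1/2)^m"
 proof (rule power_mono)
  have "2 <= exp (1::real)" using exp_ge_add_one_self[of 1] by simp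
  then show "exp (-1::real) <= 1/2" by (simp add: exp_minus field_simps)
 qed simp
 finally show ?thesis .
qed

lemma Suc_times_power_tendsto_0:
 fixes r :: real assumes "0 < r" "r < 1"
 shows "(%p. (real p + 1) * r^p) \<longlonglongrightarrow> 0"
proof -
 have "summable (%p. (real (Suc p)) * r^p)" using geometric_deriv_sums[of r] assms by (auto simp: sums_iff)
 then show ?thesis by (auto dest!: summable_LIMSEQ_zero simp: add.commute)
qed

lemma num_bound: "14 * p + 23 <= 64 * (2::nat)^p" by (induction p) auto

context innov
begin

text \<open>The kernels may depend on n and k, but their majorants only on the level p and on one of
  \<open>m p\<close> block indices. So the exceptional sets of the envelopes are summable over p
  even after a union over blocks, while below the envelopes the Gaussian tail survives a union over
  all k <= n with total at most n^-2.\<close>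

lemma quadratic_forms_small:
 fixes K :: "nat => nat => int => int => real" and om :: "nat => nat => int => real"
  and bi :: "nat => nat => nat" and m :: "nat => nat"
 assumes kp: "0 < kp" "kp <= 1" and th: "th > 0"
  and om0: "!!p b s. om p b s >= 0" and dom: "!!n k s t. n >= 1 ==> k <= n ==> lo (floor_log n) <= t ==> t <= s ==> s <= hi (floor_log n) ==>
    abs (K n k s t) <= om (floor_log n) (bi n k) s * lam th (s - t)" and bi: "!!n k. n >= 1 ==> k <= n ==> bi n k < m (floor_log n)"
  and m: "!!p. real (m p) <= C' * 2 powr (kp * p)" and S: "!!p b. b < m p ==> (SUM s:{lo p..hi p}. (om p b s)^2) <= C * 2 powr (p * (1 - kp))"
  and C: "C >= 0" "C' >= 0" and e: "e > 0"
 shows "AE x in M. \<forall>\<^sub>F n in sequentially. ALL k<=n. abs (Qf (K n k) (lo (floor_log n)) (hi (floor_log n)) x) <= e * sqrt n"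
proof -
 \<comment> \<open>The level h p = 2^(p (1 - kp')) has to be o(2^p), so kp' > 0; and (kp - kp') pm
   has to exceed kp to pay for 2^(kp p) blocks, so kp' < kp (1 - 1/pm). Half of this bound is
   taken.\<close>
 define kp' where "kp' = kp * (1 - 1/pm) / 2"
 have kp': "kp' > 0" "kp' < kp" 
 proof -
  define t where "t = kp * (1 - 1/pm)"
  have "0 < 1 - 1/pm" "1 - 1/pm < 1" using pm by auto
  then have "0 < t" "t < kp * 1" unfolding t_def using kp by (auto intro: mult_strict_left_mono simp del: mult_1_right)
  moreover have "kp' = t / 2" unfolding kp'_def t_def ..
  ultimately show "kp' > 0" "kp' < kp" by simp_all
 qed
 define h where "h = (%p::nat. 2 powr (p * (1 - kp')))"
 \<comment> \<open>The floor is so small that the length of the window times w is at most 1; R is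
   then chosen to give 2^R w = 2^p.\<close>
 define w where "w = (%p::nat. (1/2)^(13 * p + 20) :: real)"
 define R where "R = (%p::nat. 14 * p + 20)"
 define N where "N = (%p. nat (hi p - lo p + 1))"
 \<comment> \<open>x^2 = 40 (p + 1): then exp (- x^2) <= 2^(-40 (p + 1)) beats n + 1 values of k,
   about 2^(12 p) rows and all peeling levels, and still leaves n^-2.\<close>
 define x where "x = (%p::nat. sqrt (40 * (p + 1)))"
 define kpf where "kpf = (%p b s t. om p b s * lam th (s - t))"
 have h0: "h p > 0" "h p <= 2^p" for p
 proof -
  show "h p > 0" unfolding h_def by simp
  have "h p <= 2 powr p" unfolding h_def using kp' by (intro powr_mono) (auto simp: mult_left_le)
  then show "h p <= 2^p" by (simp add: powr_realpow)
 qed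
 have hR: "h p <= 2^(R p) * w p" for p
 proof -
  have "(2::real)^(R p) * w p = 2^p * (2^(13*p+20) * (1/2)^(13*p+20))"
   unfolding R_def w_def by (simp add: power_add power_mult[symmetric] flip: power_add)
  also have "(2::real)^(13*p+20) * (1/2)^(13*p+20) = 1" by (simp flip: power_mult_distrib)
  finally show ?thesis using h0(2)[of p] by simp
 qed
 have N: "real (N p) <= 2^(12 * p + 14)" for p
 proof -
  have "hi p - lo p + 1 <= 2^(12*p+14)"
  proof -
   have a: "(2::int)^(p+1) <= 2^(12*p+12)" by (intro power_increasing) auto
   have b: "(1::int) <= 2^(12*p+12)" by simp
   have "hi p - lo p + 1 = 2^(12*p+12) + 2^(p+1) + 1" unfolding hi_def lo_def by (simp add: algebra_simps)
   also have "... <= 4 * 2^(12*p+12)" using a b by linarith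
   also have "... = 2^(12*p+14)" by (simp add: power_add)
   finally show ?thesis .
  qed
  then have "int (N p) <= int (2^(12*p+14))" unfolding N_def by simp
  then have "N p <= 2^(12*p+14)" by (simp only: zle_int)
  then have "real (N p) <= real (2^(12*p+14))" by (simp only: of_nat_le_iff)
  then show ?thesis by simp
 qed
 define C1 where "C1 = 1 + C * zsum (th/2)"
 have C1: "C1 >= 1" unfolding C1_def using C zsum_ge_1[of "th/2"] th by simp
 define W where "W = (%p::nat. C1 * 2 powr (p * (1 - kp)))"
 have W1: "real (nat (hi p - lo p + 1)) * w p <= W p" for p
 proof -
  have "real (N p) * w p <= 2^(12*p+14) * (1/2)^(13*p+20)" unfolding w_def by (intro mult_right_mono N) auto
  also have "... <= 2^(13*p+20) * (1/2)^(13*p+20)" by (intro mult_right_mono power_increasing) auto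
  also have "... = 1" by (simp flip: power_mult_distrib)
  also have "1 <= C1 * 2 powr (p * (1 - kp))"
  proof -
   have "(1::real) <= 2 powr (p * (1 - kp))" using kp by (intro ge_one_powr_ge_zero) auto
   then show ?thesis using C1 by (metis mult_mono' mult_1 zero_le_one)
  qed
  finally show ?thesis unfolding W_def N_def .
 qed
 have W2: "(SUM s:{lo p..hi p}. SUM t:{lo p..s}. (kpf p b s t)^2) <= W p" if b: "b < m p" for p b
 proof -
  have "(SUM s:{lo p..hi p}. SUM t:{lo p..s}. (kpf p b s t)^2) = (SUM s:{lo p..hi p}. (om p b s)^2 * (SUM t:{lo p..s}. (lam th (s - t))^2))"
   unfolding kpf_def by (simp add: power_mult_distrib sum_distrib_left)
  also have "... <= (SUM s:{lo p..hi p}. (om p b s)^2 * zsum (th/2))" using th by (intro sum_mono mult_left_mono lam_sq_sum) auto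
  also have "... = (SUM s:{lo p..hi p}. (om p b s)^2) * zsum (th/2)" by (simp add: sum_distrib_right)
  also have "... <= C * 2 powr (p * (1 - kp)) * zsum (th/2)" using S[OF b] zsum_ge_1[of "th/2"] th by (intro mult_right_mono) auto
  also have "... <= W p" unfolding W_def C1_def by (simp add: algebra_simps)
  finally show ?thesis .
 qed
 define A where "A = (%p. {y:space M. EX b<m p. HO (kpf p b) (w p) (lo p) (hi p) y > h p | HD (kpf p b) (lo p) (hi p) y > h p})"
 have [measurable]: "A p : events" for p unfolding A_def by measurable
 \<comment> \<open>kp + (kp' - kp) pm = - eta: the exponent of the number of blocks plus that of the
   Markov bound.\<close>
 define eta where "eta = kp * (pm - 1) / 2"
 have eta: "eta > 0" unfolding eta_def using kp pm by simp
 define C2 where "C2 = C' * (3 * Cm * (2 * C1) powr pm)"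
 have PA: "prob (A p) <= C2 * (2 powr (-eta))^p" for p
 proof -
  let ?E = "%b. {y:space M. HO (kpf p b) (w p) (lo p) (hi p) y > h p | HD (kpf p b) (lo p) (hi p) y > h p}"
  have "A p = (UN b:{..<m p}. ?E b)" unfolding A_def by auto
  then have "prob (A p) <= (\<Sum>b<m p. prob (?E b))" by (simp only:) (intro measure_UNION_le, auto)
  also have "... <= (\<Sum>b<m p. 3 * Cm * (2 * W p / h p) powr pm)" by (intro sum_mono H_tail W1 W2 h0) (auto simp: w_def)
  also have "... = real (m p) * (3 * Cm * (2 * W p / h p) powr pm)" by simp
  also have "... <= (C' * 2 powr (kp * p)) * (3 * Cm * (2 * W p / h p) powr pm)" using Cm_ge by (intro mult_right_mono m) auto
  also have "2 * W p / h p = 2 * C1 * 2 powr (p * (kp' - kp))"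
    
  proof -
   have "2 powr (p * (1 - kp)) / 2 powr (p * (1 - kp')) = 2 powr (p * (kp' - kp))"
    by (simp only: powr_diff[symmetric]) (simp add: algebra_simps)
   then show ?thesis unfolding W_def h_def by (metis (no_types) mult.assoc times_divide_eq_right)
  qed
  also have "(2 * C1 * 2 powr (p * (kp' - kp))) powr pm = (2 * C1) powr pm * 2 powr (p * (kp' - kp) * pm)"
   using C1 by (simp add: powr_mult powr_powr)
  also have "(C' * 2 powr (kp * p)) * (3 * Cm * ((2 * C1) powr pm * 2 powr (p * (kp' - kp) * pm))) = C2 * (2 powr (kp * p) * 2 powr (p * (kp' - kp) * pm))"
   unfolding C2_def by simp
  also have "2 powr (kp * p) * 2 powr (p * (kp' - kp) * pm) = 2 powr (-eta * p)"
  proof -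
   have "kp * p + p * (kp' - kp) * pm = -eta * p" unfolding eta_def kp'_def using pm by (simp add: field_simps)
   then show ?thesis by (simp only: powr_add[symmetric])
  qed
  also have "2 powr (-eta * p) = (2 powr (-eta))^p" 
  proof -
   have "(2 powr (-eta))^p = (2 powr (-eta)) powr (real p)" by (simp add: powr_realpow)
   then show ?thesis by (simp only: powr_powr)
  qed
  finally show ?thesis .
 qed
 have "summable (%p. C2 * (2 powr (-eta))^p)" using eta by (intro summable_mult summable_geometric) (simp add: powr_less_one)
 then have "summable (%p. prob (A p))" by (rule summable_comparison_test'[where N=0]) (use PA in auto)
 then have AE1: "AE y in M. \<forall>\<^sub>F p in sequentially. y : space M - A p"
  by (intro borel_cantelli_AE1) (auto simp: emeasure_eq_measure)
 define b where "b = (%p. (4 * (x p)^2 + 2 * x p) * sqrt (h p))"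
 let ?X = "%n. floor_log n"
 define Bn where "Bn = (%n. {y:space M. EX k<=n. abs (Qf (K n k) (lo (?X n)) (hi (?X n)) y) > b (?X n) &
   HO (kpf (?X n) (bi n k)) (w (?X n)) (lo (?X n)) (hi (?X n)) y <= h (?X n) &
   HD (kpf (?X n) (bi n k)) (lo (?X n)) (hi (?X n)) y <= h (?X n)})"
 have [measurable]: "Bn n : events" for n unfolding Bn_def by measurable
 let ?Y = "%R p. real (Suc (R p))"
 have PB: "prob (Bn n) <= inverse (real n ^ 2)" if n: "n >= 1" for n
 proof -
  define p where "p = ?X n"
  have np: "n < 2 * 2^p" "2^p <= n" unfolding p_def using floor_log_exp2_gt[of n] floor_log_exp2_le[of n] n by auto
  let ?E = "%k. {y:space M. abs (Qf (K n k) (lo p) (hi p) y) > b p &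
    HO (kpf p (bi n k)) (w p) (lo p) (hi p) y <= h p & HD (kpf p (bi n k)) (lo p) (hi p) y <= h p}"
  have "Bn n = (UN k:{..n}. ?E k)" unfolding Bn_def p_def by auto
  then have "prob (Bn n) <= (SUM k<=n. prob (?E k))" by (simp only:) (intro measure_UNION_le, auto)
  also have "... <= (SUM k<=n. (real (N p) * ?Y R p + 2) * (2 * exp (-((x p)^2))))" unfolding b_def N_def
  proof (intro sum_mono Qf_tail)
   fix k assume k: "k : {..n}"
   show "w p > 0" unfolding w_def by simp
   show "x p >= 0" unfolding x_def by simp
   show "h p > 0" "h p <= 2^(R p) * w p" by (rule h0 hR)+
   show "abs (K n k s t) <= kpf p (bi n k) s t" if "lo p <= t" "t <= s" "s <= hi p" for s t
    unfolding kpf_def p_def using dom[OF n, of k t s] k that unfolding p_def by auto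
  qed
  also have "... = real (n + 1) * ((real (N p) * ?Y R p + 2) * (2 * exp (-((x p)^2))))" by simp
  also have "... <= 2^(p+2) * (2^(13*p+20) * (2 * (1/2)^(40 * (p+1))))"
  proof (intro mult_mono)
   show "real (n + 1) <= 2^(p+2)"
   proof -
    have "n + 1 <= 2^(p+2)" using np by simp
    then have "real (n + 1) <= real (2^(p+2))" by (simp only: of_nat_le_iff)
    then show ?thesis by simp
   qed
   show "real (N p) * ?Y R p + 2 <= 2^(13*p+20)"
   proof -
    have "real (14 * p + 23) <= real (64 * 2^p)" using num_bound[of p] by (simp only: of_nat_le_iff)
    then have r: "?Y R p + 2 <= 2^(p+6)" unfolding R_def by (simp add: power_add)
    have "real (N p) * ?Y R p + 2 <= 2^(12*p+14) * ?Y R p + 2^(12*p+14) * 2" using N[of p] by (intro add_mono mult_right_mono) auto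
    also have "... = 2^(12*p+14) * (?Y R p + 2)" by (simp only: distrib_left)
    also have "... <= 2^(12*p+14) * 2^(p+6)" using r by (intro mult_left_mono) auto
    also have "... = 2^(13*p+20)" by (simp flip: power_add)
    finally show ?thesis .
   qed
   have "(x p)^2 = real (40 * (p+1))" unfolding x_def by simp
   then show "exp (-((x p)^2)) <= (1/2)^(40 * (p+1))" by (simp only: exp_le_two_powr)
  qed auto
  also have "... = 2^((p+2) + (13*p+20) + 1) * (1/2)^(40 * (p+1))" by (simp only: power_add power_one_right mult_ac)
  also have "(p+2) + (13*p+20) + 1 = 14*p+23" by simp
  also have "(2::real)^(14*p+23) * (1/2)^(40 * (p+1)) <= 2^(38*p+38) * (1/2)^(40 * (p+1))" by (intro mult_right_mono power_increasing) auto
  also have "... = (1/2)^(2*(p+1))"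
  proof -
   have a1: "(1/2::real)^(40*(p+1)) = (1/2)^(38*p+38) * (1/2)^(2*(p+1))"
   proof -
    have "40*(p+1) = (38*p+38) + 2*(p+1)" by simp
    then show ?thesis by (simp only: power_add)
   qed
   have a2: "(2::real)^(38*p+38) * (1/2)^(38*p+38) = 1" by (simp flip: power_mult_distrib)
   show ?thesis unfolding a1 mult.assoc[symmetric] a2 by simp
  qed
  also have "... = inverse ((2 * 2^p)^2)"
  proof -
   have "(1/2::real)^(2*(p+1)) = inverse (2^(2*(p+1)))" by (simp add: power_one_over inverse_eq_divide)
   also have "(2::real)^(2*(p+1)) = (2^(p+1))^2" by (simp only: power_mult[symmetric] mult.commute)
   finally show ?thesis by simp
  qed
  also have "... <= inverse (real n ^ 2)"
  proof (intro le_imp_inverse_le power_mono)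
   have "real n <= real (2 * 2^p)" using np by (simp only: of_nat_le_iff)
   then show "real n <= 2 * 2^p" by simp
  qed (use n in auto)
  finally show ?thesis .
 qed
 have "summable (%n. inverse (real n ^ 2))" by (rule inverse_power_summable) simp
 then have "summable (%n. prob (Bn n))" by (rule summable_comparison_test'[where N=1]) (use PB in auto)
 then have AE2: "AE y in M. \<forall>\<^sub>F n in sequentially. y : space M - Bn n"
  by (intro borel_cantelli_AE1) (auto simp: emeasure_eq_measure)
 let ?Z = "%kp'. 2 powr (-kp'/2)"
 have lim: "(%p. 240 * ((real p + 1) * (?Z kp')^p)) \<longlonglongrightarrow> 240 * 0"
  using kp' by (intro tendsto_mult tendsto_const Suc_times_power_tendsto_0) (auto simp: powr_less_one)
 then have "\<forall>\<^sub>F p in sequentially. 240 * ((real p + 1) * (?Z kp')^p) < e" by (rule order_tendstoD) (use e in auto)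
 then have ev0: "\<forall>\<^sub>F n in sequentially. 240 * ((real (?X n) + 1) * (?Z kp')^(?X n)) < e"
  by (rule eventually_compose_filterlim[OF _ floor_log_at_top])
 have bb: "b p <= 240 * ((real p + 1) * (?Z kp')^p) * sqrt (2^p)" for p
 proof -
  have x1: "x p >= 1" unfolding x_def by simp
  have "x p <= (x p)^2" using x1 by (simp add: self_le_power)
  then have "4 * (x p)^2 + 2 * x p <= 6 * (x p)^2" by simp
  also have "... = 240 * (real p + 1)" unfolding x_def by simp
  finally have 1: "4 * (x p)^2 + 2 * x p <= 240 * (real p + 1)" .
  have "sqrt (h p) = 2 powr (p * (1 - kp') / 2)" unfolding h_def by (simp add: powr_half_sqrt[symmetric] powr_powr)
  also have "... = (?Z kp')^p * sqrt (2^p)"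
   by (simp add: powr_half_sqrt[symmetric] powr_powr powr_realpow[symmetric] powr_add[symmetric] algebra_simps diff_divide_distrib)
  finally have 2: "sqrt (h p) = (?Z kp')^p * sqrt (2^p)" .
  have "b p <= 240 * (real p + 1) * sqrt (h p)" unfolding b_def using 1 h0(1)[of p] by (intro mult_right_mono) auto
  then show ?thesis unfolding 2 by (simp add: algebra_simps)
 qed
 have ev: "\<forall>\<^sub>F n in sequentially. b (?X n) <= e * sqrt n" using ev0 eventually_ge_at_top[of "1::nat"]
 proof eventually_elim
  case (elim n)
  let ?p = "?X n"
  have "2^?p <= n" using floor_log_exp2_le[of n] elim by auto
  then have "real (2^?p) <= real n" by (simp only: of_nat_le_iff)
  then have s: "sqrt (2^?p) <= sqrt n" by simp
  have "b ?p <= 240 * ((real ?p + 1) * (?Z kp')^?p) * sqrt (2^?p)" by (rule bb)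
  also have "... <= e * sqrt n" using elim s e by (intro mult_mono) auto
  finally show ?case .
 qed
 show ?thesis using AE1 AE2
 proof eventually_elim
  case (elim y)
  have "\<forall>\<^sub>F n in sequentially. y : space M - A (?X n)" by (rule eventually_compose_filterlim[OF elim(1) floor_log_at_top])
  then show ?case using elim(2) ev eventually_ge_at_top[of "1::nat"]
  proof eventually_elim
   case (elim n)
   show ?case
   proof (intro allI impI)
    fix k assume k: "k <= n"
    have "HO (kpf (?X n) (bi n k)) (w (?X n)) (lo (?X n)) (hi (?X n)) y <= h (?X n)"
     "HD (kpf (?X n) (bi n k)) (lo (?X n)) (hi (?X n)) y <= h (?X n)"
     using elim(1) bi[OF elim(4) k] unfolding A_def not_less[symmetric] by blast+
    then have "abs (Qf (K n k) (lo (?X n)) (hi (?X n)) y) <= b (?X n)" using elim(2) k unfolding Bn_def by (auto simp: not_less)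
    then show "abs (Qf (K n k) (lo (?X n)) (hi (?X n)) y) <= e * sqrt n" using elim(3) by simp
   qed
  qed
 qed
qed

end

section \<open>Kernels of the partial sums\<close>

text \<open>Square root of the coefficient hypothesis. The class is stable under weighted sums over
  components, A0 being multiplied by the l1-norm of the weights.\<close>

definition adm :: "real => real => (nat => real) => bool" where
 "adm th A0 a \<longleftrightarrow> (ALL j. abs (a j) <= A0 * real (max j 1) powr (-3/4 - th/2))"

text \<open>\<open>fcoef\<close> with the sums over components collapsed: a and b will be the scalar
  filters that belong to the two weighting vectors.\<close>

definition F :: "(nat => real) => (nat => real) => nat => nat => real" where
 "F a b l j = (if l = 0 then a j * b j else a j * b (j + l) + b j * a (j + l))"

definition Ft :: "(nat => real) => (nat => real) => nat => real" where
 "Ft a b l = (\<Sum>j. F a b l j)"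

text \<open>Kernels of the partial sums of the product of two filters truncated at lag J (\<open>Kx\<close>) and of the sum of the
 sub-block variables over ]s1, s2] (\<open>KT\<close>).\<close>

definition Fz :: "nat => (nat => real) => (nat => real) => int => int => real" where
 "Fz J a b l z = (if 0 <= z & z + l <= int J then F a b (nat l) (nat z) else 0)"

definition Kx :: "nat => (nat => real) => (nat => real) => nat => int => int => real" where
 "Kx J a b k s t = (SUM i:{1..k}. Fz J a b (s - t) (int i - s))"

definition KT :: "nat => (nat => real) => (nat => real) => int => int => int => int => real" where
 "KT u a b s1 s2 s t = (if s1 < s & s <= s2 & (s - 1) div int u = (t - 1) div int u then Ft a b (nat (s - t)) else 0)"

lemma powr_antimono: "0 < x ==> x <= y ==> 0 <= e ==> y powr (- e) <= x powr (- (e::real))" by (rule powr_mono2') auto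

definition pij :: "real => nat => real" where "pij th j = real (max j 1) powr (-1 - th/2)"

lemma pij_pos: "pij th j > 0" unfolding pij_def by simp

text \<open>Of the exponent -3/4 - th/2 at j + l, the part -1/2 - th/2 is spent on the lag l and the
  remaining -1/4 on the position j, where it completes the factor at j to a summable weight.\<close>

lemma F_bound:
 assumes th: "0 < th" and a: "adm th A0 a" and b: "adm th A0 b"
 shows "abs (F a b l j) <= 2 * A0^2 * (lam (2 * th) (int l) * pij th j)"
proof -
 let ?r = "-3/4 - th/2"
 have "abs (a 0) <= A0" using a[unfolded adm_def, rule_format, of 0] by simp
 then have A0: "A0 >= 0" by linarith
 let ?Y = "real (max (j + l) 1)"
 let ?Z = "real (max j 1)"
 let ?U = "- (1/2 + th/2)"
 let ?W = "lam (2 * th) (int l)"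
 let ?S = "real (max l 1)"
 have key: "?Z powr ?r * ?Y powr ?r <= ?W * pij th j"
 proof -
  have split: "x powr ?r = x powr ?U * x powr (- (1/4))" if "x > 0" for x :: real by (simp add: powr_add[symmetric])
  have "?Y powr ?r = ?Y powr ?U * ?Y powr (- (1/4))" by (rule split) auto
  also have "... <= ?S powr ?U * ?Z powr (- (1/4))" using th by (intro mult_mono powr_antimono) auto
  finally have "?Z powr ?r * ?Y powr ?r <=
    ?Z powr ?r * (?S powr ?U * ?Z powr (- (1/4)))" by (intro mult_left_mono) auto
  also have "... = ?S powr ?U * ?Z powr (?r - 1/4)" by (simp add: powr_add[symmetric] mult.left_commute)
  also have "?S powr ?U = ?W" unfolding lam_def by (simp add: max_def)
  also have "?Z powr (?r - 1/4) = pij th j" unfolding pij_def by (simp add: algebra_simps)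
  finally show ?thesis .
 qed
 let ?X = "?W * pij th j"
 have ab: "abs (x j * y (j + l)) <= A0^2 * ?X" if x: "adm th A0 x" and y: "adm th A0 y" for x y
 proof -
  have "abs (x j * y (j + l)) <= (A0 * ?Z powr ?r) * (A0 * ?Y powr ?r)" using x y A0 unfolding adm_def abs_mult by (intro mult_mono) auto
  also have "... = A0^2 * (?Z powr ?r * ?Y powr ?r)" by (simp add: power2_eq_square)
  also have "... <= A0^2 * ?X" by (intro mult_left_mono key) auto
  finally show ?thesis .
 qed
 have p: "0 <= A0^2 * ?X" using lam_pos pij_pos by (simp add: less_imp_le)
 show ?thesis
 proof (cases "l = 0")
  case True
  then show ?thesis using ab[OF a b] p unfolding F_def by simp
 next
  case False
  have "abs (F a b l j) <= abs (a j * b (j + l)) + abs (b j * a (j + l))" using False unfolding F_def by simp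
  also have "... <= A0^2 * ?X + A0^2 * ?X" by (intro add_mono ab a b)
  finally show ?thesis by (simp add: algebra_simps)
 qed
qed

lemma lam_le: "0 < th ==> lam (2 * th) l <= lam th l" unfolding lam_def by (intro powr_mono) auto

text \<open>For lags of at least o' the reserve th/4 between the two exponents turns into the gain
  o' powr (- th/4).\<close>

lemma lam_split:
 assumes "0 < th" "1 <= o'" "o' <= l"
 shows "lam (2 * th) l <= lam th l * real_of_int o' powr (- (th/4))"
proof -
 have "lam (2 * th) l = lam th l * real_of_int (max l 1) powr (- (th/4))" unfolding lam_def by (simp add: powr_add[symmetric] algebra_simps)
 also have "... <= lam th l * real_of_int o' powr (- (th/4))" using assms lam_pos[of th l] by (intro mult_left_mono powr_antimono) auto
 finally show ?thesis .
qed

lemma pij_sum: "0 < th ==> finite A ==> (SUM j:A. pij th j) <= zsum (th/2)" unfolding pij_def by (rule zsum_ge) auto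

lemma pij_summable: "0 < th ==> summable (pij th)" unfolding pij_def by (rule zsum_summable) auto

lemma pij_tail:
 assumes th: "0 < th" and A: "finite A" "!!j. j : A ==> m <= j" and m: "m >= 1"
 shows "(SUM j:A. pij th j) <= real m powr (- (th/4)) * zsum (th/4)"
proof -
 let ?X = "%j. real (max j 1)"
 have "(SUM j:A. pij th j) <= (SUM j:A. real m powr (- (th/4)) * ?X j powr (-1 - th/4))"
 proof (intro sum_mono)
  fix j assume j: "j : A"
  have "pij th j = ?X j powr (- (th/4)) * ?X j powr (-1 - th/4)" unfolding pij_def by (simp add: powr_add[symmetric] algebra_simps)
  also have "... <= real m powr (- (th/4)) * ?X j powr (-1 - th/4)" using A(2)[OF j] m th by (intro mult_right_mono powr_antimono) auto
  finally show "pij th j <= real m powr (- (th/4)) * ?X j powr (-1 - th/4)" .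
 qed
 also have "... <= real m powr (- (th/4)) * zsum (th/4)"
  unfolding sum_distrib_left[symmetric] using th A by (intro mult_left_mono zsum_ge) auto
 finally show ?thesis .
qed

context
 fixes th A0 :: real and a b :: "nat => real"
 assumes th: "0 < th" and a: "adm th A0 a" and b: "adm th A0 b"
begin

lemma F_summable: "summable (F a b l)" "summable (%j. abs (F a b l j))"
proof -
 have "summable (%j. 2 * A0^2 * (lam (2 * th) (int l) * pij th j))" using pij_summable[OF th] by (intro summable_mult)
 then show "summable (%j. abs (F a b l j))" by (rule summable_comparison_test'[where N=0]) (use F_bound[OF th a b] in auto)
 then show "summable (F a b l)" by (rule summable_rabs_cancel)
qed

lemma Ft_tail_bound:
 assumes m: "m >= 1"
 shows "abs (Ft a b l - (\<Sum>j<m. F a b l j)) <= 2 * A0^2 * zsum (th/4) * (lam (2 * th) (int l) * real m powr (- (th/4)))"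
proof -
 let ?Y = "%j. F a b l (j + m)"
 have s: "summable (%j. ?Y j)" "summable (%j. abs (?Y j))"
  using F_summable by (simp_all add: summable_iff_shift[of "F a b l"] summable_iff_shift[of "%j. abs (F a b l j)"])
 let ?X = "lam (2 * th) (int l)"
 have "Ft a b l - (\<Sum>j<m. F a b l j) = (\<Sum>j. ?Y j)" unfolding Ft_def using suminf_minus_initial_segment[OF F_summable(1)] by simp
 also have "abs (...) <= (\<Sum>j. abs (?Y j))" by (rule summable_rabs[OF s(2)])
 also have "... <= 2 * A0^2 * zsum (th/4) * (?X * real m powr (- (th/4)))"
 proof (rule suminf_le_const[OF s(2)])
  fix n
  have "(\<Sum>j<n. abs (?Y j)) <= (\<Sum>j<n. 2 * A0^2 * (?X * pij th (j + m)))" by (intro sum_mono F_bound[OF th a b])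
  also have "... = 2 * A0^2 * ?X * (\<Sum>j<n. pij th (j + m))" by (simp only: sum_distrib_left mult.assoc)
  also have "(\<Sum>j<n. pij th (j + m)) = (SUM j:(%j. j + m) ` {..<n}. pij th j)" by (subst sum.reindex) auto
  also have "2 * A0^2 * ?X * ... <= 2 * A0^2 * ?X * (real m powr (- (th/4)) * zsum (th/4))"
   using lam_pos[of "2*th" "int l"] m by (intro mult_left_mono pij_tail th) auto
  finally show "(\<Sum>j<n. abs (?Y j)) <= 2 * A0^2 * zsum (th/4) * (?X * real m powr (- (th/4)))" by (simp add: mult_ac)
 qed
 finally show ?thesis .
qed

lemma Ft_bound: "abs (Ft a b l) <= 2 * A0^2 * zsum (th/2) * lam (2 * th) (int l)"
proof -
 let ?X = "lam (2 * th) (int l)"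
 have "abs (Ft a b l) <= (\<Sum>j. abs (F a b l j))" unfolding Ft_def by (rule summable_rabs[OF F_summable(2)])
 also have "... <= 2 * A0^2 * zsum (th/2) * ?X"
 proof (rule suminf_le_const[OF F_summable(2)])
  fix n
  have "(\<Sum>j<n. abs (F a b l j)) <= (\<Sum>j<n. 2 * A0^2 * (?X * pij th j))" by (intro sum_mono F_bound[OF th a b])
  also have "... = 2 * A0^2 * ?X * (\<Sum>j<n. pij th j)" by (simp only: sum_distrib_left mult.assoc)
  also have "... <= 2 * A0^2 * ?X * zsum (th/2)" using lam_pos[of "2*th" "int l"] by (intro mult_left_mono pij_sum th) auto
  finally show "(\<Sum>j<n. abs (F a b l j)) <= 2 * A0^2 * zsum (th/2) * ?X" by (simp add: mult_ac)
 qed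
 finally show ?thesis .
qed

lemma Fz_bound: "0 <= l ==> abs (Fz J a b l z) <= (if 0 <= z then 2 * A0^2 * (lam (2 * th) l * pij th (nat z)) else 0)"
 unfolding Fz_def using F_bound[OF th a b, of "nat l" "nat z"] lam_pos[of "2*th" l] pij_pos[of th "nat z"] by (auto simp: less_imp_le)

lemma Kx_bound_gen:
 assumes ts: "t <= s" and A: "finite A"
 shows "(SUM i:A. abs (Fz J a b (s - t) (int i - s))) <= 2 * A0^2 * lam (2 * th) (s - t) * (SUM i:{i:A. s <= int i}. pij th (nat (int i - s)))"
proof -
 let ?X = "%i. lam (2 * th) (s - t) * pij th (nat (int i - s))"
 have "(SUM i:A. abs (Fz J a b (s - t) (int i - s))) <= (SUM i:A. if s <= int i then 2 * A0^2 * (?X i) else 0)"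
  using Fz_bound[of "s - t" J "int _ - s"] ts by (intro sum_mono) (auto split: if_splits)
 also have "... = (SUM i:{i:A. s <= int i}. 2 * A0^2 * ?X i)" using A by (simp add: sum.inter_filter)
 finally show ?thesis by (simp add: sum_distrib_left mult_ac)
qed

lemma Kx_bound_pos:
 assumes ts: "t <= s"
 shows "abs (Kx J a b k s t) <= 2 * A0^2 * zsum (th/2) * lam (2 * th) (s - t)"
proof -
 let ?X = "SUM i:{i:{1..k}. s <= int i}. pij th (nat (int i - s))"
 let ?Y = "lam (2 * th) (s - t)"
 have "abs (Kx J a b k s t) <= (SUM i:{1..k}. abs (Fz J a b (s - t) (int i - s)))" unfolding Kx_def by (rule sum_abs)
 also have "... <= 2 * A0^2 * ?Y * ?X" by (rule Kx_bound_gen[OF ts]) simp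
 also have "?X = (SUM j:(%i. nat (int i - s)) ` {i:{1..k}. s <= int i}. pij th j)" by (subst sum.reindex) (auto simp: inj_on_def)
 also have "2 * A0^2 * ?Y * ... <= 2 * A0^2 * ?Y * zsum (th/2)" using lam_pos[of "2*th" "s - t"] by (intro mult_left_mono pij_sum th) auto
 finally show ?thesis by (simp add: mult_ac)
qed

text \<open>The weight (i - s)^(-1 - th/2) of an innovation before time 1 is split. The power 1/2 +
  th/8 goes to 1 - s, so that squares are summable over the past; the rest goes to i, and what it
  lacks for summability is at most N^(1/2 - th/4).\<close>

lemma Kx_bound_neg:
 assumes ts: "t <= s" and s: "s <= 0" and k: "k <= N" and th2: "th <= 2"
 shows "abs (Kx J a b k s t) <= 2 * A0^2 * zsum (th/8) * lam (2 * th) (s - t) *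
   (real N powr (1/2 - th/4) * real_of_int (1 - s) powr (- (1/2 + th/8)))"
proof -
 let ?X = "SUM i:{i:{1..k}. s <= int i}. pij th (nat (int i - s))"
 let ?W = "abs (Kx J a b k s t)"
 let ?S = "lam (2 * th) (s - t)"
 have "?W <= (SUM i:{1..k}. abs (Fz J a b (s - t) (int i - s)))" unfolding Kx_def by (rule sum_abs)
 also have "... <= 2 * A0^2 * ?S * ?X" by (rule Kx_bound_gen[OF ts]) simp
 finally have 1: "?W <= 2 * A0^2 * ?S * ?X" .
 let ?Z = "- (1/2 + th/8)"
 let ?U = "real_of_int (1 - s)"
 let ?Y = "real N powr (1/2 - th/4) * ?U powr ?Z"
 let ?T = "- (1/2 + 3*th/8)"
 have "?X <=
   (SUM i:{i:{1..k}. s <= int i}. ?Y * real (max i 1) powr (-1 - th/8))"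
 proof (intro sum_mono)
  fix i assume i: "i : {i:{1..k}. s <= int i}"
  let ?j = "real (max (nat (int i - s)) 1)"
  have j: "?j = real_of_int (int i - s)" using i s by (auto simp: max_def)
  have "pij th (nat (int i - s)) = ?j powr ?Z * ?j powr ?T" unfolding pij_def by (simp add: powr_add[symmetric] algebra_simps)
  also have "... <= ?U powr ?Z * real i powr ?T" unfolding j using i s th by (intro mult_mono powr_antimono) auto
  also have "real i powr ?T = real i powr (1/2 - th/4) * real i powr (-1 - th/8)" using i by (simp add: powr_add[symmetric] algebra_simps)
  also have "?U powr ?Z * ... <= ?U powr ?Z * (real N powr (1/2 - th/4) * real i powr (-1 - th/8))"
   using i k th2 by (intro mult_left_mono mult_right_mono powr_mono2) auto
  finally show "pij th (nat (int i - s)) <= ?Y * real (max i 1) powr (-1 - th/8)" using i by (simp add: max_absorb1 mult_ac)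
 qed
 also have "... <= ?Y * zsum (th/8)" unfolding sum_distrib_left[symmetric] using th by (intro mult_left_mono zsum_ge) auto
 finally have S: "?X <= ..." .
 have "?W <= 2 * A0^2 * ?S * (real N powr (1/2 - th/4) * ?U powr ?Z * zsum (th/8))"
  using lam_pos[of "2*th" "s - t"] by (intro order_trans[OF 1 mult_left_mono[OF S]]) auto
 then show ?thesis by (simp only: mult_ac)
qed

text \<open>Only i >= s contribute, and i - t < k <= J, so the truncation at lag J is never felt:
  what remains is a partial sum of the series \<open>Ft\<close>.\<close>

lemma Kx_eq:
 assumes ts: "t <= s" and t: "1 <= t" and sk: "s <= int k" and J: "k <= J"
 shows "Kx J a b k s t = (\<Sum>j<nat (int k - s + 1). F a b (nat (s - t)) j)"
proof -
 have "Kx J a b k s t = (SUM i:{i:{1..k}. s <= int i}. Fz J a b (s - t) (int i - s))"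
  unfolding Kx_def by (intro sum.mono_neutral_right) (auto simp: Fz_def)
 also have "... = (\<Sum>j<nat (int k - s + 1). F a b (nat (s - t)) j)" using ts t sk J
  by (intro sum.reindex_bij_witness[of _ "%j. nat (int j + s)" "%i. nat (int i - s)"]) (auto simp: Fz_def)
 finally show ?thesis .
qed

text \<open>One constant for the three kernel bounds, whose sums have the exponents -1 - th/2, -1 -
  th/4 and -1 - th/8.\<close>

definition "CK = 2 * A0^2 * (zsum (th/2) + zsum (th/4) + zsum (th/8))"

lemma CK: "2 * A0^2 * zsum (th/2) <= CK" "2 * A0^2 * zsum (th/4) <= CK" "2 * A0^2 * zsum (th/8) <= CK" "0 <= CK"
proof -
 have "zsum (th/2) >= 0" "zsum (th/4) >= 0" "zsum (th/8) >= 0"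
  using zsum_ge_1[of "th/2"] zsum_ge_1[of "th/4"] zsum_ge_1[of "th/8"] th by auto
 then show "2 * A0^2 * zsum (th/2) <= CK" "2 * A0^2 * zsum (th/4) <= CK" "2 * A0^2 * zsum (th/8) <= CK" "0 <= CK"
  unfolding CK_def by (auto intro!: mult_left_mono mult_nonneg_nonneg add_nonneg_nonneg)
qed

end

text \<open>Row majorant of the remainder kernel: s <= 0 is the past, ]0, bq] the completed blocks, with losses near
 the right end bq and near the left end of each sub-block, and ]bq, bq + q] the current block.\<close>

definition om0 :: "real => nat => nat => nat => nat => int => real" where
 "om0 th N q u bq s = (if s <= 0 then real N powr (1/2 - th/4) * real_of_int (1 - s) powr (- (1/2 + th/8))
   else if s <= int bq then real_of_int (int bq - s + 1) powr (- (th/4)) + real_of_int ((s - 1) mod int u + 1) powr (- (th/4))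
   else if s <= int bq + int q then 1 else 0)"

lemma om0_nonneg: "0 <= om0 th N q u bq s" unfolding om0_def by auto

text \<open>For s in a completed block there are two sources of error. If s and t share a sub-block,
  the partial sum of \<open>Ft\<close> has k - s + 1 >= bq - s + 1 terms, and its tail decays in
  that distance. Otherwise the lag is at least the position of s in its sub-block, and
  \<open>lam_split\<close> converts this into decay in the position.\<close>

lemma KR_bound:
 assumes th: "0 < th" "th <= 2" and a: "adm th A0 a" and b: "adm th A0 b"
  and ts: "t <= s" and q: "q >= 1" and u: "u >= 1" and k: "k <= N" "N <= J" and bq: "bq <= k" "k < bq + q"
 shows "abs (Kx J a b k s t - KT u a b 0 (int bq) s t) <= CK th A0 * om0 th N q u bq s * lam th (s - t)"
proof -
 let ?K = "Kx J a b k s t" and ?T = "KT u a b 0 (int bq) s t"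
 note CK' = CK[OF th(1) a b]
 let ?X = "lam (2 * th) (s - t)"
 let ?Z = "lam th (s - t)"
 have l0: "0 < ?X" "0 < ?Z" by (rule lam_pos)+
 let ?Y = "real_of_int (int bq - s + 1)"
 let ?U = "(s - 1) div int u"
 let ?W = "om0 th N q u bq s"
 have fin: "x <= CK th A0 * ?W * ?Z"
  if x: "x <= C * ?X * y" "C <= CK th A0" "0 <= y" "?X * y <= ?W * ?Z" for x y C
 proof -
  have "x <= C * (?X * y)" using x(1) by (simp add: mult.assoc)
  also have "... <= CK th A0 * (?X * y)" using x l0 by (intro mult_right_mono) auto
  also have "... <= CK th A0 * (?W * ?Z)" using x CK'(4) by (intro mult_left_mono) auto
  finally show ?thesis by (simp add: mult.assoc)
 qed
 consider "s <= 0" | "0 < s" "s <= int bq" | "int bq < s" "s <= int bq + int q" | "int bq + int q < s" by linarith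
 then show ?thesis
 proof cases
  case 1
  then have T: "?T = 0" unfolding KT_def by auto
  show ?thesis unfolding T using Kx_bound_neg[OF th(1) a b ts 1 k(1) th(2), of J] 1 lam_le[OF th(1), of "s - t"]
   by (intro fin[where y="real N powr (1/2 - th/4) * real_of_int (1 - s) powr (- (1/2 + th/8))" and C="2 * A0^2 * zsum (th/8)"])
     (auto simp: CK' om0_def mult.commute[of "lam _ _"] intro!: mult_left_mono)
 next
  case 2
  show ?thesis
  proof (cases "(s - 1) div int u = (t - 1) div int u")
   case True
   have "0 <= (s - 1) div int u" using 2 u by (simp add: pos_imp_zdiv_nonneg_iff)
   then have t: "1 <= t" using True u by (simp add: pos_imp_zdiv_nonneg_iff)
   let ?m = "nat (int k - s + 1)"
   have m1: "?m >= 1" using 2 bq by auto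
   have T: "?T = Ft a b (nat (s - t))" unfolding KT_def using 2 True by auto
   have K: "?K = (\<Sum>j<?m. F a b (nat (s - t)) j)" by (rule Kx_eq[OF th(1) a b ts t]) (use 2 bq k in auto)
   have "abs (?K - ?T) <= 2 * A0^2 * zsum (th/4) * (lam (2 * th) (int (nat (s - t))) * real ?m powr (- (th/4)))"
    using Ft_tail_bound[OF th(1) a b m1, of "nat (s - t)"] unfolding K T by (simp add: abs_minus_commute)
   also have "real ?m powr (- (th/4)) <= ?Y powr (- (th/4))" using 2 bq th by (intro powr_antimono) auto
   finally have "abs (?K - ?T) <= 2 * A0^2 * zsum (th/4) * ?X * ?Y powr (- (th/4))"
    using ts l0 zsum_ge_1[of "th/4"] th by (simp add: mult_left_mono mult.assoc)
   then show ?thesis using 2 lam_le[OF th(1), of "s - t"] l0 by (intro fin[where y="?Y powr (- (th/4))" and C="2 * A0^2 * zsum (th/4)"])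
      (auto simp: CK' om0_def mult.commute[of "lam _ _"] distrib_right intro!: mult_left_mono add_increasing2)
  next
   case False
   then have T: "?T = 0" unfolding KT_def by auto
   \<comment> \<open>Position of s in its sub-block, counted from 1. Here t lies before the
     sub-block, so the lag is at least this position.\<close>
   define o' where "o' = (s - 1) mod int u + 1"
   have o1: "1 <= o'" unfolding o'_def using u by simp
   have "(t - 1) div int u < (s - 1) div int u" using False zdiv_mono1[of "t - 1" "s - 1" "int u"] ts u by auto
   then have "t - 1 < int u * ?U" using zdiv_mono1[of "int u * ?U" "t - 1" "int u"] u by (cases "t - 1 < int u * ?U") auto
   then have o2: "o' <= s - t" unfolding o'_def using mult_div_mod_eq[of "int u" "s - 1"] by linarith
   show ?thesis unfolding T using Kx_bound_pos[OF th(1) a b ts, of J k] 2 lam_split[OF th(1) o1 o2] l0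
    by (intro fin[where y=1 and C="2 * A0^2 * zsum (th/2)"])
      (auto simp: CK' om0_def o'_def[symmetric] distrib_right mult.commute[of "lam _ _"] intro!: add_increasing)
  qed
 next
  case 3
  then have T: "?T = 0" unfolding KT_def by auto
  show ?thesis unfolding T using Kx_bound_pos[OF th(1) a b ts, of J k] 3 lam_le[OF th(1), of "s - t"]
   by (intro fin[where y=1 and C="2 * A0^2 * zsum (th/2)"]) (auto simp: CK' om0_def)
 next
  case 4
  then have T: "?T = 0" unfolding KT_def by auto
  have K: "?K = 0" unfolding Kx_def using 4 bq by (intro sum.neutral) (auto simp: Fz_def)
  show ?thesis unfolding T K using CK' om0_nonneg[of th N q u bq s] l0 by (simp add: mult_nonneg_nonneg)
 qed
qed

lemma KT_bound:
 assumes th: "0 < th" "th <= 2" and a: "adm th A0 a" and b: "adm th A0 b" and ts: "t <= s"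
 shows "abs (KT u a b (int bq) (int bq + int q) s t) <= CK th A0 * om0 th N q u bq s * lam th (s - t)"
proof -
 note CK' = CK[OF th(1) a b]
 have l0: "0 < lam (2 * th) (s - t)" "0 < lam th (s - t)" by (rule lam_pos)+
 let ?X = "KT u a b (int bq) (int bq + int q) s t"
 show ?thesis
 proof (cases "int bq < s & s <= int bq + int q")
  case True
  have "abs (?X) <= abs (Ft a b (nat (s - t)))" unfolding KT_def by auto
  also have "... <= 2 * A0^2 * zsum (th/2) * lam (2 * th) (s - t)" using Ft_bound[OF th(1) a b, of "nat (s - t)"] ts by simp
  also have "... <= CK th A0 * lam th (s - t)" using CK' lam_le[OF th(1), of "s - t"] l0 by (intro mult_mono) auto
  also have "... = CK th A0 * om0 th N q u bq s * lam th (s - t)" using True by (simp add: om0_def)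
  finally show ?thesis .
 next
  case False
  then have "?X = 0" unfolding KT_def by auto
  then show ?thesis using CK' om0_nonneg[of th N q u bq s] l0 by (simp add: mult_nonneg_nonneg)
 qed
qed

lemma powr_sum_le:
 assumes "0 < th" "th <= 2"
 shows "(SUM i:{1..Q::nat}. real i powr (- (th/2))) <= real Q powr (1 - th/4) * zsum (th/4)"
proof -
 have "(SUM i:{1..Q}. real i powr (- (th/2))) <= (SUM i:{1..Q}. real Q powr (1 - th/4) * real (max i 1) powr (-1 - th/4))"
 proof (intro sum_mono)
  fix i assume i: "i : {1..Q}"
  have "real i powr (- (th/2)) = real i powr (1 - th/4) * real i powr (-1 - th/4)" using i by (simp add: powr_add[symmetric])
  also have "... <= real Q powr (1 - th/4) * real (max i 1) powr (-1 - th/4)"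
   using i assms by (subst max_absorb1) (auto intro!: mult_right_mono powr_mono2)
  finally show "real i powr (- (th/2)) <= real Q powr (1 - th/4) * real (max i 1) powr (-1 - th/4)" .
 qed
 also have "... <= real Q powr (1 - th/4) * zsum (th/4)"
  unfolding sum_distrib_left[symmetric] using assms by (intro mult_left_mono zsum_ge) auto
 finally show ?thesis .
qed

text \<open>The past contributes N^(1 - th/2), the distance to bq contributes N^(1 - th/4), and the
  current block q. Each sub-block contributes u^(1 - th/4), which over at most N/u sub-blocks makes
  N u^(- th/4).\<close>

lemma om0_sq_sum:
 assumes th: "0 < th" "th <= 1" and u: "u >= 1" and bq: "bq = u * R" "bq <= N"
 shows "(SUM s:{l1..l2}. (om0 th N q u bq s)^2) <=
   zsum (th/4) * (real N powr (1 - th/2) + 2 * real N powr (1 - th/4) + 2 * (real N * real u powr (- (th/4)))) + real q"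
proof -
 let ?f = "%s. (om0 th N q u bq s)^2"
 let ?Y = "zsum (th/4)"
 have z: "?Y >= 1" using zsum_ge_1[of "th/4"] th by simp
 have bqN: "real bq <= real N" using bq(2) by simp
 have sq: "(x powr (- e))^2 = x powr (- (2 * e))" for x e :: real by (simp add: power2_eq_square powr_add[symmetric])
 let ?X = "%s. (s - 1) mod int u + 1"
 let ?Z = "SUM s:{l1..0} \<union> {1..int bq} \<union> {int bq + 1..int bq + int q}. ?f s"
 let ?U = "SUM s:{1..int bq}. real_of_int (int bq - s + 1) powr (- (th/2))"
 let ?W = "SUM s:{1..int bq}. real_of_int (?X s) powr (- (th/2))"
 let ?S = "%s. real_of_int (1 - s)"
 let ?T = "SUM s:{l1..0}. real_of_int (1 - s) powr (- 1 - th/4)"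
 let ?R = "%s. nat ((s - 1) div int u)"
 let ?Q = "SUM s:{1..int bq}. ?f s"
 let ?P = "%s. real_of_int (int bq - s + 1)"
 let ?D = "SUM s:{int bq + 1..int bq + int q}. ?f s"
 let ?E = "SUM s:{l1..0}. ?f s"
 let ?F = "%s. real_of_int (?X s)"
 have "(SUM s:{l1..l2}. ?f s) <= ?Z"
 proof -
  have "(SUM s:{l1..l2}. ?f s) = (SUM s:{l1..l2} \<inter> {s. s <= int bq + int q}. ?f s)"
   by (rule sum.mono_neutral_right) (auto simp: om0_def)
  also have "... <= ?Z" by (rule sum_mono2) auto
  finally show ?thesis .
 qed
 also have "... = ?E + ?Q + ?D" by (subst sum.union_disjoint, auto)+
 also have "?D = (SUM s:{int bq + 1..int bq + int q}. 1)" by (intro sum.cong) (auto simp: om0_def)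
 also have "... = real q" by simp
 also have "?E <= real N powr (1 - th/2) * ?Y"
 proof -
  have "?E = (SUM s:{l1..0}. real N powr (1 - th/2) * ?S s powr (- 1 - th/4))"
  proof (intro sum.cong refl)
   fix s assume "s : {l1..0}"
   then have "?f s = (real N powr (1/2 - th/4))^2 * (?S s powr (- (1/2 + th/8)))^2" by (simp add: om0_def power_mult_distrib)
   also have "(real N powr (1/2 - th/4))^2 = real N powr (1 - th/2)" by (simp add: power2_eq_square powr_add[symmetric])
   also have "(?S s powr (- (1/2 + th/8)))^2 = ?S s powr (- 1 - th/4)" unfolding sq by (simp add: algebra_simps)
   finally show "?f s = real N powr (1 - th/2) * ?S s powr (- 1 - th/4)" .
  qed
  also have "... = real N powr (1 - th/2) * ?T" by (simp add: sum_distrib_left)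
  also have "?T = (SUM j:{1..nat (1 - l1)}. real j powr (-1 - th/4))"
   by (rule sum.reindex_bij_witness[of _ "%j. 1 - int j" "%s. nat (1 - s)"]) auto
  also have "... = (SUM j:{1..nat (1 - l1)}. real (max j 1) powr (-1 - th/4))" by (intro sum.cong refl) (auto simp: max_absorb1)
  also have "real N powr (1 - th/2) * ... <= real N powr (1 - th/2) * ?Y" using th by (intro mult_left_mono zsum_ge) auto
  finally show ?thesis .
 qed
 also have "?Q <= 2 * (real N powr (1 - th/4) * ?Y) + 2 * (real N * real u powr (- (th/4)) * ?Y)"
 proof -
  have "?Q <= (SUM s:{1..int bq}. 2 * ?P s powr (- (th/2)) + 2 * ?F s powr (- (th/2)))"
  proof (intro sum_mono)
   fix s assume s: "s : {1..int bq}"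
   have "(x + y)^2 <= 2 * x^2 + 2 * y^2" for x y :: real using zero_le_power2[of "x - y"] by (simp add: power2_eq_square algebra_simps)
   note this[of "?P s powr (- (th/4))" "?F s powr (- (th/4))"]
   then show "?f s <= 2 * ?P s powr (- (th/2)) + 2 * ?F s powr (- (th/2))" unfolding sq using s by (simp add: om0_def)
  qed
  also have "... = 2 * ?U + 2 * ?W" by (simp add: sum.distrib sum_distrib_left)
  also have "?U = (SUM i:{1..bq}. real i powr (- (th/2)))"
   by (rule sum.reindex_bij_witness[of _ "%j. int bq + 1 - int j" "%s. nat (int bq - s + 1)"]) auto
  also have "... <= real bq powr (1 - th/4) * ?Y" using th by (intro powr_sum_le) auto
  also have "... <= real N powr (1 - th/4) * ?Y" using bqN th z by (intro mult_right_mono powr_mono2) auto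
  \<comment> \<open>As bq is a multiple of u, s runs exactly once through all pairs of a sub-block
    and a position in it.\<close>
  also have "?W = (SUM (r, i):{..<R} \<times> {1..u}. real i powr (- (th/2)))"
  proof (rule sum.reindex_bij_witness[of _ "%(r, i). int r * int u + int i" "%s. (?R s, nat (?X s))"])
   fix s assume s: "s : {1..int bq}"
   have m: "0 <= (s - 1) mod int u" "(s - 1) mod int u < int u" using u by auto
   have d0: "0 <= (s - 1) div int u" using s u by (simp add: pos_imp_zdiv_nonneg_iff)
   have "s - 1 < int u * int R" using s bq(1) by auto
   have dR: "(s - 1) div int u < int R"
   proof (rule ccontr)
    assume "~ (s - 1) div int u < int R"
    then have "int u * int R <= int u * ((s - 1) div int u)" by (intro mult_left_mono) auto
    then show False using \<open>s - 1 < int u * int R\<close> mult_div_mod_eq[of "int u" "s - 1"] m(1) by linarith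
   qed
   show "(case (?R s, nat (?X s)) of (r, i) => int r * int u + int i) = s" using m d0 div_mult_mod_eq[of "s - 1" "int u"] by simp
   show "(?R s, nat (?X s)) : {..<R} \<times> {1..u}" using m d0 dR by auto
   show "(case (?R s, nat (?X s)) of (r, i) => real i powr (- (th/2))) = ?F s powr (- (th/2))" using m by simp
  next
   fix x assume "x : {..<R} \<times> {1..u}"
   then obtain r i where x: "x = (r, i)" "r < R" "1 <= i" "i <= u" by auto
   have e: "int r * int u + int i - 1 = (int i - 1) + int r * int u" by simp
   have "(int r * int u + int i - 1) div int u = int r" "(int r * int u + int i - 1) mod int u = int i - 1"
    unfolding e using x u by (simp_all add: div_mult_self1 div_pos_pos_trivial)
   then show "(nat (((case x of (r, i) => int r * int u + int i) - 1) div int u), nat (((case x of (r, i) => int r * int u + int i) - 1) mod int u + 1)) = x"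
    using x by simp
   have "int r * int u + int u <= int R * int u" using x by (metis mult.commute mult_left_mono of_nat_0_le_iff of_nat_Suc of_nat_le_iff Suc_leI distrib_left mult_1_right add.commute)
   moreover have "1 <= int r * int u + int i"
   proof -
    have "0 <= int r * int u" by (intro mult_nonneg_nonneg) auto
    then show ?thesis using x(3) by linarith
   qed
   ultimately show "(case x of (r, i) => int r * int u + int i) : {1..int bq}" using x bq(1) by (simp add: mult.commute)
  qed
  also have "... = real R * (SUM i:{1..u}. real i powr (- (th/2)))" by (simp add: sum.cartesian_product[symmetric])
  also have "... <= real R * (real u powr (1 - th/4) * ?Y)" using th by (intro mult_left_mono powr_sum_le) auto
  also have "real u powr (1 - th/4) = real u * real u powr (- (th/4))" using powr_add[of "real u" 1 "- (th/4)"] u by simp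
  also have "real R * (real u * real u powr (- (th/4)) * ?Y) = real bq * real u powr (- (th/4)) * ?Y" unfolding bq(1) by simp
  also have "... <= real N * real u powr (- (th/4)) * ?Y" using bqN z by (intro mult_right_mono) auto
  finally show ?thesis by simp
 qed
 finally show ?thesis by (simp add: algebra_simps)
qed

text \<open>Lengths of blocks and sub-blocks at the dyadic level p.\<close>

definition qlen :: "nat => nat => nat" where "qlen ka p = 2^(p - p div ka)"
definition ulen :: "nat => nat => nat" where "ulen kc p = 2^(p div kc)"

lemma sum_times_sum_split:
 fixes P Q :: "nat => real"
 shows "(\<Sum>j<N. P j) * (\<Sum>j<N. Q j) = (\<Sum>j<N. P j * Q j + (\<Sum>i<j. P j * Q i + Q j * P i))"
proof (induction N)
 case (Suc N)
 have "(\<Sum>j<Suc N. P j) * (\<Sum>j<Suc N. Q j) = (\<Sum>j<N. P j) * (\<Sum>j<N. Q j) + (P N * Q N + (P N * (\<Sum>i<N. Q i) + Q N * (\<Sum>i<N. P i)))"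
  by (simp add: algebra_simps)
 also have "P N * (\<Sum>i<N. Q i) + Q N * (\<Sum>i<N. P i) = (\<Sum>i<N. P N * Q i + Q N * P i)" by (simp add: sum.distrib sum_distrib_left)
 finally show ?case using Suc by simp
qed simp

lemma powr_two_div:
 assumes "k >= 1"
 shows "real (p div k) <= real p / real k" "real p / real k <= real (p div k) + 1"
proof -
 have "p div k * k <= p" "p <= k + p div k * k" using assms dividend_less_div_times[of k p] by (auto simp: less_imp_le)
 then have "real (p div k * k) <= real p" "real p <= real (k + p div k * k)" by (simp_all only: of_nat_le_iff)
 then show "real (p div k) <= real p / real k" "real p / real k <= real (p div k) + 1" using assms by (simp_all add: field_simps)
qed

section \<open>Truncated linear processes and sub-block sums as quadratic forms\<close>

context innov
begin

definition linJ :: "nat => (nat => real) => int => 'a => real" where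
 "linJ J a i x = (SUM j<=J. a j * eps (i - int j) x)"

lemma linJ_meas[measurable]: "linJ J a i : borel_measurable M" unfolding linJ_def by measurable

text \<open>Quadratic form of the sub-block ]m', m' + u] with weights depending on the lag only. For
  ph = \<open>Ft a b\<close> its variance is the finite sum behind alpha with n' = u.\<close>

definition tau :: "nat => (nat => real) => nat => 'a => real" where
 "tau u ph m' x = (SUM j:{1..u}. ph 0 * ((eps (int (m' + j)) x)^2 - sig2 (int (m' + j)))
   + eps (int (m' + j)) x * (SUM l:{1..<j}. ph (j - l) * eps (int (m' + l)) x))"

lemma tau_meas[measurable]: "tau u ph m' : borel_measurable M" unfolding tau_def by measurable

lemma eps_prod: "integrable M (%x. eps s x * eps t x)" "expectation (%x. eps s x * eps t x) = (if s = t then sig2 s else 0)"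
proof -
 let ?X = "integrable M (%x. eps s x * eps t x)"
 let ?Y = "expectation (%x. eps s x * eps t x)"
 have "?X & ?Y = (if s = t then sig2 s else 0)"
 proof (cases "s = t")
  case True
  then show ?thesis using eps2(1)[of s] by (simp add: sig2_def power2_eq_square)
 next
  case False
  have i: "indep_vars (%_. borel) eps {s, t}" by (rule indep_vars_subset[OF eps_indep]) auto
  show ?thesis using indep_vars_lebesgue_integral[OF _ i eps1] indep_vars_integrable[OF _ i eps1] False by (simp add: eps_mean)
 qed
 then show "?X" "?Y = (if s = t then sig2 s else 0)" by auto
qed

lemma linJ_alt:
 assumes "l1 <= i - int J" "i <= l2"
 shows "linJ J a i x = (SUM s:{l1..l2}. (if 0 <= i - s & i - s <= int J then a (nat (i - s)) else 0) * eps s x)"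
proof -
 have "(SUM s:{l1..l2}. (if 0 <= i - s & i - s <= int J then a (nat (i - s)) else 0) * eps s x) =
   (SUM s:{i - int J..i}. a (nat (i - s)) * eps s x)" using assms by (intro sum.mono_neutral_cong_right) auto
 also have "... = (SUM j<=J. a j * eps (i - int j) x)" by (rule sum.reindex_bij_witness[of _ "%j. i - int j" "%s. nat (i - s)"]) auto
 finally show ?thesis unfolding linJ_def ..
qed

lemma linJ_product:
 assumes "l1 <= i - int J" "i <= l2"
 shows "linJ J a i x * linJ J b i x = (SUM s:{l1..l2}. Fz J a b 0 (i - s) * (eps s x)^2 +
   eps s x * (SUM t:{l1..<s}. Fz J a b (s - t) (i - s) * eps t x))"
proof -
 let ?al = "%s. (if 0 <= i - s & i - s <= int J then a (nat (i - s)) else 0) * eps s x"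
 let ?be = "%s. (if 0 <= i - s & i - s <= int J then b (nat (i - s)) else 0) * eps s x"
 have 1: "?al s * ?be s = Fz J a b 0 (i - s) * (eps s x)^2" for s by (auto simp: Fz_def F_def power2_eq_square)
 have 2: "?al s * ?be t + ?be s * ?al t = eps s x * (Fz J a b (s - t) (i - s) * eps t x)" if "t < s" for s t
 proof -
  have n: "nat (i - s) + nat (s - t) = nat (i - t)" if "0 <= i - s" using that \<open>t < s\<close> by auto
  show ?thesis using that n by (auto simp: Fz_def F_def algebra_simps)
 qed
 have "linJ J a i x * linJ J b i x = (SUM s:{l1..l2}. ?al s) * (SUM s:{l1..l2}. ?be s)" unfolding linJ_alt[OF assms] ..
 also have "... = (SUM s:{l1..l2}. ?al s * ?be s + (SUM t:{l1..<s}. ?al s * ?be t + ?be s * ?al t))"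
  unfolding sum_int_nat sum_times_sum_split sum_int_nat' ..
 also have "... = (SUM s:{l1..l2}. Fz J a b 0 (i - s) * (eps s x)^2 + eps s x * (SUM t:{l1..<s}. Fz J a b (s - t) (i - s) * eps t x))"
  unfolding 1 sum_distrib_left by (intro sum.cong refl arg_cong2[where f="(+)"]) (rule 2, auto)
 finally show ?thesis .
qed

lemma linJ_product_centered:
 assumes "l1 <= i - int J" "i <= l2"
 shows "integrable M (%x. linJ J a i x * linJ J b i x)"
  "linJ J a i x * linJ J b i x - expectation (%x. linJ J a i x * linJ J b i x) = Qf (%s t. Fz J a b (s - t) (i - s)) l1 l2 x"
proof -
 have e: "linJ J a i x * linJ J b i x = (SUM s:{l1..l2}. Fz J a b 0 (i - s) * (eps s x * eps s x) +
   (SUM t:{l1..<s}. Fz J a b (s - t) (i - s) * (eps s x * eps t x)))" for x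
  unfolding linJ_product[OF assms] by (simp add: sum_distrib_left power2_eq_square mult_ac)
 show "integrable M (%x. linJ J a i x * linJ J b i x)"
  unfolding e by (intro Bochner_Integration.integrable_sum Bochner_Integration.integrable_add integrable_mult_right eps_prod)
 let ?X = "expectation (%x. linJ J a i x * linJ J b i x)"
 have "?X = (SUM s:{l1..l2}. Fz J a b 0 (i - s) * sig2 s + (SUM t:{l1..<s}. Fz J a b (s - t) (i - s) * 0))" unfolding e
  by (subst Bochner_Integration.integral_sum, intro Bochner_Integration.integrable_sum Bochner_Integration.integrable_add integrable_mult_right eps_prod,
    intro sum.cong refl, subst Bochner_Integration.integral_add,
    (intro Bochner_Integration.integrable_sum Bochner_Integration.integrable_add integrable_mult_right eps_prod)+,
    subst Bochner_Integration.integral_sum, intro integrable_mult_right eps_prod) (auto simp: eps_prod intro!: sum.neutral)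
 then show "linJ J a i x * linJ J b i x - ?X = Qf (%s t. Fz J a b (s - t) (i - s)) l1 l2 x"
  unfolding linJ_product[OF assms] Qf_def by (simp add: sum_subtractf[symmetric] algebra_simps)
qed

lemma Qf_sum: "finite A ==> (SUM i:A. Qf (K i) l1 l2 x) = Qf (%s t. SUM i:A. K i s t) l1 l2 x"
proof (induction A rule: finite_induct)
 case empty
 then show ?case by (simp add: Qf_def)
next
 case (insert j A)
 then show ?case by (simp add: Qf_def sum.distrib[symmetric] algebra_simps sum_distrib_left)
qed

lemma Qf_diff: "Qf K1 l1 l2 x - Qf K2 l1 l2 x = Qf (%s t. K1 s t - K2 s t) l1 l2 x"
 by (simp add: Qf_def sum_subtractf sum.distrib algebra_simps sum_distrib_left)

lemma Xtrunc_eq: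
 assumes "l1 <= 1 - int J" "int k <= l2"
 shows "(SUM i:{1..k}. linJ J a (int i) x * linJ J b (int i) x - expectation (%x. linJ J a (int i) x * linJ J b (int i) x)) = Qf (Kx J a b k) l1 l2 x"
proof -
 have "(SUM i:{1..k}. linJ J a (int i) x * linJ J b (int i) x - expectation (%x. linJ J a (int i) x * linJ J b (int i) x))
  = (SUM i:{1..k}. Qf (%s t. Fz J a b (s - t) (int i - s)) l1 l2 x)" by (intro sum.cong refl linJ_product_centered) (use assms in auto)
 also have "... = Qf (Kx J a b k) l1 l2 x" unfolding Kx_def by (rule Qf_sum) simp
 finally show ?thesis .
qed

lemma sum_blocks:
 fixes f :: "int => real"
 shows "r0 <= r1 ==> (SUM s:{int (r0 * u) + 1..int (r1 * u)}. f s) = (SUM r:{r0..<r1}. SUM j:{1..u}. f (int (r * u + j)))"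
proof (induction r1)
 case (Suc r1)
 let ?X = "%r1. SUM s:{int (r1 * u) + 1..int (r1 * u) + int u}. f s"
 show ?case
 proof (cases "r0 <= r1")
  case True
  have le: "int (r0 * u) <= int (r1 * u)" using True by (simp add: mult_right_mono)
  have e: "int (Suc r1 * u) = int (r1 * u) + int u" by simp
  have "{int (r0 * u) + 1..int (Suc r1 * u)} = {int (r0 * u) + 1..int (r1 * u)} \<union> {int (r1 * u) + 1..int (r1 * u) + int u}"
  proof -
   have "{A + 1..B + int u} = {A + 1..B} \<union> {B + 1..B + int u}" if "A <= B" for A B using that by auto
   from this[OF le] show ?thesis unfolding e .
  qed
  then have "(SUM s:{int (r0 * u) + 1..int (Suc r1 * u)}. f s) = (SUM s:{int (r0 * u) + 1..int (r1 * u)}. f s) + ?X r1"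
   by (simp only:) (rule sum.union_disjoint, auto)
  also have "?X r1 = (SUM j:{1..u}. f (int (r1 * u + j)))"
   by (rule sum.reindex_bij_witness[of _ "%j. int (r1 * u) + int j" "%s. nat (s - int (r1 * u))"]) auto
  finally show ?thesis using Suc True by simp
 next
  case False
  then have "r0 = Suc r1" using Suc by simp
  then show ?thesis by simp
 qed
qed simp

lemma same_block_iff:
 assumes j: "1 <= j" "j <= (u::nat)"
 shows "(int (r * u + j) - 1) div int u = (t - 1) div int u \<longleftrightarrow> int (r * u) < t & t <= int (r * u) + int u"
proof -
 have u: "u >= 1" using j by simp
 have e: "int (r * u + j) - 1 = (int j - 1) + int r * int u" by simp
 have 1: "(int (r * u + j) - 1) div int u = int r" unfolding e using j by (simp add: div_mult_self1 div_pos_pos_trivial)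
 have "int r = (t - 1) div int u \<longleftrightarrow> int r * int u <= t - 1 & t - 1 < (int r + 1) * int u"
 proof
  assume h: "int r = (t - 1) div int u"
  have "(t - 1) div int u * int u + (t - 1) mod int u = t - 1" by (rule div_mult_mod_eq)
  moreover have "0 <= (t - 1) mod int u" "(t - 1) mod int u < int u" using u by auto
  ultimately show "int r * int u <= t - 1 & t - 1 < (int r + 1) * int u" unfolding h[symmetric] distrib_right by auto
 next
  assume h: "int r * int u <= t - 1 & t - 1 < (int r + 1) * int u"
  have "(t - 1 - int r * int u + int r * int u) div int u = int r + (t - 1 - int r * int u) div int u" using u by (intro div_mult_self1) auto
  moreover have "(t - 1 - int r * int u) div int u = 0" using h by (intro div_pos_pos_trivial) (auto simp: distrib_right)
  ultimately show "int r = (t - 1) div int u" by simp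
 qed
 then show ?thesis unfolding 1 by (auto simp: algebra_simps)
qed

text \<open>Sub-blocks are intervals ]r u, (r + 1) u], so s and t share one exactly if s - 1 and t -
  1 have the same quotient by u; that condition in \<open>KT\<close> switches off all pairs across
  sub-blocks.\<close>

lemma tau_sum_eq:
 assumes "r0 <= r1" "l1 <= 1" "int (r1 * u) <= l2" and u: "u >= 1"
 shows "(SUM r:{r0..<r1}. tau u (Ft a b) (r * u) x) = Qf (KT u a b (int (r0 * u)) (int (r1 * u))) l1 l2 x"
proof -
 let ?Y = "%r0. int (r0 * u)"
 let ?K = "KT u a b (?Y r0) (int (r1 * u))"
 let ?f = "%s. ?K s s * ((eps s x)^2 - sig2 s) + eps s x * (SUM t:{l1..<s}. ?K s t * eps t x)"
 have r0: "0 <= ?Y r0" by simp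
 let ?X = "%j r. SUM l:{1..<j}. Ft a b (j - l) * eps (int (r * u + l)) x"
 have "Qf ?K l1 l2 x = (SUM s:{int (r0 * u) + 1..int (r1 * u)}. ?f s)" unfolding Qf_def
 proof (intro sum.mono_neutral_right)
  have "l1 <= ?Y r0 + 1" using assms(2) r0 by linarith
  then show "{int (r0 * u) + 1..int (r1 * u)} <= {l1..l2}" using assms(3) by (auto simp del: of_nat_mult)
 qed (auto simp: KT_def simp del: of_nat_mult)
 also have "... = (SUM r:{r0..<r1}. SUM j:{1..u}. ?f (int (r * u + j)))" by (rule sum_blocks[OF assms(1)])
 also have "... = (SUM r:{r0..<r1}. tau u (Ft a b) (r * u) x)" unfolding tau_def
 proof (intro sum.cong refl arg_cong2[where f="(+)"] arg_cong2[where f="(*)"])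
  fix r j assume r: "r : {r0..<r1}" and j: "j : {1..u}"
  let ?s = "int (r * u + j)"
  have in1: "?Y r0 < ?s"
  proof -
   have "r0 * u <= r * u" using r by simp
   moreover have "1 <= j" using j by simp
   ultimately have "r0 * u < r * u + j" by linarith
   then show ?thesis by (simp only: of_nat_less_iff)
  qed
  have in2: "?s <= int (r1 * u)"
  proof -
   have "Suc r * u <= r1 * u" using r by (intro mult_right_mono) auto
   moreover have "j <= u" "Suc r * u = r * u + u" using j by auto
   ultimately have "r * u + j <= r1 * u" by linarith
   then show ?thesis by (simp only: of_nat_le_iff)
  qed
  show "?K ?s ?s = Ft a b 0" unfolding KT_def using in1 in2 by simp
  have Kt: "?K ?s t = (if ?Y r < t & t <= ?Y r + int u then Ft a b (nat (?s - t)) else 0)" for t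
   unfolding KT_def using in1 in2 same_block_iff[of j u r t] j by auto
  have "(SUM t:{l1..<?s}. ?K ?s t * eps t x) = (SUM t:{int (r * u) + 1..<?s}. Ft a b (nat (?s - t)) * eps t x)"
  proof (rule sum.mono_neutral_cong_right)
   show "{int (r * u) + 1..<?s} <= {l1..<?s}" using assms(2) by (auto intro: order_trans[of _ 1])
   show "ALL t:{l1..<?s} - {int (r * u) + 1..<?s}. ?K ?s t * eps t x = 0" unfolding Kt by auto
   show "?K ?s t * eps t x = Ft a b (nat (?s - t)) * eps t x" if "t : {int (r * u) + 1..<?s}" for t unfolding Kt using that j by auto
  qed simp
  also have "... = ?X j r" by (rule sum.reindex_bij_witness[of _ "%l. int (r * u + l)" "%t. nat (t - ?Y r)"])
     (auto simp: nat_diff_distrib' intro!: arg_cong2[where f="(*)"] arg_cong[where f="Ft a b"])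
  finally show "(SUM t:{l1..<?s}. ?K ?s t * eps t x) = ?X j r" .
 qed
 finally show ?thesis ..
qed

text \<open>All lengths are powers of two, and ka, kc >= 2 gives p div kc + p div ka <= p, so
  sub-blocks fit exactly into blocks and blocks exactly into 2^(p+1).\<close>

lemma ulen_qlen:
 assumes "2 <= ka" "2 <= kc"
 shows "qlen ka p = ulen kc p * (qlen ka p div ulen kc p)" "qlen ka p >= 1" "ulen kc p >= 1"
  "2^(p+1) = 2^(1 + p div ka) * qlen ka p"
proof -
 have "p div kc + p div ka <= p div 2 + p div 2" using assms by (intro add_mono div_le_mono2) auto
 also have "... <= p" by simp
 finally have "p div kc <= p - p div ka" by simp
 then have "ulen kc p dvd qlen ka p" unfolding ulen_def qlen_def by (rule le_imp_power_dvd)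
 then show "qlen ka p = ulen kc p * (qlen ka p div ulen kc p)" by simp
 have "p div ka <= p" by simp
 then have "p + 1 = (1 + p div ka) + (p - p div ka)" by simp
 then show "2^(p+1) = 2^(1 + p div ka) * qlen ka p" unfolding qlen_def power_add[symmetric] by simp
qed (auto simp: qlen_def ulen_def)

text \<open>Every contribution has to be of the order 2^(p (1 - 1/ka)) of one block length. The
  critical one is N u^(- th/4) with u about 2^(p/kc), which is why 1/ka <= th / (4 kc) is
  imposed.\<close>

lemma om_sum_small:
 assumes th: "0 < th" "th <= 1" and ka: "2 <= ka" "2 <= kc" "4 * real kc <= th * real ka"
  and b: "b < 2^(1 + p div ka)"
 shows "(SUM s:{l1..l2}. (CK th A0 * om0 th (2^(p+1)) (qlen ka p) (ulen kc p) (b * qlen ka p) s)^2)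
  <= (CK th A0)^2 * (14 * zsum (th/4) + 2) * 2 powr (p * (1 - 1 / real ka))"
proof -
 let ?X = "1 - 1 / real ka"
 let ?N = "2^(p+1) :: nat" and ?q = "qlen ka p" and ?u = "ulen kc p" and ?e = "2 powr (p * ?X)"
 note uq = ulen_qlen[OF ka(1,2), of p]
 have z: "zsum (th/4) >= 1" using zsum_ge_1[of "th/4"] th by simp
 have kp: "1 / real ka <= th / (4 * real kc)" using ka by (simp add: field_simps)
 have "th / (4 * real kc) <= th / 4" using th ka by (simp add: field_simps)
 with kp have kp2: "1 / real ka <= th / 4" by simp
 have bN: "b * ?q <= ?N" unfolding uq(4) using b by (intro mult_right_mono) auto
 have bu: "b * ?q = ?u * (b * (?q div ?u))" using uq(1) by (metis mult.left_commute)
 let ?Y = "1 - p * (1 / real ka)"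
 let ?Z = "real (p div kc)"
 let ?U = "real (p - p div ka)"
 have "(SUM s:{l1..l2}. (om0 th ?N ?q ?u (b * ?q) s)^2) <=
   zsum (th/4) * (real ?N powr (1 - th/2) + 2 * real ?N powr (1 - th/4) + 2 * (real ?N * real ?u powr (- (th/4)))) + real ?q"
  by (rule om0_sq_sum[OF th uq(3) bu bN])
 also have "... <= zsum (th/4) * (2 * ?e + 2 * (2 * ?e) + 2 * (4 * ?e)) + 2 * ?e"
 proof (intro add_mono mult_left_mono)
  have N: "real ?N powr y <= 2 * ?e" if "y <= 1 - 1 / real ka" "0 <= y" "y <= 1" for y
  proof -
   have "real ?N powr y = 2 powr (real (p + 1) * y)" by (simp add: powr_powr[symmetric] powr_realpow[symmetric] del: of_nat_Suc power_Suc)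
   also have "... <= 2 powr (1 + p * ?X)"
   proof (rule powr_mono)
    have "real p * y <= real p * ?X" using that by (intro mult_left_mono) auto
    then show "real (p + 1) * y <= 1 + p * ?X" using that by (simp add: algebra_simps)
   qed simp
   also have "... = 2 * ?e" by (simp add: powr_add)
   finally show ?thesis .
  qed
  show "real ?N powr (1 - th/2) <= 2 * ?e" by (rule N) (use kp2 th in auto)
  show "real ?N powr (1 - th/4) <= 2 * ?e" by (rule N) (use kp2 th in auto)
  show "real ?N * real ?u powr (- (th/4)) <= 4 * ?e"
  proof -
   have "real ?u powr (- (th/4)) = 2 powr (?Z * (- (th/4)))" unfolding ulen_def by (simp add: powr_realpow[symmetric] powr_powr)
   also have "... <= 2 powr ?Y"
   proof (rule powr_mono)
    have "real p / real kc - 1 <= ?Z" using powr_two_div[of kc p] ka by simp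
    then have "(real p / real kc - 1) * (th/4) <= ?Z * (th/4)" using th by (intro mult_right_mono) auto
    moreover have "real p * (1 / real ka) <= real p * (th / (4 * real kc))" using kp by (intro mult_left_mono) auto
    ultimately show "?Z * (- (th/4)) <= 1 - p * (1 / real ka)" using th by (simp add: algebra_simps)
   qed simp
   finally have "real ?N * real ?u powr (- (th/4)) <= real ?N * 2 powr ?Y" by (intro mult_left_mono) auto
   also have "real ?N = 2 * 2 powr p" by (simp add: powr_realpow)
   also have "2 * 2 powr p * 2 powr ?Y = 2 * (2 powr (p + ?Y))" by (simp only: powr_add mult.assoc)
   also have "p + ?Y = 1 + p * ?X" by (simp add: algebra_simps)
   also have "2 powr (1 + p * ?X) = 2 * ?e" by (simp add: powr_add)
   finally show ?thesis by (simp add: powr_realpow)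
  qed
  show "real ?q <= 2 * ?e"
  proof -
   have "real ?q = 2 powr (?U)" unfolding qlen_def by (simp add: powr_realpow del: of_nat_diff)
   also have "... <= 2 powr (1 + p * ?X)"
   proof (rule powr_mono)
    have "?U = real p - real (p div ka)" by (rule of_nat_diff) simp
    then show "?U <= 1 + p * ?X" using powr_two_div[of ka p] ka by (simp add: algebra_simps)
   qed simp
   also have "... = 2 * ?e" by (simp add: powr_add)
   finally show ?thesis .
  qed
 qed (use z in auto)
 also have "... = (14 * zsum (th/4) + 2) * ?e" by (simp add: algebra_simps)
 finally show ?thesis unfolding power_mult_distrib sum_distrib_left[symmetric] mult.assoc by (intro mult_left_mono) auto
qed

lemma mlen_bound: "2 <= ka ==> real (2^(1 + p div ka)) <= 2 * 2 powr (1 / real ka * real p)"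
proof -
 assume ka: "2 <= ka"
 have "real (2^(1 + p div ka)) = 2 * 2 powr (real (p div ka))" by (simp add: powr_realpow)
 also have "2 powr (real (p div ka)) <= 2 powr (1 / real ka * real p)" using powr_two_div[of ka p] ka by (intro powr_mono) auto
 finally show ?thesis by simp
qed

text \<open>Both claims are instances of \<open>quadratic_forms_small\<close> with exponent 1/ka and
  the number of completed blocks k div q as block index: the first for the partial sum minus the
  completed sub-blocks, the second for the sub-blocks of the current block. At multiples of q the
  second one bounds any single block sum.\<close>

lemma remainder_small:
 assumes th: "0 < th" "th <= 1" and a: "!!n. adm th A0 (a n)" and b: "!!n. adm th A0 (b n)"
  and ka: "2 <= ka" "2 <= kc" "4 * real kc <= th * real ka" and e: "e > 0"
 shows "AE x in M. \<forall>\<^sub>F n in sequentially. ALL k<=n.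
   abs ((SUM i:{1..k}. linJ (2^(12 * (floor_log n + 1))) (a n) (int i) x * linJ (2^(12 * (floor_log n + 1))) (b n) (int i) x
    - expectation (%x. linJ (2^(12 * (floor_log n + 1))) (a n) (int i) x * linJ (2^(12 * (floor_log n + 1))) (b n) (int i) x))
   - (\<Sum>r<(k div qlen ka (floor_log n)) * (qlen ka (floor_log n) div ulen kc (floor_log n)).
      tau (ulen kc (floor_log n)) (Ft (a n) (b n)) (r * ulen kc (floor_log n)) x)) <= e * sqrt n" (is "AE x in M. \<forall>\<^sub>F n in _. ALL k<=n. ?D n k x <= _")
  and block_small: "AE x in M. \<forall>\<^sub>F n in sequentially. ALL k<=n.
   abs (SUM r:{(k div qlen ka (floor_log n)) * (qlen ka (floor_log n) div ulen kc (floor_log n))..<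
      Suc (k div qlen ka (floor_log n)) * (qlen ka (floor_log n) div ulen kc (floor_log n))}.
      tau (ulen kc (floor_log n)) (Ft (a n) (b n)) (r * ulen kc (floor_log n)) x) <= e * sqrt n" (is "AE x in M. \<forall>\<^sub>F n in _. ALL k<=n. ?E n k x <= _")
proof -
 let ?p = "%n. floor_log n" and ?q = "%n. qlen ka (floor_log n)" and ?u = "%n. ulen kc (floor_log n)"
 let ?J = "%n. 2^(12 * (floor_log n + 1)) :: nat"
 let ?bi = "%n k. k div ?q n"
 define om where "om = (%p b s. CK th A0 * om0 th (2^(p+1)) (qlen ka p) (ulen kc p) (b * qlen ka p) s)"
 have ck: "0 <= CK th A0" by (rule CK(4)[OF th(1) a b])
 have om0': "om p b s >= 0" for p b s unfolding om_def using ck om0_nonneg by (simp add: mult_nonneg_nonneg)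
 have n2: "n < 2^(?p n + 1)" if "n >= 1" for n using floor_log_exp2_gt[of n] by simp
 have bi: "?bi n k < 2^(1 + ?p n div ka)" if "n >= 1" "k <= n" for n k
 proof -
  have "k < 2^(1 + ?p n div ka) * ?q n" using n2[OF that(1)] that(2) unfolding ulen_qlen(4)[OF ka(1,2), of "?p n"] by simp
  then show ?thesis by (rule less_mult_imp_div_less)
 qed
 have kp: "0 < 1 / real ka" "1 / real ka <= 1" using ka by auto
 have S: "(SUM s:{lo p..hi p}. (om p b s)^2) <= ((CK th A0)^2 * (14 * zsum (th/4) + 2)) * 2 powr (p * (1 - 1 / real ka))"
  if "b < 2^(1 + p div ka)" for p b unfolding om_def by (rule om_sum_small[OF th ka that])
 have Cpos: "0 <= (CK th A0)^2 * (14 * zsum (th/4) + 2)" using zsum_ge_1[of "th/4"] th by (intro mult_nonneg_nonneg) auto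
 have uq: "(k div ?q n) * (?q n div ?u n) * ?u n = (k div ?q n) * ?q n" for n k
  using ulen_qlen(1)[OF ka(1,2), of "?p n"] by (metis mult.assoc mult.commute)
 have lo1: "lo (?p n) <= 1 - int (?J n)" "lo (?p n) <= 1" for n unfolding lo_def by auto (simp add: add_increasing2 order_trans[of _ 0])
 have NJ: "(2::nat)^(p + 1) <= 2^(12 * (p + 1))" for p by (intro power_increasing) auto
 have kb: "(k div ?q n) * ?q n <= k" "k < (k div ?q n) * ?q n + ?q n" for n k
 proof -
  show "(k div ?q n) * ?q n <= k" by simp
  show "k < (k div ?q n) * ?q n + ?q n"
   using mod_less_divisor[of "?q n" k] ulen_qlen(2)[OF ka(1,2), of "?p n"] div_mult_mod_eq[of k "?q n"] by linarith
 qed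
 show "AE x in M. \<forall>\<^sub>F n in sequentially. ALL k<=n. ?D n k x <= e * sqrt n"
 proof -
  have "AE x in M. \<forall>\<^sub>F n in sequentially. ALL k<=n. abs (Qf (%s t. Kx (?J n) (a n) (b n) k s t - KT (?u n) (a n) (b n) 0 (int ((k div ?q n) * ?q n)) s t) (lo (?p n)) (hi (?p n)) x) <= e * sqrt n"
  proof (rule quadratic_forms_small[OF kp th(1) om0' _ bi mlen_bound[OF ka(1)] S Cpos _ e])
   fix n k s t assume n: "1 <= n" "k <= n" and st: "lo (?p n) <= t" "t <= s" "s <= hi (?p n)"
   show "abs (Kx (?J n) (a n) (b n) k s t - KT (?u n) (a n) (b n) 0 (int ((k div ?q n) * ?q n)) s t) <= om (?p n) (?bi n k) s * lam th (s - t)"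
    unfolding om_def using th n n2[OF n(1)] st by (intro KR_bound a b kb NJ ulen_qlen[OF ka(1,2)]) auto
  qed auto
  then show ?thesis
  proof eventually_elim
   case (elim x)
   show ?case using elim eventually_ge_at_top[of "1::nat"]
   proof eventually_elim
    case (elim n)
    show ?case
    proof (intro allI impI)
     fix k assume k: "k <= n"
     have kh: "int k <= hi (?p n)"
     proof -
      have "k <= 2^(?p n + 1)" using n2[OF elim(2)] k by linarith
      then have "int k <= int (2^(?p n + 1))" by (simp only: of_nat_le_iff)
      then show ?thesis unfolding hi_def by (simp only: of_nat_power of_nat_numeral)
     qed
     have r: "int ((k div ?q n) * (?q n div ?u n) * ?u n) <= hi (?p n)"
      unfolding uq by (rule order_trans[OF _ kh]) (use kb(1)[of k n] in \<open>simp only: of_nat_le_iff\<close>)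
     have "(\<Sum>r<(k div ?q n) * (?q n div ?u n). tau (?u n) (Ft (a n) (b n)) (r * ?u n) x) =
       Qf (KT (?u n) (a n) (b n) 0 (int ((k div ?q n) * ?q n))) (lo (?p n)) (hi (?p n)) x"
      using tau_sum_eq[of 0 "(k div ?q n) * (?q n div ?u n)" "lo (?p n)" "?u n" "hi (?p n)", where a="a n" and b="b n" and x=x] lo1(2) r
       ulen_qlen(3)[OF ka(1,2)] unfolding uq by (simp add: atLeast0LessThan)
     then show "?D n k x <= e * sqrt n" using elim(1) k Xtrunc_eq[OF lo1(1) kh, where a="a n" and b="b n" and x=x] by (simp add: Qf_diff)
    qed
   qed
  qed
 qed
 show "AE x in M. \<forall>\<^sub>F n in sequentially. ALL k<=n. ?E n k x <= e * sqrt n"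
 proof -
  have "AE x in M. \<forall>\<^sub>F n in sequentially. ALL k<=n. abs (Qf (KT (?u n) (a n) (b n) (int ((k div ?q n) * ?q n)) (int ((k div ?q n) * ?q n) + int (?q n))) (lo (?p n)) (hi (?p n)) x) <= e * sqrt n"
  proof (rule quadratic_forms_small[OF kp th(1) om0' _ bi mlen_bound[OF ka(1)] S Cpos _ e])
   fix n k s t assume n: "1 <= n" "k <= n" and st: "lo (?p n) <= t" "t <= s" "s <= hi (?p n)"
   show "abs (KT (?u n) (a n) (b n) (int ((k div ?q n) * ?q n)) (int ((k div ?q n) * ?q n) + int (?q n)) s t) <= om (?p n) (?bi n k) s * lam th (s - t)"
    unfolding om_def using th st by (intro KT_bound a b) auto
  qed auto
  then show ?thesis
  proof eventually_elim
   case (elim x)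
   show ?case using elim eventually_ge_at_top[of "1::nat"]
   proof eventually_elim
    case (elim n)
    show ?case
    proof (intro allI impI)
     fix k assume k: "k <= n"
     have e1: "Suc (k div ?q n) * (?q n div ?u n) * ?u n = (k div ?q n) * ?q n + ?q n"
      using uq[of k n] ulen_qlen(1)[OF ka(1,2), of "?p n"] by (simp add: algebra_simps)
     have "Suc (k div ?q n) * ?q n <= 2^(1 + ?p n div ka) * ?q n" using bi[OF elim(2) k] by (intro mult_right_mono) auto
     then have "(k div ?q n) * ?q n + ?q n <= 2^(?p n + 1)" unfolding ulen_qlen(4)[OF ka(1,2), of "?p n"] by simp
     then have r: "int ((k div ?q n) * ?q n + ?q n) <= hi (?p n)"
     proof -
      assume h: "(k div ?q n) * ?q n + ?q n <= 2^(?p n + 1)"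
      have "int ((k div ?q n) * ?q n + ?q n) <= int (2^(?p n + 1))" using h by (simp only: of_nat_le_iff)
      then show ?thesis unfolding hi_def by (simp only: of_nat_power of_nat_numeral)
     qed
     show "?E n k x <= e * sqrt n"
      using tau_sum_eq[of "(k div ?q n) * (?q n div ?u n)" "Suc (k div ?q n) * (?q n div ?u n)" "lo (?p n)" "?u n" "hi (?p n)", where a="a n" and b="b n" and x=x]
       lo1(2) r elim(1) k ulen_qlen(3)[OF ka(1,2)] unfolding uq e1 by simp
    qed
   qed
  qed
 qed
qed

end

section \<open>Linear processes and their truncation\<close>

lemma adm_sq_sum:
 assumes "0 < th" and a: "adm th A0 a" and A: "finite A" "!!j. j : A ==> N <= j" and N: "1 <= N"
 shows "(SUM j:A. (a j)^2) <= A0^2 * zsum th * real N powr (-1/2)"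
proof -
 let ?Y = "%j. real (max j 1)"
 let ?X = "%j. ?Y j powr (-1 - th) * real N powr (-1/2)"
 have "(a j)^2 <= A0^2 * ?X j" if "j : A" for j
 proof -
  have j: "real N <= ?Y j" using A(2)[OF that] N by auto
  have "abs (a j) <= A0 * ?Y j powr (-3/4 - th/2)" using a unfolding adm_def by auto
  then have "abs (a j)^2 <= (A0 * ?Y j powr (-3/4 - th/2))^2" by (intro power_mono) auto
  also have "... = A0^2 * ?Y j powr ((-1 - th) + (-1/2))" by (simp add: power2_eq_square powr_add[symmetric] mult_ac)
  also have "... = A0^2 * (?Y j powr (-1 - th) * ?Y j powr (-1/2))" unfolding powr_add ..
  also have "... <= A0^2 * ?X j" using j N by (intro mult_left_mono powr_mono2') auto
  finally show ?thesis by simp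
 qed
 then have "(SUM j:A. (a j)^2) <= (SUM j:A. A0^2 * ?X j)" by (rule sum_mono)
 also have "... = A0^2 * ((SUM j:A. ?Y j powr (-1 - th)) * real N powr (-1/2))" by (simp add: sum_distrib_left sum_distrib_right)
 also have "... <= A0^2 * (zsum th * real N powr (-1/2))" using assms by (intro mult_left_mono mult_right_mono zsum_ge) auto
 finally show ?thesis by (simp add: mult.assoc)
qed

lemma convergent_of_dyadic_blocks:
 fixes S :: "nat => real"
 assumes d: "summable d" and ev: "\<forall>\<^sub>F p in sequentially. ALL N:{2^p..2^(p+1)}. abs (S N - S (2^p)) <= d p"
 shows "convergent S"
proof -
 obtain P where P: "!!p N. P <= p ==> N : {2^p..2^(p+1)} ==> abs (S N - S (2^p)) <= d p" using ev unfolding eventually_sequentially by blast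
 have "summable (%p. S (2^(Suc p)) - S (2^p))" by (rule summable_comparison_test'[OF d, where N=P]) (use P in auto)
 then obtain L where "(%p. S (2^(Suc p)) - S (2^p)) sums L" by (auto simp: summable_def)
 then have "(%p. \<Sum>i<p. S (2^(Suc i)) - S (2^i)) \<longlonglongrightarrow> L" unfolding sums_def .
 moreover have "(%p. \<Sum>i<p. S (2^(Suc i)) - S (2^i)) = (%p. S (2^p) - S 1)"
 proof
  show "(\<Sum>i<p. S (2^(Suc i)) - S (2^i)) = S (2^p) - S 1" for p by (induction p) auto
 qed
 ultimately have "(%p. S (2^p) - S 1) \<longlonglongrightarrow> L" by simp
 from tendsto_add[OF this tendsto_const[of "S 1"]] have T: "(%p. S (2^p)) \<longlonglongrightarrow> L + S 1" by simp
 have "(%n. S n - S (2^floor_log n)) \<longlonglongrightarrow> 0"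
 proof (rule Lim_null_comparison)
  show "(%n. d (floor_log n)) \<longlonglongrightarrow> 0" by (rule filterlim_compose[OF summable_LIMSEQ_zero[OF d] floor_log_at_top])
  have "\<forall>\<^sub>F n in sequentially. P <= floor_log n" using floor_log_at_top unfolding filterlim_at_top by blast
  then show "\<forall>\<^sub>F n in sequentially. norm (S n - S (2^floor_log n)) <= d (floor_log n)" using eventually_ge_at_top[of "1::nat"]
  proof eventually_elim
   case (elim n)
   have "n : {2^floor_log n..2^(floor_log n+1)}" using floor_log_exp2_gt[of n] floor_log_exp2_le[of n] elim by auto
   from P[OF elim(1) this] show ?case by simp
  qed
 qed
 from tendsto_add[OF this filterlim_compose[OF T floor_log_at_top]]
 show ?thesis by (auto simp: convergent_def)
qed

lemma abs_diff_of_centered_sums_le: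
 fixes f g :: "nat => real"
 assumes k: "k <= n"
 shows "abs ((SUM i:{1..k}. f i - f' i) - (SUM i:{1..k}. g i - g' i)) <= (SUM i:{1..n}. abs (f i - g i)) + (SUM i:{1..n}. abs (f' i - g' i))"
proof -
 have "(SUM i:{1..k}. f i - f' i) - (SUM i:{1..k}. g i - g' i) = (SUM i:{1..k}. (f i - g i) - (f' i - g' i))" by (simp add: sum_subtractf)
 then have "abs ((SUM i:{1..k}. f i - f' i) - (SUM i:{1..k}. g i - g' i)) <= (SUM i:{1..k}. abs ((f i - g i) - (f' i - g' i)))"
  by (simp only: sum_abs)
 also have "... <= (SUM i:{1..k}. abs (f i - g i) + abs (f' i - g' i))" by (intro sum_mono abs_triangle_ineq4)
 also have "... <= (SUM i:{1..n}. abs (f i - g i) + abs (f' i - g' i))" using k by (intro sum_mono2) auto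
 finally show ?thesis by (simp add: sum.distrib)
qed

context innov
begin

text \<open>Read backwards from time i, a linear process becomes a series along nat, and the linear
  tail bound applies to its partial sums.\<close>

lemma reflected: "indep_centered M (%j. eps (i - int j)) (%j. sig2 (i - int j))"
proof
 have "indep_vars (%j. PiM {i - int j} (%_. borel)) (%j x. \<lambda>k\<in>{i - int j}. eps k x) (UNIV :: nat set)"
  by (rule indep_vars_restrict[OF eps_indep]) (auto simp: disjoint_family_on_def)
 from indep_vars_compose2[OF this, of "%j r. r (i - int j)" "%_. borel"]
 show "indep_vars (%_. borel) (%j. eps (i - int j)) UNIV" by simp
qed (auto simp: eps2 eps_mean sig2_def)

definition lin :: "(nat => real) => int => 'a => real" where
 "lin a i x = (\<Sum>j. a j * eps (i - int j) x)"

lemma lin_meas[measurable]: "lin a i : borel_measurable M" unfolding lin_def by measurable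

lemma weighted_squares_expectation:
 "NN M (%x. ennreal (SUM j:A. (k j)^2 * ((eps (f j) x)^2 + sig2 (f j)))) <= ennreal (2 * c0 * (SUM j:A. (k j)^2))"
proof -
 let ?X = "%j x. (eps (f j) x)^2 + sig2 (f j)"
 let ?Y = "expectation (%x. SUM j:A. (k j)^2 * ?X j x)"
 have "NN M (%x. ennreal (SUM j:A. (k j)^2 * ?X j x)) =
   ennreal (?Y)"
 proof (rule nn_integral_eq_integral)
  show "integrable M (%x. SUM j:A. (k j)^2 * ?X j x)"
   by (intro Bochner_Integration.integrable_sum integrable_mult_right Bochner_Integration.integrable_add eps2 integrable_const)
  show "AE x in M. 0 <= (SUM j:A. (k j)^2 * ?X j x)" by (intro AE_I2 sum_nonneg mult_nonneg_nonneg add_nonneg_nonneg) (auto simp: eps2)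
 qed
 also have "?Y = (SUM j:A. (k j)^2 * (2 * sig2 (f j)))"
  by (subst Bochner_Integration.integral_sum) (auto intro!: eps2 simp: sig2_def[symmetric] eps2 prob_space)
 also have "... <= (SUM j:A. (k j)^2 * (2 * c0))" by (intro sum_mono mult_left_mono) (auto simp: eps2)
 also have "... = 2 * c0 * (SUM j:A. (k j)^2)" by (simp add: sum_distrib_left mult_ac)
 finally show ?thesis by (simp add: ennreal_leI)
qed

text \<open>\<open>Yn\<close> is a \<open>suminf\<close>, so genuine convergence is required. Over a
  dyadic block of lags the variance is O(2^(-p/2)); Markov keeps the random variance below 2^(-p/4),
  and under that level the Gaussian tail bounds every partial sum within the block by a quantity
  summable over p.\<close>

lemma lin_summable:
 assumes th: "0 < th" and a: "adm th A0 a"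
 shows "AE x in M. summable (%j. a j * eps (i - int j) x)"
proof -
 interpret r: indep_centered M "%j. eps (i - int j)" "%j. sig2 (i - int j)" by (rule reflected)
 define k where "k = (%p j. if j < 2^p then 0 else a j)"
 define y :: "nat => real" where "y = (%p. 2 powr (- (real p / 4)))"
 let ?W = "%j x. eps (i - int j) x"
 let ?S = "%p N x. \<Sum>j<N. k p j * ?W j x"
 let ?V = "%p N x. \<Sum>j<N. (k p j)^2 * ((?W j x)^2 + sig2 (i - int j))"
 let ?D = "%p. (real p + 1) * sqrt (2 * y p)"
 have y0: "y p > 0" for p unfolding y_def by simp
 define A where "A = (%p. {x:space M. y p <= ?V p (2^(p+1)) x})"
 define E where "E = (%p N. {x:space M. abs (?S p N x) > ?D p & ?V p N x <= y p})"
 let ?Z = "%p E. UN N:{2^p..2^(p+1)}. E p N"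
 define Bad where "Bad = (%p. A p \<union> ?Z p E)"
 have [measurable]: "A p : events" "E p N : events" for p N unfolding A_def E_def by measurable
 have [measurable]: "Bad p : events" for p unfolding Bad_def by measurable
 let ?z = "2 * c0 * (A0^2 * zsum th)"
 have z0: "0 <= ?z" using c0 zsum_ge_1[OF th] by (intro mult_nonneg_nonneg) auto
 let ?X = "%p x. ennreal (?V p (2^(p+1)) x)"
 let ?Y = "%y p. ennreal (1 / y p)"
 let ?U = "2 powr (-1/4)"
 have PA: "prob (A p) <= ?z * ?U^p" for p
 proof -
  have "(\<Sum>j<2^(p+1). (k p j)^2) = (SUM j:{2^p..<2^(p+1)}. (a j)^2)" unfolding k_def by (intro sum.mono_neutral_cong_right) auto
  also have "... <= A0^2 * zsum th * real (2^p) powr (-1/2)" by (rule adm_sq_sum[OF th a]) auto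
  finally have s: "(\<Sum>j<2^(p+1). (k p j)^2) <= A0^2 * zsum th * real (2^p) powr (-1/2)" .
  have "2 * c0 * (\<Sum>j<2^(p+1). (k p j)^2) <= 2 * c0 * (A0^2 * zsum th * real (2^p) powr (-1/2))" using c0 by (intro mult_left_mono s) auto
  then have "NN M (%x. ?X p x) <= ennreal (?z * real (2^p) powr (-1/2))"
   using weighted_squares_expectation[where A="{..<2^(p+1)}" and k="k p" and f="%j. i - int j"]
   by (elim order_trans) (simp add: ennreal_leI mult_ac)
  also have "real (2^p) powr (-1/2) = 2 powr (-1/4 * real p) * y p"
   unfolding y_def by (simp add: powr_realpow[symmetric] powr_powr powr_add[symmetric])
  finally have I: "NN M (%x. ?X p x) <= ennreal (?z * 2 powr (-1/4 * real p) * y p)" by (simp add: mult.assoc)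
  have "emeasure M (A p) = emeasure M {x:space M. 1 <= ?Y y p * ?X p x}"
  proof (rule arg_cong[where f="emeasure M"])
   have "1 <= ?Y y p * ennreal v \<longleftrightarrow> y p <= v" if "v >= 0" for v
    using y0[of p] that by (simp add: ennreal_mult'[symmetric] field_simps flip: ennreal_1)
   moreover have "0 <= ?V p (2^(p+1)) x" for x by (intro sum_nonneg mult_nonneg_nonneg add_nonneg_nonneg) (auto simp: eps2)
   ultimately have "1 <= ?Y y p * ?X p x \<longleftrightarrow> y p <= ?V p (2^(p+1)) x" for x by blast
   then show "A p = {x:space M. 1 <= ?Y y p * ?X p x}" unfolding A_def by (simp only:)
  qed
  also have "... <= ?Y y p * (NN M (%x. ?X p x * indicator (space M) x))" by (rule nn_integral_Markov_inequality) auto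
  also have "NN M (%x. ?X p x * indicator (space M) x) = NN M (%x. ?X p x)" by (intro nn_integral_cong) auto
  also have "?Y y p * ... <= ?Y y p * ennreal (?z * 2 powr (-1/4 * real p) * y p)" by (intro mult_left_mono I) auto
  also have "... = ennreal (?z * 2 powr (-1/4 * real p))" using y0[of p] z0 by (simp add: ennreal_mult'[symmetric])
  also have "2 powr (-1/4 * real p) = ?U^p" by (simp add: powr_realpow[symmetric] powr_powr)
  finally show ?thesis using z0 by (simp add: emeasure_eq_measure)
 qed
 \<comment> \<open>Taking p + 1 for x gives at most 2^(-(2 p + 1)), enough for the 2^p + 1 endpoints
   N of the block.\<close>
 have PE: "prob (E p N) <= 2 * (1/2)^(2*p+1)" for p N
 proof -
  have "prob (E p N) <= 2 * exp (-((real p + 1)^2))" unfolding E_def by (rule r.linear_tail) (use y0 in auto)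
  also have "exp (-((real p + 1)^2)) <= exp (- real (2*p+1))" by (simp add: power2_eq_square algebra_simps)
  also have "... <= (1/2)^(2*p+1)" by (rule exp_le_two_powr)
  finally show ?thesis by simp
 qed
 have PB: "prob (Bad p) <= ?z * ?U^p + 3 * (1/2)^p" for p
 proof -
  have "prob (?Z p E) <= (SUM N:{2^p..2^(p+1)}. prob (E p N))" by (rule finite_measure_subadditive_finite) auto
  also have "... <= (SUM N:{(2::nat)^p..2^(p+1)}. 2 * (1/2)^(2*p+1))" by (rule sum_mono) (rule PE)
  also have "... = (2^p + 1) * (1/2)^(2*p)" by (simp add: of_nat_diff)
  also have "... <= 3 * (1/2)^p"
  proof -
   have "(2^p + 1) * (1/2)^(2*p) = (1/2)^p + (1/2::real)^(2*p)"
    by (simp add: field_simps power_mult power2_eq_square power_mult_distrib[symmetric] mult_2 power_add)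
   also have "(1/2::real)^(2*p) <= (1/2)^p" by (rule power_decreasing) auto
   finally have "(2^p + 1) * (1/2)^(2*p) <= (1/2)^p + (1/2::real)^p" by simp
   moreover have "0 <= (1/2::real)^p" by simp
   ultimately show ?thesis by linarith
  qed
  finally have 1: "prob (?Z p E) <= 3 * (1/2)^p" .
  have "prob (Bad p) <= prob (A p) + prob (?Z p E)" unfolding Bad_def by (rule measure_Un_le) auto
  with 1 PA[of p] show ?thesis by linarith
 qed
 have "summable (%p. prob (Bad p))"
 proof (rule summable_comparison_test'[where N=0])
  show "summable (%p. ?z * ?U^p + 3 * (1/2)^p)" by (intro summable_add summable_mult summable_geometric) (auto simp: powr_less_one)
 qed (use PB in auto)
 then have "AE x in M. \<forall>\<^sub>F p in sequentially. x : space M - Bad p"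
  by (intro borel_cantelli_AE1) (auto simp: emeasure_eq_measure)
 then show ?thesis
 proof eventually_elim
  case (elim x)
  let ?s = "%N. \<Sum>j<N. a j * ?W j x"
  have sd: "summable ?D"
  proof -
   have e: "sqrt (2 * y p) = sqrt 2 * (2 powr (-1/8))^p" for p
    unfolding y_def by (simp add: real_sqrt_mult powr_half_sqrt[symmetric] powr_powr powr_realpow[symmetric])
   have "summable (%p. real (Suc p) * (2 powr (-1/8))^p)"
    using geometric_deriv_sums[of "2 powr (-1/8) :: real"] by (auto simp: sums_iff powr_less_one)
   then have "summable (%p. sqrt 2 * (real (Suc p) * (2 powr (-1/8))^p))" by (rule summable_mult)
   then show ?thesis unfolding e by (simp add: mult_ac add.commute)
  qed
  have "convergent ?s"
  proof (rule convergent_of_dyadic_blocks[OF sd])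
   show "\<forall>\<^sub>F p in sequentially. ALL N:{2^p..2^(p+1)}. abs (?s N - ?s (2^p)) <= ?D p" using elim
   proof eventually_elim
    case (elim p)
    show ?case
    proof
     fix N :: nat assume N: "N : {2^p..2^(p+1)}"
     have "?V p N x <= ?V p (2^(p+1)) x" using N by (intro sum_mono2) (auto simp: eps2)
     also have "... <= y p" using elim unfolding Bad_def A_def by auto
     finally have Vy: "?V p N x <= y p" .
     have "x : space M" "x ~: E p N" using elim N unfolding Bad_def by auto
     then have "abs (?S p N x) <= ?D p" using Vy unfolding E_def by (simp add: not_less)
     moreover have "?S p N x = ?s N - ?s (2^p)"
     proof -
      have "?s N - ?s (2^p) = (SUM j:{2^p..<N}. a j * ?W j x)"
       using N sum_diff_nat_ivl[of 0 "2^p" N "%j. a j * ?W j x"] by (simp add: atLeast0LessThan del: power_Suc)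
      also have "... = ?S p N x" unfolding k_def by (rule sum.mono_neutral_cong_left) auto
      finally show ?thesis ..
     qed
     ultimately show "abs (?s N - ?s (2^p)) <= ?D p" by simp
    qed
   qed
  qed
  then show ?case by (simp add: summable_iff_convergent)
 qed
qed

lemma finite_lin_second_moment:
 assumes "finite A" "inj_on f A"
 shows "NN M (%x. ennreal ((SUM j:A. k j * eps (f j) x)^2)) <= ennreal (c0 * (SUM j:A. (k j)^2))"
proof -
 let ?X = "%x. SUM j:A. k j * eps (f j) x"
 have e: "(?X x)^2 = (SUM j:A. SUM l:A. k j * k l * (eps (f j) x * eps (f l) x))" for x
  unfolding power2_eq_square sum_product by (simp add: mult_ac)
 have int: "integrable M (%x. (?X x)^2)" unfolding e by (intro Bochner_Integration.integrable_sum integrable_mult_right eps_prod)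
 have "expectation (%x. (?X x)^2) = (SUM j:A. SUM l:A. k j * k l * (if f j = f l then sig2 (f j) else 0))"
  unfolding e by (simp add: Bochner_Integration.integral_sum Bochner_Integration.integrable_sum eps_prod)
 also have "... = (SUM j:A. SUM l:A. if l = j then (k j)^2 * sig2 (f j) else 0)"
  using assms(2) by (intro sum.cong refl) (auto simp: power2_eq_square dest: inj_onD)
 also have "... = (SUM j:A. (k j)^2 * sig2 (f j))" using assms(1) by (simp add: sum.delta)
 also have "... <= (SUM j:A. (k j)^2 * c0)" by (intro sum_mono mult_left_mono) (auto simp: eps2)
 also have "... = c0 * (SUM j:A. (k j)^2)" by (simp add: sum_distrib_left mult_ac)
 finally have "expectation (%x. (?X x)^2) <= c0 * (SUM j:A. (k j)^2)" .
 then show ?thesis using int by (subst nn_integral_eq_integral) (auto simp: ennreal_leI)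
qed

lemma linJ_second_moment:
 assumes th: "0 < th" and a: "adm th A0 a"
 shows "NN M (%x. ennreal ((linJ J a i x)^2)) <= ennreal (2 * c0 * A0^2 * zsum th)"
proof -
 have "(a 0)^2 <= A0^2 * zsum th" using adm_sq_sum[OF th a, of "{0}" 1] adm_sq_sum[OF th a, of "{}" 1] a zsum_ge_1[OF th]
 proof -
  have "abs (a 0) <= A0" using a[unfolded adm_def, rule_format, of 0] by simp
  then have "abs (a 0)^2 <= A0^2" by (intro power_mono) auto
  also have "A0^2 * 1 <= A0^2 * zsum th" using zsum_ge_1[OF th] by (intro mult_left_mono) auto
  finally show ?thesis by simp
 qed
 moreover have "(SUM j:{1..J}. (a j)^2) <= A0^2 * zsum th * real 1 powr (-1/2)" by (rule adm_sq_sum[OF th a]) auto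
 moreover have "{..J} = insert 0 {1..J}" by auto
 ultimately have "(SUM j<=J. (a j)^2) <= 2 * (A0^2 * zsum th)" by simp
 then have "c0 * (SUM j<=J. (a j)^2) <= c0 * (2 * (A0^2 * zsum th))" using c0 by (intro mult_left_mono) auto
 then show ?thesis using finite_lin_second_moment[of "{..J}" "%j. i - int j" a] unfolding linJ_def
  by (auto simp: inj_on_def mult_ac elim!: order_trans intro!: ennreal_leI)
qed

text \<open>Fatou along longer truncations, each of which exceeds the lag J by a finite sum with
  explicit second moment.\<close>

lemma lin_truncation:
 assumes th: "0 < th" and a: "adm th A0 a"
 shows "NN M (%x. ennreal ((lin a i x - linJ J a i x)^2)) <= ennreal (c0 * A0^2 * zsum th * real (Suc J) powr (-1/2))"
  (is "_ <= ?R")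
proof -
 let ?D = "%N x. (linJ N a i x - linJ J a i x)^2"
 have "NN M (%x. ennreal ((lin a i x - linJ J a i x)^2)) <= NN M (%x. liminf (%N. ennreal (?D N x)))"
 proof (rule nn_integral_mono_AE)
  show "AE x in M. ennreal ((lin a i x - linJ J a i x)^2) <= liminf (%N. ennreal (?D N x))" using lin_summable[OF th a, of i]
  proof eventually_elim
   case (elim x)
   have "(%N. linJ N a i x) \<longlonglongrightarrow> lin a i x"
    using summable_LIMSEQ[OF elim] unfolding linJ_def lin_def by (simp add: LIMSEQ_lessThan_iff_atMost)
   then have "(%N. ennreal (?D N x)) \<longlonglongrightarrow> ennreal ((lin a i x - linJ J a i x)^2)"
    by (intro tendsto_ennrealI tendsto_power tendsto_diff tendsto_const)
   then have "liminf (%N. ennreal (?D N x)) = ennreal ((lin a i x - linJ J a i x)^2)" by (intro lim_imp_Liminf) auto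
   then show ?case by simp
  qed
 qed
 also have "... <= liminf (%N. NN M (%x. ennreal (?D N x)))" by (rule nn_integral_liminf) auto
 also have "... <= ?R"
 proof (rule Liminf_le)
  have "NN M (%x. ennreal (?D N x)) <= ?R" if "J <= N" for N
  proof -
   have e: "linJ N a i x - linJ J a i x = (SUM j:{Suc J..N}. a j * eps (i - int j) x)" for x
   proof -
    have "{..N} = {..J} \<union> {Suc J..N}" using that by auto
    then have "linJ N a i x = linJ J a i x + (SUM j:{Suc J..N}. a j * eps (i - int j) x)"
     unfolding linJ_def by (simp only:) (rule sum.union_disjoint, auto)
    then show ?thesis by simp
   qed
   have "(SUM j:{Suc J..N}. (a j)^2) <= A0^2 * zsum th * real (Suc J) powr (-1/2)" by (rule adm_sq_sum[OF th a]) auto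
   then have "c0 * (SUM j:{Suc J..N}. (a j)^2) <= c0 * (A0^2 * zsum th * real (Suc J) powr (-1/2))" using c0 by (intro mult_left_mono) auto
   then have "ennreal (c0 * (SUM j:{Suc J..N}. (a j)^2)) <= ?R" by (intro ennreal_leI) (simp only: mult.assoc)
   with finite_lin_second_moment[of "{Suc J..N}" "%j. i - int j" a] show ?thesis unfolding e by (auto simp: inj_on_def intro: order_trans)
  qed
  then show "\<forall>\<^sub>F N in sequentially. NN M (%x. ennreal (?D N x)) <= ?R"
   using eventually_ge_at_top[of J] by (rule eventually_mono[rotated])
 qed simp
 finally show ?thesis .
qed

text \<open>Young's inequality |u v| <= u^2 / (2 t) + t v^2 / 2, where t balances a small U against
  a bounded V.\<close>

lemma nn_integral_abs_mult_le:
 assumes [measurable]: "U : borel_measurable M" "V : borel_measurable M" and t: "t > 0" and D: "D >= 0"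
  and U: "NN M (%x. ennreal ((U x)^2)) <= ennreal (D * t^2)" and V: "NN M (%x. ennreal ((V x)^2)) <= ennreal D"
 shows "NN M (%x. ennreal (abs (U x * V x))) <= ennreal (D * t)"
proof -
 have am: "abs (u * v) <= u^2 / (2*t) + t * v^2 / 2" for u v :: real
 proof -
  have "0 <= (abs u - t * abs v)^2" by simp
  then have "2 * t * abs (u * v) <= u^2 + t^2 * v^2" by (simp add: power2_diff abs_mult power_mult_distrib algebra_simps)
  then show ?thesis using t by (simp add: field_simps power2_eq_square)
 qed
 let ?X = "ennreal (1/(2*t))"
 have "NN M (%x. ennreal (abs (U x * V x))) <= NN M (%x. ?X * ennreal ((U x)^2) + ennreal (t/2) * ennreal ((V x)^2))"
  using t by (intro nn_integral_mono) (auto simp: ennreal_mult'[symmetric] ennreal_plus[symmetric] intro!: ennreal_leI am simp del: ennreal_plus)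
 also have "... = ?X * (NN M (%x. ennreal ((U x)^2))) + ennreal (t/2) * (NN M (%x. ennreal ((V x)^2)))"
  by (simp add: nn_integral_add nn_integral_cmult)
 also have "... <= ?X * ennreal (D * t^2) + ennreal (t/2) * ennreal D" by (intro add_mono mult_left_mono U V) auto
 also have "... = ennreal (1/(2*t) * (D * t^2) + t/2 * D)"
  using t D by (simp add: ennreal_mult'[symmetric] ennreal_plus[symmetric] del: ennreal_plus)
 also have "1/(2*t) * (D * t^2) + t/2 * D = D * t" using t by (simp add: field_simps power2_eq_square)
 finally show ?thesis .
qed

lemma lin_second_moment:
 assumes th: "0 < th" and a: "adm th A0 a"
 shows "NN M (%x. ennreal ((lin a i x)^2)) <= ennreal (6 * c0 * A0^2 * zsum th)"
proof -
 let ?R = "c0 * A0^2 * zsum th"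
 have R: "0 <= ?R" using c0 zsum_ge_1[OF th] by (intro mult_nonneg_nonneg) auto
 let ?X = "%x. ennreal ((lin a i x - linJ 0 a i x)^2)"
 let ?Y = "%x. ennreal ((linJ 0 a i x)^2)"
 let ?Z = "%x. ennreal ((lin a i x)^2)"
 have "NN M (%x. ?Z x) <= NN M (%x. 2 * ?X x + 2 * ?Y x)"
 proof (intro nn_integral_mono)
  fix x
  have "(u::real)^2 <= 2 * (u - v)^2 + 2 * v^2" for u v
  proof -
   have "0 <= (u - 2 * v)^2" by simp
   then show ?thesis by (simp add: power2_eq_square algebra_simps)
  qed
  then have "?Z x <= ennreal (2 * (lin a i x - linJ 0 a i x)^2 + 2 * (linJ 0 a i x)^2)" by (rule ennreal_leI)
  also have "... = 2 * ?X x + 2 * ?Y x" by (simp add: ennreal_plus ennreal_mult')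
  finally show "?Z x <= 2 * ?X x + 2 * ?Y x" .
 qed
 also have "... = 2 * (NN M (%x. ?X x)) + 2 * (NN M (%x. ?Y x))" by (simp add: nn_integral_add nn_integral_cmult)
 also have "... <= 2 * ennreal (?R * real (Suc 0) powr (-1/2)) + 2 * ennreal (2 * c0 * A0^2 * zsum th)"
  by (intro add_mono mult_left_mono lin_truncation[OF th a] linJ_second_moment[OF th a]) auto
 also have "... = ennreal (2 * ?R + 2 * (2 * ?R))"
 proof -
  have two: "2 * ennreal r = ennreal (2 * r)" for r by (simp add: ennreal_mult')
  have "2 * c0 * A0^2 * zsum th = 2 * ?R" by simp
  then show ?thesis using R by (simp only: two) (simp add: ennreal_plus[symmetric] del: ennreal_plus)
 qed
 also have "2 * ?R + 2 * (2 * ?R) = 6 * c0 * A0^2 * zsum th" by simp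
 finally show ?thesis .
qed

lemma lin_product_integrable:
 assumes th: "0 < th" and a: "adm th A0 a" and b: "adm th A0 b"
 shows "integrable M (%x. lin a i x * lin b i x)"
proof (rule integrableI_bounded)
 have D: "0 <= 6 * c0 * A0^2 * zsum th" using c0 zsum_ge_1[OF th] by (intro mult_nonneg_nonneg) auto
 have "NN M (%x. ennreal (abs (lin a i x * lin b i x))) <= ennreal (6 * c0 * A0^2 * zsum th * 1)"
  by (rule nn_integral_abs_mult_le) (use D lin_second_moment[OF th a] lin_second_moment[OF th b] in auto)
 then show "(NN M (%x. ennreal (norm (lin a i x * lin b i x)))) < \<infinity>" by (simp add: order_le_less_trans)
qed measurable

text \<open>Origin of the lag 2^(12 m): its power -1/2 is 2^(-6 m), so the truncation error is
  O(2^(-3 m)) in L2 and the products inherit this rate in L1. For 2^m > n this is O(n^-3).\<close>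

lemma product_truncation:
 assumes th: "0 < th" and a: "adm th A0 a" and b: "adm th A0 b"
 shows "(NN M (%x. ennreal (abs (lin a i x * lin b i x - linJ (2^(12*m)) a i x * linJ (2^(12*m)) b i x))))
   <= ennreal (12 * c0 * A0^2 * zsum th * (1/2)^(3*m))"
proof -
 let ?D = "6 * c0 * A0^2 * zsum th" and ?J = "2^(12*m) :: nat" and ?t = "(1/2::real)^(3*m)"
 have D: "0 <= ?D" using c0 zsum_ge_1[OF th] by (intro mult_nonneg_nonneg) auto
 have t: "real (Suc ?J) powr (-1/2) <= ?t^2"
 proof -
  have "real (Suc ?J) powr (-1/2) <= real ?J powr (-1/2)" by (intro powr_mono2') auto
  also have "real ?J powr (-1/2) = 2 powr (- (6 * real m))" by (simp add: powr_realpow[symmetric] powr_powr)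
  also have "... = ?t^2"
  proof -
   have h: "(1/2::real)^k = 2 powr (- real k)" for k by (simp add: powr_minus powr_realpow power_one_over inverse_eq_divide)
   have "?t^2 = (1/2)^(3*m*2)" by (simp only: power_mult)
   then show ?thesis unfolding h by simp
  qed
  finally show ?thesis .
 qed
 have T: "NN M (%x. ennreal ((lin f i x - linJ ?J f i x)^2)) <= ennreal (?D * ?t^2)" if f: "adm th A0 f" for f
 proof -
  have "c0 * A0^2 * zsum th * real (Suc ?J) powr (-1/2) <= ?D * ?t^2"
  proof (rule mult_mono[OF _ t D])
   show "c0 * A0^2 * zsum th <= ?D" using D by simp
  qed auto
  then show ?thesis using lin_truncation[OF th f, of i ?J] by (meson ennreal_leI order_trans)
 qed
 have LJ: "NN M (%x. ennreal ((linJ ?J f i x)^2)) <= ennreal ?D" if f: "adm th A0 f" for f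
 proof -
  have "2 * c0 * A0^2 * zsum th <= ?D" using D by simp
  then show ?thesis using linJ_second_moment[OF th f, of ?J i] by (meson ennreal_leI order_trans)
 qed
 let ?X = "%x. ennreal (abs ((lin b i x - linJ ?J b i x) * linJ ?J a i x))"
 let ?Y = "%x. ennreal (abs ((lin a i x - linJ ?J a i x) * lin b i x))"
 let ?Z = "%x. ennreal (abs (lin a i x * lin b i x - linJ ?J a i x * linJ ?J b i x))"
 let ?U = "ennreal (?D * ?t)"
 have "NN M (%x. ?Z x) <=
   (NN M (%x. ?Y x + ?X x))"
 proof (intro nn_integral_mono)
  fix x
  have "abs (p * q - p' * q') <= abs ((p - p') * q) + abs ((q - q') * p')" for p q p' q' :: real
  proof -
   have "p * q - p' * q' = (p - p') * q + (q - q') * p'" by (simp add: algebra_simps)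
   then show ?thesis by (metis abs_triangle_ineq)
  qed
  then show "?Z x <= ?Y x + ?X x" by (simp add: ennreal_plus[symmetric] ennreal_leI del: ennreal_plus)
 qed
 also have "... = (NN M (%x. ?Y x)) + (NN M (%x. ?X x))" by (rule nn_integral_add) auto
 also have "... <= ?U + ?U" by (intro add_mono nn_integral_abs_mult_le T LJ a b lin_second_moment[OF th] D) auto
 also have "... = ennreal (12 * c0 * A0^2 * zsum th * ?t)"
 proof -
  have "?D * ?t + ?D * ?t = 12 * c0 * A0^2 * zsum th * ?t" by simp
  moreover have "?U + ?U = ennreal (?D * ?t + ?D * ?t)" using D by (intro ennreal_plus[symmetric] mult_nonneg_nonneg[OF D]) auto
  ultimately show ?thesis by (simp only:)
 qed
 finally show ?thesis .
qed

text \<open>n products with L1-errors O(n^-3) have a total expected error O(n^-2); these are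
  summable, so the total errors tend to 0 almost surely. The differences of the expectations stay
  bounded and are absorbed by e sqrt n.\<close>

lemma truncation_negligible:
 assumes th: "0 < th" and a: "!!n. adm th A0 (a n)" and b: "!!n. adm th A0 (b n)" and e: "e > 0"
 shows "AE x in M. \<forall>\<^sub>F n in sequentially. ALL k<=n.
   abs ((SUM i:{1..k}. lin (a n) (int i) x * lin (b n) (int i) x - expectation (%x. lin (a n) (int i) x * lin (b n) (int i) x))
   - (SUM i:{1..k}. linJ (2^(12 * (floor_log n + 1))) (a n) (int i) x * linJ (2^(12 * (floor_log n + 1))) (b n) (int i) x
    - expectation (%x. linJ (2^(12 * (floor_log n + 1))) (a n) (int i) x * linJ (2^(12 * (floor_log n + 1))) (b n) (int i) x))) <= e * sqrt n"
proof -
 let ?J = "%n. 2^(12 * (floor_log n + 1)) :: nat"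
 let ?L = "%n i x. lin (a n) (int i) x * lin (b n) (int i) x"
 let ?l = "%n i x. linJ (?J n) (a n) (int i) x * linJ (?J n) (b n) (int i) x"
 let ?C = "12 * c0 * A0^2 * zsum th"
 have C: "0 <= ?C" using c0 zsum_ge_1[OF th] by (intro mult_nonneg_nonneg) auto
 have I: "NN M (%x. ennreal (abs (?L n i x - ?l n i x))) <= ennreal (?C * inverse (real n ^ 3))" if n: "n >= 1" for n i
 proof -
  have "(1/2::real)^(3*(floor_log n + 1)) <= inverse (real n ^ 3)"
  proof -
   have "n <= 2^(floor_log n + 1)" using floor_log_exp2_gt[of n] by simp
   then have "real n <= real (2^(floor_log n + 1))" by (simp only: of_nat_le_iff)
   then have "real n <= 2^(floor_log n + 1)" by simp
   then have "real n ^ 3 <= (2^(floor_log n + 1))^3" by (intro power_mono) auto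
   then have "inverse ((2^(floor_log n + 1))^3) <= inverse (real n ^ 3)" using n by (intro le_imp_inverse_le) auto
   then show ?thesis by (simp only: power_mult[symmetric] power_one_over mult.commute[of _ "3::nat"] inverse_eq_divide)
  qed
  then have "?C * (1/2)^(3*(floor_log n + 1)) <= ?C * inverse (real n ^ 3)" using C by (intro mult_left_mono) auto
  then show ?thesis using product_truncation[OF th a[of n] b[of n], where i="int i" and m="floor_log n + 1"] by (meson ennreal_leI order_trans)
 qed
 define Z where "Z = (%n x. SUM i:{1..n}. abs (?L n i x - ?l n i x))"
 have [measurable]: "Z n : borel_measurable M" for n unfolding Z_def by measurable
 have Z0: "0 <= Z n x" for n x unfolding Z_def by (intro sum_nonneg) auto
 have IZ: "NN M (%x. ennreal (Z n x)) <= ennreal (?C * inverse (real n ^ 2))" for n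
 proof (cases "n = 0")
  case False
  have "NN M (%x. ennreal (Z n x)) = (SUM i:{1..n}. NN M (%x. ennreal (abs (?L n i x - ?l n i x))))"
   unfolding Z_def by (subst nn_integral_sum[symmetric]) auto
  also have "... <= (SUM i:{1..n}. ennreal (?C * inverse (real n ^ 3)))" using False by (intro sum_mono I) auto
  also have "... = ennreal (SUM i:{1..n}. ?C * inverse (real n ^ 3))" using C by (intro sum_ennreal) auto
  also have "(SUM i:{1..n}. ?C * inverse (real n ^ 3)) = ?C * inverse (real n ^ 2)"
   using False by (simp add: field_simps power2_eq_square power3_eq_cube)
  finally show ?thesis .
 qed (simp add: Z_def)
 have "NN M (%x. (\<Sum>n. ennreal (Z n x))) = (\<Sum>n. NN M (%x. ennreal (Z n x)))" by (rule nn_integral_suminf) auto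
 also have "... <= (\<Sum>n. ennreal (?C * inverse (real n ^ 2)))" by (intro suminf_le IZ) auto
 also have "... < \<infinity>"
 proof -
  have "summable (%n. ?C * inverse (real n ^ 2))" by (intro summable_mult inverse_power_summable) auto
  then show ?thesis using C by (subst suminf_ennreal2) auto
 qed
 finally have "AE x in M. (\<Sum>n. ennreal (Z n x)) ~= \<infinity>" by (intro nn_integral_PInf_AE) auto
 then have AZ: "AE x in M. Z' x" if "!!x. (%n. Z n x) \<longlonglongrightarrow> 0 ==> Z' x" for Z'
 proof eventually_elim
  case (elim x)
  then have "summable (%n. Z n x)" using Z0 by (intro summable_suminf_not_top) (auto simp: top_ennreal_def)
  then show ?case by (intro that summable_LIMSEQ_zero)
 qed
 have Lint: "integrable M (%x. ?L n i x)" for n i by (rule lin_product_integrable[OF th a b])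
 have lint: "integrable M (%x. ?l n i x)" for n i by (rule linJ_product_centered[of "int i - int (?J n)" _ _ "int i"]) auto
 have Ediff: "(SUM i:{1..n}. abs (expectation (?L n i) - expectation (?l n i))) <= ?C" if n: "n >= 1" for n
 proof -
  have "abs (expectation (?L n i) - expectation (?l n i)) <= ?C * inverse (real n ^ 3)" for i
  proof -
   have int: "integrable M (%x. abs (?L n i x - ?l n i x))" by (intro integrable_abs Bochner_Integration.integrable_diff Lint lint)
   have 1: "abs (expectation (?L n i) - expectation (?l n i)) = abs (expectation (%x. ?L n i x - ?l n i x))"
    by (subst Bochner_Integration.integral_diff[OF Lint lint]) (rule refl)
   have 2: "abs (expectation (%x. ?L n i x - ?l n i x)) <= expectation (%x. abs (?L n i x - ?l n i x))" by (rule integral_abs_bound)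
   have "ennreal (expectation (%x. abs (?L n i x - ?l n i x))) <= ennreal (?C * inverse (real n ^ 3))"
    by (subst nn_integral_eq_integral[OF int, symmetric]) (rule AE_I2, rule abs_ge_zero, rule I[OF n])
   then have "expectation (%x. abs (?L n i x - ?l n i x)) <= ?C * inverse (real n ^ 3)"
    by (rule ennreal_le_iff[THEN iffD1, rotated]) (rule mult_nonneg_nonneg[OF C], simp)
   with 1 2 show ?thesis by linarith
  qed
  then have "(SUM i:{1..n}. abs (expectation (?L n i) - expectation (?l n i))) <= (SUM i:{1..n}. ?C * inverse (real n ^ 3))" by (intro sum_mono)
  also have "... = ?C * inverse (real n ^ 2)" using n by (simp add: field_simps power2_eq_square power3_eq_cube)
  also have "... <= ?C * 1"
  proof (rule mult_left_mono[OF _ C])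
   have "1 <= real n ^ 2" using n by (intro one_le_power) auto
   then show "inverse (real n ^ 2) <= 1" by (rule inverse_le_1_iff[THEN iffD2, OF disjI2])
  qed
  finally show ?thesis by simp
 qed
 show ?thesis
 proof (rule AZ)
  fix x assume Zx: "(%n. Z n x) \<longlonglongrightarrow> 0"
  then have "\<forall>\<^sub>F n in sequentially. Z n x < 1" by (rule order_tendstoD) simp
  moreover have "\<forall>\<^sub>F n in sequentially. 1 + ?C <= e * sqrt (real n)"
  proof -
   have "filterlim (%n. e * sqrt (real n)) at_top sequentially"
    using e by (intro filterlim_tendsto_pos_mult_at_top[OF tendsto_const] filterlim_compose[OF sqrt_at_top filterlim_real_sequentially])
   then show ?thesis unfolding filterlim_at_top by blast
  qed
  ultimately show "\<forall>\<^sub>F n in sequentially. ALL k<=n. abs ((SUM i:{1..k}. ?L n i x - expectation (?L n i)) - (SUM i:{1..k}. ?l n i x - expectation (?l n i))) <= e * sqrt n"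
   using eventually_ge_at_top[of "1::nat"]
  proof eventually_elim
   case (elim n)
   show ?case
   proof (intro allI impI)
    fix k assume k: "k <= n"
    show "abs ((SUM i:{1..k}. ?L n i x - expectation (?L n i)) - (SUM i:{1..k}. ?l n i x - expectation (?l n i))) <= e * sqrt n"
     by (rule order_trans[OF abs_diff_of_centered_sums_le[OF k]])
       (use elim(1) elim(2) Ediff[OF elim(3)] in \<open>unfold Z_def, linarith\<close>)
   qed
  qed
 qed
qed

end

section \<open>Characteristic functions of block sums\<close>

lemma integrable_mult_of_squares:
 fixes U V :: "'a => real"
 assumes [measurable]: "U : borel_measurable M" "V : borel_measurable M"
  and "integrable M (%x. (U x)^2)" "integrable M (%x. (V x)^2)"
 shows "integrable M (%x. U x * V x)"
proof (rule Bochner_Integration.integrable_bound)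
 show "integrable M (%x. (U x)^2 + (V x)^2)" using assms by auto
 have "abs (u * v) <= u^2 + v^2" for u v :: real
 proof -
  have "0 <= (abs u - abs v)^2 + (u^2 + v^2)" by simp
  then show ?thesis by (simp add: power2_diff abs_mult)
 qed
 then show "AE x in M. norm (U x * V x) <= norm ((U x)^2 + (V x)^2)" by simp
qed simp

context indep_centered
begin

lemma past_mult:
 fixes f :: "(nat => real) => real" and h :: "real => real"
 assumes f[measurable]: "f : borel_measurable (PiM {..<n} (%_. borel))" and h[measurable]: "h : borel_measurable borel"
  and i: "integrable M (%x. f (\<lambda>i\<in>{..<n}. e i x))" "integrable M (%x. h (e n x))"
 shows "integrable M (%x. f (\<lambda>i\<in>{..<n}. e i x) * h (e n x))"
  "expectation (%x. f (\<lambda>i\<in>{..<n}. e i x) * h (e n x)) = expectation (%x. f (\<lambda>i\<in>{..<n}. e i x)) * expectation (%x. h (e n x))"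
proof -
 let ?X = "%x. f (\<lambda>i\<in>{..<n}. e i x)"
 have "indep_var borel (f \<circ> (%x. \<lambda>i\<in>{..<n}. e i x)) borel ((%r. h (r n)) \<circ> (%x. \<lambda>i\<in>{n}. e i x))"
  by (rule indep_var_compose[OF indep_past]) measurable
 then have v: "indep_var borel (%x. ?X x) borel (%x. h (e n x))" by (simp add: comp_def)
 show "integrable M (%x. ?X x * h (e n x))" by (rule indep_var_integrable[OF v i])
 show "expectation (%x. ?X x * h (e n x)) = expectation (%x. ?X x) * expectation (%x. h (e n x))"
  by (rule indep_var_lebesgue_integral[OF v i])
qed

lemma linear_form_moments:
 "integrable M (%x. (\<Sum>l<n. k l * e l x))" "expectation (%x. \<Sum>l<n. k l * e l x) = 0"
 "integrable M (%x. (\<Sum>l<n. k l * e l x)^2)" "expectation (%x. (\<Sum>l<n. k l * e l x)^2) = (\<Sum>l<n. (k l)^2 * s2 l)"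
proof -
 show 1: "integrable M (%x. (\<Sum>l<n. k l * e l x))" for n by (simp add: e_int)
 show 2: "expectation (%x. \<Sum>l<n. k l * e l x) = 0" for n by (simp add: Bochner_Integration.integral_sum e_int mean0)
 have "integrable M (%x. (\<Sum>l<n. k l * e l x)^2) & expectation (%x. (\<Sum>l<n. k l * e l x)^2) = (\<Sum>l<n. (k l)^2 * s2 l)"
 proof (induction n)
  case (Suc n)
  have e: "(\<Sum>l<Suc n. k l * e l x)^2 = (\<Sum>l<n. k l * e l x)^2 + (2 * k n) * ((\<Sum>l<n. k l * e l x) * e n x) + (k n)^2 * (e n x)^2" for x
   by (simp add: power2_eq_square algebra_simps)
  have r: "(\<Sum>l<n. k l * e l x) = (%r. \<Sum>l<n. k l * r l) (\<lambda>i\<in>{..<n}. e i x)" for x by simp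
  have m: "(%r. \<Sum>l<n. k l * r l) : borel_measurable (PiM {..<n} (%_. borel))" by measurable
  have p: "integrable M (%x. (\<Sum>l<n. k l * e l x) * e n x)" "expectation (%x. (\<Sum>l<n. k l * e l x) * e n x) = 0"
   using past_mult[OF m, of "%y. y"] 1[of n] e_int[of n] by (simp_all add: mean0)
  show ?case unfolding e using Suc p sq_int by (simp add: s2)
 qed simp
 then show "integrable M (%x. (\<Sum>l<n. k l * e l x)^2)" "expectation (%x. (\<Sum>l<n. k l * e l x)^2) = (\<Sum>l<n. (k l)^2 * s2 l)" by auto
qed

text \<open>\<open>tau\<close> for an abstract sequence started at index 0, so that its moments can
  be found by induction on the length.\<close>

definition tq :: "(nat => real) => nat => 'a => real" where
 "tq ph n x = (\<Sum>j<n. ph 0 * ((e j x)^2 - s2 j) + e j x * (\<Sum>l<j. ph (j - l) * e l x))"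

lemma tq_meas[measurable]: "tq ph n : borel_measurable M" unfolding tq_def by measurable

lemma tq_moments:
 assumes f4: "!!j. integrable M (%x. (e j x)^4)"
 shows "integrable M (tq ph n)" "expectation (tq ph n) = 0" "integrable M (%x. (tq ph n x)^2)"
  "expectation (%x. (tq ph n x)^2) = (\<Sum>j<n. (ph 0)^2 * (expectation (%x. (e j x)^4) - (s2 j)^2) + (\<Sum>l<j. (ph (j - l))^2 * s2 j * s2 l))"
proof -
 have "integrable M (tq ph n) & expectation (tq ph n) = 0 & integrable M (%x. (tq ph n x)^2) &
  expectation (%x. (tq ph n x)^2) = (\<Sum>j<n. (ph 0)^2 * (expectation (%x. (e j x)^4) - (s2 j)^2) + (\<Sum>l<j. (ph (j - l))^2 * s2 j * s2 l))"
 proof (induction n)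
  case (Suc n)
  let ?h = "%x. (e n x)^2 - s2 n" and ?Z = "%x. \<Sum>l<n. ph (n - l) * e l x"
  note Z = linear_form_moments[where n=n and k="%l. ph (n - l)"]
  let ?zf = "%r. \<Sum>l<n. ph (n - l) * r l"
  let ?tf = "%r. \<Sum>j<n. ph 0 * ((r j)^2 - s2 j) + r j * (\<Sum>l<j. ph (j - l) * r l)"
  have tf: "tq ph n x = ?tf (\<lambda>i\<in>{..<n}. e i x)" for x
   unfolding tq_def by (intro sum.cong refl arg_cong2[where f="(+)"] arg_cong2[where f="(*)"]) auto
  have zf: "?Z x = ?zf (\<lambda>i\<in>{..<n}. e i x)" for x by simp
  have mz[measurable]: "?zf : borel_measurable (PiM {..<n} (%_. borel))" by measurable
  have mt[measurable]: "?tf : borel_measurable (PiM {..<n} (%_. borel))"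
  proof (intro borel_measurable_sum borel_measurable_add borel_measurable_times borel_measurable_const borel_measurable_diff borel_measurable_power)
  qed (auto intro!: measurable_component_singleton)
  have h2e: "(?h x)^2 = (e n x)^4 - 2 * s2 n * (e n x)^2 + (s2 n)^2" for x by (simp add: power2_diff flip: power_mult)
  have ih2: "integrable M (%x. (?h x)^2)" unfolding h2e using f4 sq_int by auto
  have Eh2: "expectation (%x. (?h x)^2) = expectation (%x. (e n x)^4) - (s2 n)^2"
   unfolding h2e using f4 sq_int by (simp add: s2 prob_space) (simp add: power2_eq_square)
  have ih: "integrable M ?h" using sq_int by auto
  have Eh: "expectation ?h = 0" using sq_int by (simp add: s2 prob_space)
  have ihe: "integrable M (%x. ?h x * e n x)" by (rule integrable_mult_of_squares) (use ih2 sq_int in auto)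
  have itZ: "integrable M (%x. tq ph n x * ?Z x)" by (rule integrable_mult_of_squares) (use Suc Z(3) in auto)
  have D: "integrable M (%x. ?Z x * e n x)" "expectation (%x. ?Z x * e n x) = 0"
   using past_mult[OF mz, of "%y. y"] Z(1) e_int[of n] by (simp_all add: mean0)
  have p1: "integrable M (%x. (?Z x)^2 * (e n x)^2)" "expectation (%x. (?Z x)^2 * (e n x)^2) = (\<Sum>l<n. (ph (n - l))^2 * s2 l) * s2 n"
   using past_mult[of "%r. (?zf r)^2" n "%y. y^2"] Z(3,4) sq_int[of n] by (simp_all add: s2)
  have p2: "integrable M (%x. tq ph n x * ?h x)" "expectation (%x. tq ph n x * ?h x) = 0"
   using past_mult[OF mt, of "%y. y^2 - s2 n"] Suc ih Eh unfolding tf[symmetric] by simp_all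
  have p3: "integrable M (%x. (tq ph n x * ?Z x) * e n x)" "expectation (%x. (tq ph n x * ?Z x) * e n x) = 0"
   using past_mult[OF borel_measurable_times[OF mt mz], of "%y. y"] itZ e_int[of n] unfolding tf[symmetric] zf[symmetric] by (simp_all add: mean0)
  \<comment> \<open>The factor of index n has the third moment as its mean, which need not vanish;
    here the mean of the past factor ?Z is what vanishes.\<close>
  have p4: "integrable M (%x. ?Z x * (?h x * e n x))" "expectation (%x. ?Z x * (?h x * e n x)) = 0"
   using past_mult[OF mz, of "%y. (y^2 - s2 n) * y"] Z(1,2) ihe unfolding zf[symmetric] by simp_all
  have s: "tq ph (Suc n) x = tq ph n x + (ph 0 * ?h x + ?Z x * e n x)" for x unfolding tq_def by (simp add: mult.commute)
  have sq: "(tq ph (Suc n) x)^2 = (tq ph n x)^2 + (ph 0)^2 * (?h x)^2 + (?Z x)^2 * (e n x)^2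
    + (2 * ph 0) * (tq ph n x * ?h x) + 2 * ((tq ph n x * ?Z x) * e n x) + (2 * ph 0) * (?Z x * (?h x * e n x))" for x
   unfolding s by (simp only: power2_eq_square distrib_left distrib_right mult_2 mult_ac add_ac)
  have "integrable M (tq ph (Suc n))" "expectation (tq ph (Suc n)) = 0" unfolding s[abs_def] using Suc D ih Eh by simp_all
  moreover have "integrable M (%x. (tq ph (Suc n) x)^2)"
   unfolding sq by (intro Bochner_Integration.integrable_add integrable_mult_right ih2 p1 p2 p3 p4) (use Suc in blast)
  moreover have "expectation (%x. (tq ph (Suc n) x)^2) = expectation (%x. (tq ph n x)^2) + (ph 0)^2 * expectation (%x. (?h x)^2)
    + expectation (%x. (?Z x)^2 * (e n x)^2) + (2 * ph 0) * expectation (%x. tq ph n x * ?h x)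
    + 2 * expectation (%x. (tq ph n x * ?Z x) * e n x) + (2 * ph 0) * expectation (%x. ?Z x * (?h x * e n x))"
   unfolding sq using Suc ih2 p1(1) p2(1) p3(1) p4(1) by simp
  ultimately show ?case unfolding Eh2 p1(2) p2(2) p3(2) p4(2) using Suc by (simp add: sum_distrib_left mult_ac)
 qed (simp add: tq_def)
 then show "integrable M (tq ph n)" "expectation (tq ph n) = 0" "integrable M (%x. (tq ph n x)^2)"
  "expectation (%x. (tq ph n x)^2) = (\<Sum>j<n. (ph 0)^2 * (expectation (%x. (e j x)^4) - (s2 j)^2) + (\<Sum>l<j. (ph (j - l))^2 * s2 j * s2 l))"
  by blast+
qed

end

text \<open>As 2 <= 2 pm <= 3, the power |y|^(2 pm) dominates |y|^3 for |y| <= 1 and y^2 beyond,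
  hence the second-order Taylor remainder everywhere. In the same way the passage from 1 - v/2 to
  exp (- v/2) costs (v/2)^pm.\<close>

lemma (in prob_space) char_second_order:
 assumes [measurable]: "X : borel_measurable M" and pm: "1 < pm" "pm <= 3/2"
  and i: "integrable M X" "expectation X = 0" "integrable M (%x. (X x)^2)" "expectation (%x. (X x)^2) = v"
  and K: "NN M (%x. ennreal (abs (X x) powr (2 * pm))) <= ennreal K" "0 <= K"
 shows "cmod ((CLINT x|M. iexp (X x)) - exp (- (v/2))) <= K + v powr pm"
proof -
 have v0: "0 <= v" unfolding i(4)[symmetric] by simp
 let ?Z = "%y. cmod (iexp y - (1 + \<i> * y - y^2 / 2))"
 have pt: "?Z y <= abs y powr (2 * pm)" for y :: real
 proof -
  have e: "(SUM k<= 2. (\<i> * y)^k / fact k) = 1 + \<i> * y - y^2 / 2" by (simp add: numeral_2_eq_2 power2_eq_square complex_eq_iff)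
  show ?thesis
  proof (cases "abs y <= 1")
   case True
   have "?Z y <= abs y^3 / 6" using iexp_approx1[of y 2] unfolding e by (simp add: numeral_3_eq_3 fact_numeral)
   also have "... <= abs y^3" by simp
   also have "... <= abs y powr (2 * pm)"
   proof (cases "y = 0")
    case False
    then have "abs y^3 = abs y powr 3" by simp
    also have "... <= abs y powr (2 * pm)" using True pm by (intro powr_mono') auto
    finally show ?thesis .
   qed simp
   finally show ?thesis .
  next
   case False
   have "?Z y <= abs y^2" using iexp_approx2[of y 2] unfolding e by simp
   also have "abs y^2 = abs y powr 2" using False by simp
   also have "... <= abs y powr (2 * pm)" using False pm by (intro powr_mono) auto
   finally show ?thesis .
  qed
 qed
 have int: "integrable M (%x. iexp (X x))" by (rule integrable_const_bound[where B=1]) auto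
 let ?U = "%x. complex_of_real (X x)"
 have cx: "integrable M (%x. ?U x)" "integrable M (%x. (?U x)^2)" using i(1,3) by (simp_all add: integrable_of_real flip: of_real_power)
 have int2: "integrable M (%x. 1 + \<i> * X x - (X x)^2 / 2)" using cx by simp
 have Ev: "(CLINT x|M. 1 + \<i> * X x - (X x)^2 / 2) = 1 - v / 2"
 proof -
  have "(CLINT x|M. ?U x) = 0" using i by (simp add: integral_complex_of_real)
  moreover have "(CLINT x|M. (?U x)^2) = v" using i by (simp flip: of_real_power)
  ultimately show ?thesis using cx by (simp add: prob_space)
 qed
 have "(NN M (%x. ennreal (abs (X x) powr (2 * pm)))) < \<infinity>" using K(1) by (simp add: order_le_less_trans)
 then have ip: "integrable M (%x. abs (X x) powr (2 * pm))" by (intro integrableI_nonneg) auto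
 let ?X = "cmod ((CLINT x|M. iexp (X x)) - (1 - v / 2))"
 have "?X = cmod (CLINT x|M. iexp (X x) - (1 + \<i> * X x - (X x)^2 / 2))"
  unfolding Ev[symmetric] by (subst Bochner_Integration.integral_diff[OF int int2]) (rule refl)
 also have "... <= (LINT x|M. cmod (iexp (X x) - (1 + \<i> * X x - (X x)^2 / 2)))" by (rule integral_norm_bound)
 also have "... <= (LINT x|M. abs (X x) powr (2 * pm))"
  by (intro integral_mono ip integrable_norm Bochner_Integration.integrable_diff int int2 pt)
 also have "... <= K"
 proof -
  have "ennreal (LINT x|M. abs (X x) powr (2 * pm)) <= ennreal K" by (subst nn_integral_eq_integral[OF ip, symmetric]) (auto intro: K)
  then show ?thesis using K(2) by simp
 qed
 finally have 1: "?X <= K" .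
 let ?S = "%y. abs (exp (- y) - (1 - y))"
 have ex: "?S y <= y powr pm" if "0 <= y" for y :: real
 proof -
  have 0: "0 <= exp (- y) - (1 - y)" using exp_ge_add_one_self[of "-y"] by simp
  show ?thesis
  proof (cases "y <= 1")
   case True
   have "exp (- y) <= 1 - y + y^2"
   proof -
    have "exp y >= 1 + y" by (rule exp_ge_add_one_self)
    then have "exp (- y) <= 1 / (1 + y)" using that by (simp add: exp_minus field_simps)
    also have "... <= 1 - y + y^2"
    proof -
     have "1 <= (1 - y + y^2) * (1 + y)" using that by (simp add: power2_eq_square algebra_simps)
     then show ?thesis using that by (simp add: field_simps)
    qed
    finally show ?thesis .
   qed
   then have "?S y <= y^2" using 0 by simp
   also have "... <= y powr pm"
   proof (cases "y = 0")
    case False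
    then have "y^2 = y powr 2" using that by simp
    also have "... <= y powr pm" using True that pm by (intro powr_mono') auto
    finally show ?thesis .
   qed simp
   finally show ?thesis .
  next
   case False
   have "exp (- y) <= 1" using that by simp
   then have "?S y <= y powr 1" using 0 that by simp
   also have "... <= y powr pm" using False pm by (intro powr_mono) auto
   finally show ?thesis .
  qed
 qed
 let ?Y = "exp (- (v/2))"
 let ?W = "cmod ((1 - v/2) - ?Y)"
 have "?W = abs (?Y - (1 - v/2))"
 proof -
  have "(1 - v/2) - ?Y = complex_of_real (- (?Y - (1 - v/2)))" by simp
  then show ?thesis by (simp only: norm_of_real abs_minus_cancel)
 qed
 also have "... <= (v/2) powr pm" using v0 by (intro ex) auto
 also have "... <= v powr pm" using v0 pm by (intro powr_mono2) auto
 finally have 2: "?W <= v powr pm" .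
 have "cmod ((CLINT x|M. iexp (X x)) - ?Y) <= ?X + ?W"
  using norm_triangle_ineq[of "(CLINT x|M. iexp (X x)) - (1 - v / 2)" "(1 - v/2) - ?Y"] by simp
 then show ?thesis using 1 2 by linarith
qed

text \<open>Two products of complex numbers of modulus at most 1 differ by at most the sum of the
  differences of their factors.\<close>

lemma (in prob_space) char_sum_second_order:
 assumes R: "finite R" and ind: "indep_vars (%_. borel) X R" and pm: "1 < pm" "pm <= 3/2"
  and i: "!!r. r : R ==> integrable M (X r)" "!!r. r : R ==> expectation (X r) = 0"
   "!!r. r : R ==> integrable M (%x. (X r x)^2)" "!!r. r : R ==> expectation (%x. (X r x)^2) = v r"
  and K: "!!r. r : R ==> NN M (%x. ennreal (abs (X r x) powr (2 * pm))) <= ennreal (K r)" "!!r. r : R ==> 0 <= K r"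
 shows "cmod ((CLINT x|M. iexp (SUM r:R. X r x)) - exp (- ((SUM r:R. v r)/2))) <= (SUM r:R. K r + v r powr pm)"
proof -
 have m[measurable]: "r : R ==> X r : borel_measurable M" for r using i(1) by auto
 have v0: "r : R ==> 0 <= v r" for r using i(4)[of r] by (metis integral_nonneg_AE AE_I2 zero_le_power2)
 let ?Z = "%r x. iexp (X r x)"
 let ?Y = "PROD r:R. CLINT x|M. ?Z r x"
 have "(CLINT x|M. iexp (SUM r:R. X r x)) = (CLINT x|M. (PROD r:R. ?Z r x))" by (simp add: sum_distrib_left exp_sum[OF R])
 also have "... = ?Y"
 proof (rule indep_vars_lebesgue_integral[OF R])
  show "indep_vars (%_. borel) (%r x. ?Z r x) R" by (rule indep_vars_compose2[OF ind]) simp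
  show "integrable M (%x. ?Z r x)" if "r : R" for r by (rule integrable_const_bound[where B=1]) (use that in auto)
 qed
 finally have 1: "(CLINT x|M. iexp (SUM r:R. X r x)) = ?Y" .
 let ?X = "%r. complex_of_real (exp (- (v r/2)))"
 have 2: "complex_of_real (exp (- ((SUM r:R. v r)/2))) = (PROD r:R. ?X r)"
  by (simp add: exp_sum[OF R, symmetric] sum_negf sum_divide_distrib flip: of_real_prod)
 have "cmod (?Y - (PROD r:R. ?X r)) <=
   (SUM r:R. cmod ((CLINT x|M. ?Z r x) - ?X r))"
 proof (rule norm_prod_diff)
  fix r assume r: "r : R"
  have "cmod (CLINT x|M. ?Z r x) <= (LINT x|M. cmod (?Z r x))" by (rule integral_norm_bound)
  then show "cmod (CLINT x|M. ?Z r x) <= 1" by (simp add: prob_space)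
  show "cmod (?X r) <= 1" using v0[OF r] by simp
 qed
 also have "... <= (SUM r:R. K r + v r powr pm)"
 proof (rule sum_mono)
  fix r assume r: "r : R"
  show "cmod ((CLINT x|M. ?Z r x) - ?X r) <= K r + v r powr pm" using char_second_order[OF m[OF r] pm i(1-4)[OF r] K[OF r]] by simp
 qed
 finally show ?thesis unfolding 1 2 .
qed

context innov
begin

text \<open>\<open>covsum\<close> with the coefficients given as sequences in the lag; in this form
  it is bilinear in them.\<close>

definition covs :: "nat => (nat => real) => (nat => real) => nat => real" where
 "covs u ph psi m' = ph 0 * psi 0 * (SUM j:{1..u}. gam4 (int (m' + j)) - (sig2 (int (m' + j)))^2)
   + (SUM j:{1..u}. SUM l:{1..<j}. ph (j - l) * psi (j - l) * sig2 (int (m' + j)) * sig2 (int (m' + l)))"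

lemma tau_moments:
 "integrable M (tau u ph m')" "expectation (tau u ph m') = 0"
 "integrable M (%x. (tau u ph m' x)^2)" "expectation (%x. (tau u ph m' x)^2) = covs u ph ph m'"
proof -
 let ?X = "%j. (int m' + 1) + int j"
 interpret s: indep_centered M "%j. eps (?X j)" "%j. sig2 (?X j)" by (rule shifted)
 have re: "(SUM j:{1..u}. h j) = (\<Sum>j<u. h (Suc j))" for u and h :: "nat => real"
  by (rule sum.reindex_bij_witness[of _ Suc "%j. j - 1"]) auto
 have re': "(SUM l:{1..<Suc j}. h l) = (\<Sum>l<j. h (Suc l))" for j and h :: "nat => real"
  by (rule sum.reindex_bij_witness[of _ Suc "%j. j - 1"]) auto
 have ix: "int (m' + Suc j) = (int m' + 1) + int j" for j by simp
 have e: "tau u ph m' = s.tq ph u" unfolding tau_def[abs_def] s.tq_def[abs_def] re re' ix diff_Suc_Suc ..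
 have c: "covs u ph ph m' = (\<Sum>j<u. (ph 0)^2 * (expectation (%x. (eps (?X j) x)^4) - (sig2 (?X j))^2) + (\<Sum>l<j. (ph (j - l))^2 * sig2 (?X j) * sig2 (?X l)))"
  unfolding covs_def re re' ix diff_Suc_Suc gam4_def by (simp add: sum.distrib sum_distrib_left power2_eq_square)
 show "integrable M (tau u ph m')" "expectation (tau u ph m') = 0"
  "integrable M (%x. (tau u ph m' x)^2)" "expectation (%x. (tau u ph m' x)^2) = covs u ph ph m'"
  unfolding e c using s.tq_moments[of ph u] eps4(1) by blast+
qed

lemma covs_nonneg: "0 <= covs u ph ph m'" unfolding tau_moments(4)[symmetric] by simp

definition Cg :: real where "Cg = 8 * (B + c0^3)"

text \<open>Deliberately crude: the product of two innovations is bounded by the mean of their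
  squares, at the price of a factor u. As u is a very small power of q, fixed powers of u are
  affordable.\<close>

lemma tau_abs_le:
 assumes D: "!!l. abs (ph l) <= D" and u: "1 <= u"
 shows "abs (tau u ph m' x) <= 2 * D * real u * (SUM j:{1..u}. g (int (m' + j)) x)"
proof -
 have D0: "0 <= D" using D[of 0] by linarith
 let ?e = "%j. eps (int (m' + j)) x" and ?g = "%j. g (int (m' + j)) x"
 have g0: "0 <= ?g j" for j using g_pos(2)[of "int (m' + j)" x] by simp
 let ?X = "%j. (?e j)^2 - sig2 (int (m' + j))"
 have gg: "abs (?X j) <= ?g j" "(?e j)^2 <= ?g j" for j
 proof -
  have "0 <= (?e j)^2" by simp
  then show "abs (?X j) <= ?g j" "(?e j)^2 <= ?g j" unfolding g_def abs_le_iff using eps2(2,3)[of "int (m' + j)"] c0 by linarith+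
 qed
 let ?Y = "%j. SUM l:{1..u}. D * ((?g j + ?g l) / 2)"
 let ?Z = "SUM j:{1..u}. ?g j"
 let ?U = "%j. SUM l:{1..<j}. ph (j - l) * ?e l"
 have "abs (tau u ph m' x) <= (SUM j:{1..u}. abs (ph 0 * ?X j + ?e j * ?U j))" unfolding tau_def by (rule sum_abs)
 also have "... <= (SUM j:{1..u}. D * ?g j + ?Y j)"
 proof (rule sum_mono)
  fix j assume j: "j : {1..u}"
  have pr: "abs (?e j) * abs (?e l) <= (?g j + ?g l) / 2" for l
  proof -
   have ar: "2 * p <= a + b ==> a <= a' ==> b <= b' ==> p <= (a' + b') / 2" for p a b a' b' :: real by (simp only: le_divide_eq_numeral1)
   have "0 <= (abs (?e j) - abs (?e l))^2" by simp
   then have "2 * (abs (?e j) * abs (?e l)) <= (?e j)^2 + (?e l)^2" by (simp add: power2_diff)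
   then show ?thesis by (rule ar[OF _ gg(2) gg(2)])
  qed
  have "abs (?e j * ?U j) = abs (SUM l:{1..<j}. ph (j - l) * (?e j * ?e l))" by (simp add: sum_distrib_left mult_ac)
  also have "... <= (SUM l:{1..<j}. abs (ph (j - l) * (?e j * ?e l)))" by (rule sum_abs)
  also have "... <= (SUM l:{1..<j}. D * ((?g j + ?g l) / 2))" unfolding abs_mult using D0 by (intro sum_mono mult_mono D pr) auto
  also have "... <= ?Y j" using j D0 g0 by (intro sum_mono2 mult_nonneg_nonneg divide_nonneg_nonneg add_nonneg_nonneg) auto
  finally have 1: "abs (?e j * ?U j) <= ?Y j" .
  have 2: "abs (ph 0 * ?X j) <= D * ?g j" unfolding abs_mult using D0 by (intro mult_mono D gg) auto
  show "abs (ph 0 * ?X j + ?e j * ?U j) <= D * ?g j + ?Y j" by (rule order_trans[OF abs_triangle_ineq add_mono[OF 2 1]])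
 qed
 also have "... = D * ?Z + D * (real u * ?Z)" by (simp add: sum.distrib sum_distrib_left[symmetric] sum_divide_distrib[symmetric])
 also have "... <= 2 * D * real u * ?Z"
 proof -
  have G0: "0 <= D * ?Z" using D0 g0 by (intro mult_nonneg_nonneg sum_nonneg)
  have "1 * (D * ?Z) <= real u * (D * ?Z)" using u G0 by (intro mult_right_mono) auto
  then show ?thesis by (simp add: mult_ac)
 qed
 finally show ?thesis .
qed

lemma tau_powr_moment:
 assumes D: "!!l. abs (ph l) <= D" and u: "1 <= u" and r: "1 <= r" "r <= 2 * pm"
 shows "NN M (%x. ennreal (abs (tau u ph m' x) powr r)) <= ennreal ((2 * D * (real u)^2) powr r * Cg)"
proof -
 have D0: "0 <= D" using D[of 0] by linarith
 have Cg0: "0 <= Cg" using Cm_ge(5) unfolding Cg_def by simp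
 let ?g = "%j x. g (int (m' + j)) x"
 let ?c = "(2 * D * real u) powr r * real u powr (r - 1)"
 let ?X = "%x. SUM j:{1..u}. ?g j x"
 have "abs (tau u ph m' x) powr r <= ?c * (SUM j:{1..u}. ?g j x powr (2 * pm))" for x
 proof -
  have S0: "0 <= ?X x" using g_pos(2) by (intro sum_nonneg less_imp_le)
  have "abs (tau u ph m' x) powr r <= (2 * D * real u * ?X x) powr r" using r by (intro powr_mono2 tau_abs_le D u) auto
  also have "... = (2 * D * real u) powr r * (?X x) powr r" by (rule powr_mult)
  also have "(?X x) powr r <= real u powr (r - 1) * (SUM j:{1..u}. ?g j x powr r)"
   using powr_weighted_mean_le[of "{1..u}" "%j. ?g j x" "%_. 1" r] g_pos(2) r by simp
  also have "(SUM j:{1..u}. ?g j x powr r) <= (SUM j:{1..u}. ?g j x powr (2 * pm))" using g_pos(1) r by (intro sum_mono powr_mono) auto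
  finally show ?thesis by (simp add: mult.assoc mult_left_mono)
 qed
 then have "NN M (%x. ennreal (abs (tau u ph m' x) powr r)) <= NN M (%x. ennreal ?c * (SUM j:{1..u}. ennreal (?g j x powr (2 * pm))))"
  by (intro nn_integral_mono) (simp add: ennreal_mult'[symmetric] ennreal_leI sum_nonneg)
 also have "... = ennreal ?c * (SUM j:{1..u}. NN M (%x. ennreal (?g j x powr (2 * pm))))"
  by (subst nn_integral_cmult, measurable, subst nn_integral_sum) auto
 also have "... <= ennreal ?c * (SUM j:{1..u}. ennreal Cg)" unfolding Cg_def by (intro mult_left_mono sum_mono g_mom_aux) auto
 also have "... = ennreal (?c * (real u * Cg))" using Cg0 by (simp add: ennreal_mult'[symmetric] ennreal_of_nat_eq_real_of_nat)
 also have "?c * (real u * Cg) = (2 * D * (real u)^2) powr r * Cg"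
 proof -
  have "(2 * D * (real u)^2) powr r = (2 * D * real u * real u) powr r" by (simp add: power2_eq_square mult.assoc)
  also have "... = (2 * D * real u) powr r * real u powr r" by (rule powr_mult)
  also have "real u powr r = real u powr (r - 1) * real u" using u by (simp add: powr_diff)
  finally show ?thesis by (simp add: mult_ac)
 qed
 finally show ?thesis .
qed

text \<open>Together with \<open>covs_bilinear\<close> this reduces vectors of block sums to a
  single real block sum with combined coefficients.\<close>

lemma tau_linear: "(SUM i:I. w i * tau u (ph i) m' x) = tau u (%l. SUM i:I. w i * ph i l) m' x"
proof (induction I rule: infinite_finite_induct)
 case (insert i I)
 have "tau u (%l. w i * ph i l + psi l) m' x = w i * tau u (ph i) m' x + tau u psi m' x" for psi
  unfolding tau_def by (simp add: sum_distrib_left sum.distrib[symmetric] algebra_simps)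
 with insert show ?case by simp
qed (simp_all add: tau_def)

lemma covs_bilinear:
 "covs u (%l. SUM i:I. w i * ph i l) (%l. SUM i:I. w i * ph i l) m' = (SUM i:I. SUM k:I. w i * w k * covs u (ph i) (ph k) m')"
proof -
 have pr: "(SUM i:I. w i * ph i l) * (SUM i:I. w i * ph i l) = (SUM i:I. SUM k:I. w i * w k * (ph i l * ph k l))" for l
  unfolding sum_product by (simp add: mult_ac)
 let ?Y = "%j. sig2 (int (m' + j))"
 let ?X = "SUM i:I. SUM k:I. SUM j:{1..u}. SUM l:{1..<j}. w i * w k * (ph i (j - l) * ph k (j - l)) * ?Y j * ?Y l"
 let ?Z = "SUM j:{1..u}. gam4 (int (m' + j)) - (?Y j)^2"
 have "(SUM i:I. SUM k:I. w i * w k * covs u (ph i) (ph k) m') =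
  (SUM i:I. SUM k:I. w i * w k * (ph i 0 * ph k 0)) * ?Z
  + ?X"
 proof -
  define S where "S = ?Z"
  show ?thesis unfolding covs_def S_def[symmetric] distrib_left sum.distrib by (simp only: sum_distrib_right sum_distrib_left mult.assoc)
 qed
 also have "?X
  = (SUM j:{1..u}. SUM i:I. SUM k:I. SUM l:{1..<j}. w i * w k * (ph i (j - l) * ph k (j - l)) * ?Y j * ?Y l)"
  by (subst sum.swap[of _ "{1..u}"], subst sum.swap[of _ "{1..u}"]) (rule refl)
 also have "... = (SUM j:{1..u}. SUM l:{1..<j}. SUM i:I. SUM k:I. w i * w k * (ph i (j - l) * ph k (j - l)) * ?Y j * ?Y l)"
  by (intro sum.cong refl, subst sum.swap[of _ "{1..<_}"], subst sum.swap[of _ "{1..<_}"]) (rule refl)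
 finally show ?thesis unfolding covs_def pr by (simp add: sum_distrib_right)
qed

end

lemma abs_exp_uminus_diff_le:
 fixes x y :: real
 assumes "0 <= x" "0 <= y"
 shows "abs (exp (- x) - exp (- y)) <= abs (x - y)"
proof -
 have *: "abs (exp (- x) - exp (- y)) <= abs (x - y)" if "0 <= x" "x <= y" for x y :: real
 proof -
  have "exp (- x) - exp (- y) = exp (- x) * (1 - exp (- (y - x)))" by (simp add: right_diff_distrib flip: exp_add)
  moreover have "exp (- x) * (1 - exp (- (y - x))) <= 1 * (y - x)"
  proof (rule mult_mono)
   show "1 - exp (- (y - x)) <= y - x" using exp_ge_add_one_self[of "- (y - x)"] by linarith
  qed (use that in auto)
  ultimately have "exp (- x) - exp (- y) <= y - x" by (simp only: mult_1)
  moreover have "exp (- y) <= exp (- x)" using that by simp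
  ultimately show ?thesis using that by linarith
 qed
 show ?thesis
 proof (cases "x <= y")
  case True
  then show ?thesis using *[of x y] assms by simp
 next
  case False
  then show ?thesis using *[of y x] assms by (simp add: abs_minus_commute)
 qed
qed

context innov
begin

lemma tau_vec_indep:
 assumes u: "1 <= u"
 shows "indep_vars (%_. PiM I (%_. borel)) (%r x. \<lambda>i\<in>I. tau u (ph i) (r * u) x) (UNIV :: nat set)"
proof -
 let ?D = "%r. {int (r * u) + 1..int (r * u) + int u}"
 have disj: "disjoint_family_on ?D UNIV"
 proof (unfold disjoint_family_on_def, intro ballI impI)
  have *: "?D r \<inter> ?D r' = {}" if "r < r'" for r r'
  proof -
   have "Suc r * u <= r' * u" using that by (intro mult_right_mono) auto
   then have "int (r * u) + int u <= int (r' * u)" by (simp only: mult_Suc of_nat_add[symmetric] of_nat_le_iff add.commute)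
   then show ?thesis by auto
  qed
  fix r r' :: nat assume "r ~= r'"
  then show "?D r \<inter> ?D r' = {}" using *[of r r'] *[of r' r] by (cases "r < r'") auto
 qed
 have ind: "indep_vars (%r. PiM (?D r) (%_. borel)) (%r x. \<lambda>k\<in>?D r. eps k x) (UNIV :: nat set)"
  by (rule indep_vars_restrict[OF eps_indep _ disj]) auto
 let ?X = "%r j. int (r * u + j)"
 define tf where "tf = (%r (y :: int => real). \<lambda>i\<in>I. (SUM j:{1..u}. ph i 0 * ((y (?X r j))^2 - sig2 (?X r j))
   + y (?X r j) * (SUM l:{1..<j}. ph i (j - l) * y (?X r l))))"
 have in1: "?X r j : ?D r" if "j : {1..u}" for r j using that by auto
 have tfm: "tf r : measurable (PiM (?D r) (%_. borel)) (PiM I (%_. borel))" for r unfolding tf_def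
 proof (intro measurable_restrict borel_measurable_sum borel_measurable_add borel_measurable_times borel_measurable_const borel_measurable_diff borel_measurable_power)
 qed (auto intro!: measurable_component_singleton)
 have "indep_vars (%_. PiM I (%_. borel)) (%r x. tf r (\<lambda>k\<in>?D r. eps k x)) UNIV" by (rule indep_vars_compose2[OF ind tfm])
 also have "(%r x. tf r (\<lambda>k\<in>?D r. eps k x)) = (%r x. \<lambda>i\<in>I. tau u (ph i) (r * u) x)" unfolding tf_def tau_def
 proof (rule ext, rule ext, rule restrict_ext, rule sum.cong[OF refl])
  fix r x i j assume j: "j : {1..u}"
  have a: "(\<lambda>k\<in>?D r. eps k x) (?X r l) = eps (?X r l) x" if "l : {1..u}" for l
   using in1[OF that, of r] by (simp only: restrict_apply if_True)
  have b: "(SUM l:{1..<j}. ph i (j - l) * (\<lambda>k\<in>?D r. eps k x) (?X r l)) = (SUM l:{1..<j}. ph i (j - l) * eps (?X r l) x)"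
  proof (rule sum.cong[OF refl])
   fix l assume "l : {1..<j}"
   then have "l : {1..u}" using j by auto
   from a[OF this] show "ph i (j - l) * (\<lambda>k\<in>?D r. eps k x) (?X r l) = ph i (j - l) * eps (?X r l) x" by (simp only:)
  qed
  show "ph i 0 * (((\<lambda>k\<in>?D r. eps k x) (?X r j))^2 - sig2 (?X r j)) + (\<lambda>k\<in>?D r. eps k x) (?X r j) * (SUM l:{1..<j}. ph i (j - l) * (\<lambda>k\<in>?D r. eps k x) (?X r l))
   = ph i 0 * ((eps (?X r j) x)^2 - sig2 (?X r j)) + eps (?X r j) x * (SUM l:{1..<j}. ph i (j - l) * eps (?X r l) x)" by (simp only: a[OF j] b)
 qed
 finally show ?thesis .
qed

lemma tau_indep:
 assumes u: "1 <= u"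
 shows "indep_vars (%_. borel) (%r. tau u ph (r * u)) (UNIV :: nat set)"
 using indep_vars_compose2[OF tau_vec_indep[OF u, of "{()}" "%_. ph"], of "%_ y. y ()" "%_. borel"] by simp

definition Tb :: "nat => nat => (nat => real) => nat => 'a => real" where
 "Tb q u ph b x = (SUM r:{b * (q div u)..<Suc b * (q div u)}. tau u ph (r * u) x)"

lemma Tb_meas[measurable]: "Tb q u ph b : borel_measurable M" unfolding Tb_def by measurable

lemma Tb_vec_indep:
 assumes u: "1 <= u"
 shows "indep_vars (%_. PiM I (%_. borel)) (%b x. \<lambda>i\<in>I. Tb q u (ph i) b x / s) (UNIV :: nat set)"
proof -
 let ?D = "%b. {b * (q div u)..<Suc b * (q div u)}"
 have disj: "disjoint_family_on ?D UNIV"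
 proof (unfold disjoint_family_on_def, intro ballI impI)
  have *: "?D r \<inter> ?D r' = {}" if "r < r'" for r r'
  proof -
   have "Suc r * (q div u) <= r' * (q div u)" using that by (intro mult_right_mono) auto
   then show ?thesis by auto
  qed
  fix r r' :: nat assume "r ~= r'"
  then show "?D r \<inter> ?D r' = {}" using *[of r r'] *[of r' r] by (cases "r < r'") auto
 qed
 let ?X = "PiM I (%_. borel)"
 have ind: "indep_vars (%b. PiM (?D b) (%_. ?X)) (%b x. \<lambda>r\<in>?D b. \<lambda>i\<in>I. tau u (ph i) (r * u) x) (UNIV :: nat set)"
  by (rule indep_vars_restrict[OF tau_vec_indep[OF u] _ disj]) auto
 define sf where "sf = (%b (y :: nat => 'b => real). \<lambda>i\<in>I. (SUM r:?D b. y r i) / s)"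
 have sfm: "sf b : measurable (PiM (?D b) (%_. ?X)) (?X)" for b unfolding sf_def
 proof (intro measurable_restrict borel_measurable_divide borel_measurable_const borel_measurable_sum)
  fix i r assume "i : I" "r : ?D b"
  then show "(%y. y r i) : borel_measurable (PiM (?D b) (%_. ?X))"
   by (intro measurable_compose[OF measurable_component_singleton[of r "?D b"] measurable_component_singleton[of i I]])
 qed
 have "indep_vars (%_. ?X) (%b x. sf b (\<lambda>r\<in>?D b. \<lambda>i\<in>I. tau u (ph i) (r * u) x)) UNIV"
  by (rule indep_vars_compose2[OF ind sfm])
 also have "(%b x. sf b (\<lambda>r\<in>?D b. \<lambda>i\<in>I. tau u (ph i) (r * u) x)) = (%b x. \<lambda>i\<in>I. Tb q u (ph i) b x / s)"
  unfolding sf_def Tb_def by (intro ext restrict_ext arg_cong[where f="%y. y / s"] sum.cong refl) (simp only: restrict_apply if_True)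
 finally show ?thesis .
qed

lemma Tb_second_moment:
 assumes u: "1 <= u" and q: "q = u * (q div u)" "1 <= q" and th: "0 < th"
  and V: "!!m'. abs (covs u ph ph m' - real u * V) <= C * real u powr (1 - th)"
 shows "NN M (%x. ennreal ((Tb q u ph b x / sqrt (real q))^2)) <= ennreal (V + C)"
proof -
 let ?R = "q div u"
 interpret s: indep_centered M "%r. tau u ph (r * u)" "%r. covs u ph ph (r * u)"
 proof
  show "indep_vars (%_. borel) (%r. tau u ph (r * u)) UNIV" by (rule tau_indep[OF u])
 qed (rule tau_moments)+
 let ?Y = "sqrt (real q)"
 let ?k = "%r. if b * ?R <= r then 1 / ?Y else 0"
 have e: "Tb q u ph b x / ?Y = (\<Sum>r<Suc b * ?R. ?k r * tau u ph (r * u) x)" for x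
  unfolding Tb_def sum_divide_distrib by (rule sum.mono_neutral_cong_left) auto
 have "0 <= C * real u powr (1 - th)" using V[of 0] by linarith
 then have C: "0 <= C" using u by (simp add: zero_le_mult_iff)
 have cv: "covs u ph ph m' <= real u * (V + C)" for m'
 proof -
  have "real u powr (1 - th) <= real u powr 1" using u th by (intro powr_mono) auto
  then have "C * real u powr (1 - th) <= C * real u" using C by (intro mult_left_mono) auto
  then show ?thesis using V[of m'] by (simp add: algebra_simps abs_le_iff)
 qed
 let ?X = "expectation (%x. (Tb q u ph b x / ?Y)^2)"
 have "?X = (\<Sum>r<Suc b * ?R. (?k r)^2 * covs u ph ph (r * u))" unfolding e by (rule s.linear_form_moments)
 also have "... = (SUM r:{b * ?R..<Suc b * ?R}. 1 / real q * covs u ph ph (r * u))"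
  by (rule sum.mono_neutral_cong_right) (auto simp: power_divide)
 also have "... <= (SUM r:{b * ?R..<Suc b * ?R}. 1 / real q * (real u * (V + C)))" by (intro sum_mono mult_left_mono cv) auto
 also have "... = real (?R * u) / real q * (V + C)" by simp
 also have "?R * u = q" using q(1) by (simp add: mult.commute)
 finally have "?X <= V + C" using q by simp
 moreover have "integrable M (%x. (Tb q u ph b x / ?Y)^2)" unfolding e by (rule s.linear_form_moments)
 ultimately show ?thesis by (subst nn_integral_eq_integral) (auto intro: ennreal_leI)
qed

text \<open>A linear form in the block sums is a sum of q / u independent sub-block sums with
  combined coefficients psi. Expanding each to second order costs a moment of order 2 pm, in total
  u^6 q^(1 - pm). Replacing each sub-block covariance by u times its limit costs u^(1 - th), in
  total u^(- th) after division by q.\<close>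

lemma block_char:
 assumes I: "finite I" and Cph: "!!i l. i : I ==> abs (ph i l) <= Cph" "0 <= Cph"
  and u: "1 <= u" and q: "q = u * (q div u)" "1 <= q" and C: "0 <= C"
  and V: "!!i k m'. i : I ==> k : I ==> abs (covs u (ph i) (ph k) m' - real u * V i k) <= C * real u powr (1 - th)"
  and psd: "0 <= (SUM i:I. SUM k:I. eta i * eta k * V i k)"
 shows "cmod ((CLINT x|M. iexp (SUM i:I. eta i * (Tb q u (ph i) b x / sqrt (real q)))) - exp (- ((SUM i:I. SUM k:I. eta i * eta k * V i k)/2)))
   <= (1 + (SUM i:I. abs (eta i)))^3 * (2 * Cg^2 * (1 + 2 * Cph)^3 * real u ^ 6 * real q powr (1 - pm) + C * real u powr (- th))"
proof -
 define U where "U = (SUM i:I. abs (eta i))"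
 define psi where "psi = (%l. SUM i:I. eta i * ph i l)"
 \<comment> \<open>A bound for ?d that is at least 1, so that its power 2 pm <= 3 can be replaced by
   the cube.\<close>
 define y where "y = (1 + 2 * Cph) * (1 + U) * (real u)^2"
 define Vq where "Vq = (SUM i:I. SUM k:I. eta i * eta k * V i k)"
 let ?R = "{b * (q div u)..<Suc b * (q div u)}"
 let ?d = "2 * (Cph * U) * (real u)^2" and ?V = "covs u psi psi" and ?X = "%r x. tau u psi (r * u) x / sqrt (real q)"
 let ?S = "SUM r:?R. ?V (r * u) / real q" and ?E = "C * real u powr (- th)"
  and ?B = "2 * Cg^2 * (1 + 2 * Cph)^3 * real u ^ 6 * real q powr (1 - pm)"
 have U0: "0 <= U" unfolding U_def by (intro sum_nonneg) auto
 have Cg1: "1 <= Cg" using Cm_ge(5) unfolding Cg_def by simp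
 have psi: "abs (psi l) <= Cph * U" for l
 proof -
  have "abs (psi l) <= (SUM i:I. abs (eta i * ph i l))" unfolding psi_def by (rule sum_abs)
  also have "... <= (SUM i:I. abs (eta i) * Cph)" unfolding abs_mult by (intro sum_mono mult_left_mono Cph) auto
  also have "... = Cph * U" unfolding U_def by (simp add: sum_distrib_left mult.commute)
  finally show ?thesis .
 qed
 have u2: "1 <= (real u)^2" using u by (intro one_le_power) auto
 have dy: "0 <= ?d" "?d <= y" "1 <= y"
 proof -
  show "0 <= ?d" using Cph U0 by auto
  have "2 * (Cph * U) <= (1 + 2 * Cph) * (1 + U)" using Cph U0 by (simp add: algebra_simps)
  then show "?d <= y" unfolding y_def by (rule mult_right_mono) auto
  have "1 * 1 <= (1 + 2 * Cph) * (1 + U)" using Cph U0 by (intro mult_mono) auto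
  then have "1 * 1 <= ((1 + 2 * Cph) * (1 + U)) * (real u)^2" using u2 by (intro mult_mono) auto
  then show "1 <= y" unfolding y_def by simp
 qed
 have q0: "0 < real q" using q by simp
 define K where "K = y powr 3 * Cg^2 * real q powr (- pm)"
 have yp: "?d powr (2 * pm) <= y powr 3"
 proof -
  have "?d powr (2 * pm) <= y powr (2 * pm)" using dy pm by (intro powr_mono2) auto
  also have "... <= y powr 3" using dy pm by (intro powr_mono) auto
  finally show ?thesis .
 qed
 have cvs: "?V m' <= (?d)^2 * Cg" for m'
 proof -
  have "ennreal (?V m') = NN M (%x. ennreal ((tau u psi m' x)^2))"
   unfolding tau_moments(4)[symmetric] by (rule nn_integral_eq_integral[OF tau_moments(3), symmetric]) simp
  also have "... = NN M (%x. ennreal (abs (tau u psi m' x) powr 2))" by simp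
  also have "... <= ennreal (?d powr 2 * Cg)" using pm by (intro tau_powr_moment psi u) auto
  also have "?d powr 2 = (?d)^2" using dy(1) by simp
  finally show ?thesis using Cg1 by (simp add: ennreal_le_iff)
 qed
 have main: "cmod ((CLINT x|M. iexp (SUM r:?R. ?X r x)) - exp (- (?S/2)))
   <= (SUM r:?R. K + (?V (r * u) / real q) powr pm)"
 proof (rule char_sum_second_order[OF _ _ pm])
  show "indep_vars (%_. borel) (%r x. ?X r x) ?R"
   by (rule indep_vars_subset[OF indep_vars_compose2[OF tau_indep[OF u], of "%_ y. y / sqrt (real q)" "%_. borel"]]) auto
  fix r
  show "integrable M (%x. ?X r x)" using tau_moments(1) by simp
  show "expectation (%x. ?X r x) = 0" using tau_moments(2)[of u psi "r * u"] by simp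
  show "integrable M (%x. (?X r x)^2)" using tau_moments(3) by (simp add: power_divide)
  show "expectation (%x. (?X r x)^2) = ?V (r * u) / real q" using tau_moments(4)[of u psi "r * u"] by (simp add: power_divide)
  show "0 <= K" unfolding K_def by simp
  have e: "abs (t / sqrt (real q)) powr (2 * pm) = real q powr (- pm) * abs t powr (2 * pm)" for t
  proof -
   have "sqrt (real q) powr (2 * pm) = real q powr pm" using q0 by (simp add: powr_half_sqrt[symmetric] powr_powr)
   moreover have "abs (t / sqrt (real q)) powr (2 * pm) = abs t powr (2 * pm) / sqrt (real q) powr (2 * pm)" by (simp add: powr_divide)
   ultimately show ?thesis by (simp add: powr_minus divide_inverse)
  qed
  have "NN M (%x. ennreal (abs (?X r x) powr (2 * pm))) = ennreal (real q powr (- pm)) * (NN M (%x. ennreal (abs (tau u psi (r * u) x) powr (2 * pm))))"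
   unfolding e by (subst nn_integral_cmult[symmetric]) (auto simp: ennreal_mult')
  also have "... <= ennreal (real q powr (- pm)) * ennreal (?d powr (2 * pm) * Cg)"
   using pm by (intro mult_left_mono tau_powr_moment psi u) auto
  also have "... <= ennreal (real q powr (- pm)) * ennreal (y powr 3 * Cg^2)"
   using Cg1 by (intro mult_left_mono ennreal_leI mult_mono yp) (auto simp: self_le_power)
  also have "... = ennreal K" unfolding K_def by (simp add: ennreal_mult'[symmetric] mult_ac)
  finally show "NN M (%x. ennreal (abs (?X r x) powr (2 * pm))) <= ennreal K" .
 qed simp
 have Vb: "(?V m' / real q) powr pm <= K" for m'
 proof -
  have "(?V m' / real q) powr pm <= (?d^2 * Cg / real q) powr pm"
   using q0 pm by (intro powr_mono2 divide_right_mono cvs divide_nonneg_nonneg covs_nonneg) auto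
  also have "... = (?d^2) powr pm * Cg powr pm * real q powr (- pm)"
  proof -
   have "(?d^2 * Cg / real q) powr pm = (?d^2 * Cg) powr pm / real q powr pm" by (rule powr_divide)
   then show ?thesis by (simp only: powr_mult powr_minus divide_inverse)
  qed
  also have "(?d^2) powr pm = ?d powr (2 * pm)"
  proof -
   have "?d^2 = ?d powr 2" using dy(1) by simp
   then show ?thesis by (simp only: powr_powr)
  qed
  also have "?d powr (2 * pm) * Cg powr pm * real q powr (- pm) <= y powr 3 * Cg^2 * real q powr (- pm)"
  proof (intro mult_right_mono mult_mono yp)
   have "Cg powr pm <= Cg powr 2" using Cg1 pm by (intro powr_mono) auto
   then show "Cg powr pm <= Cg^2" using Cg1 by simp
  qed auto
  finally show ?thesis unfolding K_def .
 qed
 have cardR: "real (card ?R) = real q / real u"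
 proof -
  have "real q = real (u * (q div u))" using q(1) by (rule arg_cong)
  then show ?thesis using u by simp
 qed
 have "(SUM r:?R. K + (?V (r * u) / real q) powr pm) <= (SUM r:?R. 2 * K)" unfolding mult_2 by (intro sum_mono add_left_mono Vb)
 also have "... = real (card ?R) * (2 * K)" by simp
 also have "... <= real q * (2 * K)"
 proof (rule mult_right_mono)
  show "real (card ?R) <= real q" unfolding cardR using u q0 by (simp add: divide_le_eq mult_left_mono)
 qed (simp add: K_def)
 also have "... = (1 + U)^3 * ?B"
 proof -
  have "y powr 3 = y^3" using dy(3) by simp
  also have "... = (1 + 2 * Cph)^3 * (1 + U)^3 * real u ^ 6" unfolding y_def by (simp add: power_mult_distrib flip: power_mult)
  finally have "y powr 3 = (1 + 2 * Cph)^3 * (1 + U)^3 * real u ^ 6" .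
  moreover have "real q * real q powr (- pm) = real q powr (1 - pm)" using q0 by (simp add: powr_diff powr_minus divide_inverse)
  ultimately show ?thesis unfolding K_def by (simp add: mult_ac)
 qed
 finally have m0: "(SUM r:?R. K + (?V (r * u) / real q) powr pm) <= (1 + U)^3 * ?B" .
 have m1: "cmod ((CLINT x|M. iexp (SUM r:?R. ?X r x)) - exp (- (?S/2)))
   <= (1 + U)^3 * ?B" by (rule order_trans[OF main m0])
 have lhs: "(SUM i:I. eta i * (Tb q u (ph i) b x / sqrt (real q))) = (SUM r:?R. ?X r x)" for x
 proof -
  have "(SUM i:I. eta i * (Tb q u (ph i) b x / sqrt (real q))) = (SUM i:I. SUM r:?R. eta i * tau u (ph i) (r * u) x / sqrt (real q))"
   unfolding Tb_def by (simp add: sum_distrib_left sum_divide_distrib)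
  also have "... = (SUM r:?R. SUM i:I. eta i * tau u (ph i) (r * u) x / sqrt (real q))" by (rule sum.swap)
  also have "... = (SUM r:?R. ?X r x)" unfolding sum_divide_distrib[symmetric] tau_linear psi_def ..
  finally show ?thesis .
 qed
 have cov1: "abs (?V m' - real u * Vq) <= U^2 * (C * real u powr (1 - th))" for m'
 proof -
  have "?V m' - real u * Vq = (SUM i:I. SUM k:I. eta i * eta k * (covs u (ph i) (ph k) m' - real u * V i k))"
   unfolding psi_def covs_bilinear Vq_def by (simp add: sum_distrib_left sum_subtractf right_diff_distrib mult_ac)
  also have "abs (...) <= (SUM i:I. SUM k:I. abs (eta i * eta k * (covs u (ph i) (ph k) m' - real u * V i k)))"
   by (intro order_trans[OF sum_abs] sum_mono sum_abs)
  also have "... <= (SUM i:I. SUM k:I. abs (eta i) * abs (eta k) * (C * real u powr (1 - th)))"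
   unfolding abs_mult by (intro sum_mono mult_left_mono V) auto
  also have "... = U^2 * (C * real u powr (1 - th))" unfolding U_def power2_eq_square sum_product by (simp add: sum_distrib_right)
  finally show ?thesis .
 qed
 have "abs (?S - Vq) = abs (SUM r:?R. (?V (r * u) - real u * Vq) / real q)"
 proof -
  have "(SUM r:?R. real u * Vq / real q) = Vq" using cardR u q0 by simp
  then show ?thesis by (simp only: diff_divide_distrib sum_subtractf)
 qed
 also have "... <= (SUM r:?R. abs ((?V (r * u) - real u * Vq) / real q))" by (rule sum_abs)
 also have "... <= (SUM r:?R. U^2 * (C * real u powr (1 - th)) / real q)"
  unfolding abs_divide by (intro sum_mono) (use cov1 q0 in \<open>simp add: divide_right_mono\<close>)
 also have "... = U^2 * ?E"
 proof -
  have "real u powr (1 - th) = real u * real u powr (- th)" using u by (simp add: powr_diff powr_minus divide_inverse)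
  then have "(SUM r:?R. U^2 * (C * real u powr (1 - th)) / real q) = (real q / real u) * (U^2 * (C * (real u * real u powr (- th))) / real q)"
   unfolding cardR[symmetric] by simp
  also have "... = U^2 * ?E" using u q0 by simp
  finally show ?thesis .
 qed
 also have "... <= (1 + U)^3 * ?E"
 proof (rule mult_right_mono)
  have "U^2 <= (1 + U)^2" using U0 by (intro power_mono) auto
  also have "... <= (1 + U)^3" using U0 by (intro power_increasing) auto
  finally show "U^2 <= (1 + U)^3" .
 qed (use C in auto)
 finally have dv: "abs (?S - Vq) <= (1 + U)^3 * ?E" .
 have elip: "abs (exp (- (a/2)) - exp (- (c/2))) <= abs (a - c)" if "0 <= a" "0 <= c" for a c :: real
  using abs_exp_uminus_diff_le[of "a/2" "c/2"] that by simp
 have m2: "cmod (complex_of_real (exp (- (?S/2))) - exp (- (Vq/2))) <= (1 + U)^3 * ?E"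
 proof -
  have "cmod (complex_of_real (exp (- (?S/2))) - exp (- (Vq/2))) =
   abs (exp (- (?S/2)) - exp (- (Vq/2)))" by (simp only: of_real_diff[symmetric] norm_of_real)
  also have "... <= abs (?S - Vq)" using psd q0 unfolding Vq_def[symmetric] by (intro elip sum_nonneg divide_nonneg_nonneg covs_nonneg) auto
  finally show ?thesis using dv by linarith
 qed
 have tri: "cmod (a - c) <= cmod (a - b) + cmod (b - c)" for a b c :: complex using norm_triangle_ineq[of "a - b" "b - c"] by simp
 show ?thesis unfolding lhs Vq_def[symmetric] U_def[symmetric] distrib_left by (rule order_trans[OF tri add_mono[OF m1 m2]])
qed

end

section \<open>Coupling of all levels on one probability space\<close>

lemma prob_space_density_of_nn_integral:
 assumes f: "f : borel_measurable X" and f1: "NN X f = 1"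
 shows "prob_space (density X f)"
proof (rule prob_spaceI)
 have "emeasure (density X f) (space X) = NN X (%x. f x * indicator (space X) x)" by (rule emeasure_density[OF f sets.top])
 also have "... = NN X f" by (intro nn_integral_cong) simp
 finally show "emeasure (density X f) (space (density X f)) = 1" using f1 by simp
qed

text \<open>Cylinders generate the product sigma-algebra and are stable under intersection; on a
  cylinder the kernel is a finite product of parametrized integrals, each measurable in e.\<close>

lemma PiM_density_kernel:
 fixes L :: "'e measure" and X :: "'x measure" and H :: "nat => 'e \<times> 'x => ennreal"
 assumes X: "sigma_finite_measure X" and H[measurable]: "!!n. H n : borel_measurable (L \<Otimes>\<^sub>M X)"
  and H1: "!!n e. e : space L ==> NN X (%x. H n (e, x)) = 1"
 shows "(%e. PiM UNIV (%n. density X (%x. H n (e, x)))) : measurable L (prob_algebra (PiM UNIV (%_. X)))"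
proof -
 let ?X = "%e n. density X (%x. H n (e, x))"
 have Hm: "(%x. H n (e, x)) : borel_measurable X" if "e : space L" for n e by (rule measurable_Pair2[OF H that])
 have p: "prob_space (?X e n)" if "e : space L" for e n by (rule prob_space_density_of_nn_integral[OF Hm[OF that] H1[OF that]])
 let ?Y = "%e. PiM UNIV (?X e)"
 show ?thesis
 proof (rule measurable_prob_algebra_generated)
  show "sets (PiM UNIV (%_. X)) = sigma_sets (\<Pi>\<^sub>E i\<in>UNIV. space X) (prod_algebra UNIV (%_::nat. X))" by (rule sets_PiM)
  show "Int_stable (prod_algebra UNIV (%_::nat. X))" by (rule Int_stable_prod_algebra)
  show "prod_algebra UNIV (%_::nat. X) <= Pow (\<Pi>\<^sub>E i\<in>UNIV. space X)" by (rule prod_algebra_sets_into_space)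
  show "prob_space (?Y e)" if "e : space L" for e using p[OF that] by (intro prob_space_PiM) auto
  show "sets (?Y e) = sets (PiM UNIV (%_. X))" for e by (intro sets_PiM_cong) auto
  fix A assume "A : prod_algebra UNIV (%_::nat. X)"
  then obtain J E where A: "A = prod_emb UNIV (%_. X) J (\<Pi>\<^sub>E j\<in>J. E j)" "finite J" and E[measurable]: "!!j. j : J ==> E j : sets X"
   by (rule prod_algebraE) blast
  have e: "emeasure (?Y e) A = (PROD j:J. NN X (%x. H j (e, x) * indicator (E j) x))" if "e : space L" for e
  proof -
   have "A = prod_emb UNIV (?X e) J (\<Pi>\<^sub>E j\<in>J. E j)" unfolding A(1) prod_emb_def by simp
   then have "emeasure (?Y e) A = (PROD j:J. emeasure (?X e j) (E j))" by (simp only:) (rule emeasure_PiM_emb, use p[OF that] A E in auto)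
   also have "... = (PROD j:J. NN X (%x. H j (e, x) * indicator (E j) x))" by (intro prod.cong refl emeasure_density Hm[OF that] E)
   finally show ?thesis .
  qed
  have "(%e. PROD j:J. NN X (%x. H j (e, x) * indicator (E j) x)) : borel_measurable L"
   by (intro borel_measurable_prod_ennreal sigma_finite_measure.borel_measurable_nn_integral[OF X]) measurable
  then show "(%e. emeasure (?Y e) A) : borel_measurable L" by (rule measurable_cong[THEN iffD2, rotated]) (rule e)
 qed
qed

text \<open>Given e, the copies of X for different n are drawn independently, the n-th with density
  \<open>H n (e, _)\<close>. Integrating over e returns \<open>H n\<close> as the density of the
  pair formed by e and the n-th copy.\<close>

lemma kernel_extension:
 fixes L :: "'e measure" and X :: "'x measure" and H :: "nat => 'e \<times> 'x => ennreal"
 assumes L: "prob_space L" and X: "prob_space X" and H[measurable]: "!!n. H n : borel_measurable (L \<Otimes>\<^sub>M X)"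
  and H1: "!!n e. e : space L ==> NN X (%x. H n (e, x)) = 1"
 shows "EX M0. prob_space M0 & sets M0 = sets (L \<Otimes>\<^sub>M PiM UNIV (%_::nat. X)) &
  (ALL n. distr M0 (L \<Otimes>\<^sub>M X) (%z. (fst z, snd z n)) = density (L \<Otimes>\<^sub>M X) (H n))"
proof -
 interpret L: prob_space L by fact
 interpret X: prob_space X by fact
 let ?P = "PiM UNIV (%_::nat. X)"
 let ?Y = "%n e. density X (%x. H n (e, x))"
 define kp where "kp = (%e. PiM UNIV (%n. ?Y n e))"
 have kp[measurable]: "kp : measurable L (prob_algebra ?P)" unfolding kp_def by (rule PiM_density_kernel[OF X.sigma_finite_measure_axioms H H1])
 let ?U = "L \<Otimes>\<^sub>M ?P"
 define N where "N = (%e. distr (kp e) ?U (Pair e))"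
 have N: "N : measurable L (prob_algebra ?U)" unfolding N_def by (rule measurable_distr_prob_space2[OF kp]) simp
 define M0 where "M0 = L \<bind> N"
 have Lp: "L : space (prob_algebra L)" using L by (simp add: space_prob_algebra)
 have p: "prob_space M0" unfolding M0_def by (rule prob_space_bind'[OF Lp N])
 have s: "sets M0 = sets ?U" unfolding M0_def by (rule sets_bind'[OF Lp N])
 let ?X = "L \<Otimes>\<^sub>M X"
 have Nn: "NN M0 (%z. f (fst z, snd z n)) = NN L (%e. NN X (%x. H n (e, x) * f (e, x)))"
  if f[measurable]: "f : borel_measurable ?X" for f n
 proof -
  have "NN M0 (%z. f (fst z, snd z n)) = NN L (%e. NN (N e) (%z. f (fst z, snd z n)))"
   unfolding M0_def by (rule nn_integral_bind[OF _ measurable_prob_algebraD[OF N]]) measurable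
  also have "... = NN L (%e. NN X (%x. H n (e, x) * f (e, x)))"
  proof (rule nn_integral_cong)
   fix e assume e: "e : space L"
   have sk: "sets (kp e) = sets ?P" unfolding kp_def by (intro sets_PiM_cong) auto
   have pm: "Pair e : measurable (kp e) ?U" using e unfolding measurable_cong_sets[OF sk refl] by measurable
   have fe[measurable]: "(%x. f (e, x)) : borel_measurable X" "(%x. H n (e, x)) : borel_measurable X"
    by (rule measurable_Pair2[OF f e], rule measurable_Pair2[OF H e])
   have "NN (N e) (%z. f (fst z, snd z n)) = NN (kp e) (%y. f (e, y n))" unfolding N_def by (subst nn_integral_distr[OF pm]) simp_all
   also have "... = NN (distr (kp e) (?Y n e) (%y. y n)) (%x. f (e, x))"
   proof (subst nn_integral_distr)
    show "(%y. y n) : measurable (kp e) (?Y n e)" unfolding measurable_cong_sets[OF sk refl] by simp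
   qed simp_all
   also have "distr (kp e) (?Y n e) (%y. y n) = ?Y n e"
   proof -
    have "prob_space (?Y k e)" for k
    proof -
     show ?thesis by (rule prob_space_density_of_nn_integral[OF measurable_Pair2[OF H e] H1[OF e]])
    qed
    then show ?thesis unfolding kp_def by (intro distr_PiM_component) auto
   qed
   also have "NN (?Y n e) (%x. f (e, x)) = NN X (%x. H n (e, x) * f (e, x))" by (rule nn_integral_density) auto
   finally show "NN (N e) (%z. f (fst z, snd z n)) = NN X (%x. H n (e, x) * f (e, x))" .
  qed
  finally show ?thesis .
 qed
 let ?Z = "%M0 n. distr M0 ?X (%z. (fst z, snd z n))"
 have "?Z M0 n = density ?X (H n)" for n
 proof (rule measure_eqI)
  fix A assume "A : sets (?Z M0 n)"
  then have A[measurable]: "A : sets ?X" by simp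
  have m: "(%z. (fst z, snd z n)) : measurable M0 ?X" unfolding measurable_cong_sets[OF s refl] by measurable
  have "emeasure (?Z M0 n) A = NN (?Z M0 n) (%z. indicator A z)" using A by simp
  also have "... = NN M0 (%z. indicator A (fst z, snd z n))" by (rule nn_integral_distr[OF m]) simp
  also have "... = NN L (%e. NN X (%x. H n (e, x) * indicator A (e, x)))" by (rule Nn) simp
  also have "... = NN (?X) (%z. H n z * indicator A z)" by (subst X.nn_integral_fst[symmetric]) auto
  also have "... = emeasure (density ?X (H n)) A" by (rule emeasure_density[symmetric]) auto
  finally show "emeasure (?Z M0 n) A = emeasure (density ?X (H n)) A" .
 qed simp
 then show ?thesis using p s by blast
qed

text \<open>The theorem asks for a measure on real sequences. The innovations and the sequence of
  Gaussian families have countably many real coordinates; \<open>to_nat\<close> numbers them, and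
  \<open>E\<close> and \<open>Y\<close> decode.\<close>

lemma joint_space:
 fixes L :: "('i::countable => real) measure" and X :: "('w::countable => real) measure"
  and H :: "nat => ('i => real) \<times> ('w => real) => ennreal"
 assumes L: "prob_space L" "sets L = sets (PiM UNIV (%_. borel))"
  and X: "prob_space X" "sets X = sets (PiM UNIV (%_. borel))" and H[measurable]: "!!n. H n : borel_measurable (L \<Otimes>\<^sub>M X)"
  and H1: "!!n e. NN X (%x. H n (e, x)) = 1"
 obtains M' :: "(nat => real) measure" and E Y where "prob_space M'"
  "E : measurable M' L" "!!n::nat. Y n : measurable M' X" "distr M' L E = L"
  "!!n. distr M' (L \<Otimes>\<^sub>M X) (%z. (E z, Y n z)) = density (L \<Otimes>\<^sub>M X) (H n)"
proof -
 interpret X: prob_space X by fact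
 interpret L: prob_space L by fact
 let ?X = "L \<Otimes>\<^sub>M X"
 obtain M0 where M0: "prob_space M0" "sets M0 = sets (L \<Otimes>\<^sub>M PiM UNIV (%_::nat. X))"
  "!!n. distr M0 ?X (%z. (fst z, snd z n)) = density ?X (H n)" using kernel_extension[of L X H, OF L(1) X(1) H H1] by blast
 interpret M0: prob_space M0 by fact
 define enc where "enc = (%(z :: ('i => real) \<times> (nat => 'w => real)) k.
   case from_nat k :: 'i + nat \<times> 'w of Inl i => fst z i | Inr (n, w) => snd z n w)"
 define E where "E = (%(x :: nat => real) i. x (to_nat (Inl i :: 'i + nat \<times> 'w)))"
 define Y where "Y = (%n (x :: nat => real) w. x (to_nat (Inr (n, w) :: 'i + nat \<times> 'w)))"
 let ?P = "PiM UNIV (%_. borel) :: (nat => real) measure"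
 have m1: "(%z. fst z i) : borel_measurable M0" for i
 proof -
  have "(%e. e i) : borel_measurable L" unfolding measurable_cong_sets[OF L(2) refl] by simp
  then show ?thesis unfolding measurable_cong_sets[OF M0(2) refl] by simp
 qed
 have m2: "(%z. snd z n w) : borel_measurable M0" for n w
 proof -
  have "(%e. e w) : borel_measurable X" unfolding measurable_cong_sets[OF X(2) refl] by simp
  then show ?thesis unfolding measurable_cong_sets[OF M0(2) refl] by simp
 qed
 have enc: "enc : measurable M0 ?P" unfolding enc_def
 proof (rule measurable_PiM_single')
  show "(%z. case from_nat k :: 'i + nat \<times> 'w of Inl i => fst z i | Inr (n, w) => snd z n w) : borel_measurable M0" for k
   by (cases "from_nat k :: 'i + nat \<times> 'w") (auto simp: m1 m2 split: prod.split)
 qed auto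
 define M' where "M' = distr M0 ?P enc"
 have E: "E : measurable ?P L" unfolding measurable_cong_sets[OF refl L(2)] E_def by (rule measurable_PiM_single') auto
 have Y: "Y n : measurable ?P X" for n unfolding measurable_cong_sets[OF refl X(2)] Y_def by (rule measurable_PiM_single') auto
 have p: "prob_space M'" unfolding M'_def by (rule M0.prob_space_distr[OF enc])
 have E': "E : measurable M' L" and Y': "Y n : measurable M' X" for n using E Y by (simp_all add: M'_def)
 have EY: "E (enc z) = fst z" "Y n (enc z) = snd z n" for z n unfolding E_def Y_def enc_def by auto
 have 1: "distr M' ?X (%z. (E z, Y n z)) = density ?X (H n)" for n
 proof -
  have "distr M' ?X (%z. (E z, Y n z)) = distr M0 ?X ((%z. (E z, Y n z)) \<circ> enc)"
   unfolding M'_def by (rule distr_distr[OF _ enc]) (intro measurable_Pair E Y)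
  also have "(%z. (E z, Y n z)) \<circ> enc = (%z. (fst z, snd z n))" by (auto simp: EY)
  finally show ?thesis unfolding M0(3) .
 qed
 let ?Y = "distr (density ?X (H 0)) L fst"
 have "distr M' L E = distr (distr M' ?X (%z. (E z, Y 0 z))) L fst"
  by (subst distr_distr[OF measurable_fst measurable_Pair[OF E' Y']]) (simp add: comp_def)
 also have "... = L" unfolding 1
 proof (rule measure_eqI)
  fix A assume "A : sets ?Y"
  then have A[measurable]: "A : sets L" by simp
  have "emeasure ?Y A = NN (density ?X (H 0)) (%z. indicator A (fst z))"
   using A by (subst nn_integral_indicator[symmetric], simp, subst nn_integral_distr) auto
  also have "... = NN (?X) (%z. H 0 z * indicator A (fst z))" by (rule nn_integral_density) auto
  also have "... = NN L (%e. NN X (%x. H 0 (e, x) * indicator A e))" by (subst X.nn_integral_fst[symmetric]) auto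
  also have "... = NN L (%e. (NN X (%x. H 0 (e, x))) * indicator A e)" by (intro nn_integral_cong nn_integral_multc) measurable
  also have "... = emeasure L A" unfolding H1 by simp
  finally show "emeasure ?Y A = emeasure L A" .
 qed simp
 finally have "distr M' L E = L" .
 show ?thesis by (rule that[OF p E' Y' \<open>distr M' L E = L\<close> 1])
qed

lemma (in prob_space) indep_vars_nn_integral_prod:
 fixes f :: "nat => 's => ennreal"
 assumes T: "indep_vars (%_. S) T {..<m}" and f: "!!b. b < m ==> f b : borel_measurable S"
 shows "NN M (%e. (\<Prod>b<m. f b (T b e))) = (\<Prod>b<m. NN (distr M S (T b)) (%x. f b x))"
proof -
 have Tm: "T b : measurable M S" if "b < m" for b using T that unfolding indep_vars_def by auto
 have "indep_vars (%_. borel) (%b e. f b (T b e)) {..<m}" by (rule indep_vars_compose2[OF T]) (use f in auto)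
 then have "NN M (%e. (\<Prod>b<m. f b (T b e))) = (\<Prod>b<m. NN M (%e. f b (T b e)))" by (intro indep_vars_nn_integral) auto
 also have "... = (\<Prod>b<m. NN (distr M S (T b)) (%x. f b x))" by (intro prod.cong refl nn_integral_distr[symmetric]) (use Tm f in auto)
 finally show ?thesis .
qed

lemma indep_vars_compose_distr:
 assumes M: "prob_space M" and f[measurable]: "f : measurable M N" and ind: "prob_space.indep_vars (distr M N f) S X I"
 shows "prob_space.indep_vars M S (%i x. X i (f x)) I"
proof (cases "I = {}")
 case True
 interpret prob_space M by fact
 show ?thesis unfolding True indep_vars_def indep_sets_def by simp
next
 case False
 interpret M: prob_space M by fact
 interpret D: prob_space "distr M N f" by (rule M.prob_space_distr) simp
 have X: "X i : measurable N (S i)" if "i : I" for i using ind that unfolding D.indep_vars_def by simp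
 have Xr: "(%x. \<lambda>i\<in>I. X i x) : measurable N (PiM I S)" by (intro measurable_restrict X)
 have "distr (distr M N f) (PiM I S) (%x. \<lambda>i\<in>I. X i x) = PiM I (%i. distr (distr M N f) (S i) (X i))"
  using D.indep_vars_iff_distr_eq_PiM'[OF False, of X S] X ind by simp
 also have "distr (distr M N f) (PiM I S) (%x. \<lambda>i\<in>I. X i x) = distr M (PiM I S) (%x. \<lambda>i\<in>I. X i (f x))"
  using distr_distr[OF Xr f] by (simp add: comp_def)
 also have "PiM I (%i. distr (distr M N f) (S i) (X i)) = PiM I (%i. distr M (S i) (%x. X i (f x)))"
  by (intro PiM_cong refl) (simp add: distr_distr[OF X f] comp_def)
 finally show ?thesis by (subst M.indep_vars_iff_distr_eq_PiM'[OF False]) (use measurable_compose[OF f X] in auto)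
qed

lemma is_BM_compose_distr:
 assumes M: "prob_space M" and f[measurable]: "f : measurable M X" and d: "distr M X f = X" and BM: "is_BM X I V B"
 shows "is_BM M I V (%i t x. B i t (f x))"
 unfolding is_BM_def
proof (intro conjI ballI allI impI)
 note BM' = BM[unfolded is_BM_def]
 have Bm: "B i t : borel_measurable X" if "i : I" "t : {0..1}" for i t using BM' that by blast
 show "(%x. B i t (f x)) : borel_measurable M" if "i : I" "t : {0..1}" for i t by (rule measurable_compose[OF f Bm[OF that]])
 have rg: "real_gaussian M (%x. Z (f x)) 0 s2" if "real_gaussian X Z 0 s2" for Z s2
 proof -
  have Z: "Z : borel_measurable X" using that unfolding real_gaussian_def by blast
  have "AE x in M. Z (f x) = 0" if "AE y in X. Z y = 0" by (rule AE_distrD[OF f]) (subst d, rule that)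
  moreover have "distr M lborel (%x. Z (f x)) = distr X lborel Z" using distr_distr[of Z X lborel f M] f Z d by (simp add: comp_def)
  ultimately show ?thesis using that measurable_compose[OF f Z] unfolding real_gaussian_def distributed_def by auto
 qed
 fix F :: "(nat \<times> real) set" and a :: "nat \<times> real => real"
 assume "finite F" "F <= I \<times> {0..1}"
 then obtain s2 where "real_gaussian X (%x. SUM (i,t):F. a (i,t) * B i t x) 0 s2" using BM' by blast
 from rg[OF this] show "EX s2. real_gaussian M (%x. SUM (i,t):F. a (i,t) * B i t (f x)) 0 s2" by blast
next
 fix ts :: "nat => real" and m assume "mono ts" "ALL k<=m. ts k : {0..1}"
 then have "prob_space.indep_vars X (%_. PiM I (%_. borel)) (%k x. \<lambda>i\<in>I. B i (ts (Suc k)) x - B i (ts k) x) {..<m}"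
  using BM unfolding is_BM_def by blast
 then show "prob_space.indep_vars M (%_. PiM I (%_. borel)) (%k x. \<lambda>i\<in>I. B i (ts (Suc k)) (f x) - B i (ts k) (f x)) {..<m}"
  using indep_vars_compose_distr[OF M f] unfolding d by blast
next
 fix i j s t assume ij: "i : I" "j : I" "s : {0..1::real}" "t : {0..1::real}"
 note BM' = BM[unfolded is_BM_def]
 have m: "(%x. B i s x * B j t x) : borel_measurable X" using BM' ij by (intro borel_measurable_times) blast+
 have i: "integrable X (%x. B i s x * B j t x)" "integral\<^sup>L X (%x. B i s x * B j t x) = min s t * V i j" using BM' ij by blast+
 show "integrable M (%x. B i s (f x) * B j t (f x))" using integrable_distr_eq[OF f m] i(1) unfolding d by simp
 show "integral\<^sup>L M (%x. B i s (f x) * B j t (f x)) = min s t * V i j" using integral_distr[OF f m] i(2) unfolding d by simp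
qed

lemma prod_mono_ennreal:
 fixes f f' :: "'i => ennreal"
 shows "(!!i. i : A ==> f i <= f' i) ==> prod f A <= prod f' A"
 by (induction A rule: infinite_finite_induct) (auto intro: mult_mono)

text \<open>\<open>L\<close> carries the innovations and \<open>X\<close> a Brownian motion;
  \<open>T b\<close> and \<open>G b\<close> are their block vectors, \<open>h b\<close> a coupling
  density of the two laws. The product of the \<open>h b\<close> is a density on the full spaces, so
  no information outside the block vectors is lost, and both marginals survive.\<close>

locale block_coupling = L: prob_space L + X: prob_space X
 for L :: "'e measure" and X :: "'x measure" +
 fixes S :: "'s measure" and S' :: "'t measure" and T :: "nat => 'e => 's" and G :: "nat => 'x => 't"
  and h :: "nat => 's \<times> 't => ennreal" and m :: nat
 assumes T_indep: "L.indep_vars (%_. S) T {..<m}" and G_indep: "X.indep_vars (%_. S') G {..<m}"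
  and h_meas: "!!b. b < m ==> h b : borel_measurable (S \<Otimes>\<^sub>M S')"
  and h_left: "!!b x. b < m ==> x : space S ==> NN (distr X S' (G b)) (%g. h b (x, g)) = 1"
  and h_right: "!!b g. b < m ==> g : space S' ==> NN (distr L S (T b)) (%x. h b (x, g)) = 1"
begin

definition dens :: "'e \<times> 'x => ennreal" where
 "dens z = (\<Prod>b<m. h b (T b (fst z), G b (snd z)))"

lemma T_meas: "b < m ==> T b : measurable L S" using T_indep unfolding L.indep_vars_def by auto
lemma G_meas: "b < m ==> G b : measurable X S'" using G_indep unfolding X.indep_vars_def by auto

lemma TG_meas: "b < m ==> (%z. (T b (fst z), G b (snd z))) : measurable (L \<Otimes>\<^sub>M X) (S \<Otimes>\<^sub>M S')"
 by (intro measurable_Pair measurable_compose[OF measurable_fst T_meas] measurable_compose[OF measurable_snd G_meas])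

lemma dens_meas: "dens : borel_measurable (L \<Otimes>\<^sub>M X)"
 unfolding dens_def by (intro borel_measurable_prod_ennreal measurable_compose[OF TG_meas h_meas]) auto

lemma iterated_prod:
 assumes f: "!!b. b < m ==> f b : borel_measurable (S \<Otimes>\<^sub>M S')"
 shows "NN L (%e. NN X (%x. (\<Prod>b<m. f b (T b e, G b x)))) =
  (\<Prod>b<m. NN (distr L S (T b)) (%s. NN (distr X S' (G b)) (%g. f b (s, g))))"
proof -
 let ?X = "%e. \<Prod>b<m. NN (distr X S' (G b)) (%g. f b (T b e, g))"
 let ?Y = "%e. NN X (%x. (\<Prod>b<m. f b (T b e, G b x)))"
 have "NN L (%e. ?Y e) = NN L (%e. (?X e))"
 proof (rule nn_integral_cong)
  fix e assume e: "e : space L"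
  have "(%g. f b (T b e, g)) : borel_measurable S'" if "b < m" for b
   by (rule measurable_Pair2[OF f[OF that]]) (rule measurable_space[OF T_meas[OF that] e])
  then show "?Y e = ?X e" by (rule X.indep_vars_nn_integral_prod[OF G_indep])
 qed
 also have "... = (\<Prod>b<m. NN (distr L S (T b)) (%s. NN (distr X S' (G b)) (%g. f b (s, g))))"
 proof (rule L.indep_vars_nn_integral_prod[OF T_indep])
  fix b assume b: "b < m"
  interpret D: prob_space "distr X S' (G b)" by (rule X.prob_space_distr[OF G_meas[OF b]])
  show "(%s. NN (distr X S' (G b)) (%g. f b (s, g))) : borel_measurable S"
   by (rule D.borel_measurable_nn_integral_fst) (use f[OF b] in \<open>simp cong: measurable_cong_sets\<close>)
 qed
 finally show ?thesis .
qed

lemma dens_left: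
 assumes e: "e : space L"
 shows "NN X (%x. dens (e, x)) = 1"
proof -
 have s: "T b e : space S" if "b < m" for b by (rule measurable_space[OF T_meas[OF that] e])
 have "NN X (%x. dens (e, x)) = (\<Prod>b<m. NN (distr X S' (G b)) (%g. h b (T b e, g)))" unfolding dens_def fst_conv snd_conv
  by (rule X.indep_vars_nn_integral_prod[OF G_indep measurable_Pair2[OF h_meas s]])
 also have "... = 1" using h_left s by simp
 finally show ?thesis .
qed

lemma dens_right:
 assumes x: "x : space X"
 shows "NN L (%e. dens (e, x)) = 1"
proof -
 have s: "G b x : space S'" if "b < m" for b by (rule measurable_space[OF G_meas[OF that] x])
 have "NN L (%e. dens (e, x)) = (\<Prod>b<m. NN (distr L S (T b)) (%t. h b (t, G b x)))" unfolding dens_def fst_conv snd_conv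
  by (rule L.indep_vars_nn_integral_prod[OF T_indep measurable_Pair1[OF h_meas s]])
 also have "... = 1" using h_right s by simp
 finally show ?thesis .
qed

text \<open>Under the product density, the failure of all blocks of a set J has probability at most
  pf to the power card J, since the factors outside J integrate to 1. There are at most m^r0 sets of
  size r0.\<close>

lemma many_failures:
 assumes A[measurable]: "A : sets (S \<Otimes>\<^sub>M S')" and pf: "0 <= pf"
  and hA: "!!b. b < m ==> NN (distr L S (T b)) (%s. NN (distr X S' (G b)) (%g. h b (s, g) * indicator A (s, g))) <= ennreal pf"
 shows "emeasure (density (L \<Otimes>\<^sub>M X) dens) {z : space (L \<Otimes>\<^sub>M X). r0 <= card {b. b < m & (T b (fst z), G b (snd z)) : A}} <= ennreal ((real m * pf) ^ r0)"
proof -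
 let ?P = "L \<Otimes>\<^sub>M X" and ?D = "density (L \<Otimes>\<^sub>M X) dens"
 let ?in = "%b z. (T b (fst z), G b (snd z)) : A"
 let ?J = "{J. J <= {..<m} & card J = r0}"
 have fJ: "finite ?J" by simp
 define W where "W = (%J. {z : space ?P. ALL b:J. ?in b z})"
 have inm: "{z : space ?P. ?in b z} : sets ?P" if "b < m" for b
  using measurable_sets[OF TG_meas[OF that] A] by (simp add: vimage_def Int_def conj_commute)
 have Wm: "W J : sets ?P" if "J : ?J" for J
 proof -
  have fin: "finite J" using that finite_subset by blast
  have "W J = (INT b:J. {z : space ?P. ?in b z}) \<inter> space ?P" unfolding W_def by auto
  also have "... : sets ?P"
  proof (cases "J = {}")
   case False
   then show ?thesis using fin that inm by (intro sets.Int sets.finite_INT) auto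
  qed simp
  finally show ?thesis .
 qed
 let ?X = "%b z. indicator A (T b (fst z), G b (snd z))"
 let ?Z = "ennreal (pf ^ r0)"
 have W: "emeasure ?D (W J) <= ?Z" if J: "J : ?J" for J
 proof -
  let ?f = "%b s. h b s * (if b : J then indicator A s else 1)"
  have fm: "?f b : borel_measurable (S \<Otimes>\<^sub>M S')" if "b < m" for b using h_meas[OF that] by auto
  have "emeasure ?D (W J) = NN ?P (%z. dens z * indicator (W J) z)" by (rule emeasure_density[OF dens_meas Wm[OF J]])
  also have "... = NN ?P (%z. (\<Prod>b<m. ?f b (T b (fst z), G b (snd z))))"
  proof (rule nn_integral_cong)
   fix z assume z: "z : space ?P"
   have Jm: "J <= {..<m}" using J by auto
   have "(\<Prod>b<m. if b : J then ?X b z else 1 :: ennreal) = (PROD b:J. ?X b z)" using Jm by (intro prod.mono_neutral_cong_right) auto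
   also have "... = indicator (W J) z"
   proof (cases "z : W J")
    case True
    then show ?thesis unfolding W_def by (auto intro!: prod.neutral)
   next
    case False
    then obtain b where b: "b : J" "~ ?in b z" using z unfolding W_def by auto
    have "finite J" using Jm finite_subset by blast
    then have "(PROD b:J. ?X b z :: ennreal) = 0" using b by (intro prod_zero) (auto intro!: bexI[of _ b])
    then show ?thesis by (simp only: indicator_simps(2)[OF False])
   qed
   finally show "dens z * indicator (W J) z = (\<Prod>b<m. ?f b (T b (fst z), G b (snd z)))" unfolding dens_def prod.distrib by simp
  qed
  also have "... = NN L (%e. NN X (%x. (\<Prod>b<m. ?f b (T b e, G b x))))"
  proof -
   have "(%z. \<Prod>b<m. ?f b (T b (fst z), G b (snd z))) : borel_measurable ?P"
    by (intro borel_measurable_prod_ennreal measurable_compose[OF TG_meas fm]) auto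
   from X.nn_integral_fst[OF this] show ?thesis unfolding fst_conv snd_conv by (rule sym)
  qed
  also have "... = (\<Prod>b<m. NN (distr L S (T b)) (%s. NN (distr X S' (G b)) (%g. ?f b (s, g))))" by (rule iterated_prod[OF fm])
  also have "... <= (\<Prod>b<m. if b : J then ennreal pf else 1)"
  proof (rule prod_mono_ennreal)
   fix b assume b: "b : {..<m}"
   interpret DL: prob_space "distr L S (T b)" using b by (intro L.prob_space_distr T_meas) auto
   show "NN (distr L S (T b)) (%s. NN (distr X S' (G b)) (%g. ?f b (s, g))) <= (if b : J then ennreal pf else 1)"
   proof (cases "b : J")
    case True
    then show ?thesis using hA[of b] b by simp
   next
    case False
    have "NN (distr L S (T b)) (%s. NN (distr X S' (G b)) (%g. ?f b (s, g))) = NN (distr L S (T b)) (%s. 1)"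
     using False b by (intro nn_integral_cong) (simp add: h_left)
    then show ?thesis using False DL.emeasure_space_1 by simp
   qed
  qed
  also have "... = (PROD b:J. ennreal pf)" using J by (intro prod.mono_neutral_cong_right) auto
  also have "... = ?Z" using J pf by (simp add: ennreal_power)
  finally show ?thesis .
 qed
 let ?Y = "real (m choose r0)"
 have "{z : space ?P. r0 <= card {b. b < m & ?in b z}} <= (UN J:?J. W J)"
 proof
  fix z assume z: "z : {z : space ?P. r0 <= card {b. b < m & ?in b z}}"
  then obtain J where "J <= {b. b < m & ?in b z}" "card J = r0" using obtain_subset_with_card_n by (metis (no_types, lifting) mem_Collect_eq)
  then show "z : (UN J:?J. W J)" using z unfolding W_def by blast
 qed
 then have "emeasure ?D {z : space ?P. r0 <= card {b. b < m & ?in b z}} <= emeasure ?D (UN J:?J. W J)"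
  by (rule emeasure_mono) (use Wm fJ in auto)
 also have "... <= (SUM J:?J. emeasure ?D (W J))" using Wm by (intro emeasure_subadditive_finite fJ) auto
 also have "... <= (SUM J:?J. ?Z)" by (rule sum_mono[OF W])
 also have "... = ennreal (?Y * pf ^ r0)" using n_subsets[of "{..<m}" r0] pf by (simp add: ennreal_mult ennreal_of_nat_eq_real_of_nat)
 also have "... <= ennreal ((real m * pf) ^ r0)"
 proof (rule ennreal_leI)
  have "?Y <= real m ^ r0"
  proof (cases "r0 <= m")
   case True
   then have "m choose r0 <= m ^ r0" by (rule binomial_le_pow)
   then show ?thesis by (simp flip: of_nat_power)
  next
   case False
   then show ?thesis by (simp add: binomial_eq_0)
  qed
  then show "?Y * pf ^ r0 <= (real m * pf) ^ r0" using pf by (simp add: power_mult_distrib mult_right_mono)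
 qed
 finally show ?thesis .
qed

end

lemma density_marginals:
 assumes L: "prob_space L" and X: "prob_space X" and H[measurable]: "H : borel_measurable (L \<Otimes>\<^sub>M X)"
  and H2: "!!x. x : space X ==> NN L (%e. H (e, x)) = 1"
  and EY: "E : measurable M L" "Y : measurable M X" "distr M (L \<Otimes>\<^sub>M X) (%z. (E z, Y z)) = density (L \<Otimes>\<^sub>M X) H"
 shows "distr M X Y = X"
proof -
 interpret L: prob_space L by fact
 interpret X: prob_space X by fact
 interpret P: pair_sigma_finite L X ..
 let ?Y = "L \<Otimes>\<^sub>M X"
 let ?X = "distr (density ?Y H) X snd"
 have "distr M X Y = ?X"
  unfolding EY(3)[symmetric] by (subst distr_distr[OF measurable_snd measurable_Pair[OF EY(1,2)]]) (simp add: comp_def)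
 also have "... = X"
 proof (rule measure_eqI)
  fix A assume "A : sets (?X)"
  then have A[measurable]: "A : sets X" by simp
  have "emeasure (?X) A = NN (density ?Y H) (%z. indicator A (snd z))"
   using A by (subst nn_integral_indicator[symmetric], simp, subst nn_integral_distr) auto
  also have "... = NN (?Y) (%z. H z * indicator A (snd z))" by (rule nn_integral_density) auto
  also have "... = NN X (%x. NN L (%e. H (e, x) * indicator A x))" by (subst P.nn_integral_snd[symmetric]) auto
  also have "... = NN X (%x. (NN L (%e. H (e, x))) * indicator A x)" by (intro nn_integral_cong nn_integral_multc measurable_Pair1[OF H])
  also have "... = NN X (%x. indicator A x)" by (intro nn_integral_cong) (simp add: H2)
  also have "... = emeasure X A" by simp
  finally show "emeasure (?X) A = emeasure X A" .
 qed simp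
 finally show ?thesis .
qed

section \<open>Reduction of the statement to pairs of scalar filters\<close>

definition comb :: "(nat => nat => nat => real) => (nat => nat) => nat => (nat => real) => nat => real" where
 "comb c d n v j = (SUM nu:{1..d n}. v nu * c n j nu)"

lemma fcoef_eq: "fcoef c d n l j v w = F (comb c d n v) (comb c d n w) l j"
proof (cases "l = 0")
 case True
 then show ?thesis by (simp add: fcoef_def F_def comb_def sum_product mult_ac)
next
 case False
 have "F (comb c d n v) (comb c d n w) l j = (SUM nu:{1..d n}. SUM mu:{1..d n}. (v nu * c n j nu) * (w mu * c n (j + l) mu))
   + (SUM nu:{1..d n}. SUM mu:{1..d n}. (v nu * c n (j + l) nu) * (w mu * c n j mu))"
  using False unfolding F_def comb_def sum_product[symmetric] by simp
 also have "... = fcoef c d n l j v w" using False unfolding fcoef_def sum.distrib[symmetric] by (simp add: algebra_simps)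
 finally show ?thesis ..
qed

lemma ftilde_eq: "ftilde c d n l 0 v w = Ft (comb c d n v) (comb c d n w) l" unfolding ftilde_def Ft_def by (simp add: fcoef_eq)

lemma adm_comb:
 assumes th: "0 < th" and c: "!!j nu. nu : {1..d n} ==> (c n j nu)^2 <= K * (real (max j 1)) powr (-3/2 - th)"
  and v: "(SUM nu:{1..d n}. abs (v nu)) <= L" and K: "0 <= K"
 shows "adm th (L * sqrt K) (comb c d n v)"
 unfolding adm_def
proof
 fix j
 let ?x = "real (max j 1) powr (-3/4 - th/2)"
 have c': "abs (c n j nu) <= sqrt K * ?x" if "nu : {1..d n}" for nu
 proof -
  have "?x^2 = real (max j 1) powr (-3/2 - th)" by (simp add: power2_eq_square powr_add[symmetric])
  then have "abs (c n j nu)^2 <= (sqrt K * ?x)^2" using c[OF that, of j] K by (simp add: power_mult_distrib)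
  then show ?thesis by (rule power2_le_imp_le) (use K in simp)
 qed
 have "abs (comb c d n v j) <= (SUM nu:{1..d n}. abs (v nu * c n j nu))" unfolding comb_def by (rule sum_abs)
 also have "... <= (SUM nu:{1..d n}. abs (v nu) * (sqrt K * ?x))" unfolding abs_mult by (intro sum_mono mult_left_mono c') auto
 also have "... = (SUM nu:{1..d n}. abs (v nu)) * (sqrt K * ?x)" by (rule sum_distrib_right[symmetric])
 also have "... <= L * (sqrt K * ?x)" using K by (intro mult_right_mono v) auto
 finally show "abs (comb c d n v j) <= L * sqrt K * ?x" by (simp add: mult.assoc)
qed

lemma adm_coef:
 assumes c: "!!j. (c n j nu)^2 <= K * (real (max j 1)) powr (-3/2 - th)" and K: "0 <= K"
 shows "adm th (sqrt K) (%j. c n j nu)"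
 unfolding adm_def
proof
 fix j
 let ?x = "real (max j 1) powr (-3/4 - th/2)"
 have "?x^2 = real (max j 1) powr (-3/2 - th)" by (simp add: power2_eq_square powr_add[symmetric])
 then have "abs (c n j nu)^2 <= (sqrt K * ?x)^2" using c[of j] K by (simp add: power_mult_distrib)
 then show "abs (c n j nu) <= sqrt K * ?x" by (rule power2_le_imp_le) (use K in simp)
qed

context innov
begin

lemma covsum_eq: "covsum M eps c d n v w v' w' n' m' =
 covs n' (Ft (comb c d n v) (comb c d n w)) (Ft (comb c d n v') (comb c d n w')) m'"
 unfolding covsum_def covs_def ftilde_eq gamma4_def sigma2_def gam4_def[symmetric] sig2_def[symmetric] ..

text \<open>A \<open>suminf\<close> is linear only where the component series converge, hence the
  exceptional null set; one such set serves all t.\<close>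

lemma Dn_eq:
 assumes th: "0 < th" and c: "!!j nu. nu : {1..d n} ==> (c n j nu)^2 <= K * (real (max j 1)) powr (-3/2 - th)" and K: "0 <= K"
 shows "AE x in M. ALL t. Dn M eps c d n t v w x = (1 / sqrt (real n)) *
   (SUM i:{1..nat (floor (real n * t))}. lin (comb c d n v) (int i) x * lin (comb c d n w) (int i) x
    - expectation (%x. lin (comb c d n v) (int i) x * lin (comb c d n w) (int i) x))"
proof -
 let ?D = "{1..d n}"
 let ?cc = "%nu j. c n j nu"
 have ad: "adm th (sqrt K) (?cc nu)" if "nu : ?D" for nu by (rule adm_coef[where c=c and n=n and nu=nu, OF c[OF that] K])
 have Y: "Yn eps c n i nu = lin (?cc nu) i" for i nu unfolding Yn_def lin_def by auto
 let ?Y = "comb c d n w"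
 let ?Z = "%v. comb c d n v"
 have "AE x in M. ALL nu:?D. ALL i::int. summable (%j. ?cc nu j * eps (i - int j) x)"
  by (intro AE_finite_allI AE_all_countable[THEN iffD2] allI lin_summable[OF th ad]) auto
 then have "AE x in M. ALL v i. lin (?Z v) i x = (SUM nu:?D. v nu * lin (?cc nu) i x)"
 proof eventually_elim
  case (elim x)
  have "lin (?Z v) i x = (SUM nu:?D. v nu * lin (?cc nu) i x)" for v i
  proof -
   have "lin (?Z v) i x = (\<Sum>j. SUM nu:?D. v nu * (?cc nu j * eps (i - int j) x))"
    unfolding lin_def comb_def by (simp add: sum_distrib_right mult.assoc)
   also have "... = (SUM nu:?D. \<Sum>j. v nu * (?cc nu j * eps (i - int j) x))"
    by (rule suminf_sum) (use elim in \<open>auto intro: summable_mult\<close>)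
   also have "... = (SUM nu:?D. v nu * lin (?cc nu) i x)" unfolding lin_def by (intro sum.cong refl suminf_mult) (use elim in auto)
   finally show ?thesis .
  qed
  then show ?case by blast
 qed
 then have AEl: "AE x in M. ALL i. lin (?Z v) i x * lin ?Y i x = (SUM nu:?D. SUM mu:?D. v nu * w mu * (lin (?cc nu) i x * lin (?cc mu) i x))"
  by eventually_elim (simp add: sum_product mult_ac)
 have int: "integrable M (%x. lin (?cc nu) i x * lin (?cc mu) i x)" if "nu : ?D" "mu : ?D" for nu mu i
  by (rule lin_product_integrable[OF th ad ad]) (use that in auto)
 let ?X = "%v i. SUM nu:?D. SUM mu:?D. v nu * w mu * expectation (%x. lin (?cc nu) i x * lin (?cc mu) i x)"
 have El: "expectation (%x. lin (?Z v) i x * lin ?Y i x) =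
  (?X v i)" for i
 proof -
  have "expectation (%x. lin (?Z v) i x * lin ?Y i x) =
   expectation (%x. SUM nu:?D. SUM mu:?D. v nu * w mu * (lin (?cc nu) i x * lin (?cc mu) i x))"
   by (rule integral_cong_AE) (use AEl in \<open>auto elim: eventually_mono\<close>)
  also have "... = (SUM nu:?D. SUM mu:?D. expectation (%x. v nu * w mu * (lin (?cc nu) i x * lin (?cc mu) i x)))"
   by (subst Bochner_Integration.integral_sum, intro Bochner_Integration.integrable_sum integrable_mult_right int, assumption, assumption,
     intro sum.cong refl Bochner_Integration.integral_sum integrable_mult_right int)
  also have "... = ?X v i" by simp
  finally show ?thesis .
 qed
 have S: "SigmaHat eps c n k nu mu = (%x. SUM i:{1..k}. lin (?cc nu) (int i) x * lin (?cc mu) (int i) x)" for k nu mu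
  unfolding SigmaHat_def Y by auto
 have ES: "expectation (SigmaHat eps c n k nu mu) = (SUM i:{1..k}. expectation (%x. lin (?cc nu) (int i) x * lin (?cc mu) (int i) x))" if "nu : ?D" "mu : ?D" for k nu mu
  unfolding S by (rule Bochner_Integration.integral_sum) (rule int[OF that])
 let ?U = "%v i. expectation (%x. lin (?Z v) (int i) x * lin ?Y (int i) x)"
 show ?thesis using AEl
 proof eventually_elim
  case (elim x)
  show ?case
  proof
   fix t
   let ?k = "nat (floor (real n * t))"
   let ?p = "%nu mu i. lin (?cc nu) (int i) x * lin (?cc mu) (int i) x - expectation (%x. lin (?cc nu) (int i) x * lin (?cc mu) (int i) x)"
   have "(SUM nu:?D. SUM mu:?D. v nu * w mu * (SigmaHat eps c n ?k nu mu x - expectation (SigmaHat eps c n ?k nu mu)))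
    = (SUM nu:?D. SUM mu:?D. SUM i:{1..?k}. v nu * w mu * ?p nu mu i)"
   proof (intro sum.cong refl)
    fix nu mu assume "nu : ?D" "mu : ?D"
    from ES[OF this] show "v nu * w mu * (SigmaHat eps c n ?k nu mu x - expectation (SigmaHat eps c n ?k nu mu)) = (SUM i:{1..?k}. v nu * w mu * ?p nu mu i)"
     by (simp only: S sum_subtractf[symmetric] sum_distrib_left)
   qed
   also have "... = (SUM i:{1..?k}. SUM nu:?D. SUM mu:?D. v nu * w mu * ?p nu mu i)"
    by (subst sum.swap[of _ "{1..?k}"], subst sum.swap[of _ "{1..?k}"]) (rule refl)
   also have "... = (SUM i:{1..?k}. lin (?Z v) (int i) x * lin ?Y (int i) x
    - ?U v i)" unfolding El using elim by (simp add: right_diff_distrib sum_subtractf)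
   finally show "Dn M eps c d n t v w x = (1 / sqrt (real n)) * (SUM i:{1..?k}. lin (?Z v) (int i) x * lin ?Y (int i) x
    - ?U v i)" unfolding Dn_def by (simp only:)
  qed
 qed
qed

lemma sum_Tb: "(\<Sum>b<m. Tb q u ph b x) = (\<Sum>r<m * (q div u). tau u ph (r * u) x)"
proof (induction m)
 case (Suc m)
 have "(\<Sum>r<m * (q div u). tau u ph (r * u) x) + Tb q u ph m x = (\<Sum>r<Suc m * (q div u). tau u ph (r * u) x)"
  unfolding Tb_def atLeast0LessThan[symmetric] by (rule sum.atLeastLessThan_concat) auto
 with Suc show ?case by (simp only: sum.lessThan_Suc)
qed simp

text \<open>Half of e is spent on truncating the filters and half on the remainder kernel. The bound
  on a single block is carried along for the blocks in which the coupling fails.\<close>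

lemma block_approximation:
 assumes th: "0 < th" "th <= 1" and a: "!!n. adm th A0 (a n)" and b: "!!n. adm th A0 (b n)"
  and ka: "2 <= ka" "2 <= kc" "4 * real kc <= th * real ka" and e: "e > 0"
 shows "AE x in M. \<forall>\<^sub>F n in sequentially. ALL k<=n.
   abs ((SUM i:{1..k}. lin (a n) (int i) x * lin (b n) (int i) x - expectation (%x. lin (a n) (int i) x * lin (b n) (int i) x))
   - (\<Sum>j<k div qlen ka (floor_log n). Tb (qlen ka (floor_log n)) (ulen kc (floor_log n)) (Ft (a n) (b n)) j x)) <= e * sqrt n &
   abs (Tb (qlen ka (floor_log n)) (ulen kc (floor_log n)) (Ft (a n) (b n)) (k div qlen ka (floor_log n)) x) <= e * sqrt n"
proof -
 have e2: "e/2 > 0" using e by simp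
 let ?X = "%n. qlen ka (floor_log n)"
 show ?thesis
  using remainder_small(1)[where a=a and b=b, OF th a b ka e2] block_small[where a=a and b=b, OF th a b ka e] truncation_negligible[where a=a and b=b, OF th(1) a b e2]
 proof eventually_elim
  case (elim x)
  then show ?case
  proof eventually_elim
   case (elim n)
   show ?case
   proof (intro allI impI conjI)
    fix k assume k: "k <= n"
    have tri: "abs (X - Y) <= e/2 * s ==> abs (Y - Z) <= e/2 * s ==> abs (X - Z) <= e * s" for X Y Z s :: real
    proof -
     assume "abs (X - Y) <= e/2 * s" "abs (Y - Z) <= e/2 * s"
     then have "abs (X - Z) <= e/2 * s + e/2 * s" by linarith
     then show "abs (X - Z) <= e * s" by simp
    qed
    show "abs ((SUM i:{1..k}. lin (a n) (int i) x * lin (b n) (int i) x - expectation (%x. lin (a n) (int i) x * lin (b n) (int i) x))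
     - (\<Sum>j<k div ?X n. Tb (?X n) (ulen kc (floor_log n)) (Ft (a n) (b n)) j x)) <= e * sqrt n"
     unfolding sum_Tb by (rule tri[OF elim(3)[rule_format, OF k] elim(1)[rule_format, OF k]])
    show "abs (Tb (?X n) (ulen kc (floor_log n)) (Ft (a n) (b n)) (k div ?X n) x) <= e * sqrt n"
     unfolding Tb_def by (rule elim(2)[rule_format, OF k])
   qed
  qed
 qed
qed

end

lemma powr_uminus_nat_tendsto_0: "0 < th ==> (%u. c * real (Suc u) powr (- th)) \<longlonglongrightarrow> 0" by real_asymp

context innov
begin

lemma covs_commute: "covs u ph psi m' = covs u psi ph m'" unfolding covs_def by (simp add: mult.commute mult.left_commute)

text \<open>Alpha and beta are known only through the approximation property. It makes V the limit
  of covariances of sub-block sums divided by u, so positivity and symmetry follow as u tends to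
  infinity; the bound on the diagonal is read off at u = 1.\<close>

lemma limit_covariance_facts:
 fixes V :: "'i => 'i => real"
 assumes I: "finite I" and Cph: "!!i l. i : I ==> abs (ph i l) <= Cph" and th: "0 < th"
  and V: "!!i k u m'. i : I ==> k : I ==> abs (covs u (ph i) (ph k) m' - real u * V i k) <= C * real u powr (1 - th)"
 shows "0 <= (SUM i:I. SUM k:I. eta i * eta k * V i k)"
  "i : I ==> k : I ==> V i k = V k i"
  "i : I ==> V i i <= Cph^2 * c0 + C"
proof -
 let ?X = "%u. real (Suc u)"
 have sc: "?X u powr (1 - th) = ?X u * ?X u powr (- th)" for u by (simp add: powr_diff powr_minus divide_inverse)
 let ?Z = "%i. abs (eta i)"
 let ?U = "(SUM i:I. ?Z i)"
 let ?S = "SUM i:I. SUM k:I. eta i * eta k * V i k"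
 let ?Y = "%u. C * ?X u powr (1 - th)"
 let ?W = "%u. ?U^2 * C * ?X u powr (- th)"
 have lb: "- ?W u <= ?S" for u
 proof -
  let ?psi = "%l. SUM i:I. eta i * ph i l"
  have "covs (Suc u) ?psi ?psi 0 - ?X u * ?S = (SUM i:I. SUM k:I. eta i * eta k * (covs (Suc u) (ph i) (ph k) 0 - ?X u * V i k))"
   unfolding covs_bilinear by (simp add: sum_distrib_left sum_subtractf right_diff_distrib mult_ac del: of_nat_Suc)
  also have "... <= (SUM i:I. SUM k:I. ?Z i * ?Z k * ?Y u)"
  proof (intro sum_mono)
   fix i k assume ik: "i : I" "k : I"
   have "eta i * eta k * (covs (Suc u) (ph i) (ph k) 0 - ?X u * V i k) <= abs (eta i * eta k * (covs (Suc u) (ph i) (ph k) 0 - ?X u * V i k))" by (rule abs_ge_self)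
   also have "... <= ?Z i * ?Z k * ?Y u" unfolding abs_mult by (intro mult_left_mono V ik) auto
   finally show "eta i * eta k * (covs (Suc u) (ph i) (ph k) 0 - ?X u * V i k) <= ?Z i * ?Z k * ?Y u" .
  qed
  also have "... = ?U^2 * ?Y u" unfolding power2_eq_square sum_product by (simp add: sum_distrib_right del: of_nat_Suc)
  finally have "- (?X u * ?S) <= ?U^2 * ?Y u" using covs_nonneg[of "Suc u" ?psi 0] by linarith
  then have "?X u * (- ?W u) <= ?X u * ?S" unfolding sc by (simp only: mult_minus_right mult_ac minus_le_iff)
  then show ?thesis by (rule mult_left_le_imp_le) simp
 qed
 have "(%u. - ?W u) \<longlonglongrightarrow> - 0" by (intro tendsto_minus powr_uminus_nat_tendsto_0 th)
 then have "- 0 <= ?S" by (rule LIMSEQ_le_const2) (use lb in blast)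
 then show "0 <= ?S" by simp
 show "V i k = V k i" if ik: "i : I" "k : I"
 proof -
  have "abs (V i k - V k i) <= 2 * C * ?X u powr (- th)" for u
  proof -
   have "?X u * abs (V i k - V k i) = abs (?X u * V i k - ?X u * V k i)" by (simp add: abs_mult right_diff_distrib[symmetric] del: of_nat_Suc)
   also have "... <= C * ?X u powr (1 - th) + C * ?X u powr (1 - th)"
    using V[OF ik, of "Suc u" 0] V[OF ik(2,1), of "Suc u" 0] unfolding covs_commute[of _ "ph k"] by linarith
   also have "... = ?X u * (2 * C * ?X u powr (- th))" unfolding sc by (simp del: of_nat_Suc)
   finally show ?thesis by (rule mult_left_le_imp_le) simp
  qed
  then have "abs (V i k - V k i) <= 0" by (intro LIMSEQ_le_const[OF powr_uminus_nat_tendsto_0[OF th, of "2 * C"]]) auto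
  then show ?thesis by simp
 qed
 show "V i i <= Cph^2 * c0 + C" if i: "i : I"
 proof -
  have "covs 1 (ph i) (ph i) 0 = (ph i 0)^2 * dvar 1" unfolding covs_def dvar_def by (simp add: power2_eq_square)
  also have "... <= Cph^2 * c0"
  proof (intro mult_mono)
   have "abs (ph i 0)^2 <= Cph^2" by (intro power_mono Cph i) auto
   then show "(ph i 0)^2 <= Cph^2" by simp
  qed (auto simp: dvar)
  finally show ?thesis using V[OF i i, of 1 0] by (simp add: abs_le_iff)
 qed
qed

lemma gbm_increments_indep:
 assumes I: "finite I" and A: "!!i j. i : I ==> j : I ==> V i j = (SUM l:I. A i l * A j l)"
  and mq: "m * q <= n" and n: "1 <= n"
 shows "prob_space.indep_vars Xi (%_. PiM I (%_. borel))
  (%b xi. \<lambda>i\<in>I. s * (gbm I A i (real (Suc b * q) / real n) xi - gbm I A i (real (b * q) / real n) xi)) {..<m}"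
proof -
 interpret Xi: prob_space Xi by (rule prob_space_Xi)
 let ?ts = "%k. min 1 (real (k * q) / real n)"
 have le1: "real (k * q) / real n <= 1" if "k <= m" for k
 proof -
  have "k * q <= m * q" using that by (rule mult_right_mono) simp
  then have "k * q <= n" using mq by linarith
  then have "real (k * q) <= real n" by (simp only: of_nat_le_iff)
  then show ?thesis using n by (simp add: divide_le_eq)
 qed
 let ?X = "prob_space.indep_vars Xi (%_. PiM I (%_. borel))"
 have "mono ?ts" by (intro monoI min.mono order_refl divide_right_mono) (auto intro: mult_right_mono)
 moreover have "ALL k<=m. ?ts k : {0..1}" by simp
 moreover have "ALL ts m. mono ts --> (ALL k<=m. ts k : {0..1}) --> ?X
  (%k xi. \<lambda>i\<in>I. gbm I A i (ts (Suc k)) xi - gbm I A i (ts k) xi) {..<m}"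
  using gbm_is_BM[where I=I and A=A and V=V, OF I A] unfolding is_BM_def by blast
 ultimately have "?X
  (%k xi. \<lambda>i\<in>I. gbm I A i (?ts (Suc k)) xi - gbm I A i (?ts k) xi) {..<m}" by blast
 then have "Xi.indep_vars (%_. PiM I (%_. borel))
  (%k xi. (%y. \<lambda>i\<in>I. s * y i) (\<lambda>i\<in>I. gbm I A i (?ts (Suc k)) xi - gbm I A i (?ts k) xi)) {..<m}"
  by (rule Xi.indep_vars_compose2) measurable
 also have "?this \<longleftrightarrow> ?thesis"
 proof (rule Xi.indep_vars_cong[OF refl])
  fix b assume b: "b : {..<m}"
  have "?ts (Suc b) = real (Suc b * q) / real n" "?ts b = real (b * q) / real n"
   using le1[of "Suc b"] le1[of b] b by (auto simp only: min_absorb2 lessThan_iff Suc_le_eq less_imp_le)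
  then show "(%xi. (%y. \<lambda>i\<in>I. s * y i) (\<lambda>i\<in>I. gbm I A i (?ts (Suc b)) xi - gbm I A i (?ts b) xi)) =
   (%xi. \<lambda>i\<in>I. s * (gbm I A i (real (Suc b * q) / real n) xi - gbm I A i (real (b * q) / real n) xi))"
   by (intro ext restrict_ext) (simp only: restrict_apply if_True)
 qed simp
 finally show ?thesis .
qed

text \<open>The smoothing coupling is used with rho = t, R = 1/t and r = sqrt t. The Chebyshev term
  and the mass outside the cube are then O(t). The density term loses t^(- card I) to the volume of
  the cube, t^(- card I) to the peak of the kernel and t^-3 to the third moments; the rate t^(2 card
  I + 4) leaves one factor t. The factor sqrt (n / q) gives the Brownian increments the covariance
  V.\<close>

lemma coupled_level:
 fixes I :: "nat set"
 assumes I: "finite I" and Cph: "!!i l. i : I ==> abs (ph i l) <= Cph" "0 <= Cph" and th: "0 < th" and C: "0 <= C"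
  and V: "!!i k u m'. i : I ==> k : I ==> abs (covs u (ph i) (ph k) m' - real u * V i k) <= C * real u powr (1 - th)"
  and A: "!!i j. i : I ==> j : I ==> V i j = (SUM l:I. A i l * A j l)"
  and u: "1 <= u" and q: "q = u * (q div u)" "1 <= q" and mq: "m * q <= n" and n: "1 <= n" and t: "0 < t" "t <= 1" and D: "0 <= D"
  and Del: "2 * Cg^2 * (1 + 2 * Cph)^3 * real u ^ 6 * real q powr (1 - pm) + C * real u powr (- th) <= D * t ^ (2 * card I + 4)"
 defines "c == 8 * real (card I) + 2 ^ card I * (1 + 2 * real (card I)) * (8 * (1 + real (card I) ^ 3) * D) + 2 * (real (card I) * (Cph^2 * c0 + 2 * C) + real (card I))"
 shows "EX H. H : borel_measurable (M \<Otimes>\<^sub>M Xi) & (ALL e:space M. NN Xi (%x. H (e, x)) = 1) & (ALL x:space Xi. NN M (%e. H (e, x)) = 1) &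
  (ALL r0. emeasure (density (M \<Otimes>\<^sub>M Xi) H) {z : space (M \<Otimes>\<^sub>M Xi). r0 <= card {b. b < m & (EX i:I. sqrt t <
    abs (Tb q u (ph i) b (fst z) / sqrt (real q) - sqrt (real n / real q) * (gbm I A i (real (Suc b * q) / real n) (snd z) - gbm I A i (real (b * q) / real n) (snd z))))}}
    <= ennreal ((real m * (c * t)) ^ r0))"
proof -
 interpret Xi: prob_space Xi by (rule prob_space_Xi)
 let ?XI = "PiM I (%_. borel) :: (nat => real) measure"
 let ?P = "sqrt (real q)"
 define T where "T = (%b x. \<lambda>i\<in>I. Tb q u (ph i) b x / ?P)"
 define G where "G = (%b xi. \<lambda>i\<in>I. sqrt (real n / real q) * (gbm I A i (real (Suc b * q) / real n) xi - gbm I A i (real (b * q) / real n) xi))"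
 let ?W = "%eta. SUM i:I. SUM k:I. eta i * eta k * V i k"
 have psd: "0 <= ?W eta" for eta by (rule limit_covariance_facts(1)[where ph=ph, OF I Cph(1) th V])
 have Vii: "V i i <= Cph^2 * c0 + C" if "i : I" for i
  by (rule limit_covariance_facts(3)[where ph=ph and I=I, OF I Cph(1) th V]) (use that in auto)
 let ?k = "real (card I)"
 have Tm: "T b : measurable M ?XI" for b unfolding T_def by measurable
 have Gm: "G b : measurable Xi ?XI" for b unfolding G_def by measurable
 define C2 where "C2 = ?k * (Cph^2 * c0 + 2 * C)"
 have C20: "0 <= C2" unfolding C2_def using c0 C by (intro mult_nonneg_nonneg add_nonneg_nonneg) auto
 let ?D = "2 * card I + 4"
 define Del' where "Del' = 8 * (1 + ?k ^ 3) * (D * t ^ ?D)"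
 let ?Y = "%T b. distr M ?XI (T b)"
 let ?Z = "%G b. distr Xi ?XI (G b)"
 let ?T = "borel_measurable (?XI \<Otimes>\<^sub>M ?XI)"
 define Q where "Q = (%b (h :: (nat => real) => (nat => real) => ennreal). case_prod h : ?T &
   (ALL x:space ?XI. NN (?Z G b) (%g. h x g) = 1) & (ALL g:space ?XI. NN (?Y T b) (%x. h x g) = 1) &
   (NN (?Y T b) (%x. NN (?Z G b) (%g. h x g * indicator {(x, g). EX i:I. abs (x i - g i) > sqrt t} (x, g)))) <= ennreal (c * t))"
 let ?E = "1 / (sqrt (2*pi) * t)"
 let ?X = "%Del'. ?E ^ card I * (Del' * (1 + 2 * ?k / t^3))"
 let ?S = "%i b. NN M (%x. ennreal ((Tb q u (ph i) b x / ?P)^2))"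
 let ?R = "%eta. SUM i:I. abs (eta i)^3"
 let ?Q = "ennreal (Cph^2 * c0 + 2 * C)"
 let ?F = "8 * (1 + ?k ^ 3) * D"
 let ?G = "%C2. C2 + ?k * t^2"
 have ex: "EX h. Q b h" if b: "b < m" for b
 proof -
  have cfT: "mchar (?Y T b) I eta = (CLINT x|M. iexp (SUM i:I. eta i * (Tb q u (ph i) b x / ?P)))" for eta
  proof -
   have "mchar (?Y T b) I eta = (CLINT x|M. iexp (SUM i:I. eta i * T b x i))" unfolding mchar_def by (rule integral_distr[OF Tm]) measurable
   also have "... = (CLINT x|M. iexp (SUM i:I. eta i * (Tb q u (ph i) b x / ?P)))"
    by (intro Bochner_Integration.integral_cong refl arg_cong[where f=iexp] sum.cong) (simp add: T_def)
   finally show ?thesis .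
  qed
  have cfG: "mchar (?Z G b) I eta = exp (- ((?W eta) / 2))" for eta
  proof -
   let ?ts = "%k::nat. if k = 0 then real (b * q) / real n else real (Suc b * q) / real n"
   let ?s = "sqrt (real n / real q)"
   have bq: "Suc b * q <= n"
   proof -
    have "Suc b * q <= m * q" using b by (intro mult_right_mono) auto
    then show ?thesis using mq by linarith
   qed
   have le: "real (b * q) <= real (Suc b * q)" "real (Suc b * q) <= real n" "0 <= real (b * q)"
    using bq by (auto simp only: of_nat_le_iff mult_Suc of_nat_0_le_iff)
   have mo: "mono ?ts" using le by (auto intro!: monoI divide_right_mono simp del: of_nat_mult)
   have in01: "?ts k : {0..1}" for k using le n by (auto simp: divide_le_eq simp del: of_nat_mult)
   have "mchar (?Z G b) I eta = (CLINT xi|Xi. iexp (SUM i:I. eta i * G b xi i))" unfolding mchar_def by (rule integral_distr[OF Gm]) measurable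
   also have "... = (CLINT xi|Xi. iexp (\<Sum>k<1. SUM i:I. (?s * eta i) * (gbm I A i (?ts (Suc k)) xi - gbm I A i (?ts k) xi)))"
    by (intro Bochner_Integration.integral_cong refl arg_cong[where f=iexp]) (simp add: G_def mult_ac)
   also have "... = exp (- (\<Sum>k<1. (?ts (Suc k) - ?ts k) * (SUM i:I. SUM i':I. (?s * eta i) * (?s * eta i') * V i i')) / 2)"
    by (rule gbm_increment_char[where I=I and A=A and V=V and m=1, OF I A mo in01])
   also have "(\<Sum>k<1. (?ts (Suc k) - ?ts k) * (SUM i:I. SUM i':I. (?s * eta i) * (?s * eta i') * V i i')) = ?W eta"
   proof -
    have "?s * ?s = real n / real q" by simp
    then have "(SUM i:I. SUM i':I. (?s * eta i) * (?s * eta i') * V i i') = (real n / real q) * ?W eta" by (simp add: sum_distrib_left mult_ac)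
    moreover have "?ts (Suc 0) - ?ts 0 = real q / real n" by (simp add: diff_divide_distrib[symmetric] algebra_simps)
    ultimately show ?thesis using q(2) n by simp
   qed
   finally show ?thesis by simp
  qed
  have cf: "norm (mchar (?Y T b) I eta - mchar (?Z G b) I eta) <= Del' * (1 + ?R eta)" for eta
  proof -
   let ?U = "SUM i:I. abs (eta i)" and ?B = "2 * Cg^2 * (1 + 2 * Cph)^3 * real u ^ 6 * real q powr (1 - pm) + C * real u powr (- th)"
   \<comment> \<open>The cube of the l1-norm is compared with the sum of cubes through the largest
     coordinate; \<open>smoothed_density_diff\<close> wants separate cubes.\<close>
   have U: "?U^3 <= ?k^3 * ?R eta"
   proof (cases "I = {}")
    case False
    obtain i0 where i0: "i0 : I" "!!i. i : I ==> abs (eta i) <= abs (eta i0)"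
     using Max_in[of "(%i. abs (eta i)) ` I"] Max_ge[of "(%i. abs (eta i)) ` I"] I False by (smt (verit) empty_is_image finite_imageI image_iff imageI)
    have "?U <= ?k * abs (eta i0)" using sum_bounded_above[of I "%i. abs (eta i)" "abs (eta i0)"] i0 by simp
    then have "?U^3 <= (?k * abs (eta i0))^3" by (intro power_mono sum_nonneg) auto
    also have "... = ?k^3 * abs (eta i0)^3" by (rule power_mult_distrib)
    also have "... <= ?k^3 * ?R eta" using I i0 by (intro mult_left_mono member_le_sum) auto
    finally show ?thesis .
   qed simp
   have "(1 + ?U)^3 <= 8 * (1 + ?U^3)"
   proof -
    have U0: "0 <= ?U" by (intro sum_nonneg) auto
    show ?thesis
    proof (cases "?U <= 1")
     case True
     then have "(1 + ?U)^3 <= 2^3" using U0 by (intro power_mono) auto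
     then show ?thesis using U0 by (simp add: add_increasing2)
    next
     case False
     then have "(1 + ?U)^3 <= (2 * ?U)^3" by (intro power_mono) auto
     then show ?thesis by (simp add: power_mult_distrib)
    qed
   qed
   also have "... <= 8 * (1 + ?k^3) * (1 + ?R eta)"
   proof -
    have "0 <= ?k^3" "0 <= ?R eta" by (auto intro: sum_nonneg)
    moreover have "0 <= k ==> 0 <= s ==> a <= k * s ==> 8 * (1 + a) <= 8 * (1 + k) * (1 + s)" for a k s :: real by (simp add: algebra_simps)
    ultimately show ?thesis using U by blast
   qed
   finally have U3: "(1 + ?U)^3 <= 8 * (1 + ?k^3) * (1 + ?R eta)" .
   have B0: "0 <= ?B" using C Cph by (intro add_nonneg_nonneg mult_nonneg_nonneg) auto
   have "norm (mchar (?Y T b) I eta - mchar (?Z G b) I eta) <= (1 + ?U)^3 * ?B"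
    unfolding cfT cfG by (rule block_char[where I=I and ph=ph and Cph=Cph and u=u and q=q and C=C and V=V and th=th and eta=eta and b=b, OF I Cph u q C V psd])
   also have "... <= (8 * (1 + ?k^3) * (1 + ?R eta)) * (D * t ^ ?D)"
    by (intro mult_mono U3 Del B0 mult_nonneg_nonneg add_nonneg_nonneg sum_nonneg) auto
   finally show ?thesis unfolding Del'_def by (simp only: mult_ac)
  qed
  have mom: "NN (?Y T b) (%x. ennreal (SUM i:I. (x i)^2)) <= ennreal C2"
  proof -
   have "NN (?Y T b) (%x. ennreal (SUM i:I. (x i)^2)) = NN M (%x. (SUM i:I. ennreal ((Tb q u (ph i) b x / ?P)^2)))"
    by (subst nn_integral_distr[OF Tm]) (auto simp: T_def)
   also have "... = (SUM i:I. ?S i b)" by (rule nn_integral_sum) auto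
   also have "... <= (SUM i:I. ?Q)"
   proof (rule sum_mono)
    fix i assume i: "i : I"
    have "?S i b <= ennreal (V i i + C)" by (rule Tb_second_moment[OF u q th V[OF i i]])
    also have "... <= ?Q" using Vii[OF i] by (intro ennreal_leI) simp
    finally show "?S i b <= ?Q" .
   qed
   also have "... = ennreal C2" 
   proof -
    have "(SUM i:I. ?Q) = ennreal (SUM i:I. Cph^2 * c0 + 2 * C)" using c0 C by (intro sum_ennreal add_nonneg_nonneg mult_nonneg_nonneg) auto
    then show ?thesis by (simp add: C2_def)
   qed
   finally show ?thesis .
  qed
  have cst: "8 * ?k * t^2 / (sqrt t)^2 + (2 * (1/t)) ^ card I * (?X Del')
     + 2 * (?G C2) / (1/t)^2 <= c * t"
  proof -
   have 1: "8 * ?k * t^2 / (sqrt t)^2 = 8 * ?k * t" using t by (simp add: power2_eq_square[of t])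
   have 3: "2 * (?G C2) / (1/t)^2 <= 2 * (C2 + ?k) * t"
   proof -
    have t2: "t^2 <= t" "t^2 <= 1" using t by (auto simp: power2_eq_square mult_le_one intro: mult_left_le)
    have "2 * (?G C2) / (1/t)^2 = 2 * ?G C2 * t^2" by (simp add: power_divide)
    also have "... <= 2 * (C2 + ?k * 1) * t" using t2 t C20 by (intro mult_mono add_left_mono mult_left_mono) auto
    finally show ?thesis by simp
   qed
   have 2: "(2 * (1/t)) ^ card I * ?X Del' <=
    2 ^ card I * (1 + 2 * ?k) * ?F * t"
   proof -
    have pi1: "1 <= sqrt (2 * pi)" using pi_gt3 by simp
    have "?E ^ card I <= (1/t) ^ card I" using pi1 t by (intro power_mono) (auto simp: field_simps)
    moreover have "1 + 2 * ?k / t^3 <= (1 + 2 * ?k) / t^3"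
    proof -
     have "t^3 <= 1" using t by (intro power_le_one) auto
     then have "1 <= 1 / t^3" using t by (simp add: field_simps)
     then show ?thesis by (simp add: add_divide_distrib)
    qed
    moreover have D0: "0 <= Del'" unfolding Del'_def using D t by simp
    ultimately have "(2 * (1/t)) ^ card I * ?X Del' <=
      (2 * (1/t)) ^ card I * ((1/t) ^ card I * (Del' * ((1 + 2 * ?k) / t^3)))"
     using t by (intro mult_left_mono mult_mono mult_nonneg_nonneg add_nonneg_nonneg) auto
    also have "... = 2 ^ card I * (1 + 2 * ?k) * ?F * t"
    proof -
     have "(1/t) ^ card I * ((1/t) ^ card I * (t ^ ?D / t^3)) = t"
     proof -
      have e: "2 * card I + 4 = card I + card I + 3 + 1" by simp
      have "t ^ ?D = t ^ card I * t ^ card I * t ^ 3 * t" unfolding e power_add power_one_right ..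
      moreover have "a ~= 0 ==> b ~= 0 ==> 1 / a * (1 / a * (a * a * b * t / b)) = t" for a b :: real by simp
      ultimately show ?thesis using t by (simp add: power_one_over)
     qed
     moreover have "(2^k * x) * (x * (a * (d * y) * (e / z))) = 2^k * e * (a * d) * (x * (x * (y / z)))" for x y z a d e :: real and k :: nat
      by simp
     ultimately show ?thesis unfolding Del'_def power_mult_distrib by (simp only:)
    qed
    finally show ?thesis .
   qed
   have "c * t = 8 * ?k * t + 2 ^ card I * (1 + 2 * ?k) * ?F * t + 2 * (C2 + ?k) * t" unfolding c_def C2_def by (simp only: distrib_right)
   also have "... >= 8 * ?k * t^2 / (sqrt t)^2 + (2 * (1/t)) ^ card I * ?X Del' + 2 * (?G C2) / (1/t)^2"
    unfolding 1 by (intro add_mono order_refl 2 3)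
   finally show ?thesis .
  qed
  show ?thesis
  proof (rule gaussian_smoothing_coupling[OF I t(1) prob_space_distr[OF Tm[of b]] _ Xi.prob_space_distr[OF Gm[of b]] _ cf mom C20])
   show "0 < 1 / t" "0 < sqrt t" using t by auto
   fix h
   assume h: "case_prod h : ?T"
    "!!x. x : space ?XI ==> NN (?Z G b) (%g. h x g) = 1" "!!g. g : space ?XI ==> NN (?Y T b) (%x. h x g) = 1"
    "NN (?Y T b) (%x. NN (?Z G b) (%g. h x g * indicator {(x, g). EX i:I. abs (x i - g i) > sqrt t} (x, g))) <= ennreal (real (8 * card I) * t^2 / (sqrt t)^2 + (2 * (1/t)) ^ card I * (?E ^ card I * (Del' * (1 + real (2 * card I) / t^3)))
     + 2 * (?G C2) / (1/t)^2)"
   show ?thesis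
    using h(1-3) order_trans[OF h(4)[unfolded of_nat_mult of_nat_numeral] ennreal_leI[OF cst]] unfolding Q_def by (intro exI[of _ h] conjI ballI)
  qed simp_all
 qed
 then obtain h where hQ: "!!b. b < m ==> Q b (h b)" by metis
 have h: "!!b. b < m ==> case_prod (h b) : ?T"
  "!!b x. b < m ==> x : space ?XI ==> NN (?Z G b) (%g. h b x g) = 1"
  "!!b g. b < m ==> g : space ?XI ==> NN (?Y T b) (%x. h b x g) = 1"
  "!!b. b < m ==> NN (?Y T b) (%x. NN (?Z G b) (%g. h b x g * indicator {(x, g). EX i:I. abs (x i - g i) > sqrt t} (x, g))) <= ennreal (c * t)"
  using hQ unfolding Q_def by blast+
 let ?H = "?XI \<Otimes>\<^sub>M ?XI"
 let ?A = "{z : space ?H. EX i:I. abs (fst z i - snd z i) > sqrt t}"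
 have bc: "block_coupling M Xi ?XI ?XI T G (%b. case_prod (h b)) m"
 proof (intro block_coupling.intro block_coupling_axioms.intro prob_space_axioms Xi.prob_space_axioms)
  show "indep_vars (%_. ?XI) T {..<m}" unfolding T_def by (rule indep_vars_subset[OF Tb_vec_indep[OF u]]) auto
  show "Xi.indep_vars (%_. ?XI) G {..<m}" unfolding G_def by (rule gbm_increments_indep[where I=I and A=A and V=V, OF I A mq n])
 qed (use h in auto)
 have fl: "NN (?Y T b) (%x. NN (?Z G b) (%g. case_prod (h b) (x, g) * indicator ?A (x, g))) <= ennreal (c * t)" if b: "b < m" for b
  by (rule order_trans[OF _ h(4)[OF b]]) (auto intro!: nn_integral_mono mult_left_mono split: split_indicator)
 interpret bc: block_coupling M Xi ?XI ?XI T G "%b. case_prod (h b)" m by (rule bc)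
 have Am: "?A : sets ?H"
 proof -
  have "?A = (UN i:I. {z : space ?H. abs (fst z i - snd z i) > sqrt t})" by auto
  also have "... : sets ?H"
  proof (intro sets.finite_UN I)
   fix i assume i: "i : I"
   have "(%z. fst z i) : borel_measurable ?H" "(%z. snd z i) : borel_measurable ?H"
    by (rule measurable_compose[OF measurable_fst measurable_component_singleton[OF i]])
      (rule measurable_compose[OF measurable_snd measurable_component_singleton[OF i]])
   then show "{z : space ?H. abs (fst z i - snd z i) > sqrt t} : sets ?H" by measurable
  qed
  finally show ?thesis .
 qed
 have c0': "0 <= c * t" using D t C c0 unfolding c_def by (intro mult_nonneg_nonneg add_nonneg_nonneg) auto
 have eq: "(T b e, G b x) : ?A \<longleftrightarrow> (EX i:I. sqrt t < abs (Tb q u (ph i) b e / sqrt (real q) - sqrt (real n / real q) * (gbm I A i (real (Suc b * q) / real n) x - gbm I A i (real (b * q) / real n) x)))" for b e x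
  by (auto simp: T_def G_def space_pair_measure space_PiM PiE_def)
 show ?thesis using bc.dens_meas bc.dens_left bc.dens_right bc.many_failures[OF Am c0' fl] unfolding eq
  by (intro exI[of _ bc.dens] conjI ballI allI)
qed

end

section \<open>Choice of the parameters and rates at level p\<close>

lemma level_parameters:
 assumes th: "0 < th" "th <= 1" and pm: "1 < pm" "pm <= 3/2" and c: "0 <= c1" "0 <= C"
 obtains ka kc r0 :: nat and kp :: real where "2 <= ka" "2 <= kc" "4 * real kc <= th * real ka" "0 < kp" "2 <= kp * real ka" "4 <= kp * real r0"
  "!!p. c1 * real (ulen kc p) ^ 6 * real (qlen ka p) powr (1 - pm) + C * real (ulen kc p) powr (- th) <= (c1 + 2 * C) * (2 powr (- kp * real p)) ^ (2 * K + 4)"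
proof -
 \<comment> \<open>So large that u^6 <= 2^((pm - 1) p / 4), half of the gain in the exponent of q^(1
   - pm) <= 2^(-(pm - 1) p / 2).\<close>
 obtain kc :: nat where kc: "max 2 (24 / (pm - 1)) <= real kc" using real_arch_simple by blast
 \<comment> \<open>The smaller of the gain left from q^(1 - pm) and the gain of u^(- th).\<close>
 define kp1 where "kp1 = min ((pm - 1) / 4) (th / real kc)"
 let ?Z = "real (2 * K + 4)"
 \<comment> \<open>The smoothing consumes the power 2 K + 4 of t = 2^(- kp p), so the available gain
   is divided by it.\<close>
 define kp where "kp = kp1 / ?Z"
 have kc2: "2 <= kc" "24 <= real kc * (pm - 1)" using kc pm by (auto simp: divide_le_eq)
 have kp1: "0 < kp1" unfolding kp1_def using th pm kc2 by simp
 have kp1le: "kp1 <= (pm - 1) / 4" "kp1 <= th / real kc" unfolding kp1_def by (rule min.cobounded1, rule min.cobounded2)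
 have kp: "0 < kp" unfolding kp_def using kp1 by simp
 \<comment> \<open>ka and r0 only have to be large and come last: the blocks must be long enough to
   dominate the sub-block losses and few enough for the bound 2^(kp p / 2) on their number.\<close>
 obtain ka :: nat where ka: "max 2 (max (4 * real kc / th) (2 / kp)) <= real ka" using real_arch_simple by blast
 obtain r0 :: nat where r0: "4 / kp <= real r0" using real_arch_simple by blast
 have ka2: "2 <= ka" "4 * real kc <= th * real ka" "2 <= kp * real ka" using ka th kp by (auto simp: divide_le_eq mult.commute)
 let ?X = "%kc p. real (ulen kc p)"
 let ?Y = "%p kc. real (p div kc)"
 let ?U = "%kp p. - kp * real p"
 let ?W = "%p ka. real (p - p div ka)"
 have bound: "c1 * ?X kc p ^ 6 * real (qlen ka p) powr (1 - pm) + C * ?X kc p powr (- th) <= (c1 + 2 * C) * (2 powr (?U kp p)) ^ (2 * K + 4)" for p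
 proof -
  have u: "?X kc p = 2 powr ?Y p kc" unfolding ulen_def by (simp add: powr_realpow)
  have q: "real (qlen ka p) = 2 powr ?W p ka" unfolding qlen_def by (simp add: powr_realpow del: of_nat_diff)
  have pk: "?Y p kc <= real p / real kc" "real p / real kc - 1 <= ?Y p kc" using powr_two_div[of kc p] kc2 by auto
  have pa: "real p / 2 <= ?W p ka"
  proof -
   have "p div ka <= p div 2" using ka2 by (intro div_le_mono2) auto
   then have "p <= 2 * (p - p div ka)" by linarith
   then have "real p <= real (2 * (p - p div ka))" by (simp only: of_nat_le_iff)
   then show ?thesis by simp
  qed
  have e: "(2 powr (?U kp p)) ^ (2 * K + 4) = 2 powr (?U kp1 p)"
  proof -
   have "(2 powr (?U kp p)) ^ (2 * K + 4) = 2 powr (- kp * real p * ?Z)"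
    by (simp only: powr_realpow[symmetric, of "2 powr _"] powr_gt_zero powr_powr)
   also have "- kp * real p * ?Z = - (kp * ?Z) * real p" by simp
   also have "kp * ?Z = kp1" unfolding kp_def by (simp del: of_nat_add of_nat_mult)
   finally show ?thesis .
  qed
  have "?X kc p ^ 6 * real (qlen ka p) powr (1 - pm) = 2 powr (6 * ?Y p kc + ?W p ka * (1 - pm))"
   unfolding u q by (simp add: powr_add powr_powr powr_power mult.commute del: of_nat_diff)
  also have "... <= 2 powr (?U kp1 p)"
  proof (rule powr_mono)
   have "?W p ka * (1 - pm) <= real p / 2 * (1 - pm)" using pa pm by (intro mult_right_mono_neg) auto
   moreover have "6 * ?Y p kc <= (pm - 1) / 4 * real p"
   proof -
    have "6 * ?Y p kc <= 6 * (real p / real kc)" using pk by simp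
    also have "... <= (pm - 1) / 4 * real p"
    proof -
     have "24 * real p <= real kc * (pm - 1) * real p" using kc2 by (intro mult_right_mono) auto
     then show ?thesis using kc2 by (simp add: field_simps)
    qed
    finally show ?thesis .
   qed
   moreover have "kp1 * real p <= (pm - 1) / 4 * real p" by (intro mult_right_mono kp1le) auto
   moreover have "real p / 2 * (1 - pm) = - (2 * ((pm - 1) / 4 * real p))" by (simp add: field_simps)
   ultimately show "6 * ?Y p kc + ?W p ka * (1 - pm) <= - kp1 * real p" unfolding mult_minus_left by linarith
  qed simp
  finally have 1: "?X kc p ^ 6 * real (qlen ka p) powr (1 - pm) <= 2 powr (?U kp1 p)" .
  have "?X kc p powr (- th) = 2 powr (- (th * ?Y p kc))" unfolding u by (simp add: powr_powr mult.commute)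
  also have "... <= 2 powr (1 + - kp1 * real p)"
  proof (rule powr_mono)
   have "th * (real p / real kc - 1) <= th * ?Y p kc" using pk th by (intro mult_left_mono) auto
   moreover have "kp1 * real p <= th / real kc * real p" by (intro mult_right_mono kp1le) auto
   ultimately show "- (th * ?Y p kc) <= 1 + - kp1 * real p" using th by (simp add: algebra_simps)
  qed simp
  also have "... = 2 * 2 powr (?U kp1 p)" by (simp only: powr_add powr_one_gt_zero_iff) simp
  finally have 2: "?X kc p powr (- th) <= 2 * 2 powr (?U kp1 p)" .
  have "c1 * (?X kc p ^ 6 * real (qlen ka p) powr (1 - pm)) + C * ?X kc p powr (- th) <= c1 * 2 powr (?U kp1 p) + C * (2 * 2 powr (?U kp1 p))"
   by (intro add_mono mult_left_mono 1 2 c)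
  then show ?thesis unfolding e by (simp add: algebra_simps)
 qed
 have "4 <= kp * real r0" using r0 kp by (simp add: divide_le_eq mult.commute)
 then show ?thesis using that[OF ka2(1) kc2(1) ka2(2) kp ka2(3) _ bound] by blast
qed

text \<open>Union bound over pairs of grid points at distance at most q. Each increment is Gaussian
  with variance at most CV q / n; Markov with the moment of order 2 k' leaves k' free to beat the
  number of pairs.\<close>

lemma gbm_modulus:
 assumes I: "finite I" and A: "!!i j. i : I ==> j : I ==> V i j = (SUM l:I. A i l * A j l)"
  and CV: "!!i. i : I ==> V i i <= CV" "0 <= CV" and n: "1 <= n" and ep: "0 < ep" and k0: "0 < k'"
 shows "emeasure Xi {xi : space Xi. EX i:I. EX j<=n. EX k<=n. j <= k & k <= j + q & ep < abs (gbm I A i (real k / real n) xi - gbm I A i (real j / real n) xi)}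
  <= ennreal (real (card I) * (real n + 1)^2 * (fact (2 * k') / (2 ^ k' * fact k') * (CV * real q / real n) ^ k' / ep ^ (2 * k')))"
proof -
 interpret Xi: prob_space Xi by (rule prob_space_Xi)
 let ?X = "%k. real k / real n"
 let ?Z = "%(i, j, k) xi. gbm I A i (?X k) xi - gbm I A i (?X j) xi"
 let ?S = "{(i, j, k). i : I & j <= n & k <= n & j <= k & k <= j + q}"
 let ?Y = "CV * real q / real n"
 let ?R = "2 ^ k' * fact k'"
 let ?b = "fact (2 * k') / ?R * ?Y ^ k' / ep ^ (2 * k')"
 have sub: "?S <= I \<times> {..n} \<times> {..n}" by auto
 have fS: "finite ?S" by (rule finite_subset[OF sub]) (use I in auto)
 have b0: "0 <= ?b" using CV ep by auto
 have Zm[measurable]: "?Z s : borel_measurable Xi" for s by (cases s) simp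
 let ?W = "emeasure Xi"
 let ?T = "%s. Xi.expectation (%xi. ?Z s xi ^ (2 * k'))"
 have one: "?W {xi : space Xi. ep < abs (?Z s xi)} <= ennreal ?b" if s: "s : ?S" for s
 proof -
  obtain i j k where s': "s = (i, j, k)" "i : I" "j <= n" "k <= n" "j <= k" "k <= j + q" using s by auto
  let ?tt = "%b. if b then real k / real n else real j / real n"
  let ?a = "%b. if b then 1 else - 1 :: real"
  let ?v = "V i i * (real (k - j) / real n)"
  have g: "real_gaussian Xi (%xi. SUM b:UNIV. ?a b * gbm I A i (?tt b) xi) 0 (SUM b:UNIV. SUM b':UNIV. ?a b * ?a b' * (V i i * min (?tt b) (?tt b')))"
   by (rule gbm_gaussian[where I=I and A=A and V=V and ii="%_. i", OF I A]) (use s' n in \<open>auto simp: divide_le_eq\<close>)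
  have jk: "real j / real n <= real k / real n" using s' by (simp add: divide_right_mono)
  have "(SUM b:UNIV. SUM b':UNIV. ?a b * ?a b' * (V i i * min (?tt b) (?tt b'))) = ?v"
   using jk s' by (simp add: UNIV_bool min_absorb1 min_absorb2 of_nat_diff diff_divide_distrib algebra_simps)
  moreover have "(%xi. SUM b:UNIV. ?a b * gbm I A i (?tt b) xi) = ?Z s" unfolding s'(1) by (auto simp: UNIV_bool)
  ultimately have g: "real_gaussian Xi (?Z s) 0 ?v" using g by simp
  note m = prob_space.real_gaussian_moment[OF prob_space_Xi g k0]
  have v0: "0 <= V i i" using A[OF s'(2) s'(2)] by (simp add: sum_nonneg)
  have "?v <= CV * (real q / real n)" using s' CV v0 by (intro mult_mono divide_right_mono CV) auto
  then have "?v ^ k' <= ?Y ^ k'" using v0 by (intro power_mono) auto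
  then have E: "?T s <= fact (2 * k') / ?R * ?Y ^ k'" unfolding m(2) by (intro mult_left_mono) auto
  have "?W {xi : space Xi. ep < abs (?Z s xi)} <= ?W {xi : space Xi. ep ^ (2 * k') <= ?Z s xi ^ (2 * k')}"
  proof (intro emeasure_mono subsetI)
   fix xi assume "xi : {xi : space Xi. ep < abs (?Z s xi)}"
   then have x: "xi : space Xi" "ep <= abs (?Z s xi)" by auto
   from x(2) have "ep ^ (2 * k') <= abs (?Z s xi) ^ (2 * k')" using ep by (intro power_mono) auto
   also have "... = ?Z s xi ^ (2 * k')" by (rule power_even_abs) simp
   finally show "xi : {xi : space Xi. ep ^ (2 * k') <= ?Z s xi ^ (2 * k')}" using x by simp
  qed measurable
  also have "... <= ennreal (1 / ep ^ (2 * k') * ?T s)" using integral_Markov_inequality[OF m(1), of "ep ^ (2 * k')"] ep by simp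
  also have "... <= ennreal (1 / ep ^ (2 * k') * (fact (2 * k') / ?R * ?Y ^ k'))" using ep by (intro ennreal_leI mult_left_mono E) auto
  finally show ?thesis by (simp add: mult_ac)
 qed
 have Zs: "{xi : space Xi. ep < abs (?Z s xi)} : sets Xi" for s by measurable
 let ?U = "UN s:?S. {xi : space Xi. ep < abs (?Z s xi)}"
 have "?W {xi : space Xi. EX i:I. EX j<=n. EX k<=n. j <= k & k <= j + q & ep < abs (gbm I A i (?X k) xi - gbm I A i (?X j) xi)}
  <= emeasure Xi ?U"
 proof (intro emeasure_mono sets.finite_UN fS Zs subsetI)
  fix xi assume "xi : {xi : space Xi. EX i:I. EX j<=n. EX k<=n. j <= k & k <= j + q & ep < abs (gbm I A i (?X k) xi - gbm I A i (?X j) xi)}"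
  then obtain i j k where "xi : space Xi" "(i, j, k) : ?S" "ep < abs (gbm I A i (?X k) xi - gbm I A i (?X j) xi)" by blast
  then show "xi : ?U" by (intro UN_I[of "(i, j, k)"]) simp_all
 qed
 also have "... <= (SUM s:?S. ?W {xi : space Xi. ep < abs (?Z s xi)})" by (intro emeasure_subadditive_finite fS image_subsetI Zs)
 also have "... <= (SUM s:?S. ennreal ?b)" by (rule sum_mono[OF one])
 also have "... = ennreal (real (card ?S) * ?b)" 
  by (simp only: sum_constant ennreal_of_nat_eq_real_of_nat ennreal_mult[OF of_nat_0_le_iff b0])
 also have "... <= ennreal (real (card I) * (real n + 1)^2 * ?b)"
 proof (intro ennreal_leI mult_right_mono b0)
  have "card ?S <= card (I \<times> {..n} \<times> {..n})" by (rule card_mono[OF _ sub]) (use I in simp)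
  also have "... = card I * (n + 1)^2" by (simp only: card_cartesian_product power2_eq_square card_atMost Suc_eq_plus1)
  finally have "real (card ?S) <= real (card I * (n + 1)^2)" by (simp only: of_nat_le_iff)
  then show "real (card ?S) <= real (card I) * (real n + 1)^2" by (simp add: add.commute)
 qed
 finally show ?thesis .
qed

lemma gbm_0: "gbm I A i 0 xi = 0" unfolding gbm_def wiener_def schauder_def tent_def by simp

text \<open>Expansion in unit vectors: every norm lies below a weighted l1-norm, so closeness of
  single coordinates suffices.\<close>

lemma norm_on_le:
 assumes N: "is_norm_on I N" and J: "finite J" "J <= I"
 shows "N (%i. if i : J then x i else 0) <= (SUM i:J. abs (x i) * N (%k. if k = i then 1 else 0))"
 using J
proof (induction J rule: finite_induct)
 note nm = N[unfolded is_norm_on_def, THEN spec, THEN spec, THEN spec, THEN mp, THEN mp]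
 case empty
 have "N (%i. 0) = 0" using nm[of "%_. 0" "%_. 0"] by simp
 then show ?case by simp
next
 case (insert j J)
 note nm = N[unfolded is_norm_on_def, THEN spec, THEN spec, THEN spec, THEN mp, THEN mp]
 let ?e = "%k. if k = j then 1 else 0 :: real"
 have e: "N (%k. x j * ?e k) = abs (x j) * N ?e" using nm[of ?e ?e "x j"] insert by auto
 have "(%i. if i : insert j J then x i else 0) = (%i. x j * ?e i + (if i : J then x i else 0))" using insert by auto
 moreover have "N (%i. x j * ?e i + (if i : J then x i else 0)) <= N (%k. x j * ?e k) + N (%i. if i : J then x i else 0)"
 proof -
  have 1: "ALL i. i ~: I --> x j * ?e i = 0" and 2: "ALL i. i ~: I --> (if i : J then x i else 0) = 0" using insert by auto
  show ?thesis using nm[OF 1 2, of 0] by blast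
 qed
 ultimately show ?case using insert e by simp
qed

text \<open>Bookkeeping at a fixed outcome. Two errors e come from replacing X by block sums and
  from the oscillation of \<open>Bt\<close> after the last completed block. Each of fewer than r0
  failed blocks costs 2 e, once for the block sum and once for the Brownian increment; every other
  block costs its coupling error.\<close>

lemma block_sum_close:
 fixes T :: "nat => real" and Bt :: "nat => real"
 assumes n: "1 <= n" and q: "1 <= q" and k: "k <= n" and m: "m = n div q" and e: "0 <= e" and s: "0 <= s"
  and X: "abs (X - (\<Sum>j<k div q. T j)) <= e * sqrt (real n)" and T: "!!j. j < m ==> abs (T j) <= e * sqrt (real n)"
  and B0: "Bt 0 = 0" and B: "!!j k. j <= k ==> k <= n ==> k <= j + q ==> abs (Bt k - Bt j) <= e" and fails: "card {j. j < m & P j} < r0"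
  and good: "!!j. j < m ==> ~ P j ==> abs (T j / sqrt (real q) - sqrt (real n / real q) * (Bt (Suc j * q) - Bt (j * q))) <= s"
 shows "abs (X / sqrt (real n) - Bt k) <= (2 + 2 * real r0) * e + real m * (sqrt (real q / real n) * s)"
proof -
 let ?k = "k div q"
 let ?Y = "sqrt (real n)"
 have sn: "0 < ?Y" "0 < sqrt (real q)" using n q by auto
 have km: "?k <= m" unfolding m using k by (rule div_le_mono)
 have mq: "m * q <= n" unfolding m by simp
 have kq: "?k * q <= k" "k <= ?k * q + q" using dividend_less_div_times[of q k] q by (auto simp: less_imp_le add.commute)
 let ?Z = "%j. Bt (Suc j * q) - Bt (j * q)"
 define d where "d = (%j. T j / ?Y - ?Z j)"
 have Bd: "abs (?Z j) <= e" if "j < m" for j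
 proof -
  have "Suc j * q <= m * q" using that by (intro mult_right_mono) auto
  then show ?thesis using mq by (intro B) auto
 qed
 have dbad: "abs (d j) <= 2 * e" if "j < m" for j
 proof -
  have "abs (T j / ?Y) <= e" using T[OF that] sn by (simp add: abs_divide divide_le_eq)
  then show ?thesis unfolding d_def using Bd[OF that] by linarith
 qed
 let ?X = "sqrt (real q / real n)"
 have dgood: "abs (d j) <= ?X * s" if "j < m" "~ P j" for j
 proof -
  have "d j = ?X * (T j / sqrt (real q) - sqrt (real n / real q) * ?Z j)"
   unfolding d_def real_sqrt_divide using sn by (simp add: right_diff_distrib)
  then show ?thesis using good[OF that] by (simp add: abs_mult mult_left_mono)
 qed
 have "abs (d j) <= ?X * s + (if P j then 2 * e else 0)" if "j < m" for j
  using dbad[OF that] dgood[OF that] s by (cases "P j") (auto intro: add_increasing)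
 then have "(\<Sum>j<m. abs (d j)) <= (\<Sum>j<m. ?X * s + (if P j then 2 * e else 0))" by (intro sum_mono) auto
 also have "... = real m * (?X * s) + real (card {j. j < m & P j}) * (2 * e)" by (simp add: sum.distrib sum.inter_filter[symmetric])
 also have "real (card {j. j < m & P j}) * (2 * e) <= real r0 * (2 * e)" using fails e by (intro mult_right_mono) auto
 finally have S: "(\<Sum>j<m. abs (d j)) <= real m * (?X * s) + real r0 * (2 * e)" by simp
 have tel: "(\<Sum>j<l. Bt (Suc j * q) - Bt (j * q)) = Bt (l * q)" for l by (induction l) (auto simp: B0)
 have "abs (\<Sum>j<?k. d j) <= (\<Sum>j<m. abs (d j))" using km by (intro order_trans[OF sum_abs] sum_mono2) auto
 moreover have "(\<Sum>j<?k. d j) = (\<Sum>j<?k. T j) / ?Y - Bt (?k * q)"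
 proof -
  have "(\<Sum>j<?k. d j) = (\<Sum>j<?k. T j / ?Y) - (\<Sum>j<?k. Bt (Suc j * q) - Bt (j * q))" unfolding d_def by (rule sum_subtractf)
  then show ?thesis unfolding tel sum_divide_distrib .
 qed
 moreover have "abs (X / ?Y - (\<Sum>j<?k. T j) / ?Y) <= e" using X sn by (simp add: diff_divide_distrib[symmetric] abs_divide divide_le_eq)
 moreover have "abs (Bt k - Bt (?k * q)) <= e" using kq k by (intro B) auto
 ultimately have "abs (X / ?Y - Bt k) <= 2 * e + (real m * (?X * s) + real r0 * (2 * e))" using S by linarith
 then show ?thesis by (simp add: algebra_simps)
qed

text \<open>By kp * ka >= 2 there are at most 4 * 2^(kp p / 2) blocks. A coupling error sqrt t per
  block, weighted by sqrt (q / n), therefore adds up to O(2^(- kp p / 4)).\<close>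

lemma level_rates:
 assumes ka: "2 <= ka" "0 < kp" "2 <= kp * real ka" and n: "1 <= n" and p: "p = floor_log n" and q: "q = qlen ka p"
 shows "real (n div q) <= 4 * 2 powr (kp * real p / 2)"
  "real (n div q) * sqrt (real q / real n) * sqrt (2 powr (- kp * real p)) <= 2 * (2 powr (- kp / 4)) ^ p"
  "real q / real n <= 2 * 2 powr (- real p / real ka)" "inverse (4 ^ p) <= 4 * inverse (real n ^ 2)" "real n <= 2 * 2 ^ p"
proof -
 have n1: "2^p <= n" "n < 2 * 2^p" unfolding p using floor_log_exp2_le[of n] floor_log_exp2_gt[of n] n by auto
 have "real (2^p) <= real n" "real n <= real (2 * 2^p)" using n1 by (simp_all only: of_nat_le_iff less_imp_le)
 then have n2: "2 ^ p <= real n" "real n <= 2 * 2^p" by simp_all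
 let ?Y = "real (p div ka)"
 have pa: "?Y <= real p / real ka" "real p / real ka - 1 <= ?Y" using powr_two_div[of ka p] ka by auto
 have q0: "0 < q" "0 < real q" unfolding q qlen_def by auto
 have qe: "real q * 2 powr (?Y) = 2^p"
 proof -
  have "real q * 2 powr (?Y) = 2 ^ (p - p div ka) * 2 ^ (p div ka)" unfolding q qlen_def by (simp add: powr_realpow)
  also have "... = 2 ^ p" by (simp add: power_add[symmetric])
  finally show ?thesis .
 qed
 have kpp: "real p / real ka <= kp * real p / 2"
 proof -
  have "2 * real p <= kp * real ka * real p" using ka by (intro mult_right_mono) auto
  then show ?thesis using ka by (simp add: field_simps)
 qed
 let ?X = "kp * real p / 2"
 have nq: "real n / real q <= 2 * 2 powr ?X"
 proof -
  have "real n / real q <= 2 * 2 ^ p / real q" using n2 q0 by (intro divide_right_mono) auto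
  also have "... = 2 * 2 powr (?Y)" unfolding qe[symmetric] using q0 by simp
  also have "... <= 2 * 2 powr ?X" by (intro mult_left_mono powr_mono order_trans[OF pa(1) kpp]) auto
  finally show ?thesis .
 qed
 let ?U = "real (n div q)"
 have m: "?U <= real n / real q" by (rule of_nat_div_le_of_nat)
 show "?U <= 4 * 2 powr ?X"
 proof -
  have "2 * 2 powr ?X <= 4 * 2 powr ?X" by simp
  then show ?thesis using m nq by linarith
 qed
 let ?Z = "sqrt (real q / real n)"
 let ?W = "- kp * real p / 2"
 let ?S = "kp * real p / 4"
 show "?U * ?Z * sqrt (2 powr (- kp * real p)) <= 2 * (2 powr (- kp / 4)) ^ p"
 proof -
  have "?U * ?Z <= real n / real q * ?Z" using m by (intro mult_right_mono) auto
  also have "... = sqrt (real n / real q)" using q0 n by (simp add: real_sqrt_divide real_div_sqrt field_simps)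
  also have "... <= sqrt (4 * 2 powr ?X)"
  proof (rule real_sqrt_le_mono)
   have "2 * 2 powr ?X <= 4 * 2 powr ?X" by simp
   then show "real n / real q <= 4 * 2 powr ?X" using nq by linarith
  qed
  also have "... = 2 * 2 powr ?S" by (simp add: real_sqrt_mult powr_half_sqrt[symmetric] powr_powr)
  finally have "?U * ?Z * 2 powr ?W <= 2 * 2 powr ?S * 2 powr ?W" by (intro mult_right_mono) auto
  also have "2 * 2 powr ?S * 2 powr ?W = 2 * 2 powr (- kp / 4 * real p)" by (simp add: powr_add[symmetric])
  also have "2 powr (- kp / 4 * real p) = (2 powr (- kp / 4)) ^ p" by (simp add: powr_realpow[symmetric] powr_powr)
  finally show ?thesis by (simp add: powr_half_sqrt[symmetric] powr_powr)
 qed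
 show "real q / real n <= 2 * 2 powr (- real p / real ka)"
 proof -
  have "real q / real n <= real q / 2 ^ p" by (rule divide_left_mono) (use n2 q0 n in simp_all)
  also have "... = 2 powr (- ?Y)" unfolding qe[symmetric] using q0 by (simp add: powr_minus divide_inverse)
  also have "... <= 2 powr (1 + - real p / real ka)" using pa by (intro powr_mono) auto
  also have "... = 2 * 2 powr (- real p / real ka)" by (simp only: powr_add) simp
  finally show ?thesis .
 qed
 show "inverse (4 ^ p) <= 4 * inverse (real n ^ 2)"
 proof -
  have "real n ^ 2 <= (2 * 2 ^ p)^2" using n2 by (intro power_mono) auto
  also have "... = 4 * 4 ^ p" by (simp add: power_mult_distrib power2_eq_square flip: power_mult_distrib)
  finally have "inverse (4 * 4 ^ p) <= inverse (real n ^ 2)" using n by (intro le_imp_inverse_le) auto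
  then show ?thesis by simp
 qed
 show "real n <= 2 * 2 ^ p" by (rule n2)
qed

text \<open>The construction starts from the law of the innovations on \<open>int => real\<close>
  with the coordinates as innovations: a law can be extended by further variables, whereas the given
  space may be too small for them.\<close>

lemma innov_coordinates:
 assumes M: "prob_space M" and eps_meas: "!!k. eps k : borel_measurable M"
  and ind: "prob_space.indep_vars M (%_. borel) eps UNIV" and mean: "!!k. integral\<^sup>L M (eps k) = 0"
  and pm: "1 < pm" "pm <= 3/2" and B: "B >= 1" and mom: "!!k. NN M (%x. ennreal (abs (eps k x) powr (4 * pm))) <= ennreal B"
 defines "L == distr M (PiM UNIV (%_. borel)) (%x k. eps k x)"
 shows "innov L (%k y. y k) pm B"
proof -
 interpret M: prob_space M by fact
 have m: "(%x k. eps k x) : measurable M (PiM UNIV (%_::int. borel))" by (rule measurable_PiM_single') (auto simp: eps_meas)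
 interpret L: prob_space L unfolding L_def by (rule M.prob_space_distr[OF m])
 have cm: "(%y. y k) : borel_measurable L" for k :: int unfolding L_def by simp
 have d: "distr L borel (%y. y k) = distr M borel (eps k)" for k unfolding L_def by (subst distr_distr[OF _ m]) (auto simp: comp_def)
 show ?thesis
 proof (intro innov.intro innov_axioms.intro L.prob_space_axioms pm B)
  have "distr L (PiM UNIV (%_. borel)) (%y. \<lambda>i\<in>UNIV. y i) = L" unfolding restrict_UNIV by (rule distr_id2) (simp add: L_def)
  also have "... = PiM UNIV (%i. distr M borel (eps i))"
   using M.indep_vars_iff_distr_eq_PiM'[of UNIV eps "%_. borel"] ind eps_meas unfolding L_def restrict_UNIV by simp
  finally show "L.indep_vars (%_. borel) (%k y. y k) UNIV" using L.indep_vars_iff_distr_eq_PiM'[of UNIV "%k y. y k" "%_. borel"] cm d by simp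
  fix k
  show "L.expectation (%y. y k) = 0" using integral_distr[OF m, of "%y. y k"] mean[of k] unfolding L_def by simp
  show "NN L (%y. ennreal (abs (y k) powr (4 * pm))) <= ennreal B" unfolding L_def by (subst nn_integral_distr[OF m]) (use mom in auto)
 qed
qed

lemma covsum_distr:
 assumes eps_meas: "!!k. eps k : borel_measurable M"
 shows "covsum (distr M (PiM UNIV (%_. borel)) (%x k. eps k x)) (%k y. y k) c d n v w v' w' n' m' = covsum M eps c d n v w v' w' n' m'"
proof -
 have m: "(%x k. eps k x) : measurable M (PiM UNIV (%_::int. borel))" by (rule measurable_PiM_single') (auto simp: eps_meas)
 let ?X = "distr M (PiM UNIV (%_. borel)) (%x k. eps k x)"
 have "sigma2 ?X (%k y. y k) = sigma2 M eps"
  "gamma4 ?X (%k y. y k) = gamma4 M eps" unfolding sigma2_def gamma4_def by (auto intro!: integral_distr[OF m])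
 then show ?thesis unfolding covsum_def by simp
qed

text \<open>The underlying space enters \<open>Dn\<close> only through expectations, and these agree
  because \<open>E\<close> has law L.\<close>

lemma Dn_distr:
 assumes E: "E : measurable M' (PiM UNIV (%_. borel))" and d: "distr M' (PiM UNIV (%_. borel)) E = L"
 shows "Dn M' (%k x. E x k) c d n t v w x = Dn L (%k y. y k) c d n t v w (E x)"
proof -
 have S: "SigmaHat (%k x. E x k) c n k nu mu = (%x. SigmaHat (%k y. y k) c n k nu mu (E x))" for k nu mu unfolding SigmaHat_def Yn_def ..
 have Sm: "SigmaHat (%k y. y k) c n k nu mu : borel_measurable (PiM UNIV (%_. borel))" for k nu mu
  unfolding SigmaHat_def Yn_def by measurable
 have "integral\<^sup>L M' (SigmaHat (%k x. E x k) c n k nu mu) = integral\<^sup>L L (SigmaHat (%k y. y k) c n k nu mu)" for k nu mu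
  unfolding S d[symmetric] by (rule integral_distr[OF E Sm, symmetric])
 then show ?thesis unfolding Dn_def S by simp
qed

lemma (in prob_space) moment_bound_weaken:
 assumes [measurable]: "X : borel_measurable M" and i: "integrable M (%x. abs (X x) powr b)" "expectation (%x. abs (X x) powr b) <= B" and a: "0 <= a" "a <= b"
 shows "NN M (%x. ennreal (abs (X x) powr a)) <= ennreal (1 + abs B)"
proof -
 let ?X = "expectation (%x. 1 + abs (X x) powr b)"
 have "abs y powr a <= 1 + abs y powr b" for y :: real
 proof (cases "abs y <= 1")
  case True
  have "abs y powr a <= 1 powr a" using True a by (intro powr_mono2) auto
  then show ?thesis by (simp add: add_increasing2)
 next
  case False
  then have "abs y powr a <= abs y powr b" using a by (intro powr_mono) auto
  then show ?thesis by simp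
 qed
 then have "NN M (%x. ennreal (abs (X x) powr a)) <= NN M (%x. ennreal (1 + abs (X x) powr b))" by (intro nn_integral_mono ennreal_leI)
 also have "... = ennreal (?X)" by (rule nn_integral_eq_integral) (use i in \<open>auto intro!: add_nonneg_nonneg\<close>)
 also have "?X = 1 + expectation (%x. abs (X x) powr b)" using i(1) by (simp add: prob_space)
 finally show ?thesis using i(2) by (elim order_trans) (auto intro!: ennreal_leI)
qed

lemma (in prob_space) AE_eventually_not:
 assumes A: "!!n. A n : events" and b: "!!n. 1 <= n ==> emeasure M (A n) <= ennreal (C * inverse (real n ^ 2))" and C: "0 <= C"
 shows "AE x in M. \<forall>\<^sub>F n in sequentially. x ~: A n"
proof -
 have s: "summable (%n. C * inverse (real n ^ 2))" by (intro summable_mult inverse_power_summable) auto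
 have "summable (%n. prob (A n))"
  by (rule summable_comparison_test'[OF s, where N=1]) (use b C in \<open>simp add: emeasure_eq_measure\<close>)
 then have "AE x in M. \<forall>\<^sub>F n in sequentially. x : space M - A n"
  using A by (intro borel_cantelli_AE1) (auto simp: emeasure_eq_measure)
 then show ?thesis by eventually_elim (auto elim: eventually_mono)
qed

text \<open>At most 4 * 2^(kp p / 2) blocks, each failing with probability at most c 2^(- kp p): r0
  failures cost a constant times 2^(- kp p r0 / 2) <= 2^(-2 p).\<close>

lemma failure_rate:
 assumes ka: "2 <= ka" "0 < kp" "2 <= kp * real ka" "4 <= kp * real r0" and c: "0 <= c" and n: "1 <= n" and p: "p = floor_log n" and q: "q = qlen ka p"
 shows "(real (n div q) * (c * 2 powr (- kp * real p))) ^ r0 <= 4 * (4 * c) ^ r0 * inverse (real n ^ 2)"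
proof -
 let ?X = "- kp * real p / 2 * real r0"
 let ?Y = "c * 2 powr (- kp * real p)"
 let ?Z = "inverse (real n ^ 2)"
 have "real (n div q) * ?Y <= 4 * 2 powr (kp * real p / 2) * ?Y" using level_rates(1)[OF ka(1-3) n p q] c by (intro mult_right_mono) auto
 also have "... = 4 * c * 2 powr (- kp * real p / 2)" by (simp add: powr_add[symmetric])
 finally have "(real (n div q) * ?Y) ^ r0 <= (4 * c * 2 powr (- kp * real p / 2)) ^ r0" using c by (intro power_mono) auto
 also have "... = (4 * c) ^ r0 * 2 powr ?X" by (simp add: power_mult_distrib powr_realpow[symmetric] powr_powr)
 also have "... <= (4 * c) ^ r0 * (4 * ?Z)"
 proof (rule mult_left_mono)
  have "4 * real p <= kp * real r0 * real p" using ka(4) by (rule mult_right_mono) simp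
  then have "2 powr ?X <= 2 powr (- 2 * real p)" by (intro powr_mono) (auto simp: mult_ac)
  also have "... = inverse (4 ^ p)" by (simp add: powr_minus powr_powr[symmetric] powr_realpow)
  also have "... <= 4 * ?Z" by (rule level_rates(4)[OF ka(1-3) n p q])
  finally show "2 powr ?X <= 4 * ?Z" .
 qed (use c in simp)
 finally show ?thesis by (simp add: mult_ac)
qed

text \<open>q / n is O(2^(- p / ka)), so its power 4 ka is O(n^-4); this pays for (n + 1)^2 pairs
  and leaves n^-2.\<close>

lemma modulus_rate:
 assumes ka: "2 <= ka" "0 < kp" "2 <= kp * real ka" and n: "1 <= n" and p: "p = floor_log n" and q: "q = qlen ka p"
 shows "(real n + 1)^2 * (real q / real n) ^ (4 * ka) <= 64 * 2 ^ (4 * ka) * inverse (real n ^ 2)"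
proof -
 let ?y = "inverse (real n ^ 2)"
 let ?X = "real q / real n"
 have "?X ^ (4 * ka) <= (2 * 2 powr (- real p / real ka)) ^ (4 * ka)" by (intro power_mono level_rates(3)[OF ka n p q]) auto
 also have "... = 2 ^ (4 * ka) * 2 powr (- 4 * real p)"
  using ka(1) by (simp add: power_mult_distrib powr_realpow[symmetric] powr_powr mult.commute)
 also have "2 powr (- 4 * real p) = inverse (4 ^ p) ^ 2"
 proof -
  have "2 powr (- 4 * real p) = inverse (2 powr real (4 * p))" by (simp add: powr_minus)
  also have "2 powr real (4 * p) = 2 ^ (4 * p)" by (rule powr_realpow) simp
  also have "... = ((4::real) ^ p)^2" by (simp add: power_mult power2_eq_square flip: power_mult_distrib)
  finally show ?thesis by (simp add: power_inverse)
 qed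
 also have "... <= (4 * ?y)^2" by (intro power_mono level_rates(4)[OF ka n p q]) auto
 finally have 1: "?X ^ (4 * ka) <= 2 ^ (4 * ka) * (4 * ?y)^2" by simp
 have "(real n + 1)^2 <= (2 * real n)^2" using n by (intro power_mono) auto
 then have "(real n + 1)^2 * ?X ^ (4 * ka) <= (2 * real n)^2 * (2 ^ (4 * ka) * (4 * ?y)^2)" using 1 by (intro mult_mono) auto
 also have "... = 64 * 2 ^ (4 * ka) * ((real n ^ 2 * ?y) * ?y)" by (simp add: power_mult_distrib power2_eq_square mult_ac)
 also have "real n ^ 2 * ?y = 1" using n by simp
 finally show ?thesis by simp
qed

section \<open>Assembly of the simultaneous approximation\<close>

theorem theorem2:
  fixes M :: "'a measure"
    and eps :: "int \<Rightarrow> 'a \<Rightarrow> real"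
    and c :: "nat \<Rightarrow> nat \<Rightarrow> nat \<Rightarrow> real"
    and d :: "nat \<Rightarrow> nat"
    and K0 :: nat
    and v w :: "nat \<Rightarrow> nat \<Rightarrow> nat \<Rightarrow> real"
    and alpha2 :: "nat \<Rightarrow> (nat \<Rightarrow> real) \<Rightarrow> (nat \<Rightarrow> real) \<Rightarrow> real"
    and beta :: "nat \<Rightarrow> (nat \<Rightarrow> real) \<Rightarrow> (nat \<Rightarrow> real) \<Rightarrow> (nat \<Rightarrow> real) \<Rightarrow> (nat \<Rightarrow> real) \<Rightarrow> real"
    and \<theta> :: real
  assumes M: "prob_space M"
    and eps_meas: "\<And>k. eps k \<in> borel_measurable M"
    and eps_indep: "prob_space.indep_vars M (\<lambda>_. borel) eps UNIV"
    and eps_mean: "\<And>k. integral\<^sup>L M (eps k) = 0"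
    and eps_mom: "\<exists>\<delta>>0. \<exists>B. \<forall>k. integrable M (\<lambda>x. \<bar>eps k x\<bar> powr (4 + \<delta>))
                              \<and> integral\<^sup>L M (\<lambda>x. \<bar>eps k x\<bar> powr (4 + \<delta>)) \<le> B"
    and theta: "0 < \<theta>" "\<theta> < 1/2"
    and coef: "\<exists>K. \<forall>n j \<nu>. \<nu> \<in> {1..d n} \<longrightarrow>
                 (c n j \<nu>)^2 \<le> K * (real (max j 1)) powr (-3/2 - \<theta>)"
    and l1: "\<exists>L. \<forall>n. \<forall>j\<in>{1..K0}. (\<Sum>\<nu>\<in>{1..d n}. \<bar>v n j \<nu>\<bar>) \<le> L \<and> (\<Sum>\<nu>\<in>{1..d n}. \<bar>w n j \<nu>\<bar>) \<le> L"
    and alpha_nonneg: "\<And>n j. j \<in> {1..K0} \<Longrightarrow> alpha2 n (v n j) (w n j) \<ge> 0"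
    and alpha_def: "\<exists>C. \<forall>n. \<forall>j\<in>{1..K0}. \<forall>n' m'.
           \<bar>covsum M eps c d n (v n j) (w n j) (v n j) (w n j) n' m'
             - real n' * alpha2 n (v n j) (w n j)\<bar> \<le> C * real n' powr (1 - \<theta>)"
    and beta_def: "\<exists>C. \<forall>n. \<forall>i\<in>{1..K0}. \<forall>j\<in>{1..K0}. i \<noteq> j \<longrightarrow> (\<forall>n' m'.
           \<bar>covsum M eps c d n (v n i) (w n i) (v n j) (w n j) n' m'
             - real n' * beta n (v n i) (w n i) (v n j) (w n j)\<bar> \<le> C * real n' powr (1 - \<theta>))"
  shows "\<exists>(M' :: (nat \<Rightarrow> real) measure) (eps' :: int \<Rightarrow> (nat \<Rightarrow> real) \<Rightarrow> real)
            (B :: nat \<Rightarrow> nat \<Rightarrow> real \<Rightarrow> (nat \<Rightarrow> real) \<Rightarrow> real).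
           prob_space M' \<and>
           (\<forall>k. eps' k \<in> borel_measurable M') \<and>
           distr M' (PiM UNIV (\<lambda>_. borel)) (\<lambda>x k. eps' k x)
             = distr M (PiM UNIV (\<lambda>_. borel)) (\<lambda>x k. eps k x) \<and>
           (\<forall>n. is_BM M' {1..K0}
                  (\<lambda>i j. if i = j then alpha2 n (v n i) (w n i)
                         else beta n (v n i) (w n i) (v n j) (w n j))
                  (B n)) \<and>
           (\<forall>N. is_norm_on {1..K0} N \<longrightarrow>
              (AE x in M'. \<forall>e>0. \<forall>\<^sub>F n in sequentially. \<forall>t\<in>{0..1}.
                 N (\<lambda>i. if i \<in> {1..K0}
                         then Dn M' eps' c d n t (v n i) (w n i) x
                              - B n i (real (nat \<lfloor>real n * t\<rfloor>) / real n) x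
                         else 0) < e))"
proof -
 let ?I = "{1..K0}"
 interpret M: prob_space M by fact
 interpret Xi: prob_space Xi by (rule prob_space_Xi)
 obtain \<delta> B0 where \<delta>: "\<delta> > 0" and B0: "!!k. integrable M (%x. abs (eps k x) powr (4 + \<delta>))" "!!k. M.expectation (%x. abs (eps k x) powr (4 + \<delta>)) <= B0"
  using eps_mom by blast
 \<comment> \<open>A moment of order 4 + \<delta> allows every pm up to 1 + \<delta>/4; the cap 3/2
   keeps 2 pm within the range of the Taylor estimate.\<close>
 define pm where "pm = min (3/2) (1 + \<delta>/4)"
 have pm12: "1 < pm" "pm <= 3/2" "pm <= 1 + \<delta>/4"
  using \<delta> min.cobounded1[of "3/2" "1 + \<delta>/4"] min.cobounded2[of "3/2" "1 + \<delta>/4"] unfolding pm_def by (simp_all only: min_less_iff_conj) simp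
 have "4 * pm <= 4 * (1 + \<delta>/4)" by (rule mult_left_mono[OF pm12(3)]) simp
 then have pm: "1 < pm" "pm <= 3/2" "4 * pm <= 4 + \<delta>" using pm12 by (simp_all add: distrib_left)
 define Bm where "Bm = 1 + abs B0"
 have mom: "NN M (%x. ennreal (abs (eps k x) powr (4 * pm))) <= ennreal Bm" for k
  unfolding Bm_def by (rule M.moment_bound_weaken[OF eps_meas B0(1) B0(2) _ pm(3)]) (use pm(1) in simp)
 let ?Z = "PiM UNIV (%_. borel)"
 define L where "L = distr M ?Z (%x k. eps k x)"
 have iL: "innov L (%k y. y k) pm Bm"
  unfolding L_def by (rule innov_coordinates[OF M eps_meas eps_indep eps_mean pm(1,2) _ mom]) (simp add: Bm_def)
 interpret A: innov L "%k y. y k" pm Bm by (rule iL)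
 have sL: "sets L = sets ?Z" unfolding L_def by simp
 let ?E = "%j. real (max j 1)"
 obtain K' where K': "!!n j nu. nu : {1..d n} ==> (c n j nu)^2 <= K' * (?E j) powr (-3/2 - \<theta>)" using coef by blast
 \<comment> \<open>If there are no components at all, the constant of the hypothesis may be
   negative; a square root of it is taken below.\<close>
 define K where "K = abs K'"
 have K: "0 <= K" unfolding K_def by simp
 have cK: "(c n j nu)^2 <= K * (?E j) powr (-3/2 - \<theta>)" if "nu : {1..d n}" for n j nu
  by (rule order_trans[OF K'[OF that]]) (auto simp: K_def intro!: mult_right_mono)
 obtain Lv where Lv: "!!n j. j : ?I ==> (SUM nu:{1..d n}. abs (v n j nu)) <= Lv" "!!n j. j : ?I ==> (SUM nu:{1..d n}. abs (w n j nu)) <= Lv"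
  using l1 by blast
 define A0 where "A0 = Lv * sqrt K"
 define a where "a = (%i n. comb c d n (v n i))"
 define b where "b = (%i n. comb c d n (w n i))"
 define ph where "ph = (%n i. Ft (a i n) (b i n))"
 have ab: "adm \<theta> A0 (a i n)" "adm \<theta> A0 (b i n)" if "i : ?I" for i n
  unfolding A0_def a_def b_def by (intro adm_comb theta cK Lv that K; assumption)+
 define Cph where "Cph = 2 * A0^2 * zsum (\<theta>/2)"
 have Cph0: "0 <= Cph" unfolding Cph_def using zsum_ge_1[of "\<theta>/2"] theta by simp
 let ?F = "%l. lam (2 * \<theta>) (int l)"
 have Cph: "abs (ph n i l) <= Cph" if "i : ?I" for n i l
 proof -
  have "?F l <= 1"
  proof -
   have "?E l powr (- (1/2 + \<theta>/2)) <= ?E l powr 0" using theta by (intro powr_mono) auto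
   moreover have "?E l powr 0 = 1" by (simp add: max_def)
   moreover have "?F l = ?E l powr (- (1/2 + \<theta>/2))" unfolding lam_def by (simp add: max_def)
   ultimately show ?thesis by (simp only:)
  qed
  then have "Cph * ?F l <= Cph * 1" using Cph0 by (intro mult_left_mono) auto
  then show ?thesis using Ft_bound[OF theta(1) ab[OF that], of n n l] unfolding ph_def Cph_def by linarith
 qed
 define V where "V = (%n i k. if i = k then alpha2 n (v n i) (w n i) else beta n (v n i) (w n i) (v n k) (w n k))"
 let ?T = "1 - \<theta>"
 obtain C1 where C1: "!!n j n' m'. j : ?I ==> abs (covsum M eps c d n (v n j) (w n j) (v n j) (w n j) n' m' - real n' * alpha2 n (v n j) (w n j)) <= C1 * real n' powr ?T"
  using alpha_def by blast
 obtain C2 where C2: "!!n i j n' m'. i : ?I ==> j : ?I ==> i ~= j ==> abs (covsum M eps c d n (v n i) (w n i) (v n j) (w n j) n' m' - real n' * beta n (v n i) (w n i) (v n j) (w n j)) <= C2 * real n' powr ?T"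
  using beta_def by blast
 define C where "C = abs C1 + abs C2"
 have C0: "0 <= C" unfolding C_def by simp
 have V: "abs (A.covs u (ph n i) (ph n k) m' - real u * V n i k) <= C * real u powr ?T" if ik: "i : ?I" "k : ?I" for n i k u m'
 proof -
  have e: "A.covs u (ph n i) (ph n k) m' = covsum M eps c d n (v n i) (w n i) (v n k) (w n k) u m'"
   using A.covsum_eq[of c d n "v n i" "w n i" "v n k" "w n k" u m'] unfolding ph_def a_def b_def L_def covsum_distr[OF eps_meas] by (rule sym)
  have le: "C1 * real u powr ?T <= C * real u powr ?T" "C2 * real u powr ?T <= C * real u powr ?T"
   unfolding C_def by (auto intro!: mult_right_mono)
  show ?thesis
  proof (cases "i = k")
   case True
   then show ?thesis using C1[OF ik(1), of n u m'] le unfolding e V_def by simp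
  next
   case False
   then show ?thesis using C2[OF ik False, of n u m'] le unfolding e V_def by simp
  qed
 qed
 have fI: "finite ?I" by simp
 \<comment> \<open>Alpha and beta are given separately and only through approximations; that they
   form a positive semidefinite matrix, hence have a factor, is the content of
   \<open>limit_covariance_facts\<close>.\<close>
 have "EX A. ALL i:?I. ALL j:?I. V n i j = (SUM l:?I. A i l * A j l)" for n
  by (rule psd_factorization[OF fI A.limit_covariance_facts(2)[where ph="ph n" and V="V n", OF fI Cph theta(1) V] A.limit_covariance_facts(1)[where ph="ph n" and V="V n", OF fI Cph theta(1) V]])
 then obtain AA where AA: "!!n i j. i : ?I ==> j : ?I ==> V n i j = (SUM l:?I. AA n i l * AA n j l)" by metis
 let ?c1 = "2 * A.Cg^2 * (1 + 2 * Cph)^3"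
 have c1: "0 <= ?c1" using Cph0 by simp
 have th1: "\<theta> <= 1" using theta by simp
 obtain ka kc r0 :: nat and kp :: real where kk: "2 <= ka" "2 <= kc" "4 * real kc <= \<theta> * real ka" "0 < kp" "2 <= kp * real ka" "4 <= kp * real r0"
  and rate: "!!p. ?c1 * real (ulen kc p) ^ 6 * real (qlen ka p) powr (1 - pm) + C * real (ulen kc p) powr (- \<theta>) <= (?c1 + 2 * C) * (2 powr (- kp * real p)) ^ (2 * card ?I + 4)"
  by (rule level_parameters[OF theta(1) th1 pm(1,2) c1 C0, where K="card ?I"]) blast
 define p where "p = floor_log"
 define u where "u = (%n. ulen kc (p n))"
 define q where "q = (%n. qlen ka (p n))"
 define t where "t = (%n. 2 powr (- kp * real (p n)))"
 have t: "0 < t n" "t n <= 1" for n unfolding t_def using kk(4) powr_mono[of "- kp * real (p n)" 0 2] by auto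
 have uq: "1 <= u n" "q n = u n * (q n div u n)" "1 <= q n" for n using A.ulen_qlen[OF kk(1,2), of "p n"] unfolding u_def q_def by auto
 define W where "W = (%n i k xi. gbm ?I (AA n) i (real k / real n) xi)"
 define Fl where "Fl = (%n b y xi. EX i:?I. sqrt (t n) < abs (A.Tb (q n) (u n) (ph n i) b y / sqrt (real (q n)) - sqrt (real n / real (q n)) * (W n i (Suc b * q n) xi - W n i (b * q n) xi)))"
 define DD where "DD = ?c1 + 2 * C"
 have DD0: "0 <= DD" unfolding DD_def using c1 C0 by simp
 let ?R = "real (card ?I)"
 define cc where "cc = 8 * ?R + 2 ^ card ?I * (1 + 2 * ?R) * (8 * (1 + ?R ^ 3) * DD) + 2 * (?R * (Cph^2 * A.c0 + 2 * C) + ?R)"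
 have cc: "0 <= cc" unfolding cc_def using DD0 C0 A.c0 by (intro add_nonneg_nonneg mult_nonneg_nonneg) auto
 let ?Y = "%L. L \<Otimes>\<^sub>M Xi"
 let ?D = "%n q. real (n div q n)"
 let ?J = "%L. borel_measurable (?Y L)"
 let ?L = "%n H. H : ?J L & (ALL e:space L. NN Xi (%x. H (e, x)) = 1) & (ALL x:space Xi. NN L (%e. H (e, x)) = 1) &
  (1 <= n --> emeasure (density (?Y L) H) {z : space (?Y L). r0 <= card {b. b < n div q n & Fl n b (fst z) (snd z)}} <= ennreal ((?D n q * (cc * t n)) ^ r0))"
 have level: "EX H. ?L n H" for n
 proof (cases "n = 0")
  \<comment> \<open>No estimate is asked at n = 0; the constant density 1 makes the family
    \<open>H\<close> total.\<close>
  case True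
  then show ?thesis by (intro exI[of _ "%_. 1"]) (simp add: A.emeasure_space_1 Xi.emeasure_space_1)
 next
  case False
  then have n: "1 <= n" by simp
  have mq: "n div q n * q n <= n" by simp
  have d: "?c1 * real (u n) ^ 6 * real (q n) powr (1 - pm) + C * real (u n) powr (- \<theta>) <= DD * t n ^ (2 * card ?I + 4)"
   unfolding DD_def u_def q_def t_def by (rule rate)
  show ?thesis using A.coupled_level[where I="?I" and ph="ph n" and V="V n" and A="AA n" and Cph=Cph and C=C and th=\<theta> and u="u n" and q="q n" and m="n div q n" and n=n and t="t n" and D=DD,
    OF fI Cph Cph0 theta(1) C0 V AA uq mq n t DD0 d] unfolding Fl_def W_def cc_def by blast
 qed
 from choice[of ?L, OF allI[OF level]] obtain H where H: "!!n. H n : ?J L" "!!n e. e : space L ==> NN Xi (%x. H n (e, x)) = 1"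
  "!!n x. x : space Xi ==> NN L (%e. H n (e, x)) = 1"
  "!!n. 1 <= n ==> emeasure (density (?Y L) (H n)) {z : space (?Y L). r0 <= card {b. b < n div q n & Fl n b (fst z) (snd z)}} <= ennreal ((?D n q * (cc * t n)) ^ r0)"
  by blast
 have spL: "space L = UNIV" using sets_eq_imp_space_eq[OF sL] by (simp add: space_PiM)
 have HU: "NN Xi (%x. H n (e, x)) = 1" for n e by (rule H(2)) (simp add: spL)
 obtain M' :: "(nat => real) measure" and E Y where M': "prob_space M'" and E: "E : measurable M' L" and Y: "!!n. Y n : measurable M' Xi"
  and EL: "distr M' L E = L" and EY: "!!n. distr M' (?Y L) (%z. (E z, Y n z)) = density (?Y L) (H n)"
  by (rule joint_space[where H=H, OF A.prob_space_axioms sL prob_space_Xi sets_Xi H(1) HU]) blast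
 interpret M': prob_space M' by fact
 have YX: "distr M' Xi (Y n) = Xi" for n by (rule density_marginals[OF A.prob_space_axioms prob_space_Xi H(1) H(3) E Y EY])
 have E': "E : measurable M' ?Z" using E unfolding measurable_cong_sets[OF refl sL] .
 have EP: "distr M' ?Z E = L" using distr_cong[OF refl sL[symmetric], of M' E E] EL by simp
 \<comment> \<open>Almost sure statements about the innovations alone pass to the new space because
   \<open>E\<close> has law L.\<close>
 have pull: "AE x in M'. P (E x)" if "AE y in L. P y" for P using AE_distrD[OF E] that unfolding EL .
 let ?P = "%j. real (Suc j)" and ?K = "%i n. A.Tb (q n) (u n) (ph n i)"
 let ?B = "%i n k y. SUM l:{1..k}. A.lin (a i n) (int l) y * A.lin (b i n) (int l) y - A.expectation (%x. A.lin (a i n) (int l) x * A.lin (b i n) (int l) x)"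
 let ?N = "%n i s x. Dn M' (%k x. E x k) c d n s (v n i) (w n i) x"
 \<comment> \<open>The tolerance runs through 1 / (j + 1), so that one null set serves every
   e.\<close>
 have approx: "AE x in M'. ALL j::nat. ALL i:?I. \<forall>\<^sub>F n in sequentially. ALL k<=n.
   abs (?B i n k (E x)
   - (\<Sum>j<k div q n. ?K i n j (E x))) <= 1 / ?P j * sqrt n &
   abs (?K i n (k div q n) (E x)) <= 1 / ?P j * sqrt n"
 proof (rule pull, intro AE_all_countable[THEN iffD2] allI AE_finite_allI fI)
  fix j :: nat and i assume i: "i : ?I"
  show "AE y in L. \<forall>\<^sub>F n in sequentially. ALL k<=n.
   abs (?B i n k y
   - (\<Sum>j<k div q n. ?K i n j y)) <= 1 / ?P j * sqrt n &
   abs (?K i n (k div q n) y) <= 1 / ?P j * sqrt n"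
   using A.block_approximation[where a="a i" and b="b i", OF theta(1) th1 ab[OF i] kk(1-3), of "1 / ?P j"]
   unfolding p_def q_def u_def ph_def by simp
 qed
 let ?U = "%n s. floor (real n * s)"
 have dn: "AE x in M'. ALL i:?I. ALL n s. ?N n i s x = (1 / sqrt (real n)) *
   ?B i n (nat (?U n s)) (E x)"
 proof -
  have "AE y in L. ALL i:?I. ALL n s. Dn L (%k y. y k) c d n s (v n i) (w n i) y = (1 / sqrt (real n)) *
   ?B i n (nat (?U n s)) y"
   unfolding a_def b_def by (intro AE_finite_allI fI AE_all_countable[THEN iffD2] allI A.Dn_eq[OF theta(1) cK K])
  from pull[OF this] show ?thesis unfolding Dn_distr[OF E' EP] .
 qed
 let ?W = "%n. inverse (real n ^ 2)"
 have fails: "AE x in M'. \<forall>\<^sub>F n in sequentially. card {b. b < n div q n & Fl n b (E x) (Y n x)} < r0"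
 proof -
  define S where "S = (%n. {z : space (?Y L). r0 <= card {b. b < n div q n & Fl n b (fst z) (snd z)}})"
  have Sm: "S n : sets (?Y L)" for n
  proof -
   have [measurable]: "Measurable.pred (?Y L) (%z. Fl n b (fst z) (snd z))" for b unfolding Fl_def W_def by measurable
   have "S n = {z : space (?Y L). real r0 <= (\<Sum>b<n div q n. if Fl n b (fst z) (snd z) then 1 else 0)}"
    unfolding S_def by (simp add: sum.inter_filter[symmetric])
   also have "... : sets (?Y L)" by measurable
   finally show ?thesis .
  qed
  have EYm: "(%x. (E x, Y n x)) : measurable M' (?Y L)" for n by (rule measurable_Pair[OF E Y])
  let ?A = "%n. (%x. (E x, Y n x)) -` S n \<inter> space M'"
  have "AE x in M'. \<forall>\<^sub>F n in sequentially. x ~: ?A n"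
  proof (rule M'.AE_eventually_not)
   show "?A n : sets M'" for n by (rule measurable_sets[OF EYm Sm])
   show "0 <= 4 * (4 * cc) ^ r0" using cc by simp
   fix n :: nat assume n: "1 <= n"
   have "emeasure M' (?A n) = emeasure (distr M' (?Y L) (%x. (E x, Y n x))) (S n)" by (rule emeasure_distr[OF EYm Sm, symmetric])
   also have "... <= ennreal ((?D n q * (cc * t n)) ^ r0)" unfolding EY S_def by (rule H(4)[OF n])
   also have "... <= ennreal (4 * (4 * cc) ^ r0 * ?W n)"
    unfolding t_def by (intro ennreal_leI failure_rate[where ka=ka] kk cc n) (simp_all add: p_def q_def)
   finally show "emeasure M' (?A n) <= ennreal (4 * (4 * cc) ^ r0 * ?W n)" .
  qed
  then show ?thesis using AE_space
  proof eventually_elim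
   case (elim x)
   from elim(1) show ?case
   proof eventually_elim
    case (elim n)
    then have "(E x, Y n x) ~: S n" using \<open>x : space M'\<close> by blast
    then show ?case using measurable_space[OF EYm \<open>x : space M'\<close>, of n] unfolding S_def by (simp add: not_le)
   qed
  qed
 qed
 have modulus: "AE x in M'. ALL j::nat. \<forall>\<^sub>F n in sequentially. ALL i:?I. ALL j'<=n. ALL k<=n. j' <= k --> k <= j' + q n --> abs (W n i k (Y n x) - W n i j' (Y n x)) <= 1 / ?P j"
 proof (intro AE_all_countable[THEN iffD2] allI)
  fix j :: nat
  let ?e = "1 / ?P j" and ?k = "4 * ka" and ?CV = "Cph^2 * A.c0 + C"
  define S where "S = (%n. {xi : space Xi. EX i:?I. EX j<=n. EX k<=n. j <= k & k <= j + q n & ?e < abs (gbm ?I (AA n) i (real k / real n) xi - gbm ?I (AA n) i (real j / real n) xi)})"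
  let ?C = "?R * (fact (2 * ?k) / (2 ^ ?k * fact ?k) * ?CV ^ ?k / ?e ^ (2 * ?k))"
  have Sm: "S n : sets Xi" for n unfolding S_def by measurable
  have CV0: "0 <= ?CV" using C0 A.c0 by simp
  have C0': "0 <= ?C" using CV0 by simp
  have "AE x in M'. \<forall>\<^sub>F n in sequentially. x ~: Y n -` S n \<inter> space M'"
  proof (rule M'.AE_eventually_not)
   show "Y n -` S n \<inter> space M' : sets M'" for n by (rule measurable_sets[OF Y Sm])
   show "0 <= ?C * (64 * 2 ^ ?k)" by (intro mult_nonneg_nonneg[OF C0']) simp
   fix n :: nat assume n: "1 <= n"
   have Vii: "V n i i <= ?CV" if "i : ?I" for i by (rule A.limit_covariance_facts(3)[where ph="ph n" and I="?I", OF fI Cph theta(1) V that])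
   have "emeasure M' (Y n -` S n \<inter> space M') = emeasure (distr M' Xi (Y n)) (S n)" by (rule emeasure_distr[OF Y Sm, symmetric])
   also have "... <= ennreal (?R * (real n + 1)^2 * (fact (2 * ?k) / (2 ^ ?k * fact ?k) * (?CV * real (q n) / real n) ^ ?k / ?e ^ (2 * ?k)))"
    unfolding YX S_def by (rule gbm_modulus[where V="V n" and A="AA n", OF fI AA Vii CV0 n]) (use kk(1) in simp_all)
   also have "... = ennreal (?C * ((real n + 1)^2 * (real (q n) / real n) ^ ?k))" by (simp only: divide_inverse power_mult_distrib mult_ac)
   also have "... <= ennreal (?C * (64 * 2 ^ ?k * ?W n))" using modulus_rate[where ka=ka and p="p n" and q="q n" and n=n, OF kk(1,4,5) n] C0'
    by (intro ennreal_leI mult_left_mono) (simp_all only: p_def q_def)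
   also have "?C * (64 * 2 ^ ?k * ?W n) = ?C * (64 * 2 ^ ?k) * ?W n" by (simp only: mult.assoc)
   finally show "emeasure M' (Y n -` S n \<inter> space M') <= ennreal (?C * (64 * 2 ^ ?k) * ?W n)" .
  qed
  then show "AE x in M'. \<forall>\<^sub>F n in sequentially. ALL i:?I. ALL j'<=n. ALL k<=n. j' <= k --> k <= j' + q n --> abs (W n i k (Y n x) - W n i j' (Y n x)) <= ?e"
   using AE_space
  proof eventually_elim
   case (elim x)
   from elim(1) show ?case
   proof eventually_elim
    case (elim n)
    have "Y n x : space Xi" by (rule measurable_space[OF Y \<open>x : space M'\<close>])
    moreover have "Y n x ~: S n" using elim \<open>x : space M'\<close> by blast
    ultimately show ?case unfolding S_def W_def by (simp add: not_less)
   qed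
  qed
 qed
 let ?G = "2 powr (- kp / 4)"
 have close: "AE x in M'. ALL e>0. \<forall>\<^sub>F n in sequentially. ALL i:?I. ALL s:{0..1}. abs (?N n i s x - W n i (nat (?U n s)) (Y n x)) <= e"
  using approx dn fails modulus
 proof eventually_elim
  case (elim x)
  note dnx = elim(2)
  show ?case
  proof (intro allI impI)
   fix e :: real assume e: "0 < e"
   have r: "0 < 2 + 2 * real r0" by simp
   \<comment> \<open>The at most 2 + 2 r0 errors of size 1 / (j + 1) have to fit into e / 2; the
     other half is kept for the coupling errors.\<close>
   obtain j where j: "inverse (?P j) < e / 2 / (2 + 2 * real r0)" using reals_Archimedean[of "e / 2 / (2 + 2 * real r0)"] e r by auto
   let ?e = "1 / ?P j"
   have je: "(2 + 2 * real r0) * ?e <= e / 2" using j r by (simp add: field_simps)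
   have lim: "(%n. 2 * ?G ^ p n) \<longlonglongrightarrow> 2 * 0"
    unfolding p_def by (intro tendsto_mult tendsto_const filterlim_compose[OF LIMSEQ_power_zero floor_log_at_top]) (use kk(4) powr_less_mono[of "- kp / 4" 0 2] in simp)
   have "\<forall>\<^sub>F n in sequentially. 2 * ?G ^ p n < e / 2" using order_tendstoD(2)[OF lim, of "e / 2"] e by simp
   moreover have "\<forall>\<^sub>F n in sequentially. ALL i:?I. ALL k<=n.
   abs (?B i n k (E x)
   - (\<Sum>j<k div q n. ?K i n j (E x))) <= ?e * sqrt n &
   abs (?K i n (k div q n) (E x)) <= ?e * sqrt n" using elim(1) by (intro eventually_ball_finite fI) blast
   moreover note elim(3) elim(4)[rule_format, of j] eventually_ge_at_top[of "1::nat"]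
   ultimately show "\<forall>\<^sub>F n in sequentially. ALL i:?I. ALL s:{0..1}. abs (?N n i s x - W n i (nat (?U n s)) (Y n x)) <= e"
   proof eventually_elim
    case (elim n)
    note ap = elim(2)[rule_format] and md = elim(4)[rule_format]
    show ?case
    proof (intro ballI)
     fix i and s :: real assume i: "i : ?I" and s: "s : {0..1}"
     let ?k = "nat (?U n s)"
     let ?X = "?B i n ?k (E x)"
     have kn: "?k <= n"
     proof -
      have "real n * s <= real n * 1" using s by (intro mult_left_mono) auto
      then have "?U n s <= int n" by linarith
      then show ?thesis by simp
     qed
     have "abs (?X / sqrt (real n) - W n i ?k (Y n x)) <= (2 + 2 * real r0) * ?e + ?D n q * (sqrt (real (q n) / real n) * sqrt (t n))"
     proof (rule block_sum_close[where k="?k" and q="q n" and T="%j. ?K i n j (E x)" and P="%b. Fl n b (E x) (Y n x)" and m="n div q n", OF elim(5) uq(3) kn refl])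
      show "abs (?X - (\<Sum>j<?k div q n. ?K i n j (E x))) <= ?e * sqrt (real n)" using ap[OF i kn] by blast
      \<comment> \<open>At time j' q the block j' is the current one, so the estimate for current
        blocks covers every single block.\<close>
      show "abs (?K i n j' (E x)) <= ?e * sqrt (real n)" if "j' < n div q n" for j'
      proof -
       have "j' * q n <= n div q n * q n" using that by (intro mult_right_mono) auto
       also have "... <= n" by simp
       finally show ?thesis using ap[OF i, of "j' * q n"] uq(3)[of n] by simp
      qed
      show "W n i 0 (Y n x) = 0" unfolding W_def by (simp add: gbm_0)
      show "abs (W n i k (Y n x) - W n i j' (Y n x)) <= ?e" if "j' <= k" "k <= n" "k <= j' + q n" for j' k using md[OF i, of j' k] that by simp
      show "card {b. b < n div q n & Fl n b (E x) (Y n x)} < r0" by (rule elim(3))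
      show "abs (?K i n b (E x) / sqrt (real (q n)) - sqrt (real n / real (q n)) * (W n i (Suc b * q n) (Y n x) - W n i (b * q n) (Y n x))) <= sqrt (t n)"
       if "~ Fl n b (E x) (Y n x)" for b using that i unfolding Fl_def by (meson not_less)
     qed (use t(1)[of n] in simp_all)
     also have "... <= e / 2 + e / 2"
     proof (rule add_mono[OF je])
      have "?D n q * sqrt (real (q n) / real n) * sqrt (t n) <= 2 * ?G ^ p n"
       unfolding t_def by (rule level_rates(2)[where ka=ka]) (use kk elim(5) in \<open>simp_all add: p_def q_def\<close>)
      then show "?D n q * (sqrt (real (q n) / real n) * sqrt (t n)) <= e / 2" using elim(1) unfolding mult.assoc by linarith
     qed
     finally show "abs (?N n i s x - W n i ?k (Y n x)) <= e" using dnx[rule_format, OF i, of n s] by simp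
    qed
   qed
  qed
 qed
 let ?Q = "%N i. N (%k. if k = i then 1 else 0)"
 let ?H = "%n s. real (nat (?U n s)) / real n"
 show ?thesis
 proof (intro exI[of _ M'] exI[of _ "%k x. E x k"] exI[of _ "%n i s x. gbm ?I (AA n) i s (Y n x)"] conjI allI impI M')
  fix k :: int
  have "(%y. y k) : borel_measurable L" unfolding measurable_cong_sets[OF sL refl] by simp
  then show "(%x. E x k) : borel_measurable M'" by (rule measurable_compose[OF E])
 next
  show "distr M' ?Z (%x k. E x k) = distr M ?Z (%x k. eps k x)" using EP unfolding L_def by simp
 next
  fix n
  have "is_BM Xi ?I (V n) (gbm ?I (AA n))" by (rule gbm_is_BM[OF fI AA])
  from is_BM_compose_distr[OF M' Y YX this]
  show "is_BM M' ?I (%i j. if i = j then alpha2 n (v n i) (w n i) else beta n (v n i) (w n i) (v n j) (w n j)) (%i t x. gbm ?I (AA n) i t (Y n x))"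
   unfolding V_def by simp
 next
  fix N assume N: "is_norm_on ?I N"
  let ?S = "SUM i:?I. ?Q N i"
  have N0: "0 <= ?Q N i" if "i : ?I" for i
  proof -
   have "ALL l. l ~: ?I --> (if l = i then 1 else 0 :: real) = 0" using that by auto
   from N[unfolded is_norm_on_def, THEN spec, THEN spec, THEN spec, THEN mp, THEN mp, OF this this, THEN conjunct1] show ?thesis .
  qed
  show "AE x in M'. ALL e>0. \<forall>\<^sub>F n in sequentially. ALL s:{0..1}.
    N (%i. if i : ?I then ?N n i s x - gbm ?I (AA n) i (?H n s) (Y n x) else 0) < e" using close
  proof eventually_elim
   case (elim x)
   show ?case
   proof (intro allI impI)
    fix e :: real assume e: "0 < e"
    have S0: "0 <= ?S" by (intro sum_nonneg N0)
    \<comment> \<open>The + 1 makes the final inequality strict and also covers K0 = 0, where ?S is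
      0.\<close>
    have "0 < e / (?S + 1)" using e S0 by simp
    with elim have "\<forall>\<^sub>F n in sequentially. ALL i:?I. ALL s:{0..1}. abs (?N n i s x - W n i (nat (?U n s)) (Y n x)) <= e / (?S + 1)" by blast
    then show "\<forall>\<^sub>F n in sequentially. ALL s:{0..1}. N (%i. if i : ?I then ?N n i s x - gbm ?I (AA n) i (?H n s) (Y n x) else 0) < e"
    proof eventually_elim
     case (elim n)
     show ?case
     proof
      fix s :: real assume s: "s : {0..1}"
      let ?x = "%i. ?N n i s x - gbm ?I (AA n) i (?H n s) (Y n x)"
      have "N (%i. if i : ?I then ?x i else 0) <= (SUM i:?I. abs (?x i) * ?Q N i)" by (rule norm_on_le[OF N fI order_refl])
      also have "... <= (SUM i:?I. e / (?S + 1) * ?Q N i)" using elim s by (intro sum_mono mult_right_mono N0) (auto simp: W_def)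
      also have "... = e * (?S / (?S + 1))" unfolding sum_distrib_left[symmetric] by simp
      also have "... < e * 1" using S0 e by (intro mult_strict_left_mono) auto
      finally show "N (%i. if i : ?I then ?x i else 0) < e" by simp
     qed
    qed
   qed
  qed
 qed
qed

end
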